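(* For every integer $N\ge1$, let $R_N$ be the function defined by $$C_h^{weyl}(A,B)(X)=\sum_{k=0}^{N-1}\frac{h^k}{(2i)^kk!}\,\sigma(\nabla_Y,\nabla_Z)^k\big[A(X+Y)B(X+Z)\big]\Big|_{Y=Z=0}+R_N(X,h).$$ Then, for all $A\in S_m(M,\rho,\delta)$ and $B\in S_m(M',\rho,\delta)$ with $m\ge N+6$, $$R_N(\cdot,h)\in S_{m-N-6}\left(M''\,\frac{h^N}{N!}\Big[\sum_{j=1}^n\rho_j\delta_j\Big]^N,\ 2\rho,\ 2\delta\right),\qquad M''=MM'\prod_{j\le n}(1+Kh\rho_j\delta_j),$$ where $K>0$ is the universal constant (independent of the dimension $n$) described in the context.
   Context: Symbol classes: for sequences $\rho=(\rho_j)_{j\ge1}$, $\delta=(\delta_j)_{j\ge1}$ of real numbers $\ge0$, $M\ge0$ and an integer $m\ge0$, $S_m(M,\rho,\delta)$ is the set of continuous functions $F$ on $\mathbb{R}^{2n}$ ($n\ge1$; points $X=(x,\xi)$, $x,\xi\in\mathbb{R}^n$) such that for every multi-index $(\alpha,\beta)$ with $\alpha_j\le m$ and $\beta_j\le m$ for all $j\le n$, the derivative $\partial_x^\alpha\partial_\xi^\beta F$ exists, is continuous and bounded, and $$\sup_{X\in\mathbb{R}^{2n}}|\partial_x^\alpha\partial_\xi^\beta F(X)|\le M\prod_{j\le n}\rho_j^{\alpha_j}\delta_j^{\beta_j}.$$ Here $2\rho=(2\rho_j)_j$ and $2\delta=(2\delta_j)_j$. Weyl composition (the Weyl symbol of the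 product of the two Weyl $h$-pseudodifferential operators with symbols $A$ and $B$): for $h>0$, formally, $$C_h^{weyl}(A,B)(X)=(\pi h)^{-2n}\int_{\mathbb{R}^{4n}}A(X+Y)B(X+Z)e^{-\frac{2i}{h}\sigma(Y,Z)}\,dY\,dZ,$$ with $\sigma(X,Y)=y\cdot\xi-x\cdot\eta$ for $X=(x,\xi)$, $Y=(y,\eta)$ in $\mathbb{R}^{2n}$; $\sigma(\nabla_Y,\nabla_Z)$ is the corresponding second-order differential operator in $(Y,Z)$, i.e. for $Y=(y,\eta)$, $Z=(z,\zeta)$, $\sigma(\nabla_Y,\nabla_Z)=\sum_{j=1}^n(\partial_{\eta_j}\partial_{z_j}-\partial_{y_j}\partial_{\zeta_j})$. The constant $K$: it is the universal constant from the companion composition theorem, that is, a constant $K>0$ such that for all $n\ge1$, $A\in S_6(M,\rho,\delta)$ and $B\in S_6(M',\rho,\delta)$, if $h\rho_j\delta_j\le1$ for all $j\le n$, then $\sup_X|C_h^{weyl}(A,B)(X)|\le MM'\prod_{j\le n}(1+Kh\rho_j\delta_j)$. This only serves to identify $K$ in the formula for $M''$. *)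

theory Defs
  imports "HOL-Analysis.Analysis"
begin

text \<open>The dimension \<open>n\<close> is quantified inside the statement (the constant \<open>K\<close> must not depend on it), so it
  cannot be a type. The space \<open>\<real>\<^sup>n\<close> is the set of extensional functions on \<open>{..<n}\<close>, with coordinates numbered
  from \<open>0\<close>; its topology is the subspace topology of the product topology on \<^typ>\<open>nat \<Rightarrow> real\<close>, that is, the
  Euclidean one. A point \<open>(x, \<xi>)\<close> of phase space \<open>\<real>\<^sup>2\<^sup>n\<close> is a pair of such vectors.\<close>

type_synonym point = "(nat \<Rightarrow> real) \<times> (nat \<Rightarrow> real)"
type_synonym symbol = "point \<Rightarrow> complex"

definition phase_space :: "nat \<Rightarrow> point set" where
  "phase_space n = ({..<n} \<rightarrow>\<^sub>E UNIV) \<times> ({..<n} \<rightarrow>\<^sub>E UNIV)"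

definition phase_zero :: "nat \<Rightarrow> point" where
  "phase_zero n = ((\<lambda>j\<in>{..<n}. 0), (\<lambda>j\<in>{..<n}. 0))"

definition phase_add :: "nat \<Rightarrow> point \<Rightarrow> point \<Rightarrow> point" where
  "phase_add n X Y = ((\<lambda>j\<in>{..<n}. fst X j + fst Y j), (\<lambda>j\<in>{..<n}. snd X j + snd Y j))"

definition phase_normsq :: "nat \<Rightarrow> point \<Rightarrow> real" where
  "phase_normsq n X = (\<Sum>j<n. (fst X j)\<^sup>2 + (snd X j)\<^sup>2)"

definition phase_lebesgue :: "nat \<Rightarrow> point measure" where
  "phase_lebesgue n = (\<Pi>\<^sub>M j\<in>{..<n}. lborel) \<Otimes>\<^sub>M (\<Pi>\<^sub>M j\<in>{..<n}. lborel)"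

text \<open>\<open>\<sigma>((x, \<xi>), (y, \<eta>)) = y \<cdot> \<xi> - x \<cdot> \<eta>\<close>\<close>

definition symplectic :: "nat \<Rightarrow> point \<Rightarrow> point \<Rightarrow> real" where
  "symplectic n X Y = (\<Sum>j<n. fst Y j * snd X j) - (\<Sum>j<n. fst X j * snd Y j)"


section \<open>Partial derivatives and symbol classes\<close>

text \<open>\<open>Pos j\<close> stands for the variable \<open>x\<^sub>j\<close> and \<open>Mom j\<close> for the variable \<open>\<xi>\<^sub>j\<close>. For \<open>j < n\<close>, changing that
  coordinate does not leave \<^term>\<open>phase_space n\<close>.\<close>

datatype direction = Pos nat | Mom nat

fun coord :: "direction \<Rightarrow> point \<Rightarrow> real" where
  "coord (Pos j) (x, \<xi>) = x j"
| "coord (Mom j) (x, \<xi>) = \<xi> j"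

fun set_coord :: "direction \<Rightarrow> real \<Rightarrow> point \<Rightarrow> point" where
  "set_coord (Pos j) t (x, \<xi>) = (x(j := t), \<xi>)"
| "set_coord (Mom j) t (x, \<xi>) = (x, \<xi>(j := t))"

definition partial :: "direction \<Rightarrow> symbol \<Rightarrow> symbol" where
  "partial d F X = vector_derivative (\<lambda>t. F (set_coord d t X)) (at (coord d X))"

definition partial_exists :: "nat \<Rightarrow> direction \<Rightarrow> symbol \<Rightarrow> bool" where
  "partial_exists n d F \<longleftrightarrow>
     (\<forall>X\<in>phase_space n. (\<lambda>t. F (set_coord d t X)) differentiable (at (coord d X)))"

primrec partials :: "direction list \<Rightarrow> symbol \<Rightarrow> symbol" where
  "partials [] F = F"
| "partials (d # ds) F = partial d (partials ds F)"

primrec partials_exist :: "nat \<Rightarrow> direction list \<Rightarrow> symbol \<Rightarrow> bool" where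
  "partials_exist n [] F \<longleftrightarrow> True"
| "partials_exist n (d # ds) F \<longleftrightarrow> partials_exist n ds F \<and> partial_exists n d (partials ds F)"

text \<open>\<open>\<partial>\<^sub>x\<^sup>\<alpha> \<partial>\<^sub>\<xi>\<^sup>\<beta>\<close> written out as a sequence of partial derivatives, outermost first. In the classes below all
  these derivatives are continuous, so by Schwarz's theorem the order chosen here is immaterial.\<close>

definition multi_index :: "nat \<Rightarrow> (nat \<Rightarrow> nat) \<Rightarrow> (nat \<Rightarrow> nat) \<Rightarrow> direction list" where
  "multi_index n \<alpha> \<beta> =
     concat (map (\<lambda>j. replicate (\<alpha> j) (Pos j)) [0..<n]) @
     concat (map (\<lambda>j. replicate (\<beta> j) (Mom j)) [0..<n])"

text \<open>Only the values on \<^term>\<open>phase_space n\<close> matter for membership.\<close>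

definition symbol_class ::
    "nat \<Rightarrow> nat \<Rightarrow> real \<Rightarrow> (nat \<Rightarrow> real) \<Rightarrow> (nat \<Rightarrow> real) \<Rightarrow> symbol set" where
  "symbol_class n m M \<rho> \<delta> =
     {F. \<forall>\<alpha> \<beta>. (\<forall>j<n. \<alpha> j \<le> m \<and> \<beta> j \<le> m) \<longrightarrow>
           partials_exist n (multi_index n \<alpha> \<beta>) F \<and>
           continuous_on (phase_space n) (partials (multi_index n \<alpha> \<beta>) F) \<and>
           (\<forall>X\<in>phase_space n.
              cmod (partials (multi_index n \<alpha> \<beta>) F X) \<le> M * (\<Prod>j<n. \<rho> j ^ \<alpha> j * \<delta> j ^ \<beta> j))}"


section \<open>Weyl composition\<close>

text \<open>For bounded symbols the integral
  \<open>(\<pi> h)\<^sup>-\<^sup>2\<^sup>n \<integral> A(X + Y) B(X + Z) exp (-(2 \<i> / h) \<sigma>(Y, Z)) dY dZ\<close> over \<open>\<real>\<^sup>4\<^sup>n\<close> is not absolutely convergent.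
  It is an oscillatory integral: the limit, as \<open>\<epsilon>\<close> decreases to \<open>0\<close>, of the absolutely convergent integrals with
  the additional factor \<open>exp (-\<epsilon> (|Y|\<^sup>2 + |Z|\<^sup>2))\<close>. For the symbol classes used here (two bounded derivatives in each
  variable are enough) integration by parts shows that the limit exists and is the usual cutoff-independent value.\<close>

definition weyl_composition_reg ::
    "nat \<Rightarrow> real \<Rightarrow> symbol \<Rightarrow> symbol \<Rightarrow> point \<Rightarrow> real \<Rightarrow> complex" where
  "weyl_composition_reg n h A B X \<epsilon> =
     complex_of_real (1 / (pi * h) ^ (2 * n)) *
     integral\<^sup>L (phase_lebesgue n \<Otimes>\<^sub>M phase_lebesgue n) (\<lambda>(Y, Z).
        A (phase_add n X Y) * B (phase_add n X Z) *
        exp (- (2 * \<i> / complex_of_real h) * complex_of_real (symplectic n Y Z)) *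
        complex_of_real (exp (- \<epsilon> * (phase_normsq n Y + phase_normsq n Z))))"

definition weyl_composition :: "nat \<Rightarrow> real \<Rightarrow> symbol \<Rightarrow> symbol \<Rightarrow> symbol" where
  "weyl_composition n h A B X = Lim (at_right 0) (weyl_composition_reg n h A B X)"

definition partial_fst ::
    "direction \<Rightarrow> (point \<times> point \<Rightarrow> complex) \<Rightarrow> (point \<times> point \<Rightarrow> complex)" where
  "partial_fst d G = (\<lambda>(Y, Z). partial d (\<lambda>Y'. G (Y', Z)) Y)"

definition partial_snd ::
    "direction \<Rightarrow> (point \<times> point \<Rightarrow> complex) \<Rightarrow> (point \<times> point \<Rightarrow> complex)" where
  "partial_snd d G = (\<lambda>(Y, Z). partial d (\<lambda>Z'. G (Y, Z')) Z)"

text \<open>\<open>\<sigma>(\<nabla>\<^sub>Y, \<nabla>\<^sub>Z) = \<Sum>\<^sub>j (\<partial>/\<partial>\<eta>\<^sub>j \<partial>/\<partial>z\<^sub>j - \<partial>/\<partial>y\<^sub>j \<partial>/\<partial>\<zeta>\<^sub>j)\<close> for \<open>Y = (y, \<eta>)\<close> and \<open>Z = (z, \<zeta>)\<close>\<close>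

definition symplectic_op ::
    "nat \<Rightarrow> (point \<times> point \<Rightarrow> complex) \<Rightarrow> (point \<times> point \<Rightarrow> complex)" where
  "symplectic_op n G = (\<lambda>W. \<Sum>j<n.
     partial_fst (Mom j) (partial_snd (Pos j) G) W - partial_fst (Pos j) (partial_snd (Mom j) G) W)"

definition weyl_remainder ::
    "nat \<Rightarrow> nat \<Rightarrow> real \<Rightarrow> symbol \<Rightarrow> symbol \<Rightarrow> symbol" where
  "weyl_remainder n N h A B X =
     weyl_composition n h A B X -
     (\<Sum>k<N. complex_of_real h ^ k / ((2 * \<i>) ^ k * fact k) *
        (symplectic_op n ^^ k) (\<lambda>(Y, Z). A (phase_add n X Y) * B (phase_add n X Z))
          (phase_zero n, phase_zero n))"

text \<open>The bound that identifies the universal constant \<open>K\<close>: it holds in every dimension with the same \<open>K\<close>.\<close>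

definition composition_constant :: "real \<Rightarrow> bool" where
  "composition_constant K \<longleftrightarrow> K > 0 \<and>
     (\<forall>n M M' \<rho> \<delta> h A B.
        n \<ge> 1 \<longrightarrow> M \<ge> 0 \<longrightarrow> M' \<ge> 0 \<longrightarrow> (\<forall>j. \<rho> j \<ge> 0) \<longrightarrow> (\<forall>j. \<delta> j \<ge> 0) \<longrightarrow> h > 0 \<longrightarrow>
        A \<in> symbol_class n 6 M \<rho> \<delta> \<longrightarrow> B \<in> symbol_class n 6 M' \<rho> \<delta> \<longrightarrow>
        (\<forall>j<n. h * \<rho> j * \<delta> j \<le> 1) \<longrightarrow>
        (\<forall>X\<in>phase_space n.
           cmod (weyl_composition n h A B X) \<le> M * M' * (\<Prod>j<n. 1 + K * h * \<rho> j * \<delta> j)))"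

end

theory Submission
  imports Defs "HOL-Probability.Probability" "HOL-Real_Asymp.Real_Asymp"
begin

text \<open>Rescale every variable by the weight of the symbols and exchange positions and momenta in the second symbol. The
  Weyl composition becomes an oscillatory integral \<open>I(s)\<close> of two symbols with bounds \<open>M\<close> and \<open>M'\<close>, the second
  one dilated by \<open>s\<^sub>d\<close> in the variable \<open>d\<close>, where \<open>\<bar>s\<^sub>d\<bar> = h \<rho>\<^sub>j \<delta>\<^sub>j\<close> for both variables of index \<open>j\<close>.
  Differentiating in the dilation gives \<open>\<partial>\<^sub>s I = (2 \<i>)\<^sup>-\<^sup>1 I(\<partial>\<^sub>d F, \<partial>\<^sub>d G)\<close>, so the Taylor expansion of \<open>r \<mapsto> I(r s)\<close> at
  \<open>r = 0\<close> is the expansion in powers of \<open>\<sigma>(\<nabla>\<^sub>Y, \<nabla>\<^sub>Z)\<close>, and its remainder is a sum of integrals of the same kind.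
  Integration by parts and a regularised Plancherel inequality bound each integral by a product over the variables
  of constants times \<open>max 1 (sqrt \<bar>s\<^sub>d\<bar>)\<close>; in the variables with \<open>\<bar>s\<^sub>d\<bar> \<le> 1\<close> the mean value theorem in \<open>s\<^sub>d\<close> improves the constant
  to \<open>1 + O(\<bar>s\<^sub>d\<bar>)\<close>. Derivatives of the remainder are, by Leibniz' rule, remainders for differentiated symbols, which
  accounts for the factors \<open>2\<close> in \<open>2 \<rho>\<close> and \<open>2 \<delta>\<close>.\<close>

text \<open>The final bound must grow at most linearly in \<open>h * \<rho> j * \<delta> j\<close>
  for every index j, without any smallness, and this dictates the L2 estimate. Integration by parts
  with the weight \<open>1 + 4 * \<theta> * y\<^sup>2\<close> costs \<theta> times a second
  derivative of size s^2, so for a large scale s it is affordable when \<theta> is about s^(-2). The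
  factor \<open>inverse (1 + 4 * \<theta> * y\<^sup>2)\<close> gained in return has L1 norm of order
  s, but L2 norm of order s^(1/2). Both variables of index j have the same scale, so an L1 bound
  would give s^2 per index, whereas Plancherel gives s. In each variable, two derivatives go into
  the integration by parts and a third into the mean value theorem in the scale. No limit is taken
  in a function space: the absolutely convergent form \<open>tform\<close> passes to the limit under
  pointwise convergence of uniformly bounded jets, and the removal of cutoffs, continuity, and
  derivatives in the base point are deduced from this.\<close>

section \<open>Lebesgue measure in the coordinates of a finite set\<close>

text \<open>All dimensions live on the one type \<^typ>\<open>'i \<Rightarrow> real\<close>, with the coordinates outside \<open>D\<close> set to \<open>0\<close>:
  the estimates below remove one coordinate at a time, which finite product types do not allow.\<close>

definition zero_ext :: "'i set \<Rightarrow> ('i \<Rightarrow> real) \<Rightarrow> 'i \<Rightarrow> real" where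
  "zero_ext D Y = (\<lambda>i. if i \<in> D then Y i else 0)"

text \<open>The measure lives on the whole function space and is concentrated on the functions
  vanishing off \<open>D\<close>. Its measurable sets are the Borel sets for every \<open>D\<close>,
  so one measurability proof serves all of them.\<close>

definition lborel_on :: "'i set \<Rightarrow> ('i::countable \<Rightarrow> real) measure" where
  "lborel_on D = distr (\<Pi>\<^sub>M i\<in>D. lborel) borel (zero_ext D)"

interpretation lborel_product: product_sigma_finite "\<lambda>_::'i. lborel :: real measure"
  by standard

lemma borel_measurable_coordinate [measurable]:
  "(\<lambda>Y::'i::countable \<Rightarrow> real. Y d) \<in> borel_measurable borel"
  by (rule measurable_product_coordinates)

lemma zero_ext_measurable [measurable]:
  "zero_ext D \<in> borel_measurable (\<Pi>\<^sub>M i\<in>(D::'i::countable set). (lborel::real measure))"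
proof (rule measurable_coordinatewise_then_product)
  fix i
  show "(\<lambda>x. zero_ext D x i) \<in> borel_measurable (\<Pi>\<^sub>M i\<in>D. (lborel::real measure))"
  proof (cases "i \<in> D")
    case True
    have "(\<lambda>x. x i) \<in> measurable (\<Pi>\<^sub>M i\<in>D. (lborel::real measure)) lborel"
      using True by (rule measurable_component_singleton)
    then show ?thesis using True by (simp add: zero_ext_def)
  qed (simp add: zero_ext_def)
qed

lemma measurable_fun_upd_borel [measurable]:
  "(\<lambda>(Y, t). Y(d := t)) \<in> borel_measurable (borel \<Otimes>\<^sub>M (borel :: real measure))"
  for d :: "'i::countable"
proof (rule measurable_coordinatewise_then_product)
  fix i
  show "(\<lambda>x. (case x of (Y, t) \<Rightarrow> Y(d := t)) i) \<in> borel_measurable (borel \<Otimes>\<^sub>M (borel :: real measure))"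
    by (cases "i = d") (simp_all add: case_prod_beta)
qed

lemma sets_lborel_on [simp, measurable_cong]: "sets (lborel_on D) = sets borel"
  and space_lborel_on [simp]: "space (lborel_on D) = UNIV"
  by (simp_all add: lborel_on_def)

lemma integral_lborel_on:
  fixes F :: "('i::countable \<Rightarrow> real) \<Rightarrow> 'b::{banach,second_countable_topology}"
  assumes "F \<in> borel_measurable borel"
  shows "(\<integral>Y. F Y \<partial>lborel_on D) = (\<integral>Y. F (zero_ext D Y) \<partial>(\<Pi>\<^sub>M i\<in>D. lborel))"
  unfolding lborel_on_def using assms by (intro integral_distr) auto

lemma integrable_lborel_on_iff:
  fixes F :: "('i::countable \<Rightarrow> real) \<Rightarrow> 'b::{banach,second_countable_topology}"
  assumes "F \<in> borel_measurable borel"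
  shows "integrable (lborel_on D) F \<longleftrightarrow> integrable (\<Pi>\<^sub>M i\<in>D. lborel) (\<lambda>Y. F (zero_ext D Y))"
  unfolding lborel_on_def using assms by (intro integrable_distr_eq) auto

lemma measurable_prod_coord [measurable]:
  fixes f :: "'i::countable \<Rightarrow> real \<Rightarrow> 'b::{real_normed_field,second_countable_topology}"
  assumes "\<And>d. d \<in> D \<Longrightarrow> f d \<in> borel_measurable borel"
  shows "(\<lambda>Y. \<Prod>d\<in>D. f d (Y d)) \<in> borel_measurable borel"
  using assms by (intro borel_measurable_prod) (auto intro: measurable_compose[OF borel_measurable_coordinate])

lemma
  fixes f :: "'i::countable \<Rightarrow> real \<Rightarrow> 'b::{real_normed_field,banach,second_countable_topology}"
  assumes "finite D" and i: "\<And>d. d \<in> D \<Longrightarrow> integrable lborel (f d)"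
  shows integrable_lborel_on_prod: "integrable (lborel_on D) (\<lambda>Y. \<Prod>d\<in>D. f d (Y d))"
    and integral_lborel_on_prod: "(\<integral>Y. (\<Prod>d\<in>D. f d (Y d)) \<partial>lborel_on D) = (\<Prod>d\<in>D. \<integral>y. f d y \<partial>lborel)"
proof -
  have m: "(\<lambda>Y. \<Prod>d\<in>D. f d (Y d)) \<in> borel_measurable borel"
    using i by (intro measurable_prod_coord) auto
  have e: "(\<Prod>d\<in>D. f d (zero_ext D Y d)) = (\<Prod>d\<in>D. f d (Y d))" for Y
    by (intro prod.cong) (auto simp: zero_ext_def)
  show "integrable (lborel_on D) (\<lambda>Y. \<Prod>d\<in>D. f d (Y d))"
    unfolding integrable_lborel_on_iff[OF m] e using assms by (intro lborel_product.product_integrable_prod) auto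
  show "(\<integral>Y. (\<Prod>d\<in>D. f d (Y d)) \<partial>lborel_on D) = (\<Prod>d\<in>D. \<integral>y. f d y \<partial>lborel)"
    unfolding integral_lborel_on[OF m] e using assms by (intro lborel_product.product_integral_prod) auto
qed

lemma sigma_finite_lborel_on:
  assumes "finite (D :: 'i::countable set)"
  shows "sigma_finite_measure (lborel_on D)"
proof
  \<comment> \<open>Boxes in the coordinates of \<open>D\<close> only; in the other coordinates the
    measure sits at 0 anyway.\<close>
  define A where "A n = {Y::'i\<Rightarrow>real. \<forall>d\<in>D. \<bar>Y d\<bar> \<le> real n}" for n
  have mA: "A n \<in> sets borel" for n
  proof -
    have "A n = (\<Inter>d\<in>D. {Y \<in> space borel. \<bar>Y d\<bar> \<le> real n}) \<inter> UNIV" by (auto simp: A_def)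
    also have "\<dots> \<in> sets borel"
      using assms
    proof (cases "D = {}")
      case False
      then show ?thesis
        using assms by (intro sets.Int sets.finite_INT) measurable
    qed simp
    finally show ?thesis .
  qed
  have fin: "emeasure (lborel_on D) (A n) \<noteq> \<infinity>" for n
  proof -
    have "integrable (lborel_on D) (\<lambda>Y. \<Prod>d\<in>D. indicator {-real n..real n} (Y d) :: real)"
      using assms by (intro integrable_lborel_on_prod) auto
    also have "(\<lambda>Y. \<Prod>d\<in>D. indicator {-real n..real n} (Y d) :: real) = indicator (A n)"
      using assms by (auto simp: A_def indicator_def fun_eq_iff abs_le_iff intro!: prod.neutral) (use assms in force)+
    finally show ?thesis using mA by (simp add: integrable_indicator_iff)
  qed
  have un: "(\<Union>n. A n) = UNIV"
  proof safe
    fix Y :: "'i \<Rightarrow> real"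
    obtain n where "Max (insert 0 ((\<lambda>d. \<bar>Y d\<bar>) ` D)) \<le> real n" using real_arch_simple by blast
    then have "Y \<in> A n" using assms by (auto simp: A_def)
    then show "Y \<in> (\<Union>n. A n)" by auto
  qed auto
  show "\<exists>A. countable A \<and> A \<subseteq> sets (lborel_on D) \<and> \<Union>A = space (lborel_on D) \<and> (\<forall>a\<in>A. emeasure (lborel_on D) a \<noteq> \<infinity>)"
    using mA fin un by (intro exI[of _ "range A"]) auto
qed

lemma zero_ext_upd: "d \<notin> D \<Longrightarrow> zero_ext (insert d D) (Y(d := y)) = (zero_ext D Y)(d := y)"
  by (auto simp: zero_ext_def)

text \<open>Fubini for a single coordinate; all removals of variables below go through it. The
  update overwrites the value 0 that \<open>lborel_on D\<close> assigns to coordinate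
  \<open>d\<close>.\<close>

lemma integral_lborel_on_insert:
  fixes F :: "('i::countable \<Rightarrow> real) \<Rightarrow> 'b::{banach,second_countable_topology}"
  assumes "finite D" "d \<notin> D" "integrable (lborel_on (insert d D)) F"
  shows "(\<integral>Y. F Y \<partial>lborel_on (insert d D)) = (\<integral>Y. (\<integral>y. F (Y(d := y)) \<partial>lborel) \<partial>lborel_on D)"
proof -
  have F: "F \<in> borel_measurable borel" using assms(3) by (auto dest: borel_measurable_integrable)
  have "(\<lambda>(Y, y). F (Y(d := y))) = F \<circ> (\<lambda>(Y, t). Y(d := t))" by auto
  then have "(\<lambda>(Y, y). F (Y(d := y))) \<in> borel_measurable (borel \<Otimes>\<^sub>M (borel :: real measure))"
    using F by (metis measurable_comp measurable_fun_upd_borel)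
  then have "(\<lambda>(Y, y). F (Y(d := y))) \<in> borel_measurable (borel \<Otimes>\<^sub>M (lborel :: real measure))"
    by (simp add: measurable_def sets_pair_measure space_pair_measure)
  then have m: "(\<lambda>Y. \<integral>y. F (Y(d := y)) \<partial>lborel) \<in> borel_measurable borel"
    by (rule sigma_finite_measure.borel_measurable_lebesgue_integral[OF sigma_finite_lborel])
  have "(\<integral>Y. F Y \<partial>lborel_on (insert d D)) = (\<integral>Y. (\<integral>y. F (zero_ext (insert d D) (Y(d := y))) \<partial>lborel) \<partial>(\<Pi>\<^sub>M i\<in>D. lborel))"
    unfolding integral_lborel_on[OF F] using assms integrable_lborel_on_iff[OF F] by (intro lborel_product.product_integral_insert) auto
  also have "\<dots> = (\<integral>Y. (\<integral>y. F (Y(d := y)) \<partial>lborel) \<partial>lborel_on D)"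
    using assms by (simp add: integral_lborel_on[OF m] zero_ext_upd)
  finally show ?thesis .
qed

section \<open>Pairing order_two functions through an oscillating kernel\<close>

definition cauchy :: "real \<Rightarrow> real" where
  "cauchy y = inverse (1 + y\<^sup>2)"

lemma cauchy_pos: "0 < cauchy y" and cauchy_le_1: "cauchy y \<le> 1"
  by (simp_all add: cauchy_def add_pos_nonneg inverse_le_1_iff)

lemma cauchy_nonneg [simp]: "0 \<le> cauchy y"
  using cauchy_pos less_imp_le by blast

lemma integrable_cauchy: "integrable lborel cauchy"
proof -
  have "set_integrable lborel UNIV (\<lambda>x::real. inverse (1 + x^2))"
    using integrable_inverse_1_plus_square by simp
  then show ?thesis by (simp add: set_integrable_def cauchy_def[abs_def])
qed

text \<open>The boundary terms of an integration by parts: the integral over [-k, k] is f(k) -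
  f(-k), and the decay of \<open>f\<close> removes both ends.\<close>

lemma integral_deriv_eq_0:
  fixes f f' :: "real \<Rightarrow> complex"
  assumes d: "\<And>y. (f has_vector_derivative f' y) (at y)"
    and c: "continuous_on UNIV f'"
    and b: "\<And>y. cmod (f y) \<le> C * cauchy y" "\<And>y. cmod (f' y) \<le> C * cauchy y"
  shows "(\<integral>y. f' y \<partial>lborel) = 0"
proof -
  have [measurable]: "f' \<in> borel_measurable borel" by (rule borel_measurable_continuous_onI[OF c])
  have "(\<lambda>k. \<integral>y. indicator {- real k..real k} y *\<^sub>R f' y \<partial>lborel) \<longlonglongrightarrow> (\<integral>y. f' y \<partial>lborel)"
  proof (rule integral_dominated_convergence[where w="\<lambda>y. C * cauchy y"])
    show "AE y in lborel. (\<lambda>k. indicator {- real k..real k} y *\<^sub>R f' y) \<longlonglongrightarrow> f' y"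
    proof (rule AE_I2, rule tendsto_eventually)
      fix y :: real
      obtain n where "\<bar>y\<bar> \<le> real n" using real_arch_simple by blast
      then show "\<forall>\<^sub>F k in sequentially. indicator {- real k..real k} y *\<^sub>R f' y = f' y"
        by (intro eventually_sequentiallyI[of n]) (auto simp: indicator_def)
    qed
    show "AE y in lborel. cmod (indicator {- real k..real k} y *\<^sub>R f' y) \<le> C * cauchy y" for k
      using b(2) by (intro AE_I2) (auto simp: indicator_def intro: order_trans[OF norm_ge_zero])
  qed (auto intro: integrable_cauchy)
  moreover have "(\<integral>y. indicator {- real k..real k} y *\<^sub>R f' y \<partial>lborel) = f (real k) - f (- real k)" for k
    by (intro integral_FTC_atLeastAtMost) (auto intro: has_vector_derivative_at_within[OF d] continuous_on_subset[OF c])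
  moreover have "(\<lambda>k. f (real k) - f (- real k)) \<longlonglongrightarrow> 0 - 0"
  proof (intro tendsto_diff)
    have l: "(\<lambda>k. C * cauchy (real k)) \<longlonglongrightarrow> C * 0"
    proof (intro tendsto_mult tendsto_const)
      show "(\<lambda>k. cauchy (real k)) \<longlonglongrightarrow> 0"
        unfolding cauchy_def by real_asymp
    qed
    show "(\<lambda>k. f (real k)) \<longlonglongrightarrow> 0"
      by (rule Lim_null_comparison[OF _ l[simplified]]) (use b in auto)
    have "cauchy (- y) = cauchy y" for y by (simp add: cauchy_def)
    then show "(\<lambda>k. f (- real k)) \<longlonglongrightarrow> 0"
      using b(1)[of "- _"] by (intro Lim_null_comparison[OF _ l[simplified]]) auto
  qed
  ultimately show ?thesis using LIMSEQ_unique by fastforce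
qed

text \<open>Read off from the characteristic function of the standard normal law by the substitution
  x = c z with c^2 = 2 \<epsilon>.\<close>

lemma
  fixes \<epsilon> v :: real
  assumes "\<epsilon> > 0"
  shows integrable_gauss_cis: "integrable lborel (\<lambda>z. complex_of_real (exp (- \<epsilon> * z\<^sup>2)) * cis (- 2 * v * z))"
    and integral_gauss_cis: "(\<integral>z. complex_of_real (exp (- \<epsilon> * z\<^sup>2)) * cis (- 2 * v * z) \<partial>lborel) =
       complex_of_real (sqrt (pi / \<epsilon>) * exp (- v\<^sup>2 / \<epsilon>))"
proof -
  define c where "c = sqrt (2 * \<epsilon>)"
  define t where "t = - 2 * v / c"
  have c: "c > 0" "c\<^sup>2 = 2 * \<epsilon>" using assms by (auto simp: c_def)
  let ?g = "\<lambda>x. std_normal_density x *\<^sub>R cis (t * x)"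
  have i: "integrable lborel ?g"
    by (rule Bochner_Integration.integrable_bound[OF integrable_std_normal_moment[of 0]]) (auto simp: normal_density_nonneg cis_conv_exp)
  have "complex_of_real (exp (- (t^2) / 2)) = char std_normal_distribution t"
    by (simp add: char_std_normal_distribution)
  also have "\<dots> = (\<integral>x. ?g x \<partial>lborel)"
    unfolding char_def by (subst integral_density) (auto simp: cis_conv_exp normal_density_nonneg)
  also have "\<dots> = \<bar>c\<bar> *\<^sub>R (\<integral>z. ?g (0 + c * z) \<partial>lborel)"
    using c by (intro lborel_integral_real_affine) auto
  finally have 1: "(\<integral>z. ?g (c * z) \<partial>lborel) = complex_of_real (exp (- (t^2) / 2) / c)"
    using c by (simp add: field_simps scaleR_conv_of_real)
  have 2: "complex_of_real (exp (- \<epsilon> * z\<^sup>2)) * cis (- 2 * v * z) = sqrt (2 * pi) *\<^sub>R ?g (c * z)" for z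
  proof -
    have "(c * z)\<^sup>2 / 2 = \<epsilon> * z\<^sup>2" using c by (simp add: power_mult_distrib)
    moreover have "t * (c * z) = - 2 * v * z" using c by (simp add: t_def)
    ultimately show ?thesis by (simp add: std_normal_density_def scaleR_conv_of_real)
  qed
  show "integrable lborel (\<lambda>z. complex_of_real (exp (- \<epsilon> * z\<^sup>2)) * cis (- 2 * v * z))"
    unfolding 2 using lborel_integrable_real_affine[OF i, of c 0] c
    by (intro integrable_scaleR_right) auto
  have "sqrt (2 * pi) * (1 / c) = sqrt (pi / \<epsilon>)"
    using assms by (simp add: c_def real_sqrt_mult real_sqrt_divide field_simps)
  moreover have "- (t^2) / 2 = - v\<^sup>2 / \<epsilon>"
    using c by (simp add: t_def power_divide field_simps)
  ultimately show "(\<integral>z. complex_of_real (exp (- \<epsilon> * z\<^sup>2)) * cis (- 2 * v * z) \<partial>lborel) =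
       complex_of_real (sqrt (pi / \<epsilon>) * exp (- v\<^sup>2 / \<epsilon>))"
    unfolding 2 integral_scaleR_right 1
    by (metis (no_types) scaleR_conv_of_real of_real_mult times_divide_eq_right mult.commute mult_1 times_divide_eq_left)
qed

lemma
  fixes \<epsilon> :: real
  assumes "\<epsilon> > 0"
  shows integrable_gauss: "integrable lborel (\<lambda>z. exp (- \<epsilon> * z\<^sup>2))"
    and integral_gauss: "(\<integral>z. exp (- \<epsilon> * z\<^sup>2) \<partial>lborel) = sqrt (pi / \<epsilon>)"
proof -
  have "integrable lborel (\<lambda>z. complex_of_real (exp (- \<epsilon> * z\<^sup>2)))"
    using integrable_gauss_cis[OF assms, of 0] by simp
  then show i: "integrable lborel (\<lambda>z. exp (- \<epsilon> * z\<^sup>2))"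
    by (simp add: complex_of_real_integrable_eq)
  have "complex_of_real (\<integral>z. exp (- \<epsilon> * z\<^sup>2) \<partial>lborel) = complex_of_real (sqrt (pi / \<epsilon>))"
    using integral_gauss_cis[OF assms, of 0] by (simp flip: integral_complex_of_real)
  then show "(\<integral>z. exp (- \<epsilon> * z\<^sup>2) \<partial>lborel) = sqrt (pi / \<epsilon>)" by (simp only: of_real_eq_iff)
qed

section \<open>The kernel, its transform and the bilinear pairing\<close>

definition wave :: "'i set \<Rightarrow> ('i \<Rightarrow> real) \<Rightarrow> ('i \<Rightarrow> real) \<Rightarrow> complex" where
  "wave D Y Z = cis (- 2 * (\<Sum>d\<in>D. Y d * Z d))"

definition ft :: "'i set \<Rightarrow> (('i::countable \<Rightarrow> real) \<Rightarrow> complex) \<Rightarrow> ('i \<Rightarrow> real) \<Rightarrow> complex" where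
  "ft D F Y = (\<integral>Z. F Z * wave D Y Z \<partial>lborel_on D)"

text \<open>Formally, integrating the kernel over \<open>Z\<close> gives pi times a Dirac mass in
  each coordinate of \<open>Y\<close>; this is the origin of the later divisions by
  \<open>pi ^ card D\<close>.\<close>

definition pairing :: "'i set \<Rightarrow> (('i::countable \<Rightarrow> real) \<Rightarrow> complex) \<Rightarrow> (('i \<Rightarrow> real) \<Rightarrow> complex) \<Rightarrow> complex" where
  "pairing D F G = (\<integral>Y. F Y * ft D G Y \<partial>lborel_on D)"

definition weight :: "'i set \<Rightarrow> ('i \<Rightarrow> real) \<Rightarrow> real" where
  "weight D Y = (\<Prod>d\<in>D. cauchy (Y d))"

lemma norm_wave [simp]: "cmod (wave D Y Z) = 1"
  by (simp add: wave_def)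

lemma wave_commute: "wave D Y Z = wave D Z Y"
  by (simp add: wave_def mult.commute)

lemma wave_measurable [measurable]:
  fixes f g :: "'a \<Rightarrow> 'i::countable \<Rightarrow> real"
  assumes [measurable]: "f \<in> borel_measurable M" "g \<in> borel_measurable M"
  shows "(\<lambda>x. wave D (f x) (g x)) \<in> borel_measurable M"
proof -
  have [measurable]: "(\<lambda>x. f x d) \<in> borel_measurable M" "(\<lambda>x. g x d) \<in> borel_measurable M" for d
    by (auto intro: measurable_compose[OF _ borel_measurable_coordinate])
  show ?thesis unfolding wave_def cis_conv_exp by measurable
qed

lemma wave_upd:
  assumes "finite D" "d \<notin> D"
  shows "wave (insert d D) Y (Z(d := z)) = wave D Y Z * cis (- 2 * Y d * z)"
proof -
  have "(\<Sum>i\<in>D. Y i * (Z(d := z)) i) = (\<Sum>i\<in>D. Y i * Z i)"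
    using assms by (intro sum.cong) auto
  then show ?thesis using assms by (simp add: wave_def cis_mult algebra_simps)
qed

lemma weight_nonneg [simp]: "0 \<le> weight D Y"
  unfolding weight_def by (intro prod_nonneg) auto

lemma integrable_weight: "finite D \<Longrightarrow> integrable (lborel_on D) (weight D)"
  unfolding weight_def by (intro integrable_lborel_on_prod integrable_cauchy)

lemma weight_upd: "finite D \<Longrightarrow> d \<notin> D \<Longrightarrow> weight (insert d D) (Y(d := y)) = weight D Y * cauchy y"
proof -
  assume a: "finite D" "d \<notin> D"
  then have "(\<Prod>i\<in>D. cauchy ((Y(d := y)) i)) = (\<Prod>i\<in>D. cauchy (Y i))"
    by (intro prod.cong) auto
  then show ?thesis using a by (simp add: weight_def)
qed

lemma integrable_decay:
  fixes F :: "('i::countable \<Rightarrow> real) \<Rightarrow> complex"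
  assumes "finite D" "F \<in> borel_measurable borel" "\<And>Y. cmod (F Y) \<le> C * weight D Y"
  shows "integrable (lborel_on D) F"
  using assms(2,3)
  by (intro Bochner_Integration.integrable_bound[OF integrable_mult_right[OF integrable_weight[OF assms(1)], of C]])
    (auto intro!: AE_I2 order_trans[OF assms(3)])

lemma integrable_times_bounded:
  fixes F G :: "'a \<Rightarrow> complex"
  assumes "integrable M F" "G \<in> borel_measurable M" "\<And>Y. cmod (G Y) \<le> C"
  shows "integrable M (\<lambda>Y. F Y * G Y)"
proof (rule Bochner_Integration.integrable_bound[OF integrable_mult_right[OF integrable_norm[OF assms(1)], of C]])
  show "(\<lambda>Y. F Y * G Y) \<in> borel_measurable M" using assms by auto
  show "AE Y in M. norm (F Y * G Y) \<le> norm (C * norm (F Y))"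
  proof (rule AE_I2)
    fix Y
    have "norm (F Y * G Y) \<le> norm (F Y) * C" using assms(3)[of Y] by (simp add: norm_mult mult_left_mono)
    also have "\<dots> \<le> norm (C * norm (F Y))" by (simp add: mult.commute)
    finally show "norm (F Y * G Y) \<le> norm (C * norm (F Y))" .
  qed
qed

lemma integrable_wave:
  "integrable (lborel_on D) F \<Longrightarrow> integrable (lborel_on D) (\<lambda>Z. F Z * wave D Y Z)"
  by (rule integrable_times_bounded[where C=1]) auto

lemma ft_measurable [measurable]:
  assumes "finite D" and [measurable]: "G \<in> borel_measurable borel"
  shows "ft D G \<in> borel_measurable borel"
proof -
  interpret sigma_finite_measure "lborel_on D" using assms(1) by (rule sigma_finite_lborel_on)
  show ?thesis unfolding ft_def[abs_def] by measurable
qed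

lemma norm_ft_le: "cmod (ft D G Y) \<le> (\<integral>Z. cmod (G Z) \<partial>lborel_on D)"
  unfolding ft_def by (rule order_trans[OF integral_norm_bound]) (simp add: norm_mult)

lemma integrable_pair_wave:
  assumes "finite D" and F: "integrable (lborel_on D) F" and G: "integrable (lborel_on D) G"
  shows "integrable (lborel_on D \<Otimes>\<^sub>M lborel_on D) (\<lambda>(Y, Z). F Y * G Z * wave D Y Z)"
proof -
  interpret sigma_finite_measure "lborel_on D" using assms(1) by (rule sigma_finite_lborel_on)
  interpret pair_sigma_finite "lborel_on D" "lborel_on D" ..
  have [measurable]: "F \<in> borel_measurable borel" "G \<in> borel_measurable borel"
    using F G by (auto dest!: borel_measurable_integrable)
  show ?thesis
  proof (rule Fubini_integrable)
    show "integrable (lborel_on D) (\<lambda>Y. \<integral>Z. norm (case (Y, Z) of (Y, Z) \<Rightarrow> F Y * G Z * wave D Y Z) \<partial>lborel_on D)"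
      using F by (simp add: norm_mult)
    show "AE Y in lborel_on D. integrable (lborel_on D) (\<lambda>Z. case (Y, Z) of (Y, Z) \<Rightarrow> F Y * G Z * wave D Y Z)"
      using integrable_mult_right[OF integrable_wave[OF G]] by (simp add: mult.assoc)
  qed measurable
qed

lemma pairing_eq_pair:
  assumes "finite D" and F: "integrable (lborel_on D) F" and G: "integrable (lborel_on D) G"
  shows "pairing D F G = (\<integral>(Y, Z). F Y * G Z * wave D Y Z \<partial>(lborel_on D \<Otimes>\<^sub>M lborel_on D))"
proof -
  interpret sigma_finite_measure "lborel_on D" using assms(1) by (rule sigma_finite_lborel_on)
  interpret pair_sigma_finite "lborel_on D" "lborel_on D" ..
  show ?thesis
    using integral_fst[OF integrable_pair_wave[OF assms]]
    by (simp add: pairing_def ft_def mult.assoc)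
qed

text \<open>Fubini. It moves the transform from one factor to the other, so that each factor in turn
  can be integrated by parts.\<close>

lemma pairing_commute:
  assumes "finite D" and F: "integrable (lborel_on D) F" and G: "integrable (lborel_on D) G"
  shows "pairing D F G = pairing D G F"
proof -
  interpret sigma_finite_measure "lborel_on D" using assms(1) by (rule sigma_finite_lborel_on)
  interpret pair_sigma_finite "lborel_on D" "lborel_on D" ..
  have "pairing D F G = (\<integral>Y. (\<integral>Z. F Y * G Z * wave D Y Z \<partial>lborel_on D) \<partial>lborel_on D)"
    by (simp add: pairing_def ft_def mult.assoc)
  also have "\<dots> = (\<integral>Z. (\<integral>Y. F Y * G Z * wave D Y Z \<partial>lborel_on D) \<partial>lborel_on D)"
    by (rule Fubini_integral[symmetric]) (rule integrable_pair_wave[OF assms])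
  also have "\<dots> = pairing D G F"
    by (simp add: pairing_def ft_def wave_commute[of D _ ] flip: integral_mult_right_zero)
      (simp add: mult_ac)
  finally show ?thesis .
qed

lemma continuous_on_fun_upd [continuous_intros]:
  "continuous_on A f \<Longrightarrow> continuous_on A g \<Longrightarrow> continuous_on A (\<lambda>x. (f x)(d := g x))"
  for f :: "'a::topological_space \<Rightarrow> 'i \<Rightarrow> 'b::topological_space"
proof (rule continuous_on_coordinatewise_then_product)
  fix i
  assume "continuous_on A f" "continuous_on A g"
  then show "continuous_on A (\<lambda>x. ((f x)(d := g x)) i)"
    by (cases "i = d") (simp_all add: continuous_on_product_then_coordinatewise)
qed

lemma continuous_on_section:
  fixes F :: "('i \<Rightarrow> real) \<Rightarrow> complex"
  assumes "continuous_on UNIV F"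
  shows "continuous_on UNIV (\<lambda>t. F (Y(d := t)))"
  by (rule continuous_on_compose2[OF assms]) (auto simp del: fun_upd_apply intro!: continuous_on_fun_upd continuous_on_const continuous_on_id)

text \<open>The derivative of \<open>G0 * wave\<close> along coordinate \<open>d\<close> integrates
  to 0 by the decay, and differentiating the wave brings down
  \<open>- 2 * \<i> * Y d\<close>.\<close>

lemma ft_deriv:
  fixes G0 G1 :: "('i::countable \<Rightarrow> real) \<Rightarrow> complex"
  assumes D: "finite D" "d \<in> D"
    and c: "continuous_on UNIV G0" "continuous_on UNIV G1"
    and der: "\<And>Z. ((\<lambda>t. G0 (Z(d := t))) has_vector_derivative G1 Z) (at (Z d))"
    and b: "\<And>Z. cmod (G0 Z) \<le> C * weight D Z" "\<And>Z. cmod (G1 Z) \<le> C * weight D Z"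
  shows "ft D G1 Y = 2 * \<i> * of_real (Y d) * ft D G0 Y"
proof -
  define D' where "D' = D - {d}"
  have D': "D = insert d D'" "d \<notin> D'" "finite D'" using D by (auto simp: D'_def)
  have [measurable]: "G0 \<in> borel_measurable borel" "G1 \<in> borel_measurable borel"
    using c by (auto intro: borel_measurable_continuous_onI)
  have i: "integrable (lborel_on D) G0" "integrable (lborel_on D) G1"
    by (rule integrable_decay[OF D(1)]; use b in auto)+
  have C: "0 \<le> C * weight D Z" for Z using b(1)[of Z] norm_ge_zero order_trans by blast
  have "0 \<le> C * weight D (\<lambda>_. 0)" by (rule C)
  then have C0: "0 \<le> C" by (simp add: weight_def cauchy_def)
  let ?H = "\<lambda>Z. G1 Z * wave D Y Z + G0 Z * wave D Y Z * (- 2 * \<i> * of_real (Y d))"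
  have iH: "integrable (lborel_on D) ?H"
    by (intro Bochner_Integration.integrable_add integrable_mult_left integrable_wave i)
  have "(\<integral>z. ?H (Z(d := z)) \<partial>lborel) = 0" for Z
  proof (rule integral_deriv_eq_0)
    let ?e = "\<lambda>z. cis (- 2 * Y d * z)"
    have w: "wave D Y (Z(d := z)) = wave D' Y Z * ?e z" for z
      using wave_upd[OF D'(3,2)] D'(1) by simp
    have de: "(?e has_vector_derivative ?e z * (- 2 * \<i> * of_real (Y d))) (at z)" for z
    proof -
      have "((\<lambda>w. exp (- 2 * \<i> * of_real (Y d) * w)) has_field_derivative
          exp (- 2 * \<i> * of_real (Y d) * of_real z) * (- 2 * \<i> * of_real (Y d))) (at (of_real z))"
        by (auto intro!: derivative_eq_intros)
      from has_vector_derivative_real_field[OF this]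
      show ?thesis by (simp add: cis_conv_exp mult_ac)
    qed
    show "((\<lambda>z. G0 (Z(d := z)) * wave D Y (Z(d := z))) has_vector_derivative ?H (Z(d := z))) (at z)" for z
    proof -
      have "((\<lambda>t. G0 (Z(d := t))) has_vector_derivative G1 (Z(d := z))) (at z)"
        using der[of "Z(d := z)"] by simp
      from has_vector_derivative_mult[OF this has_vector_derivative_mult_right[OF de, of "wave D' Y Z"]]
      show ?thesis unfolding w by (simp add: algebra_simps)
    qed
    show "continuous_on UNIV (\<lambda>z. ?H (Z(d := z)))"
      unfolding w cis_conv_exp by (intro continuous_intros continuous_on_section c)
    let ?C = "C * weight D' Z * (1 + 2 * \<bar>Y d\<bar>)"
    have wt: "weight D (Z(d := z)) = weight D' Z * cauchy z" for z
      using weight_upd[OF D'(3,2)] D'(1) by simp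
    show "cmod (G0 (Z(d := z)) * wave D Y (Z(d := z))) \<le> ?C * cauchy z" for z
    proof -
      have "cmod (G0 (Z(d := z)) * wave D Y (Z(d := z))) \<le> C * weight D (Z(d := z)) * 1"
        using b(1)[of "Z(d := z)"] by (simp add: norm_mult)
      also have "\<dots> \<le> C * weight D (Z(d := z)) * (1 + 2 * \<bar>Y d\<bar>)"
        by (intro mult_left_mono C) auto
      finally show ?thesis by (simp add: wt mult_ac)
    qed
    show "cmod (?H (Z(d := z))) \<le> ?C * cauchy z" for z
    proof -
      have "cmod (?H (Z(d := z))) \<le> C * weight D (Z(d := z)) + C * weight D (Z(d := z)) * (2 * \<bar>Y d\<bar>)"
        using b[of "Z(d := z)"]
        by (intro norm_triangle_le add_mono) (auto simp: norm_mult mult.assoc[symmetric] intro!: mult_right_mono)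
      then show ?thesis by (simp add: wt algebra_simps)
    qed
  qed
  then have "(\<integral>Z. ?H Z \<partial>lborel_on D) = 0"
    using integral_lborel_on_insert[OF D'(3,2), of ?H] iH D'(1) by simp
  moreover have "(\<integral>Z. ?H Z \<partial>lborel_on D) = ft D G1 Y + ft D G0 Y * (- 2 * \<i> * of_real (Y d))"
    unfolding ft_def by (subst Bochner_Integration.integral_add) (auto intro!: integrable_wave i integrable_mult_left)
  ultimately show ?thesis by (simp add: algebra_simps)
qed

section \<open>Integration by parts\<close>

text \<open>For i = 0, 1, 2 this is the i-th derivative of 1 / (1 + 4 \<theta> y^2), written through
  v so that comparison with v itself is immediate.\<close>

definition damp :: "real \<Rightarrow> nat \<Rightarrow> real \<Rightarrow> real" where
  "damp \<theta> i y = (let v = inverse (1 + 4 * \<theta> * y\<^sup>2) in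
     if i = 0 then v else if i = 1 then - 8 * \<theta> * y * v ^ 2 else - 8 * \<theta> * v ^ 2 + 128 * \<theta>\<^sup>2 * y\<^sup>2 * v ^ 3)"

lemma damp_deriv:
  assumes "\<theta> \<ge> 0"
  shows "(damp \<theta> 0 has_real_derivative damp \<theta> 1 y) (at y)"
    and "(damp \<theta> 1 has_real_derivative damp \<theta> 2 y) (at y)"
proof -
  have p: "1 + 4 * \<theta> * y\<^sup>2 > 0" for y using assms by (simp add: add_pos_nonneg)
  have n: "1 + 4 * \<theta> * y\<^sup>2 \<noteq> 0" using p[of y] by linarith
  have v: "((\<lambda>y. inverse (1 + 4 * \<theta> * y\<^sup>2)) has_real_derivative - 8 * \<theta> * y * inverse (1 + 4 * \<theta> * y\<^sup>2) ^ 2) (at y)"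
    using n by (auto intro!: derivative_eq_intros simp: field_simps power2_eq_square)
  then show "(damp \<theta> 0 has_real_derivative damp \<theta> 1 y) (at y)"
    by (simp add: damp_def[abs_def] Let_def)
  have "((\<lambda>y. (- 8 * \<theta> * y) * inverse (1 + 4 * \<theta> * y\<^sup>2) ^ 2) has_real_derivative
     (- 8 * \<theta>) * inverse (1 + 4 * \<theta> * y\<^sup>2) ^ 2 + (2 * inverse (1 + 4 * \<theta> * y\<^sup>2) * (- 8 * \<theta> * y * inverse (1 + 4 * \<theta> * y\<^sup>2) ^ 2)) * (- 8 * \<theta> * y)) (at y)"
    by (rule derivative_eq_intros v refl | simp)+
  then show "(damp \<theta> 1 has_real_derivative damp \<theta> 2 y) (at y)"
    by (simp add: damp_def[abs_def] Let_def) (simp add: algebra_simps power2_eq_square power3_eq_cube)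
qed

lemma damp_0: "damp \<theta> 0 y = cauchy (2 * sqrt \<theta> * y)" if "\<theta> \<ge> 0"
  using that by (simp add: damp_def cauchy_def power_mult_distrib)

lemma damp_0_mult: "\<theta> \<ge> 0 \<Longrightarrow> damp \<theta> 0 y * (1 + 4 * \<theta> * y\<^sup>2) = 1"
proof -
  assume "\<theta> \<ge> 0"
  then have "1 + 4 * \<theta> * y\<^sup>2 > 0" by (simp add: add_pos_nonneg)
  then show ?thesis by (simp add: damp_def)
qed

text \<open>For i = 1, 2 |y| \<le> 1 + y^2 and \<theta> \<le> 1 bound the quotient by 4. For the
  second derivative, 4 \<theta> y^2 v \<le> 1 bounds the two terms by 8 v and 32 v, whence
  40.\<close>

lemma damp_bound:
  assumes "0 \<le> \<theta>" "\<theta> \<le> 1"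
  shows "\<bar>damp \<theta> i y\<bar> \<le> 40 * damp \<theta> 0 y"
proof -
  define v where "v = inverse (1 + 4 * \<theta> * y\<^sup>2)"
  have p: "1 + 4 * \<theta> * y\<^sup>2 \<ge> 1" using assms by simp
  then have v: "0 < v" "v \<le> 1" by (auto simp: v_def inverse_le_1_iff)
  have e: "v * (1 + 4 * \<theta> * y\<^sup>2) = 1" using p by (simp add: v_def)
  then have le: "4 * \<theta> * y\<^sup>2 * v \<le> 1" using v by (simp add: algebra_simps)
  have "\<bar>8 * \<theta> * y\<bar> * v \<le> 40"
  proof -
    have "\<bar>8 * \<theta> * y\<bar> \<le> 4 * \<theta> * (1 + y\<^sup>2)"
    proof -
      have "2 * \<bar>y\<bar> \<le> 1 + y\<^sup>2" using sum_squares_bound[of 1 "\<bar>y\<bar>"] by simp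
      then have "4 * \<theta> * (2 * \<bar>y\<bar>) \<le> 4 * \<theta> * (1 + y\<^sup>2)" using assms by (intro mult_left_mono) auto
      then show ?thesis using assms by (simp add: abs_mult)
    qed
    also have "\<dots> \<le> 4 * (1 + 4 * \<theta> * y\<^sup>2)"
    proof -
      define q where "q = \<theta> * y\<^sup>2"
      have "0 \<le> q" using assms by (simp add: q_def)
      have "4 * \<theta> * (1 + y\<^sup>2) = 4 * \<theta> + 4 * q" by (simp add: algebra_simps q_def)
      also have "\<dots> \<le> 4 + 16 * q" using assms \<open>0 \<le> q\<close> by linarith
      also have "\<dots> = 4 * (1 + 4 * \<theta> * y\<^sup>2)" by (simp add: algebra_simps q_def)
      finally show ?thesis .
    qed
    finally have "\<bar>8 * \<theta> * y\<bar> * v \<le> 4 * (1 + 4 * \<theta> * y\<^sup>2) * v" using v by (intro mult_right_mono) auto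
    also have "\<dots> = 4 * (v * (1 + 4 * \<theta> * y\<^sup>2))" by (simp only: mult_ac)
    also have "\<dots> = 4" using e by simp
    finally show ?thesis by simp
  qed
  then have 1: "\<bar>8 * \<theta> * y\<bar> * v * v \<le> 40 * v" using v by (intro mult_right_mono) auto
  have 2: "8 * \<theta> * v ^ 2 \<le> 8 * v"
  proof -
    have "\<theta> * v ^ 2 \<le> 1 * v" unfolding power2_eq_square mult.assoc[symmetric]
      using assms v by (intro mult_right_mono) (auto intro: mult_le_one)
    then show ?thesis by simp
  qed
  have 3: "128 * \<theta>\<^sup>2 * y\<^sup>2 * v ^ 3 \<le> 32 * v"
  proof -
    have "128 * \<theta>\<^sup>2 * y\<^sup>2 * v ^ 3 = 32 * ((\<theta> * v) * (4 * \<theta> * y\<^sup>2 * v)) * v" by (simp add: power2_eq_square power3_eq_cube)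
    also have "(\<theta> * v) * (4 * \<theta> * y\<^sup>2 * v) \<le> 1"
    proof (rule mult_le_one[OF _ _ le])
      show "\<theta> * v \<le> 1" using assms v by (intro mult_le_one) auto
      show "0 \<le> 4 * \<theta> * y\<^sup>2 * v" using assms v by (intro mult_nonneg_nonneg) auto
    qed
    then have "32 * ((\<theta> * v) * (4 * \<theta> * y\<^sup>2 * v)) * v \<le> 32 * 1 * v"
      using v by (intro mult_right_mono mult_left_mono) auto
    finally show ?thesis by simp
  qed
  have "0 \<le> 128 * \<theta>\<^sup>2 * y\<^sup>2 * v ^ 3" "0 \<le> 8 * \<theta> * v^2" using v assms by auto
  moreover have "\<bar>- 8 * \<theta> * y * v\<^sup>2\<bar> = \<bar>8 * \<theta> * y\<bar> * v * v" using v by (simp add: abs_mult power2_eq_square)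
  moreover have "\<bar>- 8 * \<theta> * v ^ 2 + 128 * \<theta>\<^sup>2 * y\<^sup>2 * v ^ 3\<bar> \<le> 40 * v"
    using calculation(1,2) 2 3 v by linarith
  ultimately show ?thesis using 1 v
    unfolding damp_def Let_def v_def[symmetric]
    by (cases "i = 0"; cases "i = 1") auto
qed

lemma damp_le_1: "0 \<le> \<theta> \<Longrightarrow> damp \<theta> 0 y \<le> 1"
  and damp_nonneg: "0 \<le> \<theta> \<Longrightarrow> 0 \<le> damp \<theta> 0 y"
  by (auto simp: damp_0 cauchy_le_1)

lemma damp_continuous:
  assumes "0 \<le> \<theta>" shows "continuous_on UNIV (damp \<theta> i)"
proof -
  have p: "1 + 4 * \<theta> * y\<^sup>2 \<noteq> 0" for y using assms by (smt (verit) mult_nonneg_nonneg zero_le_power2)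
  show ?thesis unfolding damp_def[abs_def] Let_def using p
    by (cases "i = 0"; cases "i = 1") (auto intro!: continuous_intros)
qed

text \<open>Since (2 \<i> Y_d)^2 = - 4 Y_d^2, the operator 1 - \<theta> \<partial>_d^2 becomes the
  strictly positive multiplier 1 + 4 \<theta> Y_d^2, which can be divided by.\<close>

lemma ft_second:
  fixes G0 G1 G2 :: "('i::countable \<Rightarrow> real) \<Rightarrow> complex"
  assumes D: "finite D" "d \<in> D"
    and c: "continuous_on UNIV G0" "continuous_on UNIV G1" "continuous_on UNIV G2"
    and der: "\<And>Z. ((\<lambda>t. G0 (Z(d := t))) has_vector_derivative G1 Z) (at (Z d))"
      "\<And>Z. ((\<lambda>t. G1 (Z(d := t))) has_vector_derivative G2 Z) (at (Z d))"
    and b: "\<And>Z. cmod (G0 Z) \<le> C * weight D Z" "\<And>Z. cmod (G1 Z) \<le> C * weight D Z"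
      "\<And>Z. cmod (G2 Z) \<le> C * weight D Z"
  shows "ft D (\<lambda>Z. G0 Z - of_real \<theta> * G2 Z) Y = (1 + 4 * of_real \<theta> * (of_real (Y d))\<^sup>2) * ft D G0 Y"
proof -
  have i: "integrable (lborel_on D) G0" "integrable (lborel_on D) G2"
    by (rule integrable_decay[OF D(1)]; use b c in \<open>auto intro: borel_measurable_continuous_onI\<close>)+
  have "ft D (\<lambda>Z. G0 Z - of_real \<theta> * G2 Z) Y = ft D G0 Y - of_real \<theta> * ft D G2 Y"
  proof -
    have "ft D (\<lambda>Z. G0 Z - of_real \<theta> * G2 Z) Y = (\<integral>Z. G0 Z * wave D Y Z - of_real \<theta> * (G2 Z * wave D Y Z) \<partial>lborel_on D)"
      by (simp add: ft_def algebra_simps)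
    also have "\<dots> = ft D G0 Y - of_real \<theta> * ft D G2 Y"
      by (subst Bochner_Integration.integral_diff) (auto intro!: integrable_wave i integrable_mult_right simp: ft_def)
    finally show ?thesis .
  qed
  also have "ft D G2 Y = 2 * \<i> * of_real (Y d) * ft D G1 Y"
    by (rule ft_deriv[OF D c(2,3) der(2) b(2,3)])
  also have "ft D G1 Y = 2 * \<i> * of_real (Y d) * ft D G0 Y"
    by (rule ft_deriv[OF D c(1,2) der(1) b(1,2)])
  finally show ?thesis by (simp add: algebra_simps power2_eq_square)
qed

text \<open>Integrating by parts with \<open>1 + 4 \<theta> Y\<^sub>d\<^sup>2\<close> and with \<open>1 + 4 Z\<^sub>d\<^sup>2\<close> produces decay in both variables. The parameter \<open>\<theta>\<close>
  is matched to the size of \<open>\<partial>\<^sub>d\<^sup>2 G\<close> later on.\<close>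

lemma pairing_step:
  fixes F0 F1 F2 G0 G1 G2 :: "('i::countable \<Rightarrow> real) \<Rightarrow> complex"
  assumes D: "finite D" "d \<in> D" and lam: "0 \<le> \<theta>" "\<theta> \<le> 1"
    and cF: "continuous_on UNIV F0" "continuous_on UNIV F1" "continuous_on UNIV F2"
    and cG: "continuous_on UNIV G0" "continuous_on UNIV G1" "continuous_on UNIV G2"
    and dF: "\<And>Z. ((\<lambda>t. F0 (Z(d := t))) has_vector_derivative F1 Z) (at (Z d))"
      "\<And>Z. ((\<lambda>t. F1 (Z(d := t))) has_vector_derivative F2 Z) (at (Z d))"
    and dG: "\<And>Z. ((\<lambda>t. G0 (Z(d := t))) has_vector_derivative G1 Z) (at (Z d))"
      "\<And>Z. ((\<lambda>t. G1 (Z(d := t))) has_vector_derivative G2 Z) (at (Z d))"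
    and bF: "\<And>Z. cmod (F0 Z) \<le> C * weight D Z" "\<And>Z. cmod (F1 Z) \<le> C * weight D Z"
      "\<And>Z. cmod (F2 Z) \<le> C * weight D Z"
    and bG: "\<And>Z. cmod (G0 Z) \<le> C' * weight D Z" "\<And>Z. cmod (G1 Z) \<le> C' * weight D Z"
      "\<And>Z. cmod (G2 Z) \<le> C' * weight D Z"
  shows "pairing D F0 G0 = pairing D
    (\<lambda>Y. of_real (damp \<theta> 0 (Y d) - damp \<theta> 2 (Y d)) * F0 Y - of_real (2 * damp \<theta> 1 (Y d)) * F1 Y - of_real (damp \<theta> 0 (Y d)) * F2 Y)
    (\<lambda>Z. of_real (damp 1 0 (Z d)) * (G0 Z - of_real \<theta> * G2 Z))"
proof -
  let ?u = "\<lambda>i (Y::'i\<Rightarrow>real). complex_of_real (damp \<theta> i (Y d))"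
  define H0 where "H0 = (\<lambda>Y. ?u 0 Y * F0 Y)"
  define H1 where "H1 = (\<lambda>Y. ?u 0 Y * F1 Y + ?u 1 Y * F0 Y)"
  define H2 where "H2 = (\<lambda>Y. (?u 0 Y * F2 Y + ?u 1 Y * F1 Y) + (?u 1 Y * F1 Y + ?u 2 Y * F0 Y))"
  define L where "L = (\<lambda>Z. G0 Z - of_real \<theta> * G2 Z)"
  have cu: "continuous_on UNIV (?u i)" for i
    by (intro continuous_on_of_real continuous_on_compose2[OF damp_continuous[OF lam(1)]] continuous_on_product_coordinates) auto
  have cH: "continuous_on UNIV H0" "continuous_on UNIV H1" "continuous_on UNIV H2"
    unfolding H0_def H1_def H2_def by (intro continuous_intros cu cF)+
  have du: "((\<lambda>t. ?u 0 (Z(d := t))) has_vector_derivative ?u 1 Z) (at (Z d))"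
    "((\<lambda>t. ?u 1 (Z(d := t))) has_vector_derivative ?u 2 Z) (at (Z d))" for Z
    using damp_deriv[OF lam(1), of "Z d"]
    by (auto intro!: has_vector_derivative_of_real simp: has_real_derivative_iff_has_vector_derivative[symmetric])
  have dH: "((\<lambda>t. H0 (Z(d := t))) has_vector_derivative H1 Z) (at (Z d))"
    "((\<lambda>t. H1 (Z(d := t))) has_vector_derivative H2 Z) (at (Z d))" for Z
    unfolding H0_def H1_def H2_def
    using has_vector_derivative_mult[OF du(1)[of Z] dF(1)[of Z]]
      has_vector_derivative_add[OF has_vector_derivative_mult[OF du(1)[of Z] dF(2)[of Z]]
        has_vector_derivative_mult[OF du(2)[of Z] dF(1)[of Z]]]
    by (simp_all add: add_ac)
  have C0: "0 \<le> C * weight D Z" "0 \<le> C' * weight D Z" for Z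
    using bF(1)[of Z] bG(1)[of Z] norm_ge_zero order_trans by blast+
  have ub: "cmod (?u i Y) \<le> 40" for i Y
    using damp_bound[OF lam, of i "Y d"] damp_le_1[OF lam(1), of "Y d"] by simp
  have ub': "cmod (?u i Y * f) \<le> 40 * (C * weight D Y)" if "cmod f \<le> C * weight D Y" for i Y f
    unfolding norm_mult using ub[of i Y] that by (intro mult_mono) auto
  \<comment> \<open>At most four terms occur, each at most 40 times the bound of \<open>F0\<close>,
    \<open>F1\<close> or \<open>F2\<close>.\<close>
  have bH: "cmod (H0 Z) \<le> 160 * C * weight D Z" "cmod (H1 Z) \<le> 160 * C * weight D Z"
    "cmod (H2 Z) \<le> 160 * C * weight D Z" for Z
  proof -
    note u = ub'[OF bF(1), of 0 Z] ub'[OF bF(2), of 0 Z] ub'[OF bF(3), of 0 Z]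
      ub'[OF bF(1), of 1 Z] ub'[OF bF(2), of 1 Z] ub'[OF bF(1), of 2 Z]
    show "cmod (H0 Z) \<le> 160 * C * weight D Z" unfolding H0_def using u(1) C0(1)[of Z] by linarith
    show "cmod (H1 Z) \<le> 160 * C * weight D Z" unfolding H1_def
      by (rule norm_triangle_le) (use u(2,4) C0(1)[of Z] in linarith)
    have "cmod (H2 Z) \<le> (cmod (?u 0 Z * F2 Z) + cmod (?u 1 Z * F1 Z)) + (cmod (?u 1 Z * F1 Z) + cmod (?u 2 Z * F0 Z))"
      unfolding H2_def by (intro norm_triangle_le add_mono norm_triangle_ineq)
    then show "cmod (H2 Z) \<le> 160 * C * weight D Z" using u C0(1)[of Z] by linarith
  qed
  have iF: "integrable (lborel_on D) F0" and iG: "integrable (lborel_on D) G0"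
    using bF(1) bG(1) cF(1) cG(1)
    by (auto intro!: integrable_decay[OF D(1)] borel_measurable_continuous_onI)
  have iH: "integrable (lborel_on D) H0" "integrable (lborel_on D) H2"
    by (rule integrable_decay[OF D(1)]; use bH cH in \<open>auto intro: borel_measurable_continuous_onI\<close>)+
  have iL: "integrable (lborel_on D) L"
    unfolding L_def
    by (intro Bochner_Integration.integrable_diff integrable_mult_right iG integrable_decay[OF D(1) borel_measurable_continuous_onI[OF cG(3)] bG(3)])
  have iuL: "integrable (lborel_on D) (\<lambda>Z. of_real (damp 1 0 (Z d)) * L Z)"
  proof -
    have "continuous_on UNIV (\<lambda>Z::'i\<Rightarrow>real. complex_of_real (damp 1 0 (Z d)))"
      by (intro continuous_on_of_real continuous_on_compose2[OF damp_continuous] continuous_on_product_coordinates) auto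
    then have "(\<lambda>Z::'i\<Rightarrow>real. complex_of_real (damp 1 0 (Z d))) \<in> borel_measurable (lborel_on D)"
      unfolding measurable_cong_sets[OF sets_lborel_on refl] by (rule borel_measurable_continuous_onI)
    then show ?thesis
      unfolding mult.commute[of _ "L _"]
      by (intro integrable_times_bounded[OF iL, where C=1]) (auto simp: damp_le_1 damp_nonneg)
  qed
  \<comment> \<open>Insert 1 = damp * (1 + 4 \<theta> Y_d^2): the damping stays with
    \<open>F0\<close>, and the multiplier becomes 1 - \<theta> \<partial>_d^2 on
    \<open>G0\<close>.\<close>
  have "pairing D F0 G0 = pairing D H0 L"
    unfolding pairing_def L_def
  proof (rule Bochner_Integration.integral_cong[OF refl])
    fix Y
    have "complex_of_real (damp \<theta> 0 (Y d)) * (1 + 4 * of_real \<theta> * (of_real (Y d))\<^sup>2) = of_real (damp \<theta> 0 (Y d) * (1 + 4 * \<theta> * (Y d)\<^sup>2))"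
      by simp
    also have "\<dots> = 1" using lam by (subst damp_0_mult) auto
    finally show "F0 Y * ft D G0 Y = H0 Y * ft D (\<lambda>Z. G0 Z - of_real \<theta> * G2 Z) Y"
      unfolding ft_second[OF D cG dG bG] H0_def by (simp add: mult_ac)
  qed
  also have "\<dots> = pairing D L H0"
    by (rule pairing_commute[OF D(1) iH(1) iL])
  \<comment> \<open>The same with parameter 1 and the factors exchanged. The derivatives now fall on
    \<open>H0\<close>, hence also on the damping already attached to \<open>F0\<close>; this
    produces \<open>damp \<theta> 1\<close> and \<open>damp \<theta> 2\<close>.\<close>
  also have "\<dots> = pairing D (\<lambda>Z. of_real (damp 1 0 (Z d)) * L Z) (\<lambda>Z. H0 Z - of_real 1 * H2 Z)"
    unfolding pairing_def
  proof (rule Bochner_Integration.integral_cong[OF refl])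
    fix Y
    have "complex_of_real (damp 1 0 (Y d)) * (1 + 4 * of_real 1 * (of_real (Y d))\<^sup>2) = of_real (damp 1 0 (Y d) * (1 + 4 * 1 * (Y d)\<^sup>2))"
      by simp
    also have "\<dots> = 1" by (subst damp_0_mult) auto
    finally show "L Y * ft D H0 Y = of_real (damp 1 0 (Y d)) * L Y * ft D (\<lambda>Z. H0 Z - of_real 1 * H2 Z) Y"
      unfolding ft_second[OF D cH dH bH] by (simp add: mult_ac)
  qed
  also have "\<dots> = pairing D (\<lambda>Z. H0 Z - of_real 1 * H2 Z) (\<lambda>Z. of_real (damp 1 0 (Z d)) * L Z)"
    using iH iuL by (intro pairing_commute[OF D(1)]) auto
  also have "(\<lambda>Z. H0 Z - of_real 1 * H2 Z) = (\<lambda>Y. of_real (damp \<theta> 0 (Y d) - damp \<theta> 2 (Y d)) * F0 Y - of_real (2 * damp \<theta> 1 (Y d)) * F1 Y - of_real (damp \<theta> 0 (Y d)) * F2 Y)"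
    by (simp add: H0_def H2_def fun_eq_iff algebra_simps)
  finally show ?thesis by (simp add: L_def)
qed

section \<open>An \<open>L\<^sup>2\<close> bound for the pairing\<close>

text \<open>The optimal c is sqrt (B / A), which may be 0 or undefined. Adding e > 0 to both numbers
  keeps it positive, and then e tends to 0.\<close>

lemma le_sqrt_of_AMGM:
  fixes x A B :: real
  assumes "\<And>c. c > 0 \<Longrightarrow> x \<le> (c * A + B / c) / 2" "A \<ge> 0" "B \<ge> 0"
  shows "x \<le> sqrt (A * B)"
proof (rule tendsto_lowerbound)
  show "((\<lambda>e. sqrt ((A + e) * (B + e))) \<longlongrightarrow> sqrt (A * B)) (at_right 0)"
    by (auto intro!: tendsto_eq_intros)
  show "\<forall>\<^sub>F e in at_right 0. x \<le> sqrt ((A + e) * (B + e))"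
  proof (rule eventually_at_rightI[of 0 1])
    fix e :: real assume "e \<in> {0<..<1}"
    then have p: "A + e > 0" "B + e > 0" using assms by auto
    define a b where "a = sqrt (A + e)" and "b = sqrt (B + e)"
    have ab: "a > 0" "b > 0" "A + e = a\<^sup>2" "B + e = b\<^sup>2" using p by (auto simp: a_def b_def)
    have "x \<le> (b / a * A + B / (b / a)) / 2" using ab by (intro assms) auto
    also have "\<dots> \<le> (b / a * (A + e) + (B + e) / (b / a)) / 2"
      using ab \<open>e \<in> _\<close> by (intro divide_right_mono add_mono mult_left_mono divide_right_mono) auto
    also have "\<dots> = a * b" using ab by (simp add: field_simps power2_eq_square)
    also have "\<dots> = sqrt ((A + e) * (B + e))" by (simp add: a_def b_def real_sqrt_mult)
    finally show "x \<le> sqrt ((A + e) * (B + e))" .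
  qed auto
qed auto

definition gauss :: "'i set \<Rightarrow> real \<Rightarrow> ('i \<Rightarrow> real) \<Rightarrow> real" where
  "gauss D \<epsilon> Z = (\<Prod>d\<in>D. exp (- \<epsilon> * (Z d)\<^sup>2))"

lemma gauss_pos: "0 < gauss D \<epsilon> Z"
  unfolding gauss_def by (intro prod_pos) auto

lemma gauss_le_1: "0 \<le> \<epsilon> \<Longrightarrow> gauss D \<epsilon> Z \<le> 1"
  unfolding gauss_def by (intro prod_le_1) auto

lemma gauss_measurable [measurable]: "gauss D \<epsilon> \<in> borel_measurable borel"
  for D :: "'i::countable set"
  unfolding gauss_def by measurable

lemma integrable_gauss_lborel_on: "finite D \<Longrightarrow> \<epsilon> > 0 \<Longrightarrow> integrable (lborel_on D) (gauss D \<epsilon>)"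
  unfolding gauss_def by (intro integrable_lborel_on_prod integrable_gauss)

lemma cnj_measurable [measurable]: "cnj \<in> borel_measurable borel"
  by (intro borel_measurable_continuous_onI continuous_intros)

lemma cnj_wave: "cnj (wave D Y Z) = wave D (\<lambda>d. - Y d) Z"
  by (simp add: wave_def cis_cnj sum_negf)

lemma wave_mult: "wave D Y Z * wave D Y' Z = wave D (\<lambda>d. Y d + Y' d) Z"
  by (simp add: wave_def cis_mult sum.distrib algebra_simps)

lemma wave_prod: "finite D \<Longrightarrow> wave D Y Z = (\<Prod>d\<in>D. cis (- 2 * Y d * Z d))"
proof (induction D rule: finite_induct)
  case (insert x F)
  have e: "- 2 * (\<Sum>d\<in>insert x F. Y d * Z d) = (- 2 * Y x * Z x) + (- 2 * (\<Sum>d\<in>F. Y d * Z d))"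
    using insert by (simp add: algebra_simps)
  show ?case unfolding wave_def e cis_mult[symmetric] using insert by (simp add: wave_def)
qed (simp add: wave_def)

lemma ft_gauss:
  assumes "finite D" "\<epsilon> > 0"
  shows "ft D (\<lambda>Z. of_real (gauss D \<epsilon> Z)) V = of_real (\<Prod>d\<in>D. sqrt (pi / \<epsilon>) * exp (- (V d)\<^sup>2 / \<epsilon>))"
proof -
  have "ft D (\<lambda>Z. of_real (gauss D \<epsilon> Z)) V =
      (\<integral>Z. (\<Prod>d\<in>D. complex_of_real (exp (- \<epsilon> * (Z d)\<^sup>2)) * cis (- 2 * V d * Z d)) \<partial>lborel_on D)"
    using assms by (simp add: ft_def gauss_def wave_prod prod.distrib)
  also have "\<dots> = (\<Prod>d\<in>D. \<integral>z. complex_of_real (exp (- \<epsilon> * z\<^sup>2)) * cis (- 2 * V d * z) \<partial>lborel)"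
    by (rule integral_lborel_on_prod[OF assms(1) integrable_gauss_cis[OF assms(2)]])
  also have "\<dots> = of_real (\<Prod>d\<in>D. sqrt (pi / \<epsilon>) * exp (- (V d)\<^sup>2 / \<epsilon>))"
    by (simp only: integral_gauss_cis[OF assms(2)] of_real_prod)
  finally show ?thesis .
qed

text \<open>Plancherel's inequality, regularised: the Gaussian turns \<open>|ft a|\<^sup>2\<close> into a double integral against a
  positive convolution kernel of total mass \<open>\<pi> ^ card D\<close>, to which Schur's test applies.\<close>

lemma ft_gauss_L2:
  fixes a :: "('i::countable \<Rightarrow> real) \<Rightarrow> complex"
  assumes D: "finite D" and e: "\<epsilon> > 0" and a: "integrable (lborel_on D) a" and a2: "integrable (lborel_on D) (\<lambda>Y. (cmod (a Y))\<^sup>2)"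
  shows "(\<integral>Z. (cmod (ft D a Z))\<^sup>2 * gauss D \<epsilon> Z \<partial>lborel_on D) \<le> pi ^ card D * (\<integral>Y. (cmod (a Y))\<^sup>2 \<partial>lborel_on D)"
    and "integrable (lborel_on D) (\<lambda>Z. (cmod (ft D a Z))\<^sup>2 * gauss D \<epsilon> Z)"
proof -
  interpret sigma_finite_measure "lborel_on D" using D by (rule sigma_finite_lborel_on)
  interpret pair_sigma_finite "lborel_on D" "lborel_on D" ..
  have [measurable]: "a \<in> borel_measurable borel" using a by (auto dest!: borel_measurable_integrable)
  have [measurable]: "ft D a \<in> borel_measurable borel" by (rule ft_measurable[OF D]) measurable
  let ?g = "\<lambda>Z. complex_of_real (gauss D \<epsilon> Z)"
  define A where "A = (\<integral>Z. cmod (a Z) \<partial>lborel_on D)"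
  have fA: "cmod (ft D a Z) \<le> A" for Z unfolding A_def by (rule norm_ft_le)
  have ig: "integrable (lborel_on D) ?g" using integrable_gauss_lborel_on[OF D e] by simp
  \<comment> \<open>The transform of the Gaussian at Y' - Y: symmetric, nonnegative, and of mass pi
    in each coordinate.\<close>
  define K where "K = (\<lambda>Y Y'. \<Prod>d\<in>D. sqrt (pi / \<epsilon>) * exp (- (Y' d - Y d)\<^sup>2 / \<epsilon>))"
  have K0: "0 \<le> K Y Y'" for Y Y' unfolding K_def using e by (intro prod_nonneg) auto
  have [measurable]: "(\<lambda>(Y, Y'). K Y Y') \<in> borel_measurable (borel \<Otimes>\<^sub>M borel)" unfolding K_def
    by measurable
  have Kint: "integrable (lborel_on D) (K Y)" "(\<integral>Y'. K Y Y' \<partial>lborel_on D) = pi ^ card D" for Y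
  proof -
    have t: "exp (- (y' - y)\<^sup>2 / \<epsilon>) = exp (- (1 / \<epsilon>) * (- y + 1 * y')\<^sup>2)" for y y' :: real
      by simp
    have i: "integrable lborel (\<lambda>y'. sqrt (pi / \<epsilon>) * exp (- (y' - y)\<^sup>2 / \<epsilon>))" for y
      unfolding t using e by (intro integrable_mult_right lborel_integrable_real_affine[of "\<lambda>x. exp (- (1 / \<epsilon>) * x\<^sup>2)"] integrable_gauss) auto
    have v: "(\<integral>y'. sqrt (pi / \<epsilon>) * exp (- (y' - y)\<^sup>2 / \<epsilon>) \<partial>lborel) = pi" for y
    proof -
      have "sqrt (pi * \<epsilon>) = (\<integral>x. exp (- (1 / \<epsilon>) * x\<^sup>2) \<partial>lborel)"
        using e integral_gauss[of "1 / \<epsilon>"] by simp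
      also have "\<dots> = (\<integral>y'. exp (- (y' - y)\<^sup>2 / \<epsilon>) \<partial>lborel)"
        unfolding t using lborel_integral_real_affine[of 1 "\<lambda>x. exp (- (1 / \<epsilon>) * x\<^sup>2)" "- y"] by simp
      finally have "(\<integral>y'. sqrt (pi / \<epsilon>) * exp (- (y' - y)\<^sup>2 / \<epsilon>) \<partial>lborel) = sqrt (pi / \<epsilon>) * sqrt (pi * \<epsilon>)" by simp
      also have "\<dots> = pi" using e by (simp add: real_sqrt_mult[symmetric])
      finally show ?thesis .
    qed
    show "integrable (lborel_on D) (K Y)" unfolding K_def by (rule integrable_lborel_on_prod[OF D i])
    show "(\<integral>Y'. K Y Y' \<partial>lborel_on D) = pi ^ card D" unfolding K_def
      unfolding integral_lborel_on_prod[OF D i] v by simp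
  qed
  have Ksym: "K Y Y' = K Y' Y" for Y Y' unfolding K_def by (intro prod.cong) (auto simp: power2_commute)
  have igf: "integrable (lborel_on D) (\<lambda>Z. ?g Z * cnj (ft D a Z))"
    by (rule integrable_times_bounded[OF ig, where C=A]) (auto simp: fA)
  have igf2: "integrable (lborel_on D) (\<lambda>Z. ?g Z * cnj (ft D a Z) * ft D a Z)"
    by (rule integrable_times_bounded[OF igf, where C=A]) (auto simp: fA)
  have re: "?g Z * cnj (ft D a Z) * ft D a Z = of_real ((cmod (ft D a Z))\<^sup>2 * gauss D \<epsilon> Z)" for Z
    using complex_norm_square[of "ft D a Z"] by (simp add: mult_ac)
  show "integrable (lborel_on D) (\<lambda>Z. (cmod (ft D a Z))\<^sup>2 * gauss D \<epsilon> Z)"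
    using igf2 unfolding re by (simp only: complex_of_real_integrable_eq)
  \<comment> \<open>Convolution theorem: a Gaussian times the conjugate of \<open>ft D a\<close>
    transforms into the convolution of \<open>cnj \<circ> a\<close> with \<open>K\<close>.
    Conjugating once makes this an instance of \<open>pairing_commute\<close>.\<close>
  have inner: "ft D (\<lambda>Z. ?g Z * cnj (ft D a Z)) Y = (\<integral>Y'. cnj (a Y') * of_real (K Y Y') \<partial>lborel_on D)" for Y
  proof -
    let ?F = "\<lambda>Z. ?g Z * wave D (\<lambda>d. - Y d) Z"
    have "ft D (\<lambda>Z. ?g Z * cnj (ft D a Z)) Y = (\<integral>Z. cnj (?F Z * ft D a Z) \<partial>lborel_on D)"
      unfolding ft_def[of D "\<lambda>Z. ?g Z * cnj (ft D a Z)"]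
      by (intro Bochner_Integration.integral_cong) (simp_all add: cnj_wave mult_ac)
    also have "\<dots> = cnj (pairing D ?F a)"
      unfolding pairing_def by (rule Bochner_Integration.integral_cnj)
    also have "pairing D ?F a = pairing D a ?F"
      by (intro pairing_commute D a integrable_wave ig)
    also have "\<dots> = (\<integral>Y'. a Y' * of_real (K Y Y') \<partial>lborel_on D)"
      unfolding pairing_def
    proof (rule Bochner_Integration.integral_cong[OF refl])
      fix Y'
      have "ft D ?F Y' = ft D ?g (\<lambda>d. Y' d - Y d)"
        unfolding ft_def by (simp add: mult.assoc wave_mult)
      then show "a Y' * ft D ?F Y' = a Y' * of_real (K Y Y')"
        by (simp add: ft_gauss[OF D e] K_def)
    qed
    finally show ?thesis by (simp flip: Bochner_Integration.integral_cnj)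
  qed
  have "complex_of_real (\<integral>Z. (cmod (ft D a Z))\<^sup>2 * gauss D \<epsilon> Z \<partial>lborel_on D) = pairing D (\<lambda>Z. ?g Z * cnj (ft D a Z)) a"
    unfolding pairing_def re by (simp flip: integral_complex_of_real)
  also have "\<dots> = pairing D a (\<lambda>Z. ?g Z * cnj (ft D a Z))" by (rule pairing_commute[OF D igf a])
  also have "\<dots> = (\<integral>Y. (\<integral>Y'. a Y * (cnj (a Y') * of_real (K Y Y')) \<partial>lborel_on D) \<partial>lborel_on D)"
    unfolding pairing_def inner by simp
  finally have eq: "complex_of_real (\<integral>Z. (cmod (ft D a Z))\<^sup>2 * gauss D \<epsilon> Z \<partial>lborel_on D) = \<dots>" .
  have iK1: "integrable (lborel_on D \<Otimes>\<^sub>M lborel_on D) (\<lambda>(Y, Y'). (cmod (a Y))\<^sup>2 * K Y Y')"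
  proof (rule Fubini_integrable)
    show "integrable (lborel_on D) (\<lambda>Y. \<integral>Y'. norm (case (Y, Y') of (Y, Y') \<Rightarrow> (cmod (a Y))\<^sup>2 * K Y Y') \<partial>lborel_on D)"
      using a2 K0 by (simp add: Kint abs_mult)
    show "AE Y in lborel_on D. integrable (lborel_on D) (\<lambda>Y'. case (Y, Y') of (Y, Y') \<Rightarrow> (cmod (a Y))\<^sup>2 * K Y Y')"
      using Kint(1) by simp
  qed measurable
  have iK2: "integrable (lborel_on D \<Otimes>\<^sub>M lborel_on D) (\<lambda>(Y, Y'). (cmod (a Y'))\<^sup>2 * K Y Y')"
    using integrable_product_swap[OF iK1] by (simp add: Ksym case_prod_beta)
  have vK1: "(\<integral>(Y, Y'). (cmod (a Y))\<^sup>2 * K Y Y' \<partial>(lborel_on D \<Otimes>\<^sub>M lborel_on D)) = pi ^ card D * (\<integral>Y. (cmod (a Y))\<^sup>2 \<partial>lborel_on D)"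
    using integral_fst[OF iK1] by (simp add: Kint mult.commute)
  have vK2: "(\<integral>(Y, Y'). (cmod (a Y'))\<^sup>2 * K Y Y' \<partial>(lborel_on D \<Otimes>\<^sub>M lborel_on D)) = pi ^ card D * (\<integral>Y. (cmod (a Y))\<^sup>2 \<partial>lborel_on D)"
  proof -
    have "(\<integral>(Y, Y'). (cmod (a Y'))\<^sup>2 * K Y Y' \<partial>(lborel_on D \<Otimes>\<^sub>M lborel_on D)) = (\<integral>(Y, Y'). (cmod (a Y))\<^sup>2 * K Y Y' \<partial>(lborel_on D \<Otimes>\<^sub>M lborel_on D))"
      using integral_product_swap[of "\<lambda>(Y, Y'). (cmod (a Y))\<^sup>2 * K Y Y'"] by (simp add: Ksym case_prod_beta)
    then show ?thesis using vK1 by simp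
  qed
  have i12: "integrable (lborel_on D \<Otimes>\<^sub>M lborel_on D) (\<lambda>(Y, Y'). ((cmod (a Y))\<^sup>2 * K Y Y' + (cmod (a Y'))\<^sup>2 * K Y Y') / 2)"
    using integrable_divide[OF Bochner_Integration.integrable_add[OF iK1 iK2], of 2] by (simp add: split_beta' del: integrable_divide)
  \<comment> \<open>Schur's test for a symmetric kernel: after 2 |a Y| |a Y'| \<le> |a Y|^2 + |a
    Y'|^2, only the row integrals of \<open>K\<close> matter.\<close>
  have le: "cmod (a Y * (cnj (a Y') * of_real (K Y Y'))) \<le> ((cmod (a Y))\<^sup>2 * K Y Y' + (cmod (a Y'))\<^sup>2 * K Y Y') / 2" for Y Y'
  proof -
    have "2 * cmod (a Y) * cmod (a Y') * K Y Y' \<le> ((cmod (a Y))\<^sup>2 + (cmod (a Y'))\<^sup>2) * K Y Y'"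
      by (intro mult_right_mono sum_squares_bound K0)
    then show ?thesis using K0 by (simp add: norm_mult algebra_simps)
  qed
  have iaa: "integrable (lborel_on D \<Otimes>\<^sub>M lborel_on D) (\<lambda>(Y, Y'). a Y * (cnj (a Y') * of_real (K Y Y')))"
  proof (rule Bochner_Integration.integrable_bound[OF i12])
    show "AE x in lborel_on D \<Otimes>\<^sub>M lborel_on D. norm (case x of (Y, Y') \<Rightarrow> a Y * (cnj (a Y') * of_real (K Y Y')))
        \<le> norm (case x of (Y, Y') \<Rightarrow> ((cmod (a Y))\<^sup>2 * K Y Y' + (cmod (a Y'))\<^sup>2 * K Y Y') / 2)"
    proof (rule AE_I2, clarify)
      fix Y Y'
      show "norm (a Y * (cnj (a Y') * of_real (K Y Y'))) \<le> norm (((cmod (a Y))\<^sup>2 * K Y Y' + (cmod (a Y'))\<^sup>2 * K Y Y') / 2)"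
        using le[of Y Y'] unfolding real_norm_def by linarith
    qed
  qed measurable
  have "(\<integral>Z. (cmod (ft D a Z))\<^sup>2 * gauss D \<epsilon> Z \<partial>lborel_on D) \<le> cmod (complex_of_real (\<integral>Z. (cmod (ft D a Z))\<^sup>2 * gauss D \<epsilon> Z \<partial>lborel_on D))"
    by simp
  also have "\<dots> = cmod (\<integral>(Y, Y'). a Y * (cnj (a Y') * of_real (K Y Y')) \<partial>(lborel_on D \<Otimes>\<^sub>M lborel_on D))"
    unfolding eq using integral_fst[OF iaa] by simp
  also have "\<dots> \<le> (\<integral>(Y, Y'). ((cmod (a Y))\<^sup>2 * K Y Y' + (cmod (a Y'))\<^sup>2 * K Y Y') / 2 \<partial>(lborel_on D \<Otimes>\<^sub>M lborel_on D))"
    using le by (intro order_trans[OF integral_norm_bound] integral_mono integrable_norm iaa i12) auto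
  also have "\<dots> = pi ^ card D * (\<integral>Y. (cmod (a Y))\<^sup>2 \<partial>lborel_on D)"
    using iK1 iK2 vK1 vK2 by (simp add: split_beta')
  finally show "(\<integral>Z. (cmod (ft D a Z))\<^sup>2 * gauss D \<epsilon> Z \<partial>lborel_on D) \<le> pi ^ card D * (\<integral>Y. (cmod (a Y))\<^sup>2 \<partial>lborel_on D)" .
qed

text \<open>Cauchy-Schwarz against the regularised Plancherel inequality, carried out as AM-GM with
  a free parameter c. The Gaussian is removed by dominated convergence, because \<open>b\<close> is
  integrable and \<open>ft D a\<close> is bounded.\<close>

lemma pairing_L2_bound:
  fixes a b :: "('i::countable \<Rightarrow> real) \<Rightarrow> complex"
  assumes D: "finite D" and a: "integrable (lborel_on D) a" and a2: "integrable (lborel_on D) (\<lambda>Y. (cmod (a Y))\<^sup>2)"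
    and b: "integrable (lborel_on D) b" and b2: "integrable (lborel_on D) (\<lambda>Y. (cmod (b Y))\<^sup>2)"
  shows "cmod (pairing D a b) \<le> sqrt (pi ^ card D * (\<integral>Y. (cmod (a Y))\<^sup>2 \<partial>lborel_on D) * (\<integral>Y. (cmod (b Y))\<^sup>2 \<partial>lborel_on D))"
proof -
  have [measurable]: "a \<in> borel_measurable borel" "b \<in> borel_measurable borel"
    using a b by (auto dest!: borel_measurable_integrable)
  have [measurable]: "ft D a \<in> borel_measurable borel" by (rule ft_measurable[OF D]) measurable
  define A where "A = (\<integral>Z. cmod (a Z) \<partial>lborel_on D)"
  have fA: "cmod (ft D a Z) \<le> A" for Z unfolding A_def by (rule norm_ft_le)
  define A2 where "A2 = pi ^ card D * (\<integral>Y. (cmod (a Y))\<^sup>2 \<partial>lborel_on D)"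
  define B2 where "B2 = (\<integral>Y. (cmod (b Y))\<^sup>2 \<partial>lborel_on D)"
  have P: "pairing D a b = (\<integral>Z. b Z * ft D a Z \<partial>lborel_on D)"
    using pairing_commute[OF D a b] by (simp add: pairing_def)
  have reg: "cmod (\<integral>Z. b Z * ft D a Z * of_real (gauss D \<epsilon> Z) \<partial>lborel_on D) \<le> (c * A2 + B2 / c) / 2"
    if "\<epsilon> > 0" "c > 0" for \<epsilon> c
  proof -
    note L2 = ft_gauss_L2[OF D \<open>\<epsilon> > 0\<close> a a2]
    let ?h = "\<lambda>Z. (c * ((cmod (ft D a Z))\<^sup>2 * gauss D \<epsilon> Z) + (cmod (b Z))\<^sup>2 / c) / 2"
    have ih: "integrable (lborel_on D) ?h" using L2(2) b2 by auto
    have "cmod (\<integral>Z. b Z * ft D a Z * of_real (gauss D \<epsilon> Z) \<partial>lborel_on D) \<le> (\<integral>Z. ?h Z \<partial>lborel_on D)"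
    proof (rule order_trans[OF integral_norm_bound integral_mono[OF integrable_norm]])
      show "integrable (lborel_on D) (\<lambda>Z. b Z * ft D a Z * of_real (gauss D \<epsilon> Z))"
        using gauss_le_1[of \<epsilon> D] gauss_pos[of D \<epsilon>] that
        by (intro integrable_times_bounded[where C=1] integrable_times_bounded[OF b, where C=A]) (auto simp: fA less_imp_le)
      show "integrable (lborel_on D) ?h" by (rule ih)
      fix Z
      define g where "g = gauss D \<epsilon> Z"
      \<comment> \<open>The whole Gaussian is put on \<open>ft D a\<close>. Squaring turns it into
        \<open>g * g\<close>, which is brought back to the \<open>g\<close> of the Plancherel
        inequality by \<open>g \<le> 1\<close>.\<close>
      have g: "0 \<le> g" "g * g \<le> g"
        using gauss_le_1[of \<epsilon> D Z] gauss_pos[of D \<epsilon> Z] that by (auto simp: g_def mult_left_le)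
      let ?s = "sqrt c"
      have "2 * (?s * (cmod (ft D a Z) * g)) * (cmod (b Z) / ?s) \<le> (?s * (cmod (ft D a Z) * g))\<^sup>2 + (cmod (b Z) / ?s)\<^sup>2"
        by (rule sum_squares_bound)
      also have "\<dots> = c * ((cmod (ft D a Z))\<^sup>2 * (g * g)) + (cmod (b Z))\<^sup>2 / c"
        using that by (simp add: power_mult_distrib power_divide power2_eq_square[of g])
      also have "\<dots> \<le> c * ((cmod (ft D a Z))\<^sup>2 * g) + (cmod (b Z))\<^sup>2 / c"
        using that g by (intro add_right_mono mult_left_mono) auto
      finally show "norm (b Z * ft D a Z * of_real (gauss D \<epsilon> Z)) \<le> ?h Z"
        using that g by (simp add: norm_mult g_def[symmetric] mult_ac)
    qed
    also have "(\<integral>Z. ?h Z \<partial>lborel_on D) = (c * (\<integral>Z. (cmod (ft D a Z))\<^sup>2 * gauss D \<epsilon> Z \<partial>lborel_on D) + B2 / c) / 2"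
      using L2(2) b2 by (simp add: B2_def)
    also have "\<dots> \<le> (c * A2 + B2 / c) / 2"
      using L2(1) that unfolding A2_def by (intro divide_right_mono add_right_mono mult_left_mono) auto
    finally show ?thesis .
  qed
  have lim: "(\<lambda>k. \<integral>Z. b Z * ft D a Z * of_real (gauss D (1 / real (Suc k)) Z) \<partial>lborel_on D) \<longlonglongrightarrow> (\<integral>Z. b Z * ft D a Z \<partial>lborel_on D)"
  proof (rule integral_dominated_convergence[where w="\<lambda>Z. cmod (b Z * ft D a Z)"])
    show "integrable (lborel_on D) (\<lambda>Z. cmod (b Z * ft D a Z))"
      by (intro integrable_norm integrable_times_bounded[OF b, where C=A]) (auto simp: fA)
    show "AE Z in lborel_on D. (\<lambda>k. b Z * ft D a Z * of_real (gauss D (1 / real (Suc k)) Z)) \<longlonglongrightarrow> b Z * ft D a Z"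
    proof (rule AE_I2)
      fix Z
      have "(\<lambda>k. gauss D (1 / real (Suc k)) Z) \<longlonglongrightarrow> (\<Prod>d\<in>D. 1)"
        unfolding gauss_def
      proof (rule tendsto_prod)
        fix d
        have "(\<lambda>k. exp (- (1 / real (Suc k)) * (Z d)\<^sup>2)) \<longlonglongrightarrow> exp (- 0 * (Z d)\<^sup>2)"
          by (intro tendsto_intros) real_asymp
        then show "(\<lambda>k. exp (- (1 / real (Suc k)) * (Z d)\<^sup>2)) \<longlonglongrightarrow> 1" by simp
      qed
      then show "(\<lambda>k. b Z * ft D a Z * of_real (gauss D (1 / real (Suc k)) Z)) \<longlonglongrightarrow> b Z * ft D a Z"
        by (auto intro!: tendsto_eq_intros)
    qed
    show "AE Z in lborel_on D. cmod (b Z * ft D a Z * of_real (gauss D (1 / real (Suc k)) Z)) \<le> cmod (b Z * ft D a Z)" for k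
    proof (rule AE_I2)
      fix Z
      have "\<bar>gauss D (1 / real (Suc k)) Z\<bar> \<le> 1" using gauss_le_1[of "1 / real (Suc k)" D Z] gauss_pos[of D "1 / real (Suc k)" Z] by simp
      then show "cmod (b Z * ft D a Z * of_real (gauss D (1 / real (Suc k)) Z)) \<le> cmod (b Z * ft D a Z)"
        unfolding norm_mult norm_of_real by (intro mult_left_le) auto
    qed
  qed measurable
  have "cmod (pairing D a b) \<le> (c * A2 + B2 / c) / 2" if "c > 0" for c
    unfolding P using reg that by (intro Lim_bounded[OF tendsto_norm[OF lim]]) auto
  then have "cmod (pairing D a b) \<le> sqrt (A2 * B2)"
    by (rule le_sqrt_of_AMGM) (auto simp: A2_def B2_def)
  then show ?thesis by (simp add: A2_def B2_def)
qed

section \<open>Jets\<close>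

text \<open>A jet records a function together with its partial derivatives: \<open>A \<kappa>\<close> stands for \<open>\<partial>\<^sup>\<kappa> A\<close>, and the function
  itself is \<open>A (\<lambda>_. 0)\<close>.\<close>

type_synonym 'i jet = "('i \<Rightarrow> nat) \<Rightarrow> ('i \<Rightarrow> real) \<Rightarrow> complex"

text \<open>Orders are limited coordinate by coordinate, as in the symbol classes. Since the
  derivatives are part of the data, indexed by \<kappa>, no order of differentiation has to be
  fixed.\<close>

definition smooth :: "('i \<Rightarrow> nat) \<Rightarrow> 'i jet \<Rightarrow> bool" where
  "smooth \<mu> A \<longleftrightarrow> (\<forall>\<kappa>\<le>\<mu>. continuous_on UNIV (A \<kappa>)) \<and>
     (\<forall>\<kappa> d Y. \<kappa> \<le> \<mu> \<longrightarrow> \<kappa> d < \<mu> d \<longrightarrow>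
        ((\<lambda>t. A \<kappa> (Y(d := t))) has_vector_derivative A (\<kappa>(d := Suc (\<kappa> d))) Y) (at (Y d)))"

definition jet_bound :: "'i set \<Rightarrow> ('i \<Rightarrow> real) \<Rightarrow> ('i \<Rightarrow> nat) \<Rightarrow> (('i \<Rightarrow> real) \<Rightarrow> real) \<Rightarrow> 'i jet \<Rightarrow> bool" where
  "jet_bound D s \<mu> P A \<longleftrightarrow> (\<forall>\<kappa>\<le>\<mu>. \<forall>Y. cmod (A \<kappa> Y) \<le> P Y * (\<Prod>d\<in>D. s d ^ \<kappa> d))"

definition clear :: "'i set \<Rightarrow> ('i \<Rightarrow> nat) \<Rightarrow> 'i \<Rightarrow> nat" where
  "clear S \<mu> = (\<lambda>i. if i \<in> S then 0 else \<mu> i)"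

text \<open>A second-order operator in the single variable \<open>d\<close>. The updates set the
  order in \<open>d\<close> to 1 and 2 instead of raising it, so the result is the intended one only
  where \<open>\<kappa> d = 0\<close>; the orders are therefore passed through
  \<open>clear\<close>.\<close>

definition diff_op :: "(nat \<Rightarrow> real \<Rightarrow> real) \<Rightarrow> 'i \<Rightarrow> 'i jet \<Rightarrow> 'i jet" where
  "diff_op c d A = (\<lambda>\<kappa> Y. of_real (c 0 (Y d)) * A \<kappa> Y + of_real (c 1 (Y d)) * A (\<kappa>(d := 1)) Y
     + of_real (c 2 (Y d)) * A (\<kappa>(d := 2)) Y)"

definition amp :: "('i \<Rightarrow> nat \<Rightarrow> real \<Rightarrow> real) \<Rightarrow> 'i list \<Rightarrow> 'i jet \<Rightarrow> 'i jet" where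
  "amp c ds A = foldr (\<lambda>d. diff_op (c d) d) ds A"

lemma amp_simps [simp]: "amp c [] A = A" "amp c (d # ds) A = diff_op (c d) d (amp c ds A)"
  by (simp_all add: amp_def)

lemma smoothD:
  assumes "smooth \<mu> A" "\<kappa> \<le> \<mu>"
  shows "continuous_on UNIV (A \<kappa>)"
    and "\<kappa> d < \<mu> d \<Longrightarrow> ((\<lambda>t. A \<kappa> (Y(d := t))) has_vector_derivative A (\<kappa>(d := Suc (\<kappa> d))) Y) (at (Y d))"
  using assms unfolding smooth_def by blast+

lemma smooth_measurable:
  fixes A :: "'i::countable jet"
  shows "smooth \<mu> A \<Longrightarrow> \<kappa> \<le> \<mu> \<Longrightarrow> A \<kappa> \<in> borel_measurable borel"
  by (auto intro: borel_measurable_continuous_onI smoothD)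

lemma jet_boundD: "jet_bound D s \<mu> P A \<Longrightarrow> \<kappa> \<le> \<mu> \<Longrightarrow> cmod (A \<kappa> Y) \<le> P Y * (\<Prod>d\<in>D. s d ^ \<kappa> d)"
  unfolding jet_bound_def by blast

lemma smooth_mono: "smooth \<mu> A \<Longrightarrow> \<nu> \<le> \<mu> \<Longrightarrow> smooth \<nu> A"
  unfolding smooth_def by (meson le_fun_def order.strict_trans2 order_trans)

lemma jet_bound_mono: "jet_bound D s \<mu> P A \<Longrightarrow> \<nu> \<le> \<mu> \<Longrightarrow> jet_bound D s \<nu> P A"
  unfolding jet_bound_def by (meson order_trans)

lemma multi_index_upd_le: "\<kappa> \<le> \<mu> \<Longrightarrow> n \<le> \<mu> d \<Longrightarrow> \<kappa>(d := n) \<le> \<mu>" for \<kappa> :: "'i \<Rightarrow> nat"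
  by (simp add: le_fun_def)

lemma le_clearD:
  assumes "\<kappa> \<le> clear {d} \<mu>"
  shows "\<kappa> d = 0" "\<kappa> \<le> \<mu>"
proof -
  show "\<kappa> d = 0" using assms by (metis clear_def insertI1 le_0_eq le_fun_def)
  show "\<kappa> \<le> \<mu>" unfolding le_fun_def using assms by (metis clear_def le_fun_def order_trans zero_le)
qed

lemma clear_simps [simp]: "clear {} \<mu> = \<mu>" "clear {d} (clear S \<mu>) = clear (insert d S) \<mu>"
  by (auto simp: clear_def)

lemma clear_eq: "d \<notin> S \<Longrightarrow> clear S \<mu> d = \<mu> d"
  by (simp add: clear_def)

lemma smooth_diff_op:
  assumes A: "smooth \<mu> A" and d: "2 \<le> \<mu> d" and c: "\<And>i. continuous_on UNIV (c i)"
  shows "smooth (clear {d} \<mu>) (diff_op c d A)"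
  unfolding smooth_def
proof (intro conjI allI impI)
  have cc: "continuous_on UNIV (\<lambda>Y. complex_of_real (c i (Y d)))" for i
    by (intro continuous_on_of_real continuous_on_compose2[OF c] continuous_on_product_coordinates) auto
  fix \<kappa> assume "\<kappa> \<le> clear {d} \<mu>"
  note k = le_clearD[OF this]
  have le: "\<kappa>(d := 1) \<le> \<mu>" "\<kappa>(d := 2) \<le> \<mu>" using k d by (auto intro: multi_index_upd_le)
  show "continuous_on UNIV (diff_op c d A \<kappa>)"
    unfolding diff_op_def by (intro continuous_intros cc smoothD[OF A] k le)
  fix e Y assume "\<kappa> e < clear {d} \<mu> e"
  then have e: "e \<noteq> d" "\<kappa> e < \<mu> e" by (auto simp: clear_def split: if_splits)
  have "((\<lambda>t. A \<kappa> (Y(e := t))) has_vector_derivative A (\<kappa>(e := Suc (\<kappa> e))) Y) (at (Y e))"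
    "((\<lambda>t. A (\<kappa>(d := 1)) (Y(e := t))) has_vector_derivative A (\<kappa>(e := Suc (\<kappa> e), d := 1)) Y) (at (Y e))"
    "((\<lambda>t. A (\<kappa>(d := 2)) (Y(e := t))) has_vector_derivative A (\<kappa>(e := Suc (\<kappa> e), d := 2)) Y) (at (Y e))"
    using smoothD(2)[OF A k(2), of e Y] smoothD(2)[OF A le(1), of e Y] smoothD(2)[OF A le(2), of e Y] e
    by (simp_all add: fun_upd_twist)
  then show "((\<lambda>t. diff_op c d A \<kappa> (Y(e := t))) has_vector_derivative diff_op c d A (\<kappa>(e := Suc (\<kappa> e))) Y) (at (Y e))"
    unfolding diff_op_def using e
    by (auto intro!: has_vector_derivative_add has_vector_derivative_mult_right)
qed

lemma jet_bound_diff_op: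
  assumes D: "finite D" "d \<in> D" and A: "jet_bound D s \<mu> P A" and d: "2 \<le> \<mu> d" and s: "\<And>d. 0 \<le> s d"
    and P: "\<And>Y. 0 \<le> P Y"
    and g: "\<And>y. \<bar>c 0 y\<bar> + s d * \<bar>c 1 y\<bar> + (s d)\<^sup>2 * \<bar>c 2 y\<bar> \<le> \<gamma> y"
  shows "jet_bound D s (clear {d} \<mu>) (\<lambda>Y. \<gamma> (Y d) * P Y) (diff_op c d A)"
  unfolding jet_bound_def
proof (intro allI impI)
  fix \<kappa> Y assume "\<kappa> \<le> clear {d} \<mu>"
  note k = le_clearD[OF this]
  define p where "p = P Y * (\<Prod>d\<in>D. s d ^ \<kappa> d)"
  have p: "0 \<le> p" unfolding p_def using P s by (intro mult_nonneg_nonneg prod_nonneg) auto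
  have prd: "(\<Prod>e\<in>D. s e ^ (\<kappa>(d := n)) e) = s d ^ n * (\<Prod>e\<in>D. s e ^ \<kappa> e)" for n
  proof -
    have "(\<Prod>e\<in>D. s e ^ (\<kappa>(d := n)) e) = s d ^ n * (\<Prod>e\<in>D-{d}. s e ^ (\<kappa>(d := n)) e)"
      using D by (subst prod.remove[of _ d]) auto
    also have "(\<Prod>e\<in>D-{d}. s e ^ (\<kappa>(d := n)) e) = (\<Prod>e\<in>D-{d}. s e ^ \<kappa> e)" by (intro prod.cong) auto
    also have "\<dots> = (\<Prod>e\<in>D. s e ^ \<kappa> e)" using D k by (subst (2) prod.remove[of _ d]) auto
    finally show ?thesis .
  qed
  have b: "cmod (A (\<kappa>(d := n)) Y) \<le> s d ^ n * p" if "n \<le> 2" for n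
    using jet_boundD[OF A multi_index_upd_le[OF k(2)], of n d Y] that d unfolding prd by (simp add: p_def mult_ac)
  have "\<kappa>(d := 0) = \<kappa>" using k by auto
  then have b0: "cmod (A \<kappa> Y) \<le> p" using b[of 0] by simp
  have "cmod (diff_op c d A \<kappa> Y) \<le> \<bar>c 0 (Y d)\<bar> * p + \<bar>c 1 (Y d)\<bar> * (s d * p) + \<bar>c 2 (Y d)\<bar> * ((s d)\<^sup>2 * p)"
    unfolding diff_op_def using b[of 1] b[of 2] b0
    by (intro norm_triangle_le add_mono) (auto simp: norm_mult intro!: mult_left_mono)
  also have "\<dots> = (\<bar>c 0 (Y d)\<bar> + s d * \<bar>c 1 (Y d)\<bar> + (s d)\<^sup>2 * \<bar>c 2 (Y d)\<bar>) * p"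
    by (simp add: algebra_simps)
  also have "\<dots> \<le> \<gamma> (Y d) * p" by (intro mult_right_mono g p)
  finally show "cmod (diff_op c d A \<kappa> Y) \<le> \<gamma> (Y d) * P Y * (\<Prod>d\<in>D. s d ^ \<kappa> d)" by (simp add: p_def mult.assoc)
qed

lemma smooth_amp:
  assumes "distinct ds" "smooth \<mu> A" "\<And>d. d \<in> set ds \<Longrightarrow> 2 \<le> \<mu> d" "\<And>d i. continuous_on UNIV (c d i)"
  shows "smooth (clear (set ds) \<mu>) (amp c ds A)"
  using assms(1,3)
proof (induction ds)
  case (Cons d ds)
  then have "smooth (clear {d} (clear (set ds) \<mu>)) (diff_op (c d) d (amp c ds A))"
    by (intro smooth_diff_op assms(4)) (auto simp: clear_eq)
  then show ?case by simp
qed (simp add: assms(2))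

lemma jet_bound_amp:
  assumes D: "finite D" "set ds \<subseteq> D" "distinct ds" and A: "jet_bound D s \<mu> P A"
    and d: "\<And>d. d \<in> set ds \<Longrightarrow> 2 \<le> \<mu> d" and s: "\<And>d. 0 \<le> s d" and P: "\<And>Y. 0 \<le> P Y"
    and g: "\<And>d y. \<bar>c d 0 y\<bar> + s d * \<bar>c d 1 y\<bar> + (s d)\<^sup>2 * \<bar>c d 2 y\<bar> \<le> \<gamma> d y"
  shows "jet_bound D s (clear (set ds) \<mu>) (\<lambda>Y. (\<Prod>d\<in>set ds. \<gamma> d (Y d)) * P Y) (amp c ds A)"
proof -
  have g0: "0 \<le> \<gamma> d y" for d y
    using g[of d y] s[of d] by (smt (verit) mult_nonneg_nonneg zero_le_power2 abs_ge_zero)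
  show ?thesis using D(2,3) d
  proof (induction ds)
    case (Cons d ds)
    have "jet_bound D s (clear {d} (clear (set ds) \<mu>)) (\<lambda>Y. \<gamma> d (Y d) * ((\<Prod>d\<in>set ds. \<gamma> d (Y d)) * P Y)) (diff_op (c d) d (amp c ds A))"
      using Cons D g0 by (intro jet_bound_diff_op s g Cons.IH mult_nonneg_nonneg prod_nonneg P) (auto simp: clear_eq)
    then show ?case using Cons.prems by (simp add: mult.assoc)
  qed (simp add: A)
qed

section \<open>Integration by parts in all variables\<close>

definition coefA :: "real \<Rightarrow> nat \<Rightarrow> real \<Rightarrow> real" where
  "coefA \<theta> i y = (if i = 0 then damp \<theta> 0 y - damp \<theta> 2 y else if i = 1 then - 2 * damp \<theta> 1 y else - damp \<theta> 0 y)"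

text \<open>\<open>coefA\<close> and \<open>coefB\<close> are the two operators that
  \<open>pairing_step\<close> produces: \<open>coefA\<close> belongs to F \<mapsto> (1 -
  \<partial>^2) (damp \<theta> 0 * F), expanded by Leibniz' rule, and \<open>coefB\<close> to G
  \<mapsto> damp 1 0 * (G - \<theta> \<partial>^2 G).\<close>

definition coefB :: "real \<Rightarrow> nat \<Rightarrow> real \<Rightarrow> real" where
  "coefB \<theta> i y = (if i = 0 then damp 1 0 y else if i = 1 then 0 else - \<theta> * damp 1 0 y)"

lemma coef_continuous:
  "0 \<le> \<theta> \<Longrightarrow> continuous_on UNIV (coefA \<theta> i)" "continuous_on UNIV (coefB \<theta> i)"
  unfolding coefA_def[abs_def] coefB_def[abs_def]
  by (cases "i = 0"; cases "i = 1"; auto intro!: continuous_intros damp_continuous)+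

text \<open>With 40 from \<open>damp_bound\<close>, the three coefficients contribute (1 + 40) + 2 *
  40 + 1 = 122.\<close>

lemma coefA_bound:
  assumes "0 \<le> \<theta>" "\<theta> \<le> 1"
  shows "\<bar>coefA \<theta> 0 y\<bar> + 1 * \<bar>coefA \<theta> 1 y\<bar> + 1\<^sup>2 * \<bar>coefA \<theta> 2 y\<bar> \<le> 122 * damp \<theta> 0 y"
proof -
  note b = damp_bound[OF assms, of 1 y] damp_bound[OF assms, of 2 y] damp_nonneg[OF assms(1), of y]
  have "\<bar>damp \<theta> 0 y - damp \<theta> 2 y\<bar> \<le> 41 * damp \<theta> 0 y" using b by linarith
  moreover have "\<bar>- 2 * damp \<theta> 1 y\<bar> \<le> 80 * damp \<theta> 0 y" using b by linarith
  moreover have "\<bar>- damp \<theta> 0 y\<bar> = damp \<theta> 0 y" using b by linarith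
  ultimately show ?thesis by (simp add: coefA_def)
qed

lemma coefB_bound:
  assumes "0 \<le> \<theta>" "\<theta> * s\<^sup>2 \<le> 1"
  shows "\<bar>coefB \<theta> 0 y\<bar> + s * \<bar>coefB \<theta> 1 y\<bar> + s\<^sup>2 * \<bar>coefB \<theta> 2 y\<bar> \<le> 2 * damp 1 0 y"
proof -
  have "s\<^sup>2 * (\<theta> * damp 1 0 y) \<le> 1 * damp 1 0 y"
    using assms mult_right_mono[OF assms(2) damp_nonneg[of 1 y]] by (simp add: mult_ac)
  then show ?thesis using assms damp_nonneg[of 1 y] by (simp add: coefB_def abs_mult)
qed

lemma le_zero_fun: "(\<lambda>_. 0) \<le> (\<mu> :: 'i \<Rightarrow> nat)"
  by (simp add: le_fun_def)

text \<open>The decay \<open>C * weight D Y\<close> justifies the integrations by parts, but no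
  constant from it appears in the identity. This is what later allows the right-hand side to survive
  the removal of the cutoffs.\<close>

lemma pairing_amp:
  fixes F G :: "'i::countable jet"
  assumes D: "finite D" "set ds \<subseteq> D" "distinct ds" and th: "\<And>d. 0 \<le> \<theta> d" "\<And>d. \<theta> d \<le> 1"
    and F: "smooth \<mu> F" "jet_bound D (\<lambda>_. 1) \<mu> (\<lambda>Y. C * weight D Y) F"
    and G: "smooth \<mu> G" "jet_bound D (\<lambda>_. 1) \<mu> (\<lambda>Y. C * weight D Y) G"
    and mu: "\<And>d. d \<in> set ds \<Longrightarrow> 2 \<le> \<mu> d" and C: "0 \<le> C"
  shows "pairing D (F (\<lambda>_. 0)) (G (\<lambda>_. 0)) =
    pairing D (amp (\<lambda>d. coefA (\<theta> d)) ds F (\<lambda>_. 0)) (amp (\<lambda>d. coefB (\<theta> d)) ds G (\<lambda>_. 0))"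
  using D(2,3) mu
proof (induction ds)
  case (Cons d ds)
  define F' where "F' = amp (\<lambda>d. coefA (\<theta> d)) ds F"
  define G' where "G' = amp (\<lambda>d. coefB (\<theta> d)) ds G"
  define \<nu> where "\<nu> = clear (set ds) \<mu>"
  have nu: "2 \<le> \<nu> d" using Cons by (simp add: \<nu>_def clear_eq)
  have sm: "smooth \<nu> F'" "smooth \<nu> G'"
    unfolding F'_def G'_def \<nu>_def using Cons th F G
    by (auto intro!: smooth_amp coef_continuous)
  have bnd: "jet_bound D (\<lambda>_. 1) \<nu> (\<lambda>Y. (\<Prod>d\<in>set ds. 122 * damp (\<theta> d) 0 (Y d)) * (C * weight D Y)) F'"
    "jet_bound D (\<lambda>_. 1) \<nu> (\<lambda>Y. (\<Prod>d\<in>set ds. 2 * damp 1 0 (Y d)) * (C * weight D Y)) G'"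
    unfolding F'_def G'_def \<nu>_def
    by (rule jet_bound_amp[OF D(1)]; use Cons th F G coefA_bound coefB_bound[where s=1] C in \<open>auto\<close>)+
  define C' where "C' = (\<Prod>d\<in>set ds. 122) * C"
  have wC: "0 \<le> C * weight D Y" for Y using C by simp
  have "(\<Prod>d\<in>set ds. 122 * damp (\<theta> d) 0 (Y d)) \<le> (\<Prod>d\<in>set ds. 122)"
    "(\<Prod>d\<in>set ds. 2 * damp 1 0 (Y d)) \<le> (\<Prod>d\<in>set ds. 122)" for Y :: "'i \<Rightarrow> real"
  proof -
    have "0 \<le> 122 * damp (\<theta> d) 0 y \<and> 122 * damp (\<theta> d) 0 y \<le> 122" "0 \<le> 2 * damp 1 0 y \<and> 2 * damp 1 0 y \<le> 122" for d y
      using damp_le_1[OF th(1), of d y] damp_nonneg[OF th(1), of d y] damp_nonneg[of 1 y] damp_le_1[of 1 y] by auto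
    then show "(\<Prod>d\<in>set ds. 122 * damp (\<theta> d) 0 (Y d)) \<le> (\<Prod>d\<in>set ds. 122)"
      "(\<Prod>d\<in>set ds. 2 * damp 1 0 (Y d)) \<le> (\<Prod>d\<in>set ds. 122)"
      by (intro prod_mono; blast)+
  qed
  then have bb: "(\<Prod>d\<in>set ds. 122 * damp (\<theta> d) 0 (Y d)) * (C * weight D Y) \<le> C' * weight D Y"
    "(\<Prod>d\<in>set ds. 2 * damp 1 0 (Y d)) * (C * weight D Y) \<le> C' * weight D Y" for Y
    unfolding C'_def mult.assoc by (intro mult_right_mono wC; blast)+
  have b: "cmod (F' \<kappa> Y) \<le> C' * weight D Y" "cmod (G' \<kappa> Y) \<le> C' * weight D Y" if "\<kappa> \<le> \<nu>" for \<kappa> Y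
    using jet_boundD[OF bnd(1) that, of Y] jet_boundD[OF bnd(2) that, of Y] bb[of Y] by simp_all
  let ?z = "\<lambda>_::'i. 0::nat"
  have le: "?z \<le> \<nu>" "?z(d := 1) \<le> \<nu>" "?z(d := 2) \<le> \<nu>"
    using nu by (auto intro: multi_index_upd_le le_zero_fun)
  have dd: "((\<lambda>t. H ?z (Z(d := t))) has_vector_derivative H (?z(d := 1)) Z) (at (Z d))"
    "((\<lambda>t. H (?z(d := 1)) (Z(d := t))) has_vector_derivative H (?z(d := 2)) Z) (at (Z d))"
    if "smooth \<nu> H" for H Z
    using smoothD(2)[OF that le(1), of d Z] smoothD(2)[OF that le(2), of d Z] nu by (simp_all add: numeral_2_eq_2)
  have "pairing D (F' ?z) (G' ?z) = pairing D
    (\<lambda>Y. of_real (damp (\<theta> d) 0 (Y d) - damp (\<theta> d) 2 (Y d)) * F' ?z Y - of_real (2 * damp (\<theta> d) 1 (Y d)) * F' (?z(d := 1)) Y - of_real (damp (\<theta> d) 0 (Y d)) * F' (?z(d := 2)) Y)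
    (\<lambda>Z. of_real (damp 1 0 (Z d)) * (G' ?z Z - of_real (\<theta> d) * G' (?z(d := 2)) Z))"
    using Cons.prems D(1) th
    by (intro pairing_step[of _ _ _ _ _ _ _ "G' (?z(d := 1))" _ C' C'] smoothD[OF sm(1)] smoothD[OF sm(2)] le dd sm b) auto
  also have "\<dots> = pairing D (diff_op (coefA (\<theta> d)) d F' ?z) (diff_op (coefB (\<theta> d)) d G' ?z)"
    by (intro arg_cong2[where f="pairing D"]) (auto simp: diff_op_def coefA_def coefB_def fun_eq_iff algebra_simps)
  finally show ?case using Cons by (simp add: F'_def G'_def)
qed simp

definition cmass :: real where "cmass = (\<integral>y. cauchy y \<partial>lborel)"

lemma cmass_nonneg: "0 \<le> cmass"
  unfolding cmass_def by (rule Bochner_Integration.integral_nonneg) auto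

lemma
  assumes "0 < \<theta>"
  shows integrable_damp: "integrable lborel (damp \<theta> 0)"
    and integral_damp: "(\<integral>y. damp \<theta> 0 y \<partial>lborel) = cmass / (2 * sqrt \<theta>)"
proof -
  have d: "damp \<theta> 0 y = cauchy (0 + 2 * sqrt \<theta> * y)" for y using assms by (simp add: damp_0)
  have c: "2 * sqrt \<theta> \<noteq> 0" using assms by simp
  show "integrable lborel (damp \<theta> 0)"
    using lborel_integrable_real_affine[OF integrable_cauchy c, of 0] by (simp add: d[abs_def])
  have "cmass = \<bar>2 * sqrt \<theta>\<bar> *\<^sub>R (\<integral>y. cauchy (0 + 2 * sqrt \<theta> * y) \<partial>lborel)"
    unfolding cmass_def by (rule lborel_integral_real_affine[OF c])
  then show "(\<integral>y. damp \<theta> 0 y \<partial>lborel) = cmass / (2 * sqrt \<theta>)"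
    using assms by (simp add: d[abs_def] field_simps)
qed

definition dampA :: "('i \<Rightarrow> real) \<Rightarrow> 'i set \<Rightarrow> ('i \<Rightarrow> real) \<Rightarrow> real" where
  "dampA \<theta> D Y = (\<Prod>d\<in>D. 122 * damp (\<theta> d) 0 (Y d))"

definition dampB :: "'i set \<Rightarrow> ('i \<Rightarrow> real) \<Rightarrow> real" where
  "dampB D Y = (\<Prod>d\<in>D. 2 * damp 1 0 (Y d))"

text \<open>The absolutely convergent form of the oscillatory integral. Its value does not depend on \<open>\<theta>\<close>.\<close>

definition tform :: "('i \<Rightarrow> real) \<Rightarrow> 'i list \<Rightarrow> 'i::countable jet \<Rightarrow> 'i jet \<Rightarrow> complex" where
  "tform \<theta> ds F G = pairing (set ds) (amp (\<lambda>d. coefA (\<theta> d)) ds F (\<lambda>_. 0)) (amp (\<lambda>d. coefB (\<theta> d)) ds G (\<lambda>_. 0))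
     / of_real (pi ^ card (set ds))"

lemma integrable_dampA: "finite D \<Longrightarrow> (\<And>d. 0 < \<theta> d) \<Longrightarrow> integrable (lborel_on D) (dampA \<theta> D)"
  and integrable_dampB: "finite D \<Longrightarrow> integrable (lborel_on D) (dampB D)"
  unfolding dampA_def dampB_def by (auto intro!: integrable_lborel_on_prod integrable_mult_right integrable_damp)

lemma dampA_nonneg: "(\<And>d. 0 \<le> \<theta> d) \<Longrightarrow> 0 \<le> dampA \<theta> D Y"
  and dampB_nonneg: "0 \<le> dampB D Y"
  unfolding dampA_def dampB_def by (auto intro!: prod_nonneg damp_nonneg)

lemma clear_zero: "(\<lambda>_. 0) \<le> clear S \<mu>"
  by (rule le_zero_fun)

lemma amp_bounds:
  fixes F G :: "'i::countable jet"
  assumes ds: "distinct ds" and mu: "\<And>d. d \<in> set ds \<Longrightarrow> 2 \<le> \<mu> d"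
    and th: "\<And>d. 0 \<le> \<theta> d" "\<And>d. \<theta> d \<le> 1" "\<And>d. \<theta> d * (s d)\<^sup>2 \<le> 1" and s: "\<And>d. 0 \<le> s d"
    and F: "jet_bound (set ds) (\<lambda>_. 1) \<mu> (\<lambda>_. M) F" and G: "jet_bound (set ds) s \<mu> (\<lambda>_. M') G"
    and M: "0 \<le> M" "0 \<le> M'"
  shows "cmod (amp (\<lambda>d. coefA (\<theta> d)) ds F (\<lambda>_. 0) Y) \<le> M * dampA \<theta> (set ds) Y"
    and "cmod (amp (\<lambda>d. coefB (\<theta> d)) ds G (\<lambda>_. 0) Y) \<le> M' * dampB (set ds) Y"
proof -
  have "jet_bound (set ds) (\<lambda>_. 1) (clear (set ds) \<mu>) (\<lambda>Y. (\<Prod>d\<in>set ds. 122 * damp (\<theta> d) 0 (Y d)) * M) (amp (\<lambda>d. coefA (\<theta> d)) ds F)"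
    using assms by (intro jet_bound_amp) (auto intro!: coefA_bound[simplified])
  from jet_boundD[OF this clear_zero]
  show "cmod (amp (\<lambda>d. coefA (\<theta> d)) ds F (\<lambda>_. 0) Y) \<le> M * dampA \<theta> (set ds) Y"
    by (simp add: dampA_def mult.commute)
  have "jet_bound (set ds) s (clear (set ds) \<mu>) (\<lambda>Y. (\<Prod>d\<in>set ds. 2 * damp 1 0 (Y d)) * M') (amp (\<lambda>d. coefB (\<theta> d)) ds G)"
    by (intro jet_bound_amp coefB_bound) (use assms in auto)
  from jet_boundD[OF this clear_zero]
  show "cmod (amp (\<lambda>d. coefB (\<theta> d)) ds G (\<lambda>_. 0) Y) \<le> M' * dampB (set ds) Y"
    by (simp add: dampB_def mult.commute)
qed

lemma amp_measurable:
  fixes F :: "'i::countable jet"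
  assumes "distinct ds" "smooth \<mu> F" "\<And>d. d \<in> set ds \<Longrightarrow> 2 \<le> \<mu> d" "\<And>d i. continuous_on UNIV (c d i)"
  shows "amp c ds F (\<lambda>_. 0) \<in> borel_measurable borel"
  by (rule smooth_measurable[OF smooth_amp[OF assms] clear_zero])

lemma integrable_dominated:
  fixes f :: "'a \<Rightarrow> complex"
  assumes "integrable M w" "f \<in> borel_measurable M" "\<And>x. cmod (f x) \<le> w x"
  shows "integrable M f"
  using assms(2,3) by (intro Bochner_Integration.integrable_bound[OF assms(1)]) (auto intro!: AE_I2 intro: order_trans[OF _ abs_ge_self])

text \<open>The L2 bound has, per variable and under the square root, pi * (122^2 * cmass / 2 * r^2)
  * (2^2 * cmass / 2), which equals (pi * C0 * r)^2. The factor pi is cancelled by the normalisation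
  of \<open>tform\<close>.\<close>

definition C0 :: real where "C0 = 122 * cmass / sqrt pi"

lemma C0_nonneg: "0 \<le> C0"
  by (simp add: C0_def cmass_nonneg)

text \<open>The L2 norm of \<open>damp \<theta> 0\<close> is of order \<theta>^(-1/4). Writing
  \<theta> = r^(-4) makes the price of a variable a factor \<open>r\<close>, and \<theta> s^2 \<le>
  1 is what keeps the operator on \<open>G\<close> bounded by 2.\<close>

lemma tform_bound:
  fixes F G :: "'i::countable jet"
  assumes ds: "distinct ds" and mu: "\<And>d. d \<in> set ds \<Longrightarrow> 2 \<le> \<mu> d"
    and r: "\<And>d. 1 \<le> r d" and th: "\<And>d. \<theta> d = inverse (r d ^ 4)" "\<And>d. \<theta> d * (s d)\<^sup>2 \<le> 1" and s: "\<And>d. 0 \<le> s d"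
    and F: "smooth \<mu> F" "jet_bound (set ds) (\<lambda>_. 1) \<mu> (\<lambda>_. M) F"
    and G: "smooth \<mu> G" "jet_bound (set ds) s \<mu> (\<lambda>_. M') G"
    and M: "0 \<le> M" "0 \<le> M'"
  shows "cmod (tform \<theta> ds F G) \<le> M * M' * (\<Prod>d\<in>set ds. C0 * r d)"
proof -
  let ?D = "set ds"
  have r0: "0 < r d" for d using r[of d] by linarith
  have t: "0 < \<theta> d" "0 \<le> \<theta> d" "\<theta> d \<le> 1" for d
    using r[of d] r0[of d] by (auto simp: th inverse_le_1_iff)
  define a where "a = amp (\<lambda>d. coefA (\<theta> d)) ds F (\<lambda>_. 0)"
  define b where "b = amp (\<lambda>d. coefB (\<theta> d)) ds G (\<lambda>_. 0)"
  have ab: "cmod (a Y) \<le> M * dampA \<theta> ?D Y" "cmod (b Y) \<le> M' * dampB ?D Y" for Y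
    unfolding a_def b_def by (rule amp_bounds[OF ds mu t(2,3) th(2) s F(2) G(2) M]; assumption)+
  have [measurable]: "a \<in> borel_measurable borel" "b \<in> borel_measurable borel"
    unfolding a_def b_def using t by (auto intro!: amp_measurable[OF ds] F G mu coef_continuous)
  have i: "integrable (lborel_on ?D) a" "integrable (lborel_on ?D) b"
    by (rule integrable_dominated[where w="\<lambda>Y. M * dampA \<theta> ?D Y"] integrable_dominated[where w="\<lambda>Y. M' * dampB ?D Y"],
      use ab t in \<open>auto intro!: integrable_mult_right integrable_dampA integrable_dampB\<close>)+
  define wa where "wa = (\<lambda>Y::'i\<Rightarrow>real. M\<^sup>2 * (\<Prod>d\<in>?D. 122\<^sup>2 * damp (\<theta> d) 0 (Y d)))"
  define wb where "wb = (\<lambda>Y::'i\<Rightarrow>real. M'\<^sup>2 * (\<Prod>d\<in>?D. 2\<^sup>2 * damp 1 0 (Y d)))"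
  \<comment> \<open>As 0 \<le> damp \<le> 1, its square lies below it, so the integral of
    \<open>damp\<close> itself also controls the L2 norm.\<close>
  have sq: "(k * damp x 0 y)\<^sup>2 \<le> k\<^sup>2 * damp x 0 y" if "0 \<le> x" for k x y
  proof -
    have "(damp x 0 y)\<^sup>2 \<le> damp x 0 y" unfolding power2_eq_square
      using damp_le_1[OF that, of y] damp_nonneg[OF that, of y] by (rule mult_left_le)
    then show ?thesis by (simp add: power_mult_distrib mult_left_mono)
  qed
  have sqa: "(cmod (a Y))\<^sup>2 \<le> wa Y" for Y
  proof -
    have "(cmod (a Y))\<^sup>2 \<le> (M * dampA \<theta> ?D Y)\<^sup>2" by (intro power_mono ab) auto
    also have "\<dots> = M\<^sup>2 * (\<Prod>d\<in>?D. (122 * damp (\<theta> d) 0 (Y d))\<^sup>2)"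
      by (simp only: dampA_def power_mult_distrib prod_power_distrib)
    also have "\<dots> \<le> wa Y" unfolding wa_def using t by (intro mult_left_mono prod_mono conjI sq) auto
    finally show ?thesis .
  qed
  have sqb: "(cmod (b Y))\<^sup>2 \<le> wb Y" for Y
  proof -
    have "(cmod (b Y))\<^sup>2 \<le> (M' * dampB ?D Y)\<^sup>2" by (intro power_mono ab) auto
    also have "\<dots> = M'\<^sup>2 * (\<Prod>d\<in>?D. (2 * damp 1 0 (Y d))\<^sup>2)"
      by (simp only: dampB_def power_mult_distrib prod_power_distrib)
    also have "\<dots> \<le> wb Y" unfolding wb_def using t by (intro mult_left_mono prod_mono conjI sq) auto
    finally show ?thesis .
  qed
  have iw: "integrable (lborel_on ?D) wa" "integrable (lborel_on ?D) wb"
    unfolding wa_def wb_def using t by (auto intro!: integrable_mult_right integrable_lborel_on_prod integrable_damp)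
  have vw: "(\<integral>Y. wa Y \<partial>lborel_on ?D) = M\<^sup>2 * (\<Prod>d\<in>?D. 122\<^sup>2 * (cmass / 2 * (r d)\<^sup>2))"
    "(\<integral>Y. wb Y \<partial>lborel_on ?D) = M'\<^sup>2 * (\<Prod>d\<in>?D. 2\<^sup>2 * (cmass / 2))"
  proof -
    have "sqrt (\<theta> d) = inverse ((r d)\<^sup>2)" for d
    proof -
      have "sqrt (r d ^ 4) = (r d)\<^sup>2" using real_sqrt_unique[of "(r d)\<^sup>2" "r d ^ 4"] by (simp flip: power_mult)
      then show ?thesis by (simp add: th real_sqrt_inverse)
    qed
    then have e: "(\<integral>y. 122\<^sup>2 * damp (\<theta> d) 0 y \<partial>lborel) = 122\<^sup>2 * (cmass / 2 * (r d)\<^sup>2)" for d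
      using integral_damp[OF t(1)[of d]] r0[of d] by (simp add: field_simps)
    have i: "integrable lborel (\<lambda>y. 122\<^sup>2 * damp (\<theta> d) 0 y)" for d
      by (intro integrable_mult_right integrable_damp t)
    show "(\<integral>Y. wa Y \<partial>lborel_on ?D) = M\<^sup>2 * (\<Prod>d\<in>?D. 122\<^sup>2 * (cmass / 2 * (r d)\<^sup>2))"
      unfolding wa_def by (subst integral_mult_right_zero) (simp only: integral_lborel_on_prod[OF finite_set i] e)
    have "integrable lborel (\<lambda>y. 2\<^sup>2 * damp 1 0 y)" by (intro integrable_mult_right integrable_damp) auto
    then show "(\<integral>Y. wb Y \<partial>lborel_on ?D) = M'\<^sup>2 * (\<Prod>d\<in>?D. 2\<^sup>2 * (cmass / 2))"
      unfolding wb_def by (subst integral_mult_right_zero, subst integral_lborel_on_prod) (auto simp: integral_damp)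
  qed
  have i2: "integrable (lborel_on ?D) (\<lambda>Y. (cmod (a Y))\<^sup>2)" "integrable (lborel_on ?D) (\<lambda>Y. (cmod (b Y))\<^sup>2)"
    by (rule Bochner_Integration.integrable_bound[OF iw(1)] Bochner_Integration.integrable_bound[OF iw(2)];
      use sqa sqb in \<open>auto intro!: AE_I2 intro: order_trans[OF _ abs_ge_self]\<close>)+
  have "cmod (pairing ?D a b) \<le> sqrt (pi ^ card ?D * (\<integral>Y. (cmod (a Y))\<^sup>2 \<partial>lborel_on ?D) * (\<integral>Y. (cmod (b Y))\<^sup>2 \<partial>lborel_on ?D))"
    by (rule pairing_L2_bound[OF finite_set i(1) i2(1) i(2) i2(2)])
  also have "\<dots> \<le> sqrt (pi ^ card ?D * (\<integral>Y. wa Y \<partial>lborel_on ?D) * (\<integral>Y. wb Y \<partial>lborel_on ?D))"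
    by (intro real_sqrt_le_mono mult_mono integral_mono i2 iw sqa sqb mult_nonneg_nonneg Bochner_Integration.integral_nonneg)
      (auto intro: order_trans[OF _ sqa])
  also have "pi ^ card ?D * (\<integral>Y. wa Y \<partial>lborel_on ?D) * (\<integral>Y. wb Y \<partial>lborel_on ?D) = (pi ^ card ?D * (M * M' * (\<Prod>d\<in>?D. C0 * r d)))\<^sup>2"
  proof -
    have "pi * (122\<^sup>2 * (cmass / 2 * (r d)\<^sup>2)) * (2\<^sup>2 * (cmass / 2)) = (pi * (C0 * r d))\<^sup>2" for d
    proof -
      have "(sqrt pi)\<^sup>2 = pi" by simp
      then show ?thesis unfolding C0_def by (simp add: power_mult_distrib power_divide field_simps power2_eq_square)
    qed
    then have "(\<Prod>d\<in>?D. pi * (122\<^sup>2 * (cmass / 2 * (r d)\<^sup>2)) * (2\<^sup>2 * (cmass / 2))) = (\<Prod>d\<in>?D. (pi * (C0 * r d))\<^sup>2)" by simp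
    then have "pi ^ card ?D * (\<Prod>d\<in>?D. 122\<^sup>2 * (cmass / 2 * (r d)\<^sup>2)) * (\<Prod>d\<in>?D. 2\<^sup>2 * (cmass / 2)) = (pi ^ card ?D * (\<Prod>d\<in>?D. C0 * r d))\<^sup>2"
      by (simp only: prod.distrib prod_constant prod_power_distrib[symmetric])
    then show ?thesis unfolding vw by (simp only: power_mult_distrib) (simp only: mult_ac)
  qed
  also have "sqrt \<dots> = pi ^ card ?D * (M * M' * (\<Prod>d\<in>?D. C0 * r d))"
    using M C0_nonneg r0 by (intro real_sqrt_abs[THEN trans] abs_of_nonneg mult_nonneg_nonneg prod_nonneg) (auto simp: less_imp_le)
  finally show ?thesis unfolding tform_def a_def[symmetric] b_def[symmetric]
    by (simp add: norm_divide divide_le_eq mult.commute norm_power)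
qed

lemma amp_tendsto:
  assumes "distinct ds" "\<And>d. d \<in> set ds \<Longrightarrow> 2 \<le> \<mu> d"
    and "\<And>\<kappa>. \<kappa> \<le> \<mu> \<Longrightarrow> ((\<lambda>k. Fk k \<kappa> Y) \<longlongrightarrow> F \<kappa> Y) f" "\<kappa> \<le> clear (set ds) \<mu>"
  shows "((\<lambda>k. amp c ds (Fk k) \<kappa> Y) \<longlongrightarrow> amp c ds F \<kappa> Y) f"
  using assms(1,2,4)
proof (induction ds arbitrary: \<kappa>)
  case (Cons d ds)
  have "\<kappa> \<le> clear {d} (clear (set ds) \<mu>)" using Cons.prems by simp
  note k = le_clearD[OF this]
  have "2 \<le> clear (set ds) \<mu> d" using Cons.prems by (simp add: clear_eq)
  then show ?case using Cons.prems k
    by (auto simp: diff_op_def intro!: tendsto_intros Cons.IH multi_index_upd_le)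
qed (simp add: assms(3))

lemma jet_bound_limit:
  assumes "\<And>k::nat. jet_bound D s \<mu> P (Fk k)" "\<And>\<kappa> Y. \<kappa> \<le> \<mu> \<Longrightarrow> (\<lambda>k. Fk k \<kappa> Y) \<longlonglongrightarrow> F \<kappa> Y"
  shows "jet_bound D s \<mu> P F"
  unfolding jet_bound_def
  using assms(1) by (auto intro!: Lim_bounded[OF tendsto_norm[OF assms(2)]] dest: jet_boundD)

text \<open>Dominated convergence in the absolutely convergent double integral: the dominating
  functions depend on the jets only through M and M'. The removal of cutoffs, continuity and the
  differentiation in the scales all rest on this.\<close>

lemma tform_tendsto:
  fixes F G :: "'i::countable jet" and Fk Gk :: "nat \<Rightarrow> 'i jet"
  assumes ds: "distinct ds" and mu: "\<And>d. d \<in> set ds \<Longrightarrow> 2 \<le> \<mu> d"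
    and th: "\<And>d. 0 < \<theta> d" "\<And>d. \<theta> d \<le> 1"
    and F: "smooth \<mu> F" "\<And>k. smooth \<mu> (Fk k)" "\<And>k. jet_bound (set ds) (\<lambda>_. 1) \<mu> (\<lambda>_. M) (Fk k)"
      "\<And>\<kappa> Y. \<kappa> \<le> \<mu> \<Longrightarrow> (\<lambda>k. Fk k \<kappa> Y) \<longlonglongrightarrow> F \<kappa> Y"
    and G: "smooth \<mu> G" "\<And>k. smooth \<mu> (Gk k)" "\<And>k. jet_bound (set ds) (\<lambda>_. 1) \<mu> (\<lambda>_. M') (Gk k)"
      "\<And>\<kappa> Y. \<kappa> \<le> \<mu> \<Longrightarrow> (\<lambda>k. Gk k \<kappa> Y) \<longlonglongrightarrow> G \<kappa> Y"
    and M: "0 \<le> M" "0 \<le> M'"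
  shows "(\<lambda>k. tform \<theta> ds (Fk k) (Gk k)) \<longlonglongrightarrow> tform \<theta> ds F G"
proof -
  let ?D = "set ds"
  have t: "0 \<le> \<theta> d" for d using th(1)[of d] by simp
  let ?A = "\<lambda>F. amp (\<lambda>d. coefA (\<theta> d)) ds F (\<lambda>_. 0)"
  let ?B = "\<lambda>G. amp (\<lambda>d. coefB (\<theta> d)) ds G (\<lambda>_. 0)"
  have F5: "jet_bound ?D (\<lambda>_. 1) \<mu> (\<lambda>_. M) F" using F(3,4) by (rule jet_bound_limit)
  have G5: "jet_bound ?D (\<lambda>_. 1) \<mu> (\<lambda>_. M') G" using G(3,4) by (rule jet_bound_limit)
  have mA: "?A H \<in> borel_measurable borel" if "smooth \<mu> H" for H
    using that by (auto intro!: amp_measurable[OF ds] mu coef_continuous t)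
  have mB: "?B H \<in> borel_measurable borel" if "smooth \<mu> H" for H
    using that by (auto intro!: amp_measurable[OF ds] mu coef_continuous t)
  have bA: "cmod (?A H Y) \<le> M * dampA \<theta> ?D Y" if "jet_bound ?D (\<lambda>_. 1) \<mu> (\<lambda>_. M) H" for H Y
    by (rule amp_bounds(1)[OF ds mu t th(2) _ _ that that]) (auto simp: th M)
  have bB: "cmod (?B H Y) \<le> M' * dampB ?D Y" if "jet_bound ?D (\<lambda>_. 1) \<mu> (\<lambda>_. M') H" for H Y
    by (rule amp_bounds(2)[OF ds mu t th(2) _ _ that that]) (auto simp: th M)
  have iA: "integrable (lborel_on ?D) (?A H)" if "smooth \<mu> H" "jet_bound ?D (\<lambda>_. 1) \<mu> (\<lambda>_. M) H" for H
    by (rule integrable_dominated[OF integrable_mult_right[OF integrable_dampA] _ bA]) (use that th mA in auto)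
  have iB: "integrable (lborel_on ?D) (?B H)" if "smooth \<mu> H" "jet_bound ?D (\<lambda>_. 1) \<mu> (\<lambda>_. M') H" for H
    by (rule integrable_dominated[OF integrable_mult_right[OF integrable_dampB] _ bB]) (use that th mB in auto)
  have tA: "(\<lambda>k. ?A (Fk k) Y) \<longlonglongrightarrow> ?A F Y" for Y
    by (rule amp_tendsto[where \<mu>=\<mu>, OF ds mu _ clear_zero]) (auto intro: F(4))
  have tB: "(\<lambda>k. ?B (Gk k) Y) \<longlonglongrightarrow> ?B G Y" for Y
    by (rule amp_tendsto[where \<mu>=\<mu>, OF ds mu _ clear_zero]) (auto intro: G(4))
  have "(\<lambda>k. pairing ?D (?A (Fk k)) (?B (Gk k))) \<longlonglongrightarrow> pairing ?D (?A F) (?B G)"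
    unfolding pairing_eq_pair[OF finite_set iA[OF F(1) F5] iB[OF G(1) G5]] pairing_eq_pair[OF finite_set iA[OF F(2,3)] iB[OF G(2,3)]]
  proof (rule integral_dominated_convergence[where w="\<lambda>(Y, Z). (M * dampA \<theta> ?D Y) * (M' * dampB ?D Z)"])
    note [measurable] = mA[OF F(1)] mB[OF G(1)] mA[OF F(2)] mB[OF G(2)]
    show "(\<lambda>(Y, Z). ?A F Y * ?B G Z * wave ?D Y Z) \<in> borel_measurable (lborel_on ?D \<Otimes>\<^sub>M lborel_on ?D)" by measurable
    show "(\<lambda>(Y, Z). ?A (Fk k) Y * ?B (Gk k) Z * wave ?D Y Z) \<in> borel_measurable (lborel_on ?D \<Otimes>\<^sub>M lborel_on ?D)" for k by measurable
    have "integrable (lborel_on ?D \<Otimes>\<^sub>M lborel_on ?D) (\<lambda>(Y, Z). complex_of_real (M * dampA \<theta> ?D Y) * complex_of_real (M' * dampB ?D Z) * wave ?D Y Z)"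
      by (intro integrable_pair_wave integrable_of_real integrable_mult_right integrable_dampA integrable_dampB th) auto
    from integrable_norm[OF this]
    show "integrable (lborel_on ?D \<Otimes>\<^sub>M lborel_on ?D) (\<lambda>(Y, Z). (M * dampA \<theta> ?D Y) * (M' * dampB ?D Z))"
      using M dampA_nonneg[of \<theta> ?D] dampB_nonneg[of ?D] t by (simp add: split_beta' norm_mult)
    show "AE x in lborel_on ?D \<Otimes>\<^sub>M lborel_on ?D. (\<lambda>k. case x of (Y, Z) \<Rightarrow> ?A (Fk k) Y * ?B (Gk k) Z * wave ?D Y Z) \<longlonglongrightarrow> (case x of (Y, Z) \<Rightarrow> ?A F Y * ?B G Z * wave ?D Y Z)"
      using tA tB by (auto intro!: AE_I2 tendsto_intros)
    show "AE x in lborel_on ?D \<Otimes>\<^sub>M lborel_on ?D. norm (case x of (Y, Z) \<Rightarrow> ?A (Fk k) Y * ?B (Gk k) Z * wave ?D Y Z) \<le> (case x of (Y, Z) \<Rightarrow> (M * dampA \<theta> ?D Y) * (M' * dampB ?D Z))" for k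
      using bA[OF F(3)] bB[OF G(3)] M dampA_nonneg[of \<theta> ?D] t
      by (auto intro!: AE_I2 simp: norm_mult) (intro mult_mono; auto)
  qed
  then show ?thesis unfolding tform_def by (intro tendsto_divide tendsto_const) auto
qed

section \<open>Oscillatory integrals\<close>

definition gauss_deriv :: "nat \<Rightarrow> real \<Rightarrow> real" where
  "gauss_deriv i y = (if i = 0 then 1 else if i = 1 then - 2 * y else if i = 2 then 4 * y\<^sup>2 - 2 else 12 * y - 8 * y ^ 3) * exp (- y\<^sup>2)"

lemma gauss_deriv_deriv: "i < 3 \<Longrightarrow> (gauss_deriv i has_real_derivative gauss_deriv (Suc i) y) (at y)"
proof -
  assume "i < 3"
  then consider "i = 0" | "i = 1" | "i = 2" by linarith
  then show ?thesis
    by cases (auto simp: gauss_deriv_def[abs_def] algebra_simps power2_eq_square power3_eq_cube intro!: derivative_eq_intros)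
qed

lemma gauss_deriv_continuous: "continuous_on A (gauss_deriv i)"
  unfolding gauss_deriv_def[abs_def] by (cases "i = 0"; cases "i = 1"; cases "i = 2") (auto intro!: continuous_intros)

text \<open>With x = y^2, the polynomial factors are at most 20 (1 + x)^2, and (1 + x)^3 e^(-x)
  \<le> 27 because 1 + x \<le> 3 (1 + x / 3) and (1 + x / 3)^3 \<le> e^x. Hence 540 = 20 *
  27.\<close>

lemma gauss_deriv_bound: "\<bar>gauss_deriv i y\<bar> \<le> 540 * cauchy y"
proof -
  define x where "x = y\<^sup>2"
  have x: "0 \<le> x" by (simp add: x_def)
  have y1: "\<bar>y\<bar> \<le> 1 + x" 
  proof -
    have "2 * \<bar>y\<bar> \<le> 1 + x" using sum_squares_bound[of 1 "\<bar>y\<bar>"] by (simp add: x_def)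
    then show ?thesis using x by linarith
  qed
  have s: "1 \<le> (1 + x)\<^sup>2" "1 + x \<le> (1 + x)\<^sup>2" using x by (auto simp: power2_eq_square algebra_simps)
  have y3: "\<bar>y ^ 3\<bar> \<le> (1 + x)\<^sup>2"
  proof -
    have "\<bar>y ^ 3\<bar> = \<bar>y\<bar> * x" by (simp add: x_def power2_eq_square power3_eq_cube abs_mult)
    also have "\<dots> \<le> (1 + x) * (1 + x)" using y1 x by (intro mult_mono) auto
    finally show ?thesis by (simp add: power2_eq_square)
  qed
  define p where "p = (if i = 0 then 1 else if i = 1 then - 2 * y else if i = 2 then 4 * y\<^sup>2 - 2 else 12 * y - 8 * y ^ 3)"
  have p: "\<bar>p\<bar> \<le> 20 * (1 + x)\<^sup>2"
  proof -
    have "\<bar>1::real\<bar> \<le> 20 * (1 + x)\<^sup>2" "\<bar>- 2 * y\<bar> \<le> 20 * (1 + x)\<^sup>2" "\<bar>4 * x - 2\<bar> \<le> 20 * (1 + x)\<^sup>2"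
      "\<bar>12 * y - 8 * y ^ 3\<bar> \<le> 20 * (1 + x)\<^sup>2"
      using s y1 y3 x by linarith+
    then show ?thesis unfolding p_def x_def[symmetric] by presburger
  qed
  have "(1 + x) ^ 3 \<le> (3 * (1 + x / 3)) ^ 3" using x by (intro power_mono) auto
  also have "\<dots> = 27 * (1 + x / real 3) ^ 3" by (simp only: power_mult_distrib) simp
  also have "\<dots> \<le> 27 * exp x" using x by (intro mult_left_mono exp_ge_one_plus_x_over_n_power_n) auto
  finally have e: "(1 + x) ^ 3 * exp (- x) \<le> 27" by (simp add: exp_minus divide_simps)
  have "\<bar>gauss_deriv i y\<bar> * (1 + x) = \<bar>p\<bar> * (1 + x) * exp (- x)"
  proof -
    have "gauss_deriv i y = p * exp (- x)" by (simp only: gauss_deriv_def p_def x_def)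
    then show ?thesis using x by (simp add: abs_mult)
  qed
  also have "\<dots> \<le> 20 * (1 + x)\<^sup>2 * (1 + x) * exp (- x)" using p x by (intro mult_right_mono) auto
  also have "\<dots> = 20 * ((1 + x) ^ 3 * exp (- x))" by (simp add: power3_eq_cube power2_eq_square)
  also have "\<dots> \<le> 20 * 27" by (intro mult_left_mono e) auto
  finally show ?thesis using x by (simp add: cauchy_def x_def[symmetric] divide_simps add_pos_nonneg)
qed

text \<open>Leibniz' rule in the variable \<open>d\<close>: the jet of the product of
  \<open>A\<close> with a function of \<open>Y d\<close> whose successive derivatives are
  \<open>\<phi> i\<close>.\<close>

definition mul_jet :: "(nat \<Rightarrow> real \<Rightarrow> real) \<Rightarrow> 'i \<Rightarrow> 'i jet \<Rightarrow> 'i jet" where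
  "mul_jet \<phi> d A = (\<lambda>\<kappa> Y. \<Sum>i\<le>\<kappa> d. of_nat (\<kappa> d choose i) * of_real (\<phi> i (Y d)) * A (\<kappa>(d := \<kappa> d - i)) Y)"

text \<open>Pascal's rule, checked case by case. Cut off jets carry order at most 3: two for the
  integration by parts and one for the derivative in the scale.\<close>

lemma leibniz_3:
  fixes p a :: "nat \<Rightarrow> complex"
  assumes "k < 3"
  shows "(\<Sum>i\<le>k. of_nat (k choose i) * (p i * a (Suc (k - i)) + p (Suc i) * a (k - i))) =
    (\<Sum>i\<le>Suc k. of_nat (Suc k choose i) * p i * a (Suc k - i))"
proof -
  consider "k = 0" | "k = 1" | "k = 2" using assms by linarith
  then show ?thesis
    by cases (simp_all add: numeral_2_eq_2 algebra_simps)
qed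

lemma smooth_mul_jet:
  assumes A: "smooth \<mu> A" and d: "\<mu> d \<le> 3"
    and p: "\<And>i y. i < 3 \<Longrightarrow> (\<phi> i has_real_derivative \<phi> (Suc i) y) (at y)" "\<And>i. continuous_on UNIV (\<phi> i)"
  shows "smooth \<mu> (mul_jet \<phi> d A)"
  unfolding smooth_def
proof (intro conjI allI impI)
  have cc: "continuous_on UNIV (\<lambda>Y. complex_of_real (\<phi> i (Y d)))" for i
    by (intro continuous_on_of_real continuous_on_compose2[OF p(2)] continuous_on_product_coordinates) auto
  fix \<kappa> assume k: "\<kappa> \<le> \<mu>"
  have le: "\<kappa>(d := \<kappa> d - i) \<le> \<mu>" for i
    by (rule multi_index_upd_le[OF k]) (metis diff_le_self k le_fun_def order_trans)
  show "continuous_on UNIV (mul_jet \<phi> d A \<kappa>)"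
    unfolding mul_jet_def by (intro continuous_intros cc smoothD[OF A] le)
  fix e Y assume e: "\<kappa> e < \<mu> e"
  show "((\<lambda>t. mul_jet \<phi> d A \<kappa> (Y(e := t))) has_vector_derivative mul_jet \<phi> d A (\<kappa>(e := Suc (\<kappa> e))) Y) (at (Y e))"
  proof (cases "e = d")
    case False
    have "((\<lambda>t. A (\<kappa>(d := \<kappa> d - i)) (Y(e := t))) has_vector_derivative A (\<kappa>(e := Suc (\<kappa> e), d := \<kappa> d - i)) Y) (at (Y e))" for i
      using smoothD(2)[OF A le, of i e Y] e False by (simp add: fun_upd_twist)
    then show ?thesis using False unfolding mul_jet_def
      by (auto intro!: has_vector_derivative_sum has_vector_derivative_mult_right)
  next
    case True
    define k where "k = \<kappa> d"
    have k3: "k < 3" using e True d by (simp add: k_def)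
    let ?p = "\<lambda>i. complex_of_real (\<phi> i (Y d))" and ?a = "\<lambda>j. A (\<kappa>(d := j)) Y"
    have dp: "((\<lambda>t. complex_of_real (\<phi> i t)) has_vector_derivative ?p (Suc i)) (at (Y d))" if "i \<le> k" for i
      using p(1)[of i "Y d"] that k3
      by (intro has_vector_derivative_of_real) (simp add: has_real_derivative_iff_has_vector_derivative)
    have da: "((\<lambda>t. A (\<kappa>(d := k - i)) (Y(d := t))) has_vector_derivative ?a (Suc (k - i))) (at (Y d))" for i
      using smoothD(2)[OF A le, of i d Y] e True by (simp add: k_def)
    have "((\<lambda>t. \<Sum>i\<le>k. of_nat (k choose i) * (of_real (\<phi> i t) * A (\<kappa>(d := k - i)) (Y(d := t)))) has_vector_derivative
        (\<Sum>i\<le>k. of_nat (k choose i) * (?p i * ?a (Suc (k - i)) + ?p (Suc i) * ?a (k - i)))) (at (Y d))"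
    proof (intro has_vector_derivative_sum has_vector_derivative_mult_right)
      fix i assume "i \<in> {..k}"
      then show "((\<lambda>t. of_real (\<phi> i t) * A (\<kappa>(d := k - i)) (Y(d := t))) has_vector_derivative
        ?p i * ?a (Suc (k - i)) + ?p (Suc i) * ?a (k - i)) (at (Y d))"
        using has_vector_derivative_mult[OF dp da, of i i] by simp
    qed
    then show ?thesis
      unfolding leibniz_3[OF k3, of ?p ?a] True mul_jet_def k_def[symmetric] by (simp add: mult.assoc k_def[symmetric] del: sum.atMost_Suc)
  qed
qed

lemma jet_bound_mul_jet:
  assumes A: "jet_bound D (\<lambda>_. 1) \<mu> P A" and d: "\<mu> d \<le> 3" and P: "\<And>Y. 0 \<le> P Y"
    and p: "\<And>i y. i \<le> 3 \<Longrightarrow> \<bar>\<phi> i y\<bar> \<le> \<gamma> y"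
  shows "jet_bound D (\<lambda>_. 1) \<mu> (\<lambda>Y. 8 * \<gamma> (Y d) * P Y) (mul_jet \<phi> d A)"
  unfolding jet_bound_def
proof (intro allI impI)
  fix \<kappa> Y assume k: "\<kappa> \<le> \<mu>"
  have kd: "\<kappa> d \<le> 3" using k d by (meson le_fun_def order_trans)
  have g0: "0 \<le> \<gamma> (Y d)" using p[of 0 "Y d"] by linarith
  have le: "\<kappa>(d := \<kappa> d - i) \<le> \<mu>" for i
    by (rule multi_index_upd_le[OF k]) (metis diff_le_self k le_fun_def order_trans)
  have "cmod (mul_jet \<phi> d A \<kappa> Y) \<le> (\<Sum>i\<le>\<kappa> d. of_nat (\<kappa> d choose i) * (\<gamma> (Y d) * P Y))"
    unfolding mul_jet_def
  proof (rule sum_norm_le)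
    fix i assume "i \<in> {..\<kappa> d}"
    have "\<bar>\<phi> i (Y d)\<bar> * cmod (A (\<kappa>(d := \<kappa> d - i)) Y) \<le> \<gamma> (Y d) * P Y"
      using jet_boundD[OF A le, of i Y] kd \<open>i \<in> _\<close> g0 by (intro mult_mono p) auto
    then show "cmod (of_nat (\<kappa> d choose i) * of_real (\<phi> i (Y d)) * A (\<kappa>(d := \<kappa> d - i)) Y) \<le> of_nat (\<kappa> d choose i) * (\<gamma> (Y d) * P Y)"
      by (simp add: norm_mult mult.assoc mult_left_mono)
  qed
  also have "\<dots> = 2 ^ \<kappa> d * (\<gamma> (Y d) * P Y)"
    by (simp add: choose_row_sum flip: sum_distrib_right of_nat_sum)
  also have "\<dots> \<le> 2 ^ 3 * (\<gamma> (Y d) * P Y)"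
    using kd P g0 by (intro mult_right_mono power_increasing mult_nonneg_nonneg) auto
  finally show "cmod (mul_jet \<phi> d A \<kappa> Y) \<le> 8 * \<gamma> (Y d) * P Y * (\<Prod>d\<in>D. 1 ^ \<kappa> d)" by simp
qed

definition cut :: "('i \<Rightarrow> real) \<Rightarrow> 'i list \<Rightarrow> 'i jet \<Rightarrow> 'i jet" where
  "cut \<eta> ds A = foldr (\<lambda>d. mul_jet (\<lambda>i y. \<eta> d ^ i * gauss_deriv i (\<eta> d * y)) d) ds A"

lemma cut_simps [simp]: "cut \<eta> [] A = A"
  "cut \<eta> (d # ds) A = mul_jet (\<lambda>i y. \<eta> d ^ i * gauss_deriv i (\<eta> d * y)) d (cut \<eta> ds A)"
  by (simp_all add: cut_def)

lemma cut_deriv: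
  "i < 3 \<Longrightarrow> ((\<lambda>y. e ^ i * gauss_deriv i (e * y)) has_real_derivative e ^ Suc i * gauss_deriv (Suc i) (e * y)) (at y)"
proof -
  assume "i < 3"
  have "((\<lambda>y. gauss_deriv i (e * y)) has_real_derivative gauss_deriv (Suc i) (e * y) * e) (at y)"
    by (rule DERIV_chain2[OF gauss_deriv_deriv[OF \<open>i < 3\<close>]]) (auto intro!: derivative_eq_intros)
  from DERIV_cmult[OF this, of "e ^ i"] show ?thesis by (simp add: mult_ac)
qed

lemma smooth_cut: "smooth \<mu> A \<Longrightarrow> (\<And>d. \<mu> d \<le> 3) \<Longrightarrow> smooth \<mu> (cut \<eta> ds A)"
proof (induction ds)
  case (Cons d ds)
  then show ?case unfolding cut_simps
    by (intro smooth_mul_jet cut_deriv) (auto intro!: continuous_intros continuous_on_compose2[OF gauss_deriv_continuous])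
qed simp

lemma cut_weight_bound:
  assumes "\<bar>e\<bar> \<le> 1"
  shows "\<bar>e ^ i * gauss_deriv i (e * y)\<bar> \<le> 540 * cauchy (e * y)"
proof -
  have "\<bar>e\<bar> ^ i * \<bar>gauss_deriv i (e * y)\<bar> \<le> 1 * (540 * cauchy (e * y))"
    using assms by (intro mult_mono power_le_one gauss_deriv_bound) auto
  then show ?thesis by (simp add: abs_mult power_abs)
qed

text \<open>4320 = 8 * 540, with 8 = 2^3 from the binomial coefficients and 540 from
  \<open>gauss_deriv_bound\<close>.\<close>

lemma jet_bound_cut:
  assumes A: "jet_bound D (\<lambda>_. 1) \<mu> P A" and d: "\<And>d. \<mu> d \<le> 3" and P: "\<And>Y. 0 \<le> P Y"
    and e: "\<And>d. \<bar>\<eta> d\<bar> \<le> 1" and "distinct ds"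
  shows "jet_bound D (\<lambda>_. 1) \<mu> (\<lambda>Y. (\<Prod>d\<in>set ds. 4320 * cauchy (\<eta> d * Y d)) * P Y) (cut \<eta> ds A)"
  using \<open>distinct ds\<close>
proof (induction ds)
  case (Cons d ds)
  then have "jet_bound D (\<lambda>_. 1) \<mu> (\<lambda>Y. 8 * (540 * cauchy (\<eta> d * Y d)) * ((\<Prod>d\<in>set ds. 4320 * cauchy (\<eta> d * Y d)) * P Y))
     (cut \<eta> (d # ds) A)"
    unfolding cut_simps
    by (intro jet_bound_mul_jet[where \<gamma>="\<lambda>y. 540 * cauchy (\<eta> d * y)"] cut_weight_bound e d mult_nonneg_nonneg prod_nonneg P) auto
  then show ?case using Cons.prems by (simp add: mult_ac)
qed (simp add: A)

lemma cauchy_scale_le: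
  assumes "0 < e" "e \<le> 1"
  shows "cauchy (e * y) \<le> inverse (e\<^sup>2) * cauchy y"
proof -
  have "e\<^sup>2 \<le> 1" using assms by (simp add: power_le_one)
  then have "e\<^sup>2 * (1 + y\<^sup>2) \<le> 1 + (e * y)\<^sup>2" by (simp add: power_mult_distrib algebra_simps)
  then have "inverse (1 + (e * y)\<^sup>2) \<le> inverse (e\<^sup>2 * (1 + y\<^sup>2))"
    using assms by (intro le_imp_inverse_le) (auto intro!: mult_pos_pos add_pos_nonneg)
  then show ?thesis by (simp add: cauchy_def)
qed

lemma jet_bound_weaken: "jet_bound D s \<mu> P A \<Longrightarrow> (\<And>Y. P Y \<le> Q Y) \<Longrightarrow> (\<And>d. 0 \<le> s d) \<Longrightarrow> jet_bound D s \<mu> Q A"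
  unfolding jet_bound_def by (meson mult_right_mono order_trans prod_nonneg zero_le_power)

text \<open>The bound of \<open>jet_bound_cut\<close> is read in two ways: here uniformly in \<eta>,
  as limits require, and in \<open>jet_bound_cut_decay\<close> with decay but a constant depending
  on \<eta>, as integration by parts requires.\<close>

lemma jet_bound_cut_uniform:
  assumes A: "jet_bound D (\<lambda>_. 1) \<mu> (\<lambda>_. M) A" and d: "\<And>d. \<mu> d \<le> 3" and M: "0 \<le> M"
    and e: "\<And>d. \<bar>\<eta> d\<bar> \<le> 1" and ds: "distinct ds"
  shows "jet_bound D (\<lambda>_. 1) \<mu> (\<lambda>_. 4320 ^ length ds * M) (cut \<eta> ds A)"
proof (rule jet_bound_weaken[OF jet_bound_cut[OF A d M e ds]])
  fix Y
  have "(\<Prod>d\<in>set ds. 4320 * cauchy (\<eta> d * Y d)) \<le> (\<Prod>d\<in>set ds. 4320)"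
    by (intro prod_mono) (auto simp: cauchy_le_1)
  then show "(\<Prod>d\<in>set ds. 4320 * cauchy (\<eta> d * Y d)) * M \<le> 4320 ^ length ds * M"
    using M ds by (intro mult_right_mono) (auto simp: distinct_card)
qed auto

lemma jet_bound_cut_decay:
  assumes A: "jet_bound (set ds) (\<lambda>_. 1) \<mu> (\<lambda>_. M) A" and d: "\<And>d. \<mu> d \<le> 3" and M: "0 \<le> M"
    and e: "\<And>d. 0 < \<eta> d" "\<And>d. \<eta> d \<le> 1" and ds: "distinct ds"
  shows "\<exists>C\<ge>0. jet_bound (set ds) (\<lambda>_. 1) \<mu> (\<lambda>Y. C * weight (set ds) Y) (cut \<eta> ds A)"
proof (intro exI conjI)
  let ?C = "(\<Prod>d\<in>set ds. 4320 * inverse ((\<eta> d)\<^sup>2)) * M"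
  show "0 \<le> ?C" using M by (intro mult_nonneg_nonneg prod_nonneg) auto
  have e': "\<bar>\<eta> d\<bar> \<le> 1" for d using e[of d] by simp
  show "jet_bound (set ds) (\<lambda>_. 1) \<mu> (\<lambda>Y. ?C * weight (set ds) Y) (cut \<eta> ds A)"
  proof (rule jet_bound_weaken[OF jet_bound_cut[OF A d M e' ds]])
    fix Y
    have "(\<Prod>d\<in>set ds. 4320 * cauchy (\<eta> d * Y d)) \<le> (\<Prod>d\<in>set ds. (4320 * inverse ((\<eta> d)\<^sup>2)) * cauchy (Y d))"
      using cauchy_scale_le[OF e] by (intro prod_mono) (auto simp: mult.assoc)
    then have "(\<Prod>d\<in>set ds. 4320 * cauchy (\<eta> d * Y d)) * M \<le> (\<Prod>d\<in>set ds. (4320 * inverse ((\<eta> d)\<^sup>2)) * cauchy (Y d)) * M"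
      using M by (rule mult_right_mono)
    then show "(\<Prod>d\<in>set ds. 4320 * cauchy (\<eta> d * Y d)) * M \<le> ?C * weight (set ds) Y"
      unfolding prod.distrib weight_def by (simp only: mult_ac)
  qed auto
qed

lemma cut_zero:
  "distinct ds \<Longrightarrow> (\<And>d. d \<in> set ds \<Longrightarrow> \<kappa> d = 0) \<Longrightarrow> cut \<eta> ds A \<kappa> Y = of_real (\<Prod>d\<in>set ds. exp (- (\<eta> d * Y d)\<^sup>2)) * A \<kappa> Y"
proof (induction ds)
  case (Cons d ds)
  have "\<kappa>(d := 0) = \<kappa>" using Cons.prems by auto
  then show ?case using Cons by (simp add: mul_jet_def gauss_deriv_def mult.assoc)
qed simp

lemma cut_zero_fun:
  "distinct ds \<Longrightarrow> cut \<eta> ds A (\<lambda>_. 0) = (\<lambda>Y. of_real (\<Prod>d\<in>set ds. exp (- (\<eta> d * Y d)\<^sup>2)) * A (\<lambda>_. 0) Y)"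
  by (intro ext cut_zero) auto

lemma cut_tendsto:
  assumes "\<And>d. (\<lambda>k::nat. \<eta> k d) \<longlonglongrightarrow> 0" "\<And>\<kappa>. \<kappa> \<le> \<mu> \<Longrightarrow> (\<lambda>k. Ak k \<kappa> Y) \<longlonglongrightarrow> A \<kappa> Y" "\<kappa> \<le> \<mu>"
  shows "(\<lambda>k. cut (\<eta> k) ds (Ak k) \<kappa> Y) \<longlonglongrightarrow> A \<kappa> Y"
  using assms(3)
proof (induction ds arbitrary: \<kappa>)
  case (Cons d ds)
  let ?q = "\<lambda>k. cut (\<eta> k) ds (Ak k)"
  have le: "\<kappa>(d := \<kappa> d - i) \<le> \<mu>" for i
    by (rule multi_index_upd_le[OF Cons.prems]) (metis diff_le_self Cons.prems le_fun_def order_trans)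
  have "(\<lambda>k. \<Sum>i\<le>\<kappa> d. of_nat (\<kappa> d choose i) * of_real (\<eta> k d ^ i * gauss_deriv i (\<eta> k d * Y d)) * ?q k (\<kappa>(d := \<kappa> d - i)) Y)
     \<longlonglongrightarrow> (\<Sum>i\<le>\<kappa> d. of_nat (\<kappa> d choose i) * of_real (0 ^ i * gauss_deriv i (0 * Y d)) * A (\<kappa>(d := \<kappa> d - i)) Y)"
  proof (intro tendsto_intros Cons.IH le assms(1))
    fix i
    have "isCont (gauss_deriv i) (0 * Y d)"
      using gauss_deriv_continuous[of UNIV i] by (simp add: continuous_on_eq_continuous_at)
    then show "(\<lambda>k. gauss_deriv i (\<eta> k d * Y d)) \<longlonglongrightarrow> gauss_deriv i (0 * Y d)"
      by (rule isCont_tendsto_compose) (intro tendsto_intros assms(1))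
  qed
  also have "(\<Sum>i\<le>\<kappa> d. of_nat (\<kappa> d choose i) * of_real (0 ^ i * gauss_deriv i (0 * Y d)) * A (\<kappa>(d := \<kappa> d - i)) Y)
     = (\<Sum>i\<le>\<kappa> d. if i = 0 then A \<kappa> Y else 0)"
    by (intro sum.cong) (auto simp: gauss_deriv_def)
  finally show ?case by (simp add: mul_jet_def fun_upd_def)
qed (simp add: assms(2))

section \<open>The oscillatory integral and its elementary properties\<close>

definition osc :: "'i set \<Rightarrow> (('i::countable \<Rightarrow> real) \<Rightarrow> complex) \<Rightarrow> (('i \<Rightarrow> real) \<Rightarrow> complex) \<Rightarrow> complex" where
  "osc D F G = lim (\<lambda>k. pairing D (\<lambda>Y. of_real (\<Prod>d\<in>D. exp (- (inverse (real (Suc k)) * Y d)\<^sup>2)) * F Y)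
     (\<lambda>Z. of_real (\<Prod>d\<in>D. exp (- (inverse (real (Suc k)) * Z d)\<^sup>2)) * G Z) / of_real (pi ^ card D))"

lemma tform_cut:
  fixes F G :: "'i::countable jet"
  assumes ds: "distinct ds" and mu: "\<And>d. d \<in> set ds \<Longrightarrow> 2 \<le> \<mu> d" "\<And>d. \<mu> d \<le> 3"
    and th: "\<And>d. 0 < \<theta> d" "\<And>d. \<theta> d \<le> 1" and M: "0 \<le> M" "0 \<le> M'"
    and F: "smooth \<mu> F" "jet_bound (set ds) (\<lambda>_. 1) \<mu> (\<lambda>_. M) F"
    and G: "smooth \<mu> G" "jet_bound (set ds) (\<lambda>_. 1) \<mu> (\<lambda>_. M') G"
    and e: "\<And>d. 0 < \<eta> d" "\<And>d. \<eta> d \<le> 1" and e': "\<And>d. 0 < \<eta>' d" "\<And>d. \<eta>' d \<le> 1"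
  shows "tform \<theta> ds (cut \<eta> ds F) (cut \<eta>' ds G) = pairing (set ds) (cut \<eta> ds F (\<lambda>_. 0)) (cut \<eta>' ds G (\<lambda>_. 0)) / of_real (pi ^ card (set ds))"
proof -
  obtain C where C: "C \<ge> 0" "jet_bound (set ds) (\<lambda>_. 1) \<mu> (\<lambda>Y. C * weight (set ds) Y) (cut \<eta> ds F)"
    using jet_bound_cut_decay[where \<eta>=\<eta>, OF F(2) mu(2) M(1) e ds] by (elim exE conjE)
  obtain C' where C': "C' \<ge> 0" "jet_bound (set ds) (\<lambda>_. 1) \<mu> (\<lambda>Y. C' * weight (set ds) Y) (cut \<eta>' ds G)"
    using jet_bound_cut_decay[where \<eta>=\<eta>', OF G(2) mu(2) M(2) e' ds] by (elim exE conjE)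
  have wF: "jet_bound (set ds) (\<lambda>_. 1) \<mu> (\<lambda>Y. max C C' * weight (set ds) Y) (cut \<eta> ds F)"
    by (rule jet_bound_weaken[OF C(2) mult_right_mono[OF max.cobounded1 weight_nonneg]]) (rule zero_le_one)
  have wG: "jet_bound (set ds) (\<lambda>_. 1) \<mu> (\<lambda>Y. max C C' * weight (set ds) Y) (cut \<eta>' ds G)"
    by (rule jet_bound_weaken[OF C'(2) mult_right_mono[OF max.cobounded2 weight_nonneg]]) (rule zero_le_one)
  have th0: "0 \<le> \<theta> d" for d using th(1)[of d] by simp
  have "0 \<le> max C C'" using C by simp
  from pairing_amp[OF finite_set order_refl ds th0 th(2) smooth_cut[OF F(1) mu(2)] wF smooth_cut[OF G(1) mu(2)] wG mu(1) this]
  show ?thesis unfolding tform_def by simp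
qed

text \<open>With cutoffs the pairing equals \<open>tform\<close> exactly, and
  \<open>tform_tendsto\<close> removes them. The cutoff widths may differ between the factors and
  between variables: rescaling makes the isotropic Gaussian of the Weyl composition
  anisotropic.\<close>

lemma osc_limit:
  fixes F G :: "'i::countable jet"
  assumes ds: "distinct ds" and mu: "\<And>d. d \<in> set ds \<Longrightarrow> 2 \<le> \<mu> d" "\<And>d. \<mu> d \<le> 3"
    and th: "\<And>d. 0 < \<theta> d" "\<And>d. \<theta> d \<le> 1" and M: "0 \<le> M" "0 \<le> M'"
    and F: "smooth \<mu> F" "jet_bound (set ds) (\<lambda>_. 1) \<mu> (\<lambda>_. M) F"
    and G: "smooth \<mu> G" "jet_bound (set ds) (\<lambda>_. 1) \<mu> (\<lambda>_. M') G"
    and e: "\<And>k d. 0 < \<eta> k d" "\<And>k d. \<eta> k d \<le> 1" "\<And>d. (\<lambda>k. \<eta> k d) \<longlonglongrightarrow> 0"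
    and e': "\<And>k d. 0 < \<eta>' k d" "\<And>k d. \<eta>' k d \<le> 1" "\<And>d. (\<lambda>k. \<eta>' k d) \<longlonglongrightarrow> 0"
  shows "(\<lambda>k. pairing (set ds) (\<lambda>Y. of_real (\<Prod>d\<in>set ds. exp (- (\<eta> k d * Y d)\<^sup>2)) * F (\<lambda>_. 0) Y)
     (\<lambda>Z. of_real (\<Prod>d\<in>set ds. exp (- (\<eta>' k d * Z d)\<^sup>2)) * G (\<lambda>_. 0) Z) / of_real (pi ^ card (set ds))) \<longlonglongrightarrow> tform \<theta> ds F G"
proof -
  have ab: "\<bar>\<eta> k d\<bar> \<le> 1" "\<bar>\<eta>' k d\<bar> \<le> 1" for k d using e(1,2)[of k d] e'(1,2)[of k d] by auto
  have "(\<lambda>k. tform \<theta> ds (cut (\<eta> k) ds F) (cut (\<eta>' k) ds G)) \<longlonglongrightarrow> tform \<theta> ds F G"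
    by (rule tform_tendsto[where \<mu>=\<mu> and M="4320 ^ length ds * M" and M'="4320 ^ length ds * M'"])
      (auto intro!: ds mu th F G smooth_cut jet_bound_cut_uniform M ab cut_tendsto[OF _ tendsto_const] e e' mult_nonneg_nonneg)
  moreover have "tform \<theta> ds (cut (\<eta> k) ds F) (cut (\<eta>' k) ds G) =
     pairing (set ds) (\<lambda>Y. of_real (\<Prod>d\<in>set ds. exp (- (\<eta> k d * Y d)\<^sup>2)) * F (\<lambda>_. 0) Y)
     (\<lambda>Z. of_real (\<Prod>d\<in>set ds. exp (- (\<eta>' k d * Z d)\<^sup>2)) * G (\<lambda>_. 0) Z) / of_real (pi ^ card (set ds))" for k
    using tform_cut[where \<eta>="\<eta> k" and \<eta>'="\<eta>' k", OF ds mu th M F G e(1,2) e'(1,2)] unfolding cut_zero_fun[OF ds] .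
  ultimately show ?thesis by simp
qed

lemma osc_eq_tform:
  fixes F G :: "'i::countable jet"
  assumes ds: "distinct ds" and mu: "\<And>d. d \<in> set ds \<Longrightarrow> 2 \<le> \<mu> d" "\<And>d. \<mu> d \<le> 3"
    and th: "\<And>d. 0 < \<theta> d" "\<And>d. \<theta> d \<le> 1" and M: "0 \<le> M" "0 \<le> M'"
    and F: "smooth \<mu> F" "jet_bound (set ds) (\<lambda>_. 1) \<mu> (\<lambda>_. M) F"
    and G: "smooth \<mu> G" "jet_bound (set ds) (\<lambda>_. 1) \<mu> (\<lambda>_. M') G"
  shows "osc (set ds) (F (\<lambda>_. 0)) (G (\<lambda>_. 0)) = tform \<theta> ds F G"
  unfolding osc_def
  by (rule limI, rule osc_limit[OF ds mu th M F G])
    (auto intro!: LIMSEQ_inverse_real_of_nat simp: inverse_le_1_iff simp del: of_nat_Suc)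

definition order_two :: "'i set \<Rightarrow> 'i \<Rightarrow> nat" where
  "order_two D = (\<lambda>i. if i \<in> D then 2 else 0)"

definition nice :: "'i set \<Rightarrow> ('i \<Rightarrow> nat) \<Rightarrow> real \<Rightarrow> 'i jet \<Rightarrow> bool" where
  "nice D \<mu> M A \<longleftrightarrow> 0 \<le> M \<and> smooth \<mu> A \<and> jet_bound D (\<lambda>_. 1) \<mu> (\<lambda>_. M) A"

lemma nice_mono: "nice D \<mu> M A \<Longrightarrow> \<nu> \<le> \<mu> \<Longrightarrow> nice D \<nu> M A"
  unfolding nice_def using smooth_mono jet_bound_mono by blast

lemma niceD: "nice D \<mu> M A \<Longrightarrow> \<kappa> \<le> \<mu> \<Longrightarrow> cmod (A \<kappa> Y) \<le> M"
  unfolding nice_def using jet_boundD by fastforce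

lemma niceI: "0 \<le> M \<Longrightarrow> smooth \<mu> A \<Longrightarrow> (\<And>\<kappa> Y. \<kappa> \<le> \<mu> \<Longrightarrow> cmod (A \<kappa> Y) \<le> M) \<Longrightarrow> nice D \<mu> M A"
  unfolding nice_def jet_bound_def by auto

lemma nice_measurable: "nice D \<mu> M A \<Longrightarrow> \<kappa> \<le> \<mu> \<Longrightarrow> A \<kappa> \<in> borel_measurable borel"
  for A :: "'i::countable jet"
  unfolding nice_def using smooth_measurable by blast

lemma order_two_le_3: "order_two D d \<le> 3"
  by (simp add: order_two_def)

definition gcut :: "'i set \<Rightarrow> ('i \<Rightarrow> real) \<Rightarrow> ('i \<Rightarrow> real) \<Rightarrow> complex" where
  "gcut D \<eta> Y = of_real (\<Prod>d\<in>D. exp (- (\<eta> d * Y d)\<^sup>2))"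

lemma cut_eq_gcut: "distinct ds \<Longrightarrow> cut \<eta> ds A (\<lambda>_. 0) = (\<lambda>Y. gcut (set ds) \<eta> Y * A (\<lambda>_. 0) Y)"
  unfolding cut_zero_fun gcut_def ..

lemma gcut_measurable [measurable]: "gcut D \<eta> \<in> borel_measurable borel"
  for D :: "'i::countable set"
  unfolding gcut_def by measurable

lemma integrable_gcut: "finite D \<Longrightarrow> (\<And>d. 0 < \<eta> d) \<Longrightarrow> integrable (lborel_on D) (gcut D \<eta>)"
proof -
  assume "finite D" "\<And>d. 0 < \<eta> d"
  then have "integrable (lborel_on D) (\<lambda>Y. \<Prod>d\<in>D. exp (- ((\<eta> d)\<^sup>2) * (Y d)\<^sup>2))"
    by (intro integrable_lborel_on_prod integrable_gauss zero_less_power)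
  then have "integrable (lborel_on D) (\<lambda>Y. complex_of_real (\<Prod>d\<in>D. exp (- ((\<eta> d)\<^sup>2) * (Y d)\<^sup>2)))"
    by (rule integrable_of_real)
  then show ?thesis unfolding gcut_def by (simp add: power_mult_distrib)
qed

lemma integrable_gcut_times:
  "finite D \<Longrightarrow> (\<And>d. 0 < \<eta> d) \<Longrightarrow> nice D' \<mu> M A \<Longrightarrow> \<kappa> \<le> \<mu> \<Longrightarrow> integrable (lborel_on D) (\<lambda>Y. gcut D \<eta> Y * A \<kappa> Y)"
  for A :: "'i::countable jet"
  by (intro integrable_times_bounded[where C=M] integrable_gcut)
    (auto simp: measurable_cong_sets[OF sets_lborel_on refl] intro: niceD nice_measurable)

definition harmonic_seq :: "nat \<Rightarrow> 'i \<Rightarrow> real" where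
  "harmonic_seq k = (\<lambda>_. inverse (real (Suc k)))"

lemma harmonic_seq: "0 < harmonic_seq k d" "harmonic_seq k d \<le> 1" "(\<lambda>k. harmonic_seq k d) \<longlonglongrightarrow> 0"
  unfolding harmonic_seq_def using LIMSEQ_inverse_real_of_nat by (auto simp: inverse_le_1_iff)

context
  fixes D :: "'i::countable set"
  assumes D: "finite D"
begin

lemma osc_tendsto:
  assumes F: "nice D (order_two D) M F" and G: "nice D (order_two D) M' G"
    and e: "\<And>k d. 0 < \<eta> k d" "\<And>k d. \<eta> k d \<le> 1" "\<And>d. (\<lambda>k. \<eta> k d) \<longlonglongrightarrow> 0"
    and e': "\<And>k d. 0 < \<eta>' k d" "\<And>k d. \<eta>' k d \<le> 1" "\<And>d. (\<lambda>k. \<eta>' k d) \<longlonglongrightarrow> 0"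
  shows "(\<lambda>k. pairing D (\<lambda>Y. gcut D (\<eta> k) Y * F (\<lambda>_. 0) Y) (\<lambda>Z. gcut D (\<eta>' k) Z * G (\<lambda>_. 0) Z) / of_real (pi ^ card D))
    \<longlonglongrightarrow> osc D (F (\<lambda>_. 0)) (G (\<lambda>_. 0))"
proof -
  obtain ds where ds: "set ds = D" "distinct ds" using finite_distinct_list[OF D] by blast
  show ?thesis
    using osc_limit[OF ds(2), of "order_two D" "\<lambda>_. 1" M M' F G \<eta> \<eta>'] osc_eq_tform[OF ds(2), of "order_two D" "\<lambda>_. 1" M M' F G]
      F G e e' ds order_two_le_3 by (simp add: nice_def gcut_def order_two_def)
qed

text \<open>Pointwise convergence of the derivatives up to order two under a common bound suffices,
  so the lemma applies to difference quotients and to moving scales and base points.\<close>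

lemma osc_continuous:
  assumes F: "\<And>k. nice D (order_two D) M (Fk k)" "nice D (order_two D) M F" "\<And>\<kappa> Y. \<kappa> \<le> order_two D \<Longrightarrow> (\<lambda>k. Fk k \<kappa> Y) \<longlonglongrightarrow> F \<kappa> Y"
    and G: "\<And>k. nice D (order_two D) M' (Gk k)" "nice D (order_two D) M' G" "\<And>\<kappa> Y. \<kappa> \<le> order_two D \<Longrightarrow> (\<lambda>k. Gk k \<kappa> Y) \<longlonglongrightarrow> G \<kappa> Y"
  shows "(\<lambda>k. osc D (Fk k (\<lambda>_. 0)) (Gk k (\<lambda>_. 0))) \<longlonglongrightarrow> osc D (F (\<lambda>_. 0)) (G (\<lambda>_. 0))"
proof -
  obtain ds where ds: "set ds = D" "distinct ds" using finite_distinct_list[OF D] by blast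
  have o: "osc D (F (\<lambda>_. 0)) (G (\<lambda>_. 0)) = tform (\<lambda>_. 1) ds F G"
    if "nice D (order_two D) M F" "nice D (order_two D) M' G" for F G
    using osc_eq_tform[OF ds(2), of "order_two D" "\<lambda>_. 1" M M' F G] that ds order_two_le_3 by (simp add: nice_def order_two_def)
  show ?thesis unfolding o[OF F(1) G(1)] o[OF F(2) G(2)]
    using F G ds by (intro tform_tendsto[where \<mu>="order_two D" and M=M and M'=M']) (auto simp: nice_def order_two_def)
qed

lemma osc_commute:
  assumes F: "nice D (order_two D) M F" and G: "nice D (order_two D) M' G"
  shows "osc D (F (\<lambda>_. 0)) (G (\<lambda>_. 0)) = osc D (G (\<lambda>_. 0)) (F (\<lambda>_. 0))"
proof (rule LIMSEQ_unique)
  note h = harmonic_seq(1) harmonic_seq(2) harmonic_seq(3)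
  show "(\<lambda>k. pairing D (\<lambda>Y. gcut D (harmonic_seq k) Y * F (\<lambda>_. 0) Y) (\<lambda>Z. gcut D (harmonic_seq k) Z * G (\<lambda>_. 0) Z) / of_real (pi ^ card D))
    \<longlonglongrightarrow> osc D (F (\<lambda>_. 0)) (G (\<lambda>_. 0))"
    by (rule osc_tendsto[OF F G h h])
  show "(\<lambda>k. pairing D (\<lambda>Y. gcut D (harmonic_seq k) Y * F (\<lambda>_. 0) Y) (\<lambda>Z. gcut D (harmonic_seq k) Z * G (\<lambda>_. 0) Z) / of_real (pi ^ card D))
    \<longlonglongrightarrow> osc D (G (\<lambda>_. 0)) (F (\<lambda>_. 0))"
    using osc_tendsto[OF G F h h] F G
    by (subst pairing_commute[OF D]) (auto intro: integrable_gcut_times[OF D harmonic_seq(1)] simp: le_zero_fun)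
qed

lemma smooth_add_scale:
  assumes "smooth \<mu> F" "smooth \<mu> G"
  shows "smooth \<mu> (\<lambda>\<kappa> Y. a * F \<kappa> Y + b * G \<kappa> Y)"
  using assms unfolding smooth_def
  by (auto intro!: continuous_intros has_vector_derivative_add has_vector_derivative_mult_right)

lemma nice_add_scale:
  assumes "nice D' \<mu> M F" "nice D' \<mu> M' G"
  shows "nice D' \<mu> (cmod a * M + cmod b * M') (\<lambda>\<kappa> Y. a * F \<kappa> Y + b * G \<kappa> Y)"
proof (rule niceI)
  show "0 \<le> cmod a * M + cmod b * M'" using assms by (auto simp: nice_def)
  show "smooth \<mu> (\<lambda>\<kappa> Y. a * F \<kappa> Y + b * G \<kappa> Y)" using assms by (auto simp: nice_def intro: smooth_add_scale)
  fix \<kappa> Y assume "\<kappa> \<le> \<mu>"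
  then show "cmod (a * F \<kappa> Y + b * G \<kappa> Y) \<le> cmod a * M + cmod b * M'"
    using niceD[OF assms(1)] niceD[OF assms(2)]
    by (intro norm_triangle_le add_mono) (auto simp: norm_mult intro!: mult_left_mono)
qed

lemma osc_linear:
  assumes F: "nice D (order_two D) M1 F1" "nice D (order_two D) M2 F2" and G: "nice D (order_two D) M' G"
  shows "osc D (\<lambda>Y. a * F1 (\<lambda>_. 0) Y + b * F2 (\<lambda>_. 0) Y) (G (\<lambda>_. 0)) =
    a * osc D (F1 (\<lambda>_. 0)) (G (\<lambda>_. 0)) + b * osc D (F2 (\<lambda>_. 0)) (G (\<lambda>_. 0))"
proof (rule LIMSEQ_unique)
  note h = harmonic_seq(1) harmonic_seq(2) harmonic_seq(3)
  let ?P = "\<lambda>k H. pairing D (\<lambda>Y. gcut D (harmonic_seq k) Y * H Y) (\<lambda>Z. gcut D (harmonic_seq k) Z * G (\<lambda>_. 0) Z)"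
  show "(\<lambda>k. ?P k (\<lambda>Y. a * F1 (\<lambda>_. 0) Y + b * F2 (\<lambda>_. 0) Y) / of_real (pi ^ card D)) \<longlonglongrightarrow> osc D (\<lambda>Y. a * F1 (\<lambda>_. 0) Y + b * F2 (\<lambda>_. 0) Y) (G (\<lambda>_. 0))"
    by (rule osc_tendsto[OF nice_add_scale[OF F] G h h])
  have "?P k (\<lambda>Y. a * F1 (\<lambda>_. 0) Y + b * F2 (\<lambda>_. 0) Y) = a * ?P k (F1 (\<lambda>_. 0)) + b * ?P k (F2 (\<lambda>_. 0))" for k
  proof -
    let ?f = "ft D (\<lambda>Z. gcut D (harmonic_seq k) Z * G (\<lambda>_. 0) Z)"
    have g: "integrable (lborel_on D) (\<lambda>Z. gcut D (harmonic_seq k) Z * G (\<lambda>_. 0) Z)"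
      by (rule integrable_gcut_times[OF D harmonic_seq(1) G le_zero_fun])
    have "?f \<in> borel_measurable borel"
      using borel_measurable_integrable[OF g] by (intro ft_measurable[OF D]) simp
    then have i: "integrable (lborel_on D) (\<lambda>Y. gcut D (harmonic_seq k) Y * F (\<lambda>_. 0) Y * ?f Y)" if "nice D (order_two D) M F" for F M
      by (intro integrable_times_bounded[OF _ _ norm_ft_le] integrable_gcut_times[OF D harmonic_seq(1) that le_zero_fun])
        (simp add: measurable_cong_sets[OF sets_lborel_on refl])
    have "?P k (\<lambda>Y. a * F1 (\<lambda>_. 0) Y + b * F2 (\<lambda>_. 0) Y) = (\<integral>Y. a * (gcut D (harmonic_seq k) Y * F1 (\<lambda>_. 0) Y * ?f Y) + b * (gcut D (harmonic_seq k) Y * F2 (\<lambda>_. 0) Y * ?f Y) \<partial>lborel_on D)"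
      unfolding pairing_def by (simp add: algebra_simps)
    also have "\<dots> = a * ?P k (F1 (\<lambda>_. 0)) + b * ?P k (F2 (\<lambda>_. 0))"
      unfolding pairing_def by (simp add: i[OF F(1)] i[OF F(2)])
    finally show ?thesis .
  qed
  then show "(\<lambda>k. ?P k (\<lambda>Y. a * F1 (\<lambda>_. 0) Y + b * F2 (\<lambda>_. 0) Y) / of_real (pi ^ card D)) \<longlonglongrightarrow>
     a * osc D (F1 (\<lambda>_. 0)) (G (\<lambda>_. 0)) + b * osc D (F2 (\<lambda>_. 0)) (G (\<lambda>_. 0))"
    using tendsto_add[OF tendsto_mult_left[OF osc_tendsto[OF F(1) G h h], of a] tendsto_mult_left[OF osc_tendsto[OF F(2) G h h], of b]]
    by (simp add: add_divide_distrib)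
qed

lemma osc_bound:
  assumes F: "nice D (order_two D) M F" and G: "smooth (order_two D) G" "jet_bound D s (order_two D) (\<lambda>_. M') G"
    and s: "\<And>d. 0 \<le> s d" and M': "0 \<le> M'"
  shows "cmod (osc D (F (\<lambda>_. 0)) (G (\<lambda>_. 0))) \<le> M * M' * (\<Prod>d\<in>D. C0 * max 1 (sqrt (s d)))"
proof -
  obtain ds where ds: "set ds = D" "distinct ds" using finite_distinct_list[OF D] by blast
  \<comment> \<open>The smallest r \<ge> 1 for which \<theta> = r^(-4) satisfies \<theta> s^2 \<le>
    1.\<close>
  define r where "r d = max 1 (sqrt (s d))" for d
  define \<theta> where "\<theta> d = inverse (r d ^ 4)" for d
  have r: "1 \<le> r d" for d by (simp add: r_def)
  have ths: "\<theta> d * (s d)\<^sup>2 \<le> 1" for d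
  proof -
    have "s d = (sqrt (s d))\<^sup>2" using s by simp
    also have "\<dots> \<le> (r d)\<^sup>2" by (intro power_mono) (auto simp: r_def s)
    finally have "(s d)\<^sup>2 \<le> ((r d)\<^sup>2)\<^sup>2" using s by (intro power_mono) auto
    then have "(s d)\<^sup>2 \<le> r d ^ 4" by (simp flip: power_mult)
    moreover have "0 < r d ^ 4" using r[of d] by (intro zero_less_power) linarith
    ultimately show ?thesis unfolding \<theta>_def by (simp add: field_simps)
  qed
  have th: "0 < \<theta> d" "\<theta> d \<le> 1" for d
  proof -
    have "1 \<le> r d ^ 4" using r by (simp add: one_le_power)
    then show "0 < \<theta> d" "\<theta> d \<le> 1" unfolding \<theta>_def by (auto simp: inverse_le_1_iff)
  qed
  \<comment> \<open>A crude bound without the factors \<open>s d\<close>, enough to identify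
    \<open>osc\<close> with \<open>tform\<close>; the estimate itself then uses the bound with these
    factors.\<close>
  define M'' where "M'' = M' * (\<Prod>d\<in>D. max 1 (s d) ^ 2)"
  have M'': "0 \<le> M''" unfolding M''_def using M' by (intro mult_nonneg_nonneg prod_nonneg) auto
  have G': "jet_bound D (\<lambda>_. 1) (order_two D) (\<lambda>_. M'') G"
    unfolding jet_bound_def
  proof (intro allI impI)
    fix \<kappa> Y assume k: "\<kappa> \<le> order_two D"
    have "(\<Prod>d\<in>D. s d ^ \<kappa> d) \<le> (\<Prod>d\<in>D. max 1 (s d) ^ 2)"
    proof (intro prod_mono conjI)
      fix d assume "d \<in> D"
      then have "\<kappa> d \<le> 2" using k by (metis le_fun_def order_two_def)
      then have "max 1 (s d) ^ \<kappa> d \<le> max 1 (s d) ^ 2" by (intro power_increasing) auto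
      moreover have "s d ^ \<kappa> d \<le> max 1 (s d) ^ \<kappa> d" using s by (intro power_mono) auto
      ultimately show "s d ^ \<kappa> d \<le> max 1 (s d) ^ 2" by linarith
    qed (auto simp: s)
    then have "M' * (\<Prod>d\<in>D. s d ^ \<kappa> d) \<le> M''" unfolding M''_def using M' by (rule mult_left_mono)
    then show "cmod (G \<kappa> Y) \<le> M'' * (\<Prod>d\<in>D. 1 ^ \<kappa> d)" using jet_boundD[OF G(2) k, of Y] by simp
  qed
  have "osc D (F (\<lambda>_. 0)) (G (\<lambda>_. 0)) = tform \<theta> ds F G"
    using osc_eq_tform[OF ds(2), of "order_two D" \<theta> M M'' F G] F G(1) G' ds th M'' order_two_le_3 by (simp add: nice_def order_two_def)
  also have "cmod \<dots> \<le> M * M' * (\<Prod>d\<in>set ds. C0 * r d)"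
    using F G ds M' by (intro tform_bound[where \<mu>="order_two D" and s=s]) (auto simp: nice_def order_two_def \<theta>_def r ths[unfolded \<theta>_def] s)
  finally show ?thesis unfolding ds r_def .
qed

end

section \<open>Differentiated jets and affine substitutions\<close>

definition shift :: "'i \<Rightarrow> 'i jet \<Rightarrow> 'i jet" where
  "shift d A = (\<lambda>\<kappa>. A (\<kappa>(d := Suc (\<kappa> d))))"

lemma shift_le:
  assumes "\<kappa> \<le> \<nu>" "\<nu>(d := Suc (\<nu> d)) \<le> (\<mu> :: 'i \<Rightarrow> nat)"
  shows "\<kappa>(d := Suc (\<kappa> d)) \<le> \<mu>"
proof -
  have "\<kappa>(d := Suc (\<kappa> d)) \<le> \<nu>(d := Suc (\<nu> d))" using assms(1) by (auto simp: le_fun_def)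
  then show ?thesis using assms(2) by order
qed

lemma smooth_shift:
  assumes A: "smooth \<mu> A" and n: "\<nu>(d := Suc (\<nu> d)) \<le> \<mu>"
  shows "smooth \<nu> (shift d A)"
  unfolding smooth_def
proof (intro conjI allI impI)
  fix \<kappa> assume k: "\<kappa> \<le> \<nu>"
  note l = shift_le[OF k n]
  show "continuous_on UNIV (shift d A \<kappa>)" unfolding shift_def by (rule smoothD[OF A l])
  fix e Y assume e: "\<kappa> e < \<nu> e"
  have "(\<kappa>(d := Suc (\<kappa> d))) e < \<mu> e"
  proof -
    have "(\<nu>(d := Suc (\<nu> d))) e \<le> \<mu> e" using n by (simp add: le_fun_def)
    then show ?thesis using e by (cases "e = d") auto
  qed
  note lt = this
  have eq: "\<kappa>(e := Suc (\<kappa> e), d := Suc ((\<kappa>(e := Suc (\<kappa> e))) d)) = \<kappa>(d := Suc (\<kappa> d), e := Suc ((\<kappa>(d := Suc (\<kappa> d))) e))"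
    by (auto simp: fun_eq_iff)
  show "((\<lambda>t. shift d A \<kappa> (Y(e := t))) has_vector_derivative shift d A (\<kappa>(e := Suc (\<kappa> e))) Y) (at (Y e))"
    unfolding shift_def eq by (rule smoothD(2)[OF A l lt])
qed

lemma prod_Suc_upd:
  fixes s :: "'i \<Rightarrow> real"
  assumes "finite D" "d \<in> D"
  shows "(\<Prod>e\<in>D. s e ^ (\<kappa>(d := Suc (\<kappa> d))) e) = s d * (\<Prod>e\<in>D. s e ^ \<kappa> e)"
proof -
  have "(\<Prod>e\<in>D. s e ^ (\<kappa>(d := Suc (\<kappa> d))) e) = s d ^ Suc (\<kappa> d) * (\<Prod>e\<in>D-{d}. s e ^ \<kappa> e)"
    using assms by (subst prod.remove[of _ d]) auto
  also have "\<dots> = s d * (\<Prod>e\<in>D. s e ^ \<kappa> e)" using assms by (subst (2) prod.remove[of _ d]) auto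
  finally show ?thesis .
qed

lemma jet_bound_shift:
  assumes A: "jet_bound D s \<mu> (\<lambda>_. M) A" and n: "\<nu>(d := Suc (\<nu> d)) \<le> \<mu>" and D: "finite D" "d \<in> D"
  shows "jet_bound D s \<nu> (\<lambda>_. M * s d) (shift d A)"
  unfolding jet_bound_def
proof (intro allI impI)
  fix \<kappa> Y assume k: "\<kappa> \<le> \<nu>"
  show "cmod (shift d A \<kappa> Y) \<le> M * s d * (\<Prod>d\<in>D. s d ^ \<kappa> d)"
    using jet_boundD[OF A shift_le[OF k n], of Y] unfolding shift_def prod_Suc_upd[OF D] by (simp add: mult.assoc)
qed

lemma nice_shift:
  assumes "nice D \<mu> M A" "\<nu>(d := Suc (\<nu> d)) \<le> \<mu>"
  shows "nice D' \<nu> M (shift d A)"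
  using assms smooth_shift[of \<mu> A \<nu> d] niceD[OF assms(1) shift_le[OF _ assms(2)]]
  by (intro niceI) (auto simp: nice_def shift_def)

text \<open>The jet of Y \<mapsto> A (b + s Y), with the chain rule built into the leading product.
  Scales may be negative, and \<open>s i = 0\<close> freezes coordinate \<open>i\<close> at
  \<open>b i\<close>.\<close>

definition rescale :: "'i set \<Rightarrow> ('i \<Rightarrow> real) \<Rightarrow> ('i \<Rightarrow> real) \<Rightarrow> 'i jet \<Rightarrow> 'i jet" where
  "rescale D b s A = (\<lambda>\<kappa> Y. of_real (\<Prod>i\<in>D. s i ^ \<kappa> i) * A \<kappa> (\<lambda>i. b i + s i * Y i))"

text \<open>The chain-rule product runs over \<open>D\<close>, so differentiations have to stay
  inside \<open>D\<close>: this is why the orders vanish elsewhere.\<close>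

lemma smooth_rescale:
  assumes A: "smooth \<mu> A" and D: "finite D" "\<And>i. i \<notin> D \<Longrightarrow> \<mu> i = 0"
  shows "smooth \<mu> (rescale D b s A)"
  unfolding smooth_def
proof (intro conjI allI impI)
  fix \<kappa> assume k: "\<kappa> \<le> \<mu>"
  show "continuous_on UNIV (rescale D b s A \<kappa>)" unfolding rescale_def
    by (intro continuous_intros continuous_on_compose2[OF smoothD(1)[OF A k]] continuous_on_coordinatewise_then_product continuous_on_product_coordinates) auto
  fix e Y assume e: "\<kappa> e < \<mu> e"
  then have eD: "e \<in> D" using D(2)[of e] by (cases "e \<in> D") auto
  let ?B = "\<lambda>i. b i + s i * Y i"
  have "((\<lambda>t. A \<kappa> (?B(e := t))) has_vector_derivative A (\<kappa>(e := Suc (\<kappa> e))) ?B) (at (b e + s e * Y e))"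
    using smoothD(2)[OF A k e, of ?B] by simp
  then have "((\<lambda>t. A \<kappa> (?B(e := t))) \<circ> (\<lambda>t. b e + s e * t) has_vector_derivative s e *\<^sub>R A (\<kappa>(e := Suc (\<kappa> e))) ?B) (at (Y e))"
    by (intro vector_diff_chain_at) (auto simp flip: has_real_derivative_iff_has_vector_derivative intro!: derivative_eq_intros)
  moreover have "(\<lambda>i. b i + s i * (Y(e := t)) i) = ?B(e := b e + s e * t)" for t by auto
  ultimately have "((\<lambda>t. A \<kappa> (\<lambda>i. b i + s i * (Y(e := t)) i)) has_vector_derivative of_real (s e) * A (\<kappa>(e := Suc (\<kappa> e))) ?B) (at (Y e))"
    by (simp add: o_def scaleR_conv_of_real)
  from has_vector_derivative_mult_right[OF this, of "of_real (\<Prod>i\<in>D. s i ^ \<kappa> i)"]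
  show "((\<lambda>t. rescale D b s A \<kappa> (Y(e := t))) has_vector_derivative rescale D b s A (\<kappa>(e := Suc (\<kappa> e))) Y) (at (Y e))"
    unfolding rescale_def prod_Suc_upd[OF D(1) eD] by (simp add: mult_ac)
qed

lemma jet_bound_rescale:
  assumes A: "jet_bound D w \<mu> (\<lambda>_. M) A"
  shows "jet_bound D (\<lambda>d. \<bar>s d\<bar> * w d) \<mu> (\<lambda>_. M) (rescale D b s A)"
  unfolding jet_bound_def
proof (intro allI impI)
  fix \<kappa> Y assume k: "\<kappa> \<le> \<mu>"
  have "cmod (rescale D b s A \<kappa> Y) = (\<Prod>i\<in>D. \<bar>s i\<bar> ^ \<kappa> i) * cmod (A \<kappa> (\<lambda>i. b i + s i * Y i))"
    by (simp add: rescale_def norm_mult abs_prod power_abs del: of_real_prod)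
  also have "\<dots> \<le> (\<Prod>i\<in>D. \<bar>s i\<bar> ^ \<kappa> i) * (M * (\<Prod>d\<in>D. w d ^ \<kappa> d))"
    using jet_boundD[OF A k] by (intro mult_left_mono prod_nonneg) auto
  also have "\<dots> = M * (\<Prod>d\<in>D. (\<bar>s d\<bar> * w d) ^ \<kappa> d)" by (simp add: power_mult_distrib prod.distrib)
  finally show "cmod (rescale D b s A \<kappa> Y) \<le> M * (\<Prod>d\<in>D. (\<bar>s d\<bar> * w d) ^ \<kappa> d)" .
qed

lemma tendsto_coordinatewise:
  fixes f :: "'a \<Rightarrow> 'i \<Rightarrow> 'b::topological_space"
  assumes "\<And>i. ((\<lambda>x. f x i) \<longlongrightarrow> l i) F"
  shows "(f \<longlongrightarrow> l) F"
proof -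
  have "limitin (product_topology (\<lambda>_. euclidean) UNIV) f l F"
    using assms by (simp add: limitin_componentwise)
  then show ?thesis by (simp add: euclidean_product_topology)
qed

lemma rescale_tendsto:
  fixes A :: "'i::countable jet"
  assumes A: "smooth \<mu> A" "\<kappa> \<le> \<mu>" and b: "\<And>i. (\<lambda>k. bk k i) \<longlonglongrightarrow> b i" and s: "\<And>i. (\<lambda>k. sk k i) \<longlonglongrightarrow> s i"
  shows "(\<lambda>k. rescale D (bk k) (sk k) A \<kappa> Y) \<longlonglongrightarrow> rescale D b s A \<kappa> Y"
  unfolding rescale_def
proof (intro tendsto_intros s)
  have "isCont (A \<kappa>) (\<lambda>i. b i + s i * Y i)"
    using smoothD(1)[OF A] by (simp add: continuous_on_eq_continuous_at)
  moreover have "(\<lambda>k i. bk k i + sk k i * Y i) \<longlonglongrightarrow> (\<lambda>i. b i + s i * Y i)"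
    by (intro tendsto_coordinatewise tendsto_intros b s)
  ultimately show "(\<lambda>k. A \<kappa> (\<lambda>i. bk k i + sk k i * Y i)) \<longlonglongrightarrow> A \<kappa> (\<lambda>i. b i + s i * Y i)"
    by (rule isCont_tendsto_compose)
qed

lemma shift_rescale:
  assumes "finite D" "d \<in> D"
  shows "shift d (rescale D b s A) = (\<lambda>\<kappa> Y. of_real (s d) * rescale D b s (shift d A) \<kappa> Y)"
  unfolding shift_def rescale_def prod_Suc_upd[OF assms] by (simp add: mult.assoc)

section \<open>Dependence of the oscillatory integral on scales and base points\<close>

lemma has_vector_derivative_iff_quotient:
  fixes f :: "real \<Rightarrow> complex"
  shows "(f has_vector_derivative v) (at x) \<longleftrightarrow> ((\<lambda>h. (f (x + h) - f x) / of_real h) \<longlongrightarrow> v) (at 0)"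
proof -
  have "(f has_vector_derivative v) (at x) \<longleftrightarrow> ((\<lambda>h. norm (f (x + h) - f x - h *\<^sub>R v) / norm h) \<longlongrightarrow> 0) (at 0)"
    unfolding has_vector_derivative_def has_derivative_at by (simp add: bounded_linear_scaleR_left)
  also have "\<dots> \<longleftrightarrow> ((\<lambda>h. norm ((f (x + h) - f x) / of_real h - v)) \<longlongrightarrow> 0) (at 0)"
  proof (rule tendsto_cong)
    have "norm (f (x + h) - f x - h *\<^sub>R v) / norm h = norm ((f (x + h) - f x) / of_real h - v)" if "h \<noteq> 0" for h
    proof -
      have "(f (x + h) - f x) / of_real h - v = (f (x + h) - f x - h *\<^sub>R v) / of_real h"
        using that by (simp add: scaleR_conv_of_real field_simps)
      then show ?thesis by (simp add: norm_divide)
    qed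
    then show "\<forall>\<^sub>F h in at 0. norm (f (x + h) - f x - h *\<^sub>R v) / norm h = norm ((f (x + h) - f x) / of_real h - v)"
      by (auto simp: eventually_at_filter)
  qed
  also have "\<dots> \<longleftrightarrow> ((\<lambda>h. (f (x + h) - f x) / of_real h) \<longlongrightarrow> v) (at 0)"
    by (simp add: tendsto_norm_zero_iff LIM_zero_iff)
  finally show ?thesis .
qed

text \<open>In this form, dominated convergence and \<open>osc_continuous\<close>, which speak of
  sequences, apply to difference quotients directly.\<close>

lemma has_vector_derivative_sequentially:
  fixes f :: "real \<Rightarrow> complex"
  shows "(f has_vector_derivative v) (at x) \<longleftrightarrow>
    (\<forall>h. (\<forall>k::nat. h k \<noteq> 0) \<longrightarrow> h \<longlonglongrightarrow> 0 \<longrightarrow> (\<lambda>k. (f (x + h k) - f x) / of_real (h k)) \<longlonglongrightarrow> v)"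
  unfolding has_vector_derivative_iff_quotient tendsto_at_iff_sequentially by (simp add: o_def)

lemma mean_value_bound:
  fixes f :: "real \<Rightarrow> complex"
  assumes "\<And>r. (f has_vector_derivative f' r) (at r)" "\<And>r. cmod (f' r) \<le> B"
  shows "cmod (f b - f a) \<le> B * \<bar>b - a\<bar>"
proof -
  have "norm (f b - f a) \<le> B * norm (b - a)"
  proof (rule differentiable_bound[of UNIV f "\<lambda>r h. h *\<^sub>R f' r"])
    show "(f has_derivative (\<lambda>h. h *\<^sub>R f' r)) (at r within UNIV)" for r
      using assms(1) by (simp add: has_vector_derivative_def)
    show "onorm (\<lambda>h. h *\<^sub>R f' r) \<le> B" for r
      by (rule onorm_le) (simp only: norm_scaleR mult.commute[of B] real_norm_def mult_left_mono[OF assms(2)] abs_ge_zero)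
  qed auto
  then show ?thesis by simp
qed

lemma has_vector_derivative_integral:
  fixes f f' :: "real \<Rightarrow> 'a \<Rightarrow> complex"
  assumes f: "\<And>r. integrable M (f r)" "\<And>r. f' r \<in> borel_measurable M"
    and d: "\<And>r x. ((\<lambda>r. f r x) has_vector_derivative f' r x) (at r)"
    and b: "\<And>r x. cmod (f' r x) \<le> g x" and g: "integrable M g"
  shows "((\<lambda>r. \<integral>x. f r x \<partial>M) has_vector_derivative (\<integral>x. f' r x \<partial>M)) (at r)"
  unfolding has_vector_derivative_sequentially
proof (intro allI impI)
  fix h :: "nat \<Rightarrow> real" assume h: "\<forall>k. h k \<noteq> 0" "h \<longlonglongrightarrow> 0"
  have lim: "(\<lambda>k. \<integral>x. (f (r + h k) x - f r x) / of_real (h k) \<partial>M) \<longlonglongrightarrow> (\<integral>x. f' r x \<partial>M)"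
  proof (rule integral_dominated_convergence[where w=g])
    show "AE x in M. (\<lambda>k. (f (r + h k) x - f r x) / of_real (h k)) \<longlonglongrightarrow> f' r x"
      using d h unfolding has_vector_derivative_sequentially by auto
    show "AE x in M. cmod ((f (r + h k) x - f r x) / of_real (h k)) \<le> g x" for k
    proof (rule AE_I2)
      fix x
      have "cmod (f (r + h k) x - f r x) \<le> g x * \<bar>r + h k - r\<bar>"
        by (rule mean_value_bound[OF d b])
      then show "cmod ((f (r + h k) x - f r x) / of_real (h k)) \<le> g x"
        using h by (simp add: norm_divide divide_le_eq)
    qed
    show "(\<lambda>x. (f (r + h k) x - f r x) / of_real (h k)) \<in> borel_measurable M" for k
      using borel_measurable_integrable[OF f(1)] by measurable
  qed (use f(2) g in auto)
  have e: "(\<integral>x. (f (r + h k) x - f r x) / of_real (h k) \<partial>M) = ((\<integral>x. f (r + h k) x \<partial>M) - (\<integral>x. f r x \<partial>M)) / of_real (h k)" for k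
    using f(1) by simp
  show "(\<lambda>k. ((\<integral>x. f (r + h k) x \<partial>M) - (\<integral>x. f r x \<partial>M)) / of_real (h k)) \<longlonglongrightarrow> (\<integral>x. f' r x \<partial>M)"
    using lim unfolding e .
qed

text \<open>The function space carries no norm, so the chain rule cannot pass through a Frechet
  derivative in \<open>Y\<close>. The induction splits off one direction: in \<open>P x y\<close>
  the directions of \<open>S\<close> move with x and \<open>d\<close> moves with y. A function of
  two real variables with both partial derivatives, one of them continuous, is differentiable, and
  restriction to the diagonal gives the sum.\<close>

lemma has_vector_derivative_line:
  fixes f :: "('i \<Rightarrow> real) \<Rightarrow> complex"
  assumes "finite S" and cont: "\<And>d. d \<in> S \<Longrightarrow> continuous_on UNIV (f' d)"
    and der: "\<And>d Y. d \<in> S \<Longrightarrow> ((\<lambda>t. f (Y(d := t))) has_vector_derivative f' d Y) (at (Y d))"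
    and v: "\<And>i. i \<notin> S \<Longrightarrow> v i = 0"
  shows "((\<lambda>r. f (\<lambda>i. u i + r * v i)) has_vector_derivative (\<Sum>d\<in>S. of_real (v d) * f' d (\<lambda>i. u i + r * v i))) (at r)"
  using assms
proof (induction S arbitrary: u v r rule: finite_induct)
  case empty
  then show ?case by simp
next
  case (insert d S)
  define v' where "v' = v(d := 0)"
  define P where "P = (\<lambda>x y. (\<lambda>i. u i + x * v' i)(d := u d + y * v d))"
  define G where "G = (\<lambda>x y. of_real (v d) * f' d (P x y))"
  have Pd: "P x x = (\<lambda>i. u i + x * v i)" for x by (auto simp: P_def v'_def)
  have fx: "((\<lambda>x. f (P x y)) has_vector_derivative (\<Sum>e\<in>S. of_real (v' e) * f' e (P x y))) (at x)" for x y
  proof -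
    have e: "P x y = (\<lambda>i. (u(d := u d + y * v d)) i + x * v' i)" for x by (auto simp: P_def v'_def)
    show ?thesis unfolding e by (rule insert.IH) (use insert in \<open>auto simp: v'_def\<close>)
  qed
  have fy: "((\<lambda>y. f (P x y)) has_vector_derivative G x y) (at y)" for x y
  proof -
    have Py: "P x y d = u d + y * v d" by (simp add: P_def)
    have "((\<lambda>t. f ((P x y)(d := t))) has_vector_derivative f' d (P x y)) (at (u d + y * v d))"
      unfolding Py[symmetric] by (rule insert.prems(2)) simp
    then have "((\<lambda>t. f ((P x y)(d := t))) \<circ> (\<lambda>y. u d + y * v d) has_vector_derivative v d *\<^sub>R f' d (P x y)) (at y)"
      by (intro vector_diff_chain_at) (auto simp flip: has_real_derivative_iff_has_vector_derivative intro!: derivative_eq_intros)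
    moreover have "(P x y)(d := u d + t * v d) = P x t" for t by (simp add: P_def)
    ultimately show ?thesis by (simp add: o_def G_def scaleR_conv_of_real)
  qed
  have cP: "continuous_on UNIV (\<lambda>(x, y). P x y)"
    unfolding P_def case_prod_beta
    by (intro continuous_on_fun_upd continuous_on_coordinatewise_then_product) (auto intro!: continuous_intros)
  have "((\<lambda>(x, y). f (P x y)) has_derivative (\<lambda>(tx, ty). tx *\<^sub>R (\<Sum>e\<in>S. of_real (v' e) * f' e (P r r)) + blinfun_apply (blinfun_scaleR_left (G r r)) ty)) (at (r, r) within UNIV \<times> UNIV)"
  proof (rule has_derivative_partialsI[where fy="\<lambda>x y. blinfun_scaleR_left (G x y)"])
    show "((\<lambda>x. f (P x r)) has_derivative (\<lambda>tx. tx *\<^sub>R (\<Sum>e\<in>S. of_real (v' e) * f' e (P r r)))) (at r)"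
      using fx by (simp add: has_vector_derivative_def)
    show "((\<lambda>y. f (P x y)) has_derivative blinfun_apply (blinfun_scaleR_left (G x y))) (at y)" for x y
      using fy by (simp add: has_vector_derivative_def)
    have "continuous_on UNIV (\<lambda>(x, y). G x y)"
      unfolding G_def case_prod_beta
      by (intro continuous_intros continuous_on_compose2[OF insert.prems(1)[of d]] cP[unfolded case_prod_beta]) auto
    then have "continuous_on UNIV (\<lambda>(x, y). blinfun_scaleR_left (G x y))"
      unfolding case_prod_beta by (rule bounded_linear.continuous_on[OF bounded_linear_blinfun_scaleR_left])
    then show "continuous (at (r, r) within UNIV \<times> UNIV) (\<lambda>(x, y). blinfun_scaleR_left (G x y))"
      by (simp add: continuous_on_eq_continuous_within)
  qed auto
  then have "((\<lambda>(x, y). f (P x y)) has_derivative (\<lambda>(tx, ty). tx *\<^sub>R (\<Sum>e\<in>S. of_real (v' e) * f' e (P r r)) + ty *\<^sub>R G r r)) (at (r, r))"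
    by simp
  moreover have "((\<lambda>r::real. (r, r)) has_derivative (\<lambda>h. (h, h))) (at r)"
    by (intro has_derivative_Pair has_derivative_ident)
  ultimately have "((\<lambda>x. (\<lambda>(x, y). f (P x y)) (x, x)) has_derivative (\<lambda>h. (\<lambda>(tx, ty). tx *\<^sub>R (\<Sum>e\<in>S. of_real (v' e) * f' e (P r r)) + ty *\<^sub>R G r r) (h, h))) (at r)"
    by (rule has_derivative_compose[rotated])
  then
  have "((\<lambda>r. f (P r r)) has_derivative (\<lambda>h. h *\<^sub>R (\<Sum>e\<in>S. of_real (v' e) * f' e (P r r)) + h *\<^sub>R G r r)) (at r)"
    by simp
  moreover have "(\<Sum>e\<in>S. of_real (v' e) * f' e (P r r)) = (\<Sum>e\<in>S. of_real (v e) * f' e (P r r))"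
    using insert.hyps by (intro sum.cong) (auto simp: v'_def)
  ultimately show ?case
    using insert.hyps unfolding Pd G_def has_vector_derivative_def by (simp add: scaleR_add_right add_ac)
qed

section \<open>Derivative of the oscillatory integral in the scales\<close>

lemma nice_rescale:
  assumes A: "nice D \<mu> M A" and D: "finite D" "\<And>i. i \<notin> D \<Longrightarrow> \<mu> i = 0" and s: "\<And>i. \<bar>s i\<bar> \<le> S i"
  shows "nice D \<mu> (M * (\<Prod>i\<in>D. max 1 (S i) ^ \<mu> i)) (rescale D b s A)"
proof (rule niceI)
  show "0 \<le> M * (\<Prod>i\<in>D. max 1 (S i) ^ \<mu> i)" using A by (auto simp: nice_def intro!: mult_nonneg_nonneg prod_nonneg)
  show "smooth \<mu> (rescale D b s A)" using A D by (auto simp: nice_def intro!: smooth_rescale)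
  fix \<kappa> Y assume k: "\<kappa> \<le> \<mu>"
  have "(\<Prod>i\<in>D. \<bar>s i\<bar> ^ \<kappa> i) \<le> (\<Prod>i\<in>D. max 1 (S i) ^ \<mu> i)"
  proof (intro prod_mono conjI)
    fix i assume "i \<in> D"
    have "\<bar>s i\<bar> ^ \<kappa> i \<le> max 1 (S i) ^ \<kappa> i" using s[of i] by (intro power_mono) auto
    also have "\<dots> \<le> max 1 (S i) ^ \<mu> i" using k by (intro power_increasing) (auto simp: le_fun_def)
    finally show "\<bar>s i\<bar> ^ \<kappa> i \<le> max 1 (S i) ^ \<mu> i" .
  qed auto
  then have "(\<Prod>i\<in>D. \<bar>s i\<bar> ^ \<kappa> i) * cmod (A \<kappa> (\<lambda>i. b i + s i * Y i)) \<le> (\<Prod>i\<in>D. max 1 (S i) ^ \<mu> i) * M"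
    using niceD[OF A k] by (intro mult_mono prod_nonneg) auto
  then show "cmod (rescale D b s A \<kappa> Y) \<le> M * (\<Prod>i\<in>D. max 1 (S i) ^ \<mu> i)"
    by (simp add: rescale_def norm_mult abs_prod power_abs mult.commute del: of_real_prod)
qed

lemma order_two_off: "i \<notin> D \<Longrightarrow> order_two D i = 0"
  by (simp add: order_two_def)

lemma rescale_zero: "rescale D b s A (\<lambda>_. 0) Y = A (\<lambda>_. 0) (\<lambda>i. b i + s i * Y i)"
  by (simp add: rescale_def)

lemma order_two_le: "(\<And>d. d \<in> D \<Longrightarrow> 2 \<le> \<mu> d) \<Longrightarrow> order_two D \<le> \<mu>"
  by (simp add: order_two_def le_fun_def)

lemma order_two_upd_le: "(\<And>d. d \<in> D \<Longrightarrow> 2 \<le> \<mu> d) \<Longrightarrow> d \<in> D \<Longrightarrow> 3 \<le> \<mu> d \<Longrightarrow> (order_two D)(d := Suc (order_two D d)) \<le> \<mu>"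
  by (simp add: order_two_def le_fun_def)

text \<open>Differentiating G (b + (p + r q) Z) in r brings down the unbounded factors q_d Z_d. In
  the cut off integral, \<open>ft_deriv\<close> converts Z_d times the transform of F into the
  transform of \<partial>_d F divided by 2 \<i>, so the growth turns into a derivative of the other
  factor. The derivatives \<open>Wk\<close> are only known to converge pointwise and boundedly; the
  limit is therefore taken in the integrated identity, and differentiability is recovered from the
  continuity of \<open>W\<close>.\<close>

lemma osc_deriv_aux:
  fixes F G :: "'i::countable jet"
  assumes D: "finite D" and F: "nice D \<mu> M F" and G: "nice D \<mu> M' G"
    and mu: "\<And>d. d \<in> D \<Longrightarrow> 2 \<le> \<mu> d" "\<And>d. d \<in> D \<Longrightarrow> q d \<noteq> 0 \<Longrightarrow> 3 \<le> \<mu> d" "\<And>d. \<mu> d \<le> 3" "\<And>d. d \<notin> D \<Longrightarrow> \<mu> d = 0"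
    and q: "\<And>d. d \<notin> D \<Longrightarrow> q d = 0"
  shows "((\<lambda>r. osc D (F (\<lambda>_. 0)) (rescale D b (\<lambda>i. p i + r * q i) G (\<lambda>_. 0))) has_vector_derivative
    (\<Sum>d\<in>{d\<in>D. q d \<noteq> 0}. of_real (q d) / (2 * \<i>) * osc D (shift d F (\<lambda>_. 0)) (rescale D b (\<lambda>i. p i + r * q i) (shift d G) (\<lambda>_. 0)))) (at r)"
proof -
  obtain ds where ds: "set ds = D" "distinct ds" using finite_distinct_list[OF D] by blast
  define S where "S = {d\<in>D. q d \<noteq> 0}"
  have S: "finite S" "S \<subseteq> D" "\<And>d. d \<in> S \<Longrightarrow> q d \<noteq> 0" using D by (auto simp: S_def)
  define s where "s = (\<lambda>r i. p i + r * q i)"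
  let ?h = "harmonic_seq :: nat \<Rightarrow> 'i \<Rightarrow> real"
  let ?z = "\<lambda>_::'i. 0::nat"
  let ?E = "\<lambda>k. gcut D (?h k)"
  have t2: "order_two D \<le> \<mu>" by (rule order_two_le[OF mu(1)])
  have t3: "(order_two D)(d := Suc (order_two D d)) \<le> \<mu>" if "d \<in> S" for d
    using that S by (intro order_two_upd_le mu) auto
  have nF: "nice D (order_two D) M F" and nG: "nice D (order_two D) M' G" using nice_mono[OF F t2] nice_mono[OF G t2] by auto
  have nFd: "nice D (order_two D) M (shift d F)" and nGd: "nice D (order_two D) M' (shift d G)" if "d \<in> S" for d
    using nice_shift[OF F t3[OF that]] nice_shift[OF G t3[OF that]] by auto
  have M: "0 \<le> M" "0 \<le> M'" using F G by (auto simp: nice_def)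
  \<comment> \<open>The argument takes place on [r - 1, r + 1], where all scales have a common
    bound.\<close>
  define R where "R = \<bar>r\<bar> + 1"
  define B where "B = (\<Prod>i\<in>D. max 1 (\<bar>p i\<bar> + R * \<bar>q i\<bar>) ^ order_two D i)"
  have sb: "\<bar>s x i\<bar> \<le> \<bar>p i\<bar> + R * \<bar>q i\<bar>" if "\<bar>x\<bar> \<le> R" for x i
  proof -
    have "\<bar>s x i\<bar> \<le> \<bar>p i\<bar> + \<bar>x\<bar> * \<bar>q i\<bar>" unfolding s_def by (metis abs_mult abs_triangle_ineq)
    also have "\<dots> \<le> \<bar>p i\<bar> + R * \<bar>q i\<bar>" using that by (intro add_left_mono mult_right_mono) auto
    finally show ?thesis .
  qed
  have nsc: "nice D (order_two D) (K * B) (rescale D b (s x) A)" if "nice D (order_two D) K A" "\<bar>x\<bar> \<le> R" for K A x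
    unfolding B_def by (rule nice_rescale[OF that(1) D order_two_off sb[OF that(2)]])
  have nsc': "\<exists>K'. nice D (order_two D) K' (rescale D b (s x) A)" if "nice D (order_two D) K A" for K A x
    using nice_rescale[OF that D order_two_off, of "s x" "\<lambda>i. \<bar>s x i\<bar>"] by blast
  define V where "V = (\<lambda>x. osc D (F ?z) (rescale D b (s x) G ?z))"
  define W where "W = (\<lambda>x. \<Sum>d\<in>S. of_real (q d) / (2 * \<i>) * osc D (shift d F ?z) (rescale D b (s x) (shift d G) ?z))"
  define cF where "cF = (\<lambda>k. cut (?h k) ds F)"
  have cF0: "cF k ?z = (\<lambda>Y. ?E k Y * F ?z Y)" for k unfolding cF_def cut_eq_gcut[OF ds(2)] ds ..
  define Vk where "Vk = (\<lambda>k x. pairing D (cF k ?z) (\<lambda>Z. ?E k Z * rescale D b (s x) G ?z Z) / of_real (pi ^ card D))"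
  \<comment> \<open>\<open>shift d (cF k)\<close> differentiates the product of F with its Gaussian;
    the terms in which the Gaussian is differentiated vanish in the limit.\<close>
  define Wk where "Wk = (\<lambda>k x. \<Sum>d\<in>S. of_real (q d) / (2 * \<i>) * (pairing D (shift d (cF k) ?z) (\<lambda>Z. ?E k Z * rescale D b (s x) (shift d G) ?z Z) / of_real (pi ^ card D)))"
  note h = harmonic_seq(1) harmonic_seq(2) harmonic_seq(3)
  have smF: "smooth \<mu> (cF k)" for k unfolding cF_def using F mu(3) by (auto simp: nice_def intro!: smooth_cut)
  obtain Ck where Ck: "\<And>k. Ck k \<ge> 0" "\<And>k. jet_bound D (\<lambda>_. 1) \<mu> (\<lambda>Y. Ck k * weight D Y) (cF k)"
  proof -
    have "\<forall>k. \<exists>C\<ge>0. jet_bound D (\<lambda>_. 1) \<mu> (\<lambda>Y. C * weight D Y) (cF k)"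
      unfolding cF_def ds(1)[symmetric]
      by (intro allI jet_bound_cut_decay[OF _ mu(3) M(1) h(1,2) ds(2)]) (use F ds in \<open>simp add: nice_def\<close>)
    then show ?thesis using that by metis
  qed
  have cFb: "cmod (cF k \<kappa> Y) \<le> Ck k * weight D Y" if "\<kappa> \<le> \<mu>" for k \<kappa> Y
    using jet_boundD[OF Ck(2) that] by simp
  have z1: "?z(d := Suc 0) \<le> \<mu>" if "d \<in> D" for d
    using mu(1)[OF that] by (intro multi_index_upd_le le_zero_fun) simp
  have sh0: "shift d A ?z = A (?z(d := Suc 0))" for d and A :: "'i jet" by (simp add: shift_def)
  have icF: "integrable (lborel_on D) (cF k \<kappa>)" if "\<kappa> \<le> \<mu>" for k \<kappa>
    by (rule integrable_decay[OF D smooth_measurable[OF smF that] cFb[OF that]])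
  have iE: "integrable (lborel_on D) (\<lambda>Z. ?E k Z * rescale D b (s x) A ?z Z)" if nA: "nice D (order_two D) K A" for k x K A

  proof -
    obtain K' where "nice D (order_two D) K' (rescale D b (s x) A)" using nsc'[OF nA] by blast
    then show ?thesis by (rule integrable_gcut_times[OF D harmonic_seq(1) _ le_zero_fun])
  qed
  have ftm: "ft D (cF k \<kappa>) \<in> borel_measurable borel" if "\<kappa> \<le> \<mu>" for k \<kappa>
    by (rule ft_measurable[OF D smooth_measurable[OF smF that]])
  have dVk: "(Vk k has_vector_derivative Wk k x) (at x)" for k x
  proof -
    let ?f = "\<lambda>x Z. ?E k Z * rescale D b (s x) G ?z Z * ft D (cF k ?z) Z"
    let ?f' = "\<lambda>x Z. \<Sum>d\<in>S. of_real (q d) / (2 * \<i>) * (?E k Z * rescale D b (s x) (shift d G) ?z Z * ft D (shift d (cF k) ?z) Z)"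
    define A where "A = (\<lambda>d. \<integral>Z. cmod (shift d (cF k) ?z Z) \<partial>lborel_on D)"
    let ?g = "\<lambda>Z. \<Sum>d\<in>S. \<bar>q d\<bar> / 2 * (cmod (?E k Z) * (M' * A d))"
    have "((\<lambda>x. \<integral>Z. ?f x Z \<partial>lborel_on D) has_vector_derivative (\<integral>Z. ?f' x Z \<partial>lborel_on D)) (at x)"
    proof (rule has_vector_derivative_integral[where g="?g"])
      show "integrable (lborel_on D) (?f x)" for x
        by (rule integrable_times_bounded[OF iE[OF nG] _ norm_ft_le])
          (use ftm[OF le_zero_fun] in \<open>simp add: measurable_cong_sets[OF sets_lborel_on refl]\<close>)
      show "?f' x \<in> borel_measurable (lborel_on D)" for x
      proof (intro borel_measurable_sum borel_measurable_times borel_measurable_const)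
        fix d assume d: "d \<in> S"
        show "?E k \<in> borel_measurable (lborel_on D)" by measurable
        obtain K' where "nice D (order_two D) K' (rescale D b (s x) (shift d G))" using nsc'[OF nGd[OF d]] by blast
        then show "rescale D b (s x) (shift d G) ?z \<in> borel_measurable (lborel_on D)"
          unfolding measurable_cong_sets[OF sets_lborel_on refl] by (rule nice_measurable[OF _ le_zero_fun])
        show "ft D (shift d (cF k) ?z) \<in> borel_measurable (lborel_on D)"
          unfolding measurable_cong_sets[OF sets_lborel_on refl] sh0 using d S by (intro ftm z1) auto
      qed
      show "((\<lambda>x. ?f x Z) has_vector_derivative ?f' x Z) (at x)" for x Z
      proof -
        have "((\<lambda>x. G ?z (\<lambda>i. (b i + p i * Z i) + x * (if i \<in> D then q i * Z i else 0))) has_vector_derivative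
          (\<Sum>d\<in>S. of_real (if d \<in> D then q d * Z d else 0) * G (?z(d := Suc 0)) (\<lambda>i. (b i + p i * Z i) + x * (if i \<in> D then q i * Z i else 0)))) (at x)"
        proof (rule has_vector_derivative_line[OF S(1)])
          fix d assume d: "d \<in> S"
          then have dD: "d \<in> D" using S by auto
          show "continuous_on UNIV (G (?z(d := Suc 0)))" using G z1[OF dD] by (auto simp: nice_def intro: smoothD)
          show "((\<lambda>t. G ?z (Y(d := t))) has_vector_derivative G (?z(d := Suc 0)) Y) (at (Y d))" for Y
            using smoothD(2)[of \<mu> G ?z d Y] G mu(1)[OF dD] by (simp add: nice_def le_zero_fun)
        qed (auto simp: S_def)
        moreover have "(\<lambda>i. (b i + p i * Z i) + x * (if i \<in> D then q i * Z i else 0)) = (\<lambda>i. b i + s x i * Z i)" for x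
          using q by (auto simp: s_def fun_eq_iff algebra_simps)
        ultimately have dG: "((\<lambda>x. rescale D b (s x) G ?z Z) has_vector_derivative
          (\<Sum>d\<in>S. of_real (q d * Z d) * rescale D b (s x) (shift d G) ?z Z)) (at x)"
          unfolding rescale_zero sh0 using S(2) by (auto intro!: sum.cong elim!: has_vector_derivative_eq_rhs)
        have "ft D (shift d (cF k) ?z) Z = 2 * \<i> * of_real (Z d) * ft D (cF k ?z) Z" if "d \<in> S" for d
        proof -
          have dD: "d \<in> D" using that S by auto
          show ?thesis unfolding sh0
            using smoothD(2)[OF smF le_zero_fun, of d] mu(1)[OF dD]
            by (intro ft_deriv[OF D dD, where C="Ck k"] smoothD(1)[OF smF] cFb z1[OF dD] le_zero_fun) auto
        qed
        then have "?f' x Z = ?E k Z * (\<Sum>d\<in>S. of_real (q d * Z d) * rescale D b (s x) (shift d G) ?z Z) * ft D (cF k ?z) Z"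
          unfolding sum_distrib_left sum_distrib_right
          by (intro sum.cong) (simp_all add: mult_ac)
        then show ?thesis
          using has_vector_derivative_mult_left[OF has_vector_derivative_mult_right[OF dG, of "?E k Z"], of "ft D (cF k ?z) Z"]
          by simp
      qed
      show "cmod (?f' x Z) \<le> ?g Z" for x Z
      proof (rule sum_norm_le)
        fix d assume d: "d \<in> S"
        have "cmod (rescale D b (s x) (shift d G) ?z Z) \<le> M'" unfolding rescale_zero using niceD[OF nGd[OF d] le_zero_fun] .
        moreover have "cmod (ft D (shift d (cF k) ?z) Z) \<le> A d" unfolding A_def by (rule norm_ft_le)
        ultimately have "cmod (rescale D b (s x) (shift d G) ?z Z) * cmod (ft D (shift d (cF k) ?z) Z) \<le> M' * A d"
          using M by (intro mult_mono) auto
        then have "\<bar>q d\<bar> / 2 * (cmod (?E k Z) * (cmod (rescale D b (s x) (shift d G) ?z Z) * cmod (ft D (shift d (cF k) ?z) Z))) \<le> \<bar>q d\<bar> / 2 * (cmod (?E k Z) * (M' * A d))"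
          by (intro mult_left_mono) auto
        then show "cmod (of_real (q d) / (2 * \<i>) * (?E k Z * rescale D b (s x) (shift d G) ?z Z * ft D (shift d (cF k) ?z) Z)) \<le> \<bar>q d\<bar> / 2 * (cmod (?E k Z) * (M' * A d))"
          by (simp add: norm_mult norm_divide mult.assoc)
      qed
      show "integrable (lborel_on D) ?g"
        by (intro Bochner_Integration.integrable_sum integrable_mult_right integrable_mult_left integrable_norm integrable_gcut[OF D harmonic_seq(1)])
    qed
    moreover have "(\<integral>Z. ?f x Z \<partial>lborel_on D) / of_real (pi ^ card D) = Vk k x" for x
      unfolding Vk_def by (subst pairing_commute[OF D icF[OF le_zero_fun] iE[OF nG]]) (simp add: pairing_def)
    moreover have "(\<integral>Z. ?f' x Z \<partial>lborel_on D) / of_real (pi ^ card D) = Wk k x"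
    proof -
      have i: "integrable (lborel_on D) (\<lambda>Z. ?E k Z * rescale D b (s x) (shift d G) ?z Z * ft D (shift d (cF k) ?z) Z)" if "d \<in> S" for d
        using that S unfolding sh0
        by (intro integrable_times_bounded[OF iE[OF nGd[OF that], unfolded sh0] _ norm_ft_le])
          (auto simp: measurable_cong_sets[OF sets_lborel_on refl] intro!: ftm z1)
      have "pairing D (shift d (cF k) ?z) (\<lambda>Z. ?E k Z * rescale D b (s x) (shift d G) ?z Z) = (\<integral>Z. ?E k Z * rescale D b (s x) (shift d G) ?z Z * ft D (shift d (cF k) ?z) Z \<partial>lborel_on D)" if "d \<in> S" for d
        using that S by (subst pairing_commute[OF D _ iE[OF nGd[OF that]]]) (auto simp: sh0 pairing_def intro!: icF z1)
      then show ?thesis unfolding Wk_def using i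
        by (simp add: Bochner_Integration.integral_sum sum_divide_distrib)
    qed
    ultimately show ?thesis
      using has_vector_derivative_mult_left[of "\<lambda>x. \<integral>Z. ?f x Z \<partial>lborel_on D" "\<integral>Z. ?f' x Z \<partial>lborel_on D" "at x" "1 / of_real (pi ^ card D)"]
      by simp
  qed
  \<comment> \<open>A derivative of a cut off jet is not itself given as a \<open>cut\<close>, so
    \<open>tform_cut\<close> does not cover it; but it has the decay that \<open>pairing_amp\<close>
    asks for.\<close>
  have tf: "pairing D (shift d (cF k) ?z) (\<lambda>Z. ?E k Z * rescale D b (s x) (shift d G) ?z Z) / of_real (pi ^ card D)
     = tform (\<lambda>_. 1) ds (shift d (cF k)) (cut (?h k) ds (rescale D b (s x) (shift d G)))" if d: "d \<in> S" for d k x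
  proof -
    obtain K' where K': "nice D (order_two D) K' (rescale D b (s x) (shift d G))" using nsc'[OF nGd[OF d]] by blast
    have dD: "d \<in> D" using d S by auto
    obtain C where C: "C \<ge> 0" "jet_bound D (\<lambda>_. 1) (order_two D) (\<lambda>Y. C * weight D Y) (cut (?h k) ds (rescale D b (s x) (shift d G)))"
    proof -
      have "\<exists>C\<ge>0. jet_bound D (\<lambda>_. 1) (order_two D) (\<lambda>Y. C * weight D Y) (cut (?h k) ds (rescale D b (s x) (shift d G)))"
        unfolding ds(1)[symmetric]
        by (rule jet_bound_cut_decay[OF _ order_two_le_3 _ h(1,2) ds(2)]) (use K' ds in \<open>auto simp: nice_def\<close>)
      then show ?thesis using that by (elim exE conjE)
    qed
    have w: "jet_bound D (\<lambda>_. 1) (order_two D) (\<lambda>Y. max C (Ck k) * weight D Y) (cut (?h k) ds (rescale D b (s x) (shift d G)))"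
      by (rule jet_bound_weaken[OF C(2) mult_right_mono[OF max.cobounded1 weight_nonneg]]) (rule zero_le_one)
    have w': "jet_bound D (\<lambda>_. 1) (order_two D) (\<lambda>Y. max C (Ck k) * weight D Y) (shift d (cF k))"
      unfolding jet_bound_def
    proof (intro allI impI)
      fix \<kappa> Y assume "\<kappa> \<le> order_two D"
      then have "cmod (shift d (cF k) \<kappa> Y) \<le> Ck k * weight D Y"
        unfolding shift_def by (intro cFb shift_le[OF _ t3[OF d]])
      also have "\<dots> \<le> max C (Ck k) * weight D Y" by (rule mult_right_mono) auto
      finally show "cmod (shift d (cF k) \<kappa> Y) \<le> max C (Ck k) * weight D Y * (\<Prod>d\<in>D. 1 ^ \<kappa> d)" by simp
    qed
    have "smooth (order_two D) (rescale D b (s x) (shift d G))" using K' by (simp add: nice_def)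
    from pairing_amp[where \<theta>="\<lambda>_. 1", OF D _ ds(2) _ _ smooth_shift[OF smF t3[OF d]] w' smooth_cut[OF this order_two_le_3] w]
    show ?thesis using C ds unfolding tform_def cut_eq_gcut[OF ds(2), symmetric, unfolded ds(1)]
      by (simp add: order_two_def le_max_iff_disj cut_eq_gcut[OF ds(2)])
  qed
  have cut_nice: "nice D (order_two D) (4320 ^ length ds * K) (cut (?h k) ds A)" if "nice D (order_two D) K A" for K A k
  proof -
    have "\<bar>?h k d\<bar> \<le> 1" for d using h(1)[of k d] h(2)[of k d] by simp
    then have "jet_bound D (\<lambda>_. 1) (order_two D) (\<lambda>_. 4320 ^ length ds * K) (cut (?h k) ds A)"
      using that by (intro jet_bound_cut_uniform order_two_le_3 ds(2)) (auto simp: nice_def)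
    then show ?thesis using that order_two_le_3 by (auto simp: nice_def intro!: smooth_cut)
  qed
  define N1 where "N1 = 4320 ^ length ds * M"
  define N2 where "N2 = 4320 ^ length ds * (M' * B)"
  have shc: "nice D (order_two D) N1 (shift d (cF k))" if d: "d \<in> S" for d k
  proof -
    have "jet_bound D (\<lambda>_. 1) \<mu> (\<lambda>_. N1) (cF k)"
      unfolding cF_def N1_def
    proof (rule jet_bound_cut_uniform[OF _ mu(3) M(1) _ ds(2)])
      show "\<bar>?h k d\<bar> \<le> 1" for d using h(1)[of k d] h(2)[of k d] by simp
    qed (use F in \<open>simp add: nice_def\<close>)
    moreover have "0 \<le> N1" using M by (simp add: N1_def)
    ultimately have "nice D \<mu> N1 (cF k)" using smF by (simp add: nice_def)
    then show ?thesis by (rule nice_shift[OF _ t3[OF d]])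
  qed
  have Wklim: "(\<lambda>k. Wk k x) \<longlonglongrightarrow> W x" if "\<bar>x\<bar> \<le> R" for x
    unfolding Wk_def W_def
  proof (intro tendsto_sum tendsto_mult_left)
    fix d assume d: "d \<in> S"
    note n = nsc[OF nGd[OF d] that]
    have o: "osc D (shift d F ?z) (rescale D b (s x) (shift d G) ?z) = tform (\<lambda>_. 1) ds (shift d F) (rescale D b (s x) (shift d G))"
      using osc_eq_tform[OF ds(2), of "order_two D" "\<lambda>_. 1" M "M' * B" "shift d F"] nFd[OF d] n ds order_two_le_3
      by (simp add: nice_def order_two_def)
    show "(\<lambda>k. pairing D (shift d (cF k) ?z) (\<lambda>Z. ?E k Z * rescale D b (s x) (shift d G) ?z Z) / of_real (pi ^ card D)) \<longlonglongrightarrow>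
      osc D (shift d F ?z) (rescale D b (s x) (shift d G) ?z)"
      unfolding tf[OF d] o
    proof (rule tform_tendsto[where \<mu>="order_two D" and M=N1 and M'=N2])
      show "(\<lambda>k. shift d (cF k) \<kappa> Y) \<longlonglongrightarrow> shift d F \<kappa> Y" if "\<kappa> \<le> order_two D" for \<kappa> Y
        unfolding shift_def cF_def by (rule cut_tendsto[OF h(3) tendsto_const shift_le[OF that t3[OF d]]])
      show "(\<lambda>k. cut (?h k) ds (rescale D b (s x) (shift d G)) \<kappa> Y) \<longlonglongrightarrow> rescale D b (s x) (shift d G) \<kappa> Y" if "\<kappa> \<le> order_two D" for \<kappa> Y
        by (rule cut_tendsto[OF h(3) tendsto_const that])
    qed (use shc[OF d] cut_nice[OF n] nFd[OF d] n ds in \<open>auto simp: nice_def order_two_def N2_def\<close>)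
  qed
  define BW where "BW = (\<Sum>d\<in>S. \<bar>q d\<bar> / 2 * (N1 * N2 * (\<Prod>d\<in>D. C0)))"
  have Wkb: "cmod (Wk k x) \<le> BW" if "\<bar>x\<bar> \<le> R" for k x
    unfolding Wk_def BW_def
  proof (rule sum_norm_le)
    fix d assume d: "d \<in> S"
    have "cmod (tform (\<lambda>_. 1) ds (shift d (cF k)) (cut (?h k) ds (rescale D b (s x) (shift d G)))) \<le> N1 * N2 * (\<Prod>d\<in>set ds. C0 * 1)"
      using shc[OF d, of k] cut_nice[OF nsc[OF nGd[OF d] that], of k] ds
      by (intro tform_bound[where \<mu>="order_two D" and s="\<lambda>_. 1"]) (auto simp: nice_def order_two_def N2_def)
    then show "cmod (of_real (q d) / (2 * \<i>) * (pairing D (shift d (cF k) ?z) (\<lambda>Z. ?E k Z * rescale D b (s x) (shift d G) ?z Z) / of_real (pi ^ card D)))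
      \<le> \<bar>q d\<bar> / 2 * (N1 * N2 * (\<Prod>d\<in>D. C0))"
      unfolding tf[OF d] norm_mult using ds by (intro mult_mono) (auto simp: norm_divide norm_mult)
  qed
  have Vklim: "(\<lambda>k. Vk k x) \<longlonglongrightarrow> V x" if "\<bar>x\<bar> \<le> R" for x
    unfolding Vk_def V_def cF0 by (rule osc_tendsto[OF D nF nsc[OF nG that] h h])
  have FTC: "(Wk k has_integral (Vk k x - Vk k (r - 1))) {r - 1..x}" if "r - 1 \<le> x" for k x
    by (rule fundamental_theorem_of_calculus[OF that]) (rule has_vector_derivative_at_within[OF dVk])
  \<comment> \<open>Dominated convergence in the scale parameter: \<open>BW\<close> bounds all
    \<open>Wk k\<close> on the interval, independently of k.\<close>
  have Wint: "integral {r - 1..x} W = V x - V (r - 1)" if x: "x \<in> {r - 1..r + 1}" for x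
  proof -
    have in_R: "\<bar>y\<bar> \<le> R" if "y \<in> {r - 1..x}" for y using that x unfolding R_def by auto
    have "(\<lambda>k. integral {r - 1..x} (Wk k)) \<longlonglongrightarrow> integral {r - 1..x} W"
    proof (rule dominated_convergence(2)[where h="\<lambda>_. BW"])
      show "Wk k integrable_on {r - 1..x}" for k using FTC x by (auto intro: has_integral_integrable)
    qed (use Wkb Wklim in_R in auto)
    moreover have "integral {r - 1..x} (Wk k) = Vk k x - Vk k (r - 1)" for k
      using FTC[of x k] x by (auto intro: integral_unique)
    moreover have "(\<lambda>k. Vk k x - Vk k (r - 1)) \<longlonglongrightarrow> V x - V (r - 1)"
      using in_R x by (intro tendsto_diff Vklim) auto
    ultimately show ?thesis using LIMSEQ_unique by force
  qed
  have Wcont: "continuous_on {r - 1..r + 1} W"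
    unfolding W_def
  proof (intro continuous_on_sum continuous_on_mult continuous_on_const continuous_on_sequentiallyI)
    fix d x and xk :: "nat \<Rightarrow> real" assume d: "d \<in> S" and xk: "\<forall>n. xk n \<in> {r - 1..r + 1}" "x \<in> {r - 1..r + 1}" "xk \<longlonglongrightarrow> x"
    have b: "\<bar>xk n\<bar> \<le> R" "\<bar>x\<bar> \<le> R" for n using spec[OF xk(1), of n] xk(2) unfolding R_def by auto
    have sm: "smooth (order_two D) (shift d G)" using nGd[OF d] by (simp add: nice_def)
    show "(\<lambda>n. osc D (shift d F ?z) (rescale D b (s (xk n)) (shift d G) ?z)) \<longlonglongrightarrow> osc D (shift d F ?z) (rescale D b (s x) (shift d G) ?z)"
      by (rule osc_continuous[OF D nFd[OF d] nFd[OF d] tendsto_const nsc[OF nGd[OF d] b(1)] nsc[OF nGd[OF d] b(2)]])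
        (auto intro!: rescale_tendsto[OF sm] tendsto_intros xk simp: s_def)
  qed
  have "((\<lambda>x. integral {r - 1..x} W) has_vector_derivative W r) (at r within {r - 1..r + 1})"
    by (rule integral_has_vector_derivative[OF Wcont]) auto
  then have "((\<lambda>x. integral {r - 1..x} W + V (r - 1)) has_vector_derivative W r) (at r)"
    by (simp add: at_within_Icc_at has_vector_derivative_add_const)
  then have "(V has_vector_derivative W r) (at r)"
    by (rule has_vector_derivative_transform_within_open[of _ _ _ "{r - 1<..<r + 1}"]) (use Wint in auto)
  then show ?thesis by (simp add: V_def W_def s_def S_def)
qed

text \<open>The Gaussian jets stop at order 3, so the orders are capped at 3 before
  \<open>osc_deriv_aux\<close> is applied. Directions with \<open>q d = 0\<close> enter the sum with
  coefficient 0.\<close>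

lemma osc_deriv:
  fixes F G :: "'i::countable jet"
  assumes D: "finite D" and F: "nice D \<mu> M F" and G: "nice D \<mu> M' G"
    and mu: "\<And>d. d \<in> D \<Longrightarrow> 2 \<le> \<mu> d" "\<And>d. d \<in> D \<Longrightarrow> q d \<noteq> 0 \<Longrightarrow> 3 \<le> \<mu> d"
    and q: "\<And>d. d \<notin> D \<Longrightarrow> q d = 0"
  shows "((\<lambda>r. osc D (F (\<lambda>_. 0)) (rescale D b (\<lambda>i. p i + r * q i) G (\<lambda>_. 0))) has_vector_derivative
    (\<Sum>d\<in>D. of_real (q d) / (2 * \<i>) * osc D (shift d F (\<lambda>_. 0)) (rescale D b (\<lambda>i. p i + r * q i) (shift d G) (\<lambda>_. 0)))) (at r)"
proof -
  define \<nu> where "\<nu> = (\<lambda>d. if d \<in> D then min (\<mu> d) 3 else 0)"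
  have le: "\<nu> \<le> \<mu>" by (simp add: \<nu>_def le_fun_def)
  have "((\<lambda>r. osc D (F (\<lambda>_. 0)) (rescale D b (\<lambda>i. p i + r * q i) G (\<lambda>_. 0))) has_vector_derivative
    (\<Sum>d\<in>{d\<in>D. q d \<noteq> 0}. of_real (q d) / (2 * \<i>) * osc D (shift d F (\<lambda>_. 0)) (rescale D b (\<lambda>i. p i + r * q i) (shift d G) (\<lambda>_. 0)))) (at r)"
    by (rule osc_deriv_aux[OF D nice_mono[OF F le] nice_mono[OF G le]])
      (use mu q in \<open>auto simp: \<nu>_def\<close>)
  also have "(\<Sum>d\<in>{d\<in>D. q d \<noteq> 0}. of_real (q d) / (2 * \<i>) * osc D (shift d F (\<lambda>_. 0)) (rescale D b (\<lambda>i. p i + r * q i) (shift d G) (\<lambda>_. 0)))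
    = (\<Sum>d\<in>D. of_real (q d) / (2 * \<i>) * osc D (shift d F (\<lambda>_. 0)) (rescale D b (\<lambda>i. p i + r * q i) (shift d G) (\<lambda>_. 0)))"
    using D by (intro sum.mono_neutral_left) auto
  finally show ?thesis .
qed

section \<open>Derivative of the oscillatory integral in the base points\<close>

lemma rescale_base_deriv:
  fixes A :: "'i jet"
  assumes A: "smooth \<mu> A" "\<kappa> \<le> \<mu>" "\<kappa> d < \<mu> d"
  shows "((\<lambda>t. rescale D (b(d := t)) s A \<kappa> Y) has_vector_derivative rescale D (b(d := t)) s (shift d A) \<kappa> Y) (at t)"
proof -
  define Z where "Z = (\<lambda>i. b i + s i * Y i)"
  have e: "(\<lambda>i. (b(d := t)) i + s i * Y i) = Z(d := t + s d * Y d)" for t by (auto simp: Z_def)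
  have "((\<lambda>u. A \<kappa> ((Z(d := t + s d * Y d))(d := u))) has_vector_derivative A (\<kappa>(d := Suc (\<kappa> d))) (Z(d := t + s d * Y d))) (at (t + s d * Y d))"
    using smoothD(2)[OF A, of "Z(d := t + s d * Y d)"] by (simp only: fun_upd_same)
  then have "((\<lambda>u. A \<kappa> ((Z(d := t + s d * Y d))(d := u))) \<circ> (\<lambda>t. t + s d * Y d) has_vector_derivative 1 *\<^sub>R A (\<kappa>(d := Suc (\<kappa> d))) (Z(d := t + s d * Y d))) (at t)"
    by (intro vector_diff_chain_at) (auto simp flip: has_real_derivative_iff_has_vector_derivative intro!: derivative_eq_intros)
  then have "((\<lambda>t. A \<kappa> (Z(d := t + s d * Y d))) has_vector_derivative A (\<kappa>(d := Suc (\<kappa> d))) (Z(d := t + s d * Y d))) (at t)"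
    by (simp add: o_def)
  from has_vector_derivative_mult_right[OF this]
  show ?thesis unfolding rescale_def e shift_def .
qed

text \<open>The difference quotient is formed in all derivatives at once, so that it is again a jet
  and \<open>osc\<close> can be applied to it.\<close>

definition base_quotient :: "'i set \<Rightarrow> ('i \<Rightarrow> real) \<Rightarrow> ('i \<Rightarrow> real) \<Rightarrow> 'i \<Rightarrow> 'i jet \<Rightarrow> real \<Rightarrow> real \<Rightarrow> 'i jet" where
  "base_quotient D b s d A t h = (\<lambda>\<kappa> Y. (1 / of_real h) * rescale D (b(d := t + h)) s A \<kappa> Y + (- 1 / of_real h) * rescale D (b(d := t)) s A \<kappa> Y)"

text \<open>The mean value theorem bounds the quotient by the next derivative, uniformly in the
  increment; this supplies the common bound for \<open>osc_continuous\<close>.\<close>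

lemma
  fixes A :: "'i::countable jet"
  assumes D: "finite D" "d \<in> D" and A: "nice D \<mu> M A"
    and mu: "\<And>d. d \<in> D \<Longrightarrow> 2 \<le> \<mu> d" "3 \<le> \<mu> d"
  shows nice_base_quotient: "h \<noteq> 0 \<Longrightarrow> nice D (order_two D) (M * (\<Prod>i\<in>D. max 1 \<bar>s i\<bar> ^ order_two D i)) (base_quotient D b s d A t h)"
    and base_quotient_tendsto: "\<kappa> \<le> order_two D \<Longrightarrow> \<forall>k::nat. H k \<noteq> 0 \<Longrightarrow> H \<longlonglongrightarrow> 0 \<Longrightarrow>
      (\<lambda>k. base_quotient D b s d A t (H k) \<kappa> Y) \<longlonglongrightarrow> rescale D (b(d := t)) s (shift d A) \<kappa> Y"
proof -
  have t2: "order_two D \<le> \<mu>" by (rule order_two_le[OF mu(1)])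
  have t3: "(order_two D)(d := Suc (order_two D d)) \<le> \<mu>" using D mu by (intro order_two_upd_le) auto
  note nA = nice_mono[OF A t2] and nAd = nice_shift[OF A t3, of D]
  have nsc: "nice D (order_two D) (K * (\<Prod>i\<in>D. max 1 \<bar>s i\<bar> ^ order_two D i)) (rescale D b s A)" if "nice D (order_two D) K A" for K A b
    by (rule nice_rescale[OF that D(1) order_two_off order_refl])
  have Q: "base_quotient D b s d A t h \<kappa> Y = (rescale D (b(d := t + h)) s A \<kappa> Y - rescale D (b(d := t)) s A \<kappa> Y) / of_real h" for h \<kappa> Y
    by (simp add: base_quotient_def diff_divide_distrib)
  have der: "((\<lambda>t. rescale D (b(d := t)) s A \<kappa> Y) has_vector_derivative rescale D (b(d := t)) s (shift d A) \<kappa> Y) (at t)" if "\<kappa> \<le> order_two D" for \<kappa> Y t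
  proof (rule rescale_base_deriv)
    show "smooth \<mu> A" using A by (simp add: nice_def)
    show "\<kappa> \<le> \<mu>" using that t2 by order
    have "\<kappa> d \<le> 2" using that D(2) by (metis le_fun_def order_two_def)
    then show "\<kappa> d < \<mu> d" using mu(2) by linarith
  qed
  show "nice D (order_two D) (M * (\<Prod>i\<in>D. max 1 \<bar>s i\<bar> ^ order_two D i)) (base_quotient D b s d A t h)" if h: "h \<noteq> 0"
  proof (rule niceI)
    show "0 \<le> M * (\<Prod>i\<in>D. max 1 \<bar>s i\<bar> ^ order_two D i)" using nsc[OF nA] by (simp add: nice_def)
    show "smooth (order_two D) (base_quotient D b s d A t h)" unfolding base_quotient_def
      using nsc[OF nA] by (intro smooth_add_scale[OF D(1)]) (auto simp: nice_def)
    fix \<kappa> :: "'i \<Rightarrow> nat" and Y assume k: "\<kappa> \<le> order_two D"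
    have "cmod (rescale D (b(d := t + h)) s A \<kappa> Y - rescale D (b(d := t)) s A \<kappa> Y) \<le> (M * (\<Prod>i\<in>D. max 1 \<bar>s i\<bar> ^ order_two D i)) * \<bar>t + h - t\<bar>"
      by (rule mean_value_bound[OF der[OF k]]) (rule niceD[OF nsc[OF nAd] k])
    then show "cmod (base_quotient D b s d A t h \<kappa> Y) \<le> M * (\<Prod>i\<in>D. max 1 \<bar>s i\<bar> ^ order_two D i)"
      unfolding Q using h by (simp add: norm_divide divide_le_eq)
  qed
  show "(\<lambda>k. base_quotient D b s d A t (H k) \<kappa> Y) \<longlonglongrightarrow> rescale D (b(d := t)) s (shift d A) \<kappa> Y"
    if "\<kappa> \<le> order_two D" "\<forall>k. H k \<noteq> 0" "H \<longlonglongrightarrow> 0"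
    using der[OF that(1), unfolded has_vector_derivative_sequentially] that(2,3) unfolding Q by simp
qed

text \<open>The classical proof of the product rule, from bilinearity and continuity of
  \<open>osc\<close>. One parameter t moves both base points because the two symbols of a Weyl
  composition are translated by the same point; the second carries the coordinate under another name
  d'.\<close>

lemma osc_base_deriv:
  fixes F G :: "'i::countable jet"
  assumes D: "finite D" "d \<in> D" "d' \<in> D" and F: "nice D \<mu> M F" and G: "nice D \<mu> M' G"
    and mu: "\<And>d. d \<in> D \<Longrightarrow> 3 \<le> \<mu> d"
  shows "((\<lambda>t. osc D (rescale D (b(d := t)) s F (\<lambda>_. 0)) (rescale D (b'(d' := t)) s' G (\<lambda>_. 0))) has_vector_derivative
     osc D (rescale D (b(d := t)) s (shift d F) (\<lambda>_. 0)) (rescale D (b'(d' := t)) s' G (\<lambda>_. 0))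
     + osc D (rescale D (b(d := t)) s F (\<lambda>_. 0)) (rescale D (b'(d' := t)) s' (shift d' G) (\<lambda>_. 0))) (at t)"
  unfolding has_vector_derivative_sequentially
proof (intro allI impI)
  fix h :: "nat \<Rightarrow> real" assume h: "\<forall>k. h k \<noteq> 0" "h \<longlonglongrightarrow> 0"
  let ?z = "\<lambda>_::'i. 0::nat"
  have mu2: "2 \<le> \<mu> d" if "d \<in> D" for d using mu[OF that] by linarith
  have t2: "order_two D \<le> \<mu>" by (rule order_two_le[OF mu2])
  have t3: "(order_two D)(e := Suc (order_two D e)) \<le> \<mu>" if "e \<in> D" for e using that mu mu2 by (intro order_two_upd_le) auto
  define N where "N = (\<lambda>s. \<Prod>i\<in>D. max 1 \<bar>s i :: real\<bar> ^ order_two D i)"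
  have nsc: "nice D (order_two D) (K * N s) (rescale D b s A)" if "nice D (order_two D) K A" for K A b s
    unfolding N_def by (rule nice_rescale[OF that D(1) order_two_off order_refl])
  note nF = nice_mono[OF F t2] and nG = nice_mono[OF G t2]
  note nFd = nice_shift[OF F t3[OF D(2)], of D] and nGd = nice_shift[OF G t3[OF D(3)], of D]
  define Q where "Q = (\<lambda>k. base_quotient D b s d F t (h k))"
  define Q' where "Q' = (\<lambda>k. base_quotient D b' s' d' G t (h k))"
  have nQ: "nice D (order_two D) (M * N s) (Q k)" for k
    unfolding Q_def N_def using h by (intro nice_base_quotient[OF D(1,2) F mu2 mu] D) auto
  have nQ': "nice D (order_two D) (M' * N s') (Q' k)" for k
    unfolding Q'_def N_def using h by (intro nice_base_quotient[OF D(1,3) G mu2 mu] D) auto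
  have smG: "smooth \<mu> G" using G by (simp add: nice_def)
  have G_lim: "(\<lambda>k. rescale D (b'(d' := t + h k)) s' G \<kappa> Y) \<longlonglongrightarrow> rescale D (b'(d' := t)) s' G \<kappa> Y" if "\<kappa> \<le> order_two D" for \<kappa> Y
  proof (rule rescale_tendsto[OF smG])
    show "\<kappa> \<le> \<mu>" using that t2 by order
    fix i
    have "(\<lambda>k. t + h k) \<longlonglongrightarrow> t + 0" by (intro tendsto_intros h)
    then show "(\<lambda>k. (b'(d' := t + h k)) i) \<longlonglongrightarrow> (b'(d' := t)) i" by (cases "i = d'") auto
  qed auto
  have 1: "(\<lambda>k. osc D (Q k ?z) (rescale D (b'(d' := t + h k)) s' G ?z)) \<longlonglongrightarrow>
    osc D (rescale D (b(d := t)) s (shift d F) ?z) (rescale D (b'(d' := t)) s' G ?z)"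
    unfolding Q_def
    by (rule osc_continuous[OF D(1) nQ[unfolded Q_def] nsc[OF nFd] base_quotient_tendsto[OF D(1,2) F mu2 mu[OF D(2)] _ h] nsc[OF nG] nsc[OF nG] G_lim])
  have 2: "(\<lambda>k. osc D (rescale D (b(d := t)) s F ?z) (Q' k ?z)) \<longlonglongrightarrow>
    osc D (rescale D (b(d := t)) s F ?z) (rescale D (b'(d' := t)) s' (shift d' G) ?z)"
    unfolding Q'_def
    by (rule osc_continuous[OF D(1) nsc[OF nF] nsc[OF nF] tendsto_const nQ'[unfolded Q'_def] nsc[OF nGd] base_quotient_tendsto[OF D(1,3) G mu2 mu[OF D(3)] _ h]])
  have e1: "osc D (Q k ?z) (rescale D (b'(d' := t + h k)) s' G ?z) =
    (osc D (rescale D (b(d := t + h k)) s F ?z) (rescale D (b'(d' := t + h k)) s' G ?z) - osc D (rescale D (b(d := t)) s F ?z) (rescale D (b'(d' := t + h k)) s' G ?z)) / of_real (h k)" for k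
    unfolding Q_def base_quotient_def by (subst osc_linear[OF D(1) nsc[OF nF] nsc[OF nF] nsc[OF nG]]) (simp add: diff_divide_distrib)
  have e2: "osc D (rescale D (b(d := t)) s F ?z) (Q' k ?z) =
    (osc D (rescale D (b(d := t)) s F ?z) (rescale D (b'(d' := t + h k)) s' G ?z) - osc D (rescale D (b(d := t)) s F ?z) (rescale D (b'(d' := t)) s' G ?z)) / of_real (h k)" for k
  proof -
    have "osc D (Q' k ?z) (rescale D (b(d := t)) s F ?z) =
      (osc D (rescale D (b'(d' := t + h k)) s' G ?z) (rescale D (b(d := t)) s F ?z) - osc D (rescale D (b'(d' := t)) s' G ?z) (rescale D (b(d := t)) s F ?z)) / of_real (h k)"
      unfolding Q'_def base_quotient_def by (subst osc_linear[OF D(1) nsc[OF nG] nsc[OF nG] nsc[OF nF]]) (simp add: diff_divide_distrib)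
    then show ?thesis
      using osc_commute[OF D(1) nsc[OF nF] nQ'] osc_commute[OF D(1) nsc[OF nF] nsc[OF nG]] by simp
  qed
  show "(\<lambda>k. (osc D (rescale D (b(d := t + h k)) s F ?z) (rescale D (b'(d' := t + h k)) s' G ?z) - osc D (rescale D (b(d := t)) s F ?z) (rescale D (b'(d' := t)) s' G ?z)) / of_real (h k))
     \<longlonglongrightarrow> osc D (rescale D (b(d := t)) s (shift d F) ?z) (rescale D (b'(d' := t)) s' G ?z)
       + osc D (rescale D (b(d := t)) s F ?z) (rescale D (b'(d' := t)) s' (shift d' G) ?z)"
    using tendsto_add[OF 1 2] unfolding e1 e2 by (simp add: add_divide_distrib[symmetric])
qed

section \<open>Integrating out variables\<close>

lemma osc_empty:
  fixes F G :: "('i::countable \<Rightarrow> real) \<Rightarrow> complex"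
  assumes [measurable]: "F \<in> borel_measurable borel" "G \<in> borel_measurable borel"
  shows "osc {} F G = F (\<lambda>_. 0) * G (\<lambda>_. 0)"
proof -
  have v: "(\<integral>Y. H Y \<partial>lborel_on {}) = H (\<lambda>_. 0)" if "H \<in> borel_measurable borel" for H :: "('i \<Rightarrow> real) \<Rightarrow> complex"
  proof -
    interpret prob_space "\<Pi>\<^sub>M i\<in>{}::'i set. (lborel::real measure)" by (rule prob_spaceI) (simp add: space_PiM_empty)
    have "zero_ext {} Y = (\<lambda>_. 0::real)" for Y :: "'i \<Rightarrow> real" by (simp add: zero_ext_def)
    then show ?thesis unfolding integral_lborel_on[OF that] by (simp add: prob_space)
  qed
  have "ft {} G = (\<lambda>_. G (\<lambda>_. 0))" by (rule ext) (simp add: ft_def wave_def v)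
  then have "pairing {} F G = F (\<lambda>_. 0) * G (\<lambda>_. 0)" by (simp add: pairing_def v)
  then show ?thesis unfolding osc_def by simp
qed

lemma integral_exp_neg_square: "(\<integral>v. exp (- v\<^sup>2) \<partial>lborel) = sqrt pi"
  and integrable_exp_neg_square: "integrable lborel (\<lambda>v::real. exp (- v\<^sup>2))"
  using integral_gauss[of 1] integrable_gauss[of 1] by simp_all

text \<open>If \<open>G\<close> does not depend on the variable \<open>d\<close>, integrating it out leaves a Gaussian approximate identity in
  \<open>Y d\<close>, so that variable is set to \<open>0\<close> in \<open>F\<close>.\<close>

lemma osc_drop:
  fixes F G :: "'i::countable jet"
  assumes D: "finite D" "d \<notin> D" and F: "nice (insert d D) (order_two (insert d D)) M F" and G: "nice (insert d D) (order_two (insert d D)) M' G"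
    and ind: "\<And>Y t. G (\<lambda>_. 0) (Y(d := t)) = G (\<lambda>_. 0) Y"
  shows "osc (insert d D) (F (\<lambda>_. 0)) (G (\<lambda>_. 0)) = osc D (F (\<lambda>_. 0)) (G (\<lambda>_. 0))"
proof -
  let ?I = "insert d D" and ?z = "\<lambda>_::'i. 0::nat"
  interpret zD: sigma_finite_measure "lborel_on D" using D(1) by (rule sigma_finite_lborel_on)
  interpret P: pair_sigma_finite "lborel_on D" lborel ..
  obtain ds where ds: "set ds = D" "distinct ds" using finite_distinct_list[OF D(1)] by blast
  have le2: "order_two D \<le> order_two ?I" by (simp add: order_two_def le_fun_def)
  have nF: "nice D (order_two D) M F" and nG: "nice D (order_two D) M' G"
    using nice_mono[OF F le2] nice_mono[OF G le2] by (auto simp: nice_def jet_bound_def)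
  have M: "0 \<le> M" "0 \<le> M'" using F G by (auto simp: nice_def)
  have [measurable]: "F ?z \<in> borel_measurable borel" "G ?z \<in> borel_measurable borel"
    by (rule nice_measurable[OF nF le_zero_fun], rule nice_measurable[OF nG le_zero_fun])
  define e where "e = (\<lambda>k. inverse (real (Suc k)))"
  have e: "0 < e k" "e k \<le> 1" "e \<longlonglongrightarrow> 0" for k
    unfolding e_def using LIMSEQ_inverse_real_of_nat by (auto simp: inverse_le_1_iff simp del: of_nat_Suc)
  let ?h = "harmonic_seq :: nat \<Rightarrow> 'i \<Rightarrow> real"
  have he: "?h k i = e k" for k i by (simp add: harmonic_seq_def e_def)
  note h = harmonic_seq(1) harmonic_seq(2) harmonic_seq(3)
  let ?E = "\<lambda>k. gcut D (?h k)"
  have EI: "gcut ?I (?h k) (Y(d := y)) = ?E k Y * of_real (exp (- (e k * y)\<^sup>2))" for k Y y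
  proof -
    have "(\<Prod>i\<in>D. exp (- (?h k i * (Y(d := y)) i)\<^sup>2)) = (\<Prod>i\<in>D. exp (- (?h k i * Y i)\<^sup>2))"
      using D by (intro prod.cong) auto
    then show ?thesis using D by (simp add: gcut_def he mult.commute)
  qed
  have iG: "integrable (lborel_on D) (\<lambda>Z. ?E k Z * G ?z Z)" for k
    by (rule integrable_gcut_times[OF D(1) h(1) nG le_zero_fun])
  have iF: "integrable (lborel_on ?I) (\<lambda>Z. gcut ?I (?h k) Z * F ?z Z)" and iGI: "integrable (lborel_on ?I) (\<lambda>Z. gcut ?I (?h k) Z * G ?z Z)" for k
    using D by (auto intro!: integrable_gcut_times[OF _ h(1) F le_zero_fun] integrable_gcut_times[OF _ h(1) G le_zero_fun])
  define g where "g = (\<lambda>k. ft D (\<lambda>Z. ?E k Z * G ?z Z))"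
  have [measurable]: "g k \<in> borel_measurable borel" for k
    unfolding g_def by (rule ft_measurable[OF D(1)]) measurable
  define A where "A = (\<lambda>k. \<integral>Z. cmod (?E k Z * G ?z Z) \<partial>lborel_on D)"
  have gA: "cmod (g k Y) \<le> A k" for k Y unfolding g_def A_def by (rule norm_ft_le)
  \<comment> \<open>In direction \<open>d\<close> only the cutoff is transformed: the result is a
    Gaussian in \<open>y\<close> of width \<open>e k\<close> and mass pi.\<close>
  have ftI: "ft ?I (\<lambda>Z. gcut ?I (?h k) Z * G ?z Z) (Y(d := y)) = of_real (sqrt pi / e k * exp (- (y / e k)\<^sup>2)) * g k Y" for k Y y
  proof -
    have w: "wave ?I (Y(d := y)) (Z(d := z)) = wave D Y Z * cis (- 2 * y * z)" for Z z
    proof -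
      have "wave D (Y(d := y)) Z = wave D Y Z" unfolding wave_def using D by (intro arg_cong[where f=cis] arg_cong2[where f="(*)"] refl sum.cong) auto
      then show ?thesis using wave_upd[OF D, of "Y(d := y)" Z z] by simp
    qed
    have "ft ?I (\<lambda>Z. gcut ?I (?h k) Z * G ?z Z) (Y(d := y)) =
       (\<integral>Z. (\<integral>z. gcut ?I (?h k) (Z(d := z)) * G ?z (Z(d := z)) * wave ?I (Y(d := y)) (Z(d := z)) \<partial>lborel) \<partial>lborel_on D)"
      unfolding ft_def by (rule integral_lborel_on_insert[OF D integrable_wave[OF iGI]])
    also have "\<dots> = (\<integral>Z. (?E k Z * G ?z Z * wave D Y Z) * (\<integral>z. of_real (exp (- ((e k)\<^sup>2) * z\<^sup>2)) * cis (- 2 * y * z) \<partial>lborel) \<partial>lborel_on D)"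
      unfolding EI ind w by (intro Bochner_Integration.integral_cong refl) (simp add: power_mult_distrib mult_ac flip: integral_mult_right_zero)
    also have "(\<integral>z. of_real (exp (- ((e k)\<^sup>2) * z\<^sup>2)) * cis (- 2 * y * z) \<partial>lborel) = complex_of_real (sqrt pi / e k * exp (- (y / e k)\<^sup>2))"
      using e(1)[of k] by (subst integral_gauss_cis) (auto simp: real_sqrt_divide power_divide)
    finally show ?thesis by (simp only: g_def ft_def[of D] integral_mult_left_zero mult.commute)
  qed
  define R where "R = (\<lambda>k v. \<integral>Y. ?E k Y * F ?z (Y(d := e k * v)) * g k Y \<partial>lborel_on D)"
  define W where "W = (\<lambda>k v. complex_of_real (exp (- (e k * (e k * v))\<^sup>2) * exp (- v\<^sup>2) / sqrt pi))"
  have Pk: "pairing ?I (\<lambda>Z. gcut ?I (?h k) Z * F ?z Z) (\<lambda>Z. gcut ?I (?h k) Z * G ?z Z) / of_real (pi ^ card ?I)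
    = (\<integral>v. W k v * (R k v / of_real (pi ^ card D)) \<partial>lborel)" for k
  proof -
    let ?c = "\<lambda>y. complex_of_real (exp (- (e k * y)\<^sup>2) * (sqrt pi / e k * exp (- (y / e k)\<^sup>2)))"
    let ?H = "\<lambda>Y y. ?c y * (?E k Y * F ?z (Y(d := y)) * g k Y)"
    have mu: "(\<lambda>x. (fst x)(d := snd x)) \<in> borel_measurable (lborel_on D \<Otimes>\<^sub>M (lborel :: real measure))"
    proof -
      have "(\<lambda>x. (fst x)(d := snd x)) = (\<lambda>(Y::'i\<Rightarrow>real, t). Y(d := t))" by auto
      then show ?thesis using measurable_fun_upd_borel[of d]
        by (simp add: measurable_def sets_pair_measure space_pair_measure)
    qed
    have mF: "(\<lambda>x. F ?z ((fst x)(d := snd x))) \<in> borel_measurable (lborel_on D \<Otimes>\<^sub>M (lborel :: real measure))"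
      by (rule measurable_compose[OF mu]) measurable
    have ic: "integrable lborel (\<lambda>y. exp (- (e k * y)\<^sup>2) * (sqrt pi / e k))"
      using integrable_gauss[of "(e k)\<^sup>2"] e(1)[of k] by (simp add: power_mult_distrib)
    have icc: "integrable lborel ?c"
    proof (rule Bochner_Integration.integrable_bound[OF ic])
      show "AE y in lborel. norm (?c y) \<le> norm (exp (- (e k * y)\<^sup>2) * (sqrt pi / e k))"
      proof (rule AE_I2)
        fix y
        have "exp (- (e k * y)\<^sup>2) * (sqrt pi / e k) * exp (- (y / e k)\<^sup>2) \<le> exp (- (e k * y)\<^sup>2) * (sqrt pi / e k)"
          using e(1)[of k] by (intro mult_left_le) auto
        then show "norm (?c y) \<le> norm (exp (- (e k * y)\<^sup>2) * (sqrt pi / e k))"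
          using e(1)[of k] by (simp only: norm_of_real real_norm_def abs_mult abs_exp_cancel abs_divide abs_of_pos mult.assoc) simp
      qed
      have "continuous_on UNIV ?c" using e(1)[of k] by (auto intro!: continuous_intros)
      then show "?c \<in> borel_measurable lborel" by (simp add: borel_measurable_continuous_onI)
    qed
    have iH: "integrable (lborel_on D \<Otimes>\<^sub>M lborel) (\<lambda>(Y, y). ?H Y y)"
    proof -
      have "integrable (lborel_on D \<Otimes>\<^sub>M lborel) (\<lambda>(Y, y). ?E k Y * ?c y)"
      proof (rule P.Fubini_integrable)
        have eq: "(\<lambda>Y. \<integral>y. norm (case (Y, y) of (Y, y) \<Rightarrow> ?E k Y * ?c y) \<partial>lborel) = (\<lambda>Y. cmod (?E k Y) * (\<integral>y. cmod (?c y) \<partial>lborel))"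
          by (rule ext) (simp only: prod.case norm_mult[of "?E k _"] integral_mult_right_zero)
        show "integrable (lborel_on D) (\<lambda>Y. \<integral>y. norm (case (Y, y) of (Y, y) \<Rightarrow> ?E k Y * ?c y) \<partial>lborel)"
          unfolding eq by (intro integrable_mult_left integrable_norm integrable_gcut[OF D(1) h(1)])
        show "AE Y in lborel_on D. integrable lborel (\<lambda>y. case (Y, y) of (Y, y) \<Rightarrow> ?E k Y * ?c y)"
          using icc by (intro AE_I2) (simp only: prod.case, intro integrable_mult_right)
      qed measurable
      then have "integrable (lborel_on D \<Otimes>\<^sub>M lborel) (\<lambda>x. (case x of (Y, y) \<Rightarrow> ?E k Y * ?c y) * (F ?z ((fst x)(d := snd x)) * g k (fst x)))"
      proof (rule integrable_times_bounded[where C="M * A k"])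
        show "(\<lambda>x. F ?z ((fst x)(d := snd x)) * g k (fst x)) \<in> borel_measurable (lborel_on D \<Otimes>\<^sub>M lborel)"
          by (intro borel_measurable_times mF) measurable
        fix x :: "('i \<Rightarrow> real) \<times> real"
        show "cmod (F ?z ((fst x)(d := snd x)) * g k (fst x)) \<le> M * A k"
          unfolding norm_mult using niceD[OF nF le_zero_fun] gA M by (intro mult_mono) auto
      qed
      then show ?thesis by (simp add: case_prod_beta' mult_ac)
    qed
    let ?f = "ft ?I (\<lambda>Z. gcut ?I (?h k) Z * G ?z Z)"
    have mf: "?f \<in> borel_measurable (lborel_on ?I)"
      unfolding measurable_cong_sets[OF sets_lborel_on refl] using D by (intro ft_measurable) (auto intro: borel_measurable_times)
    have "pairing ?I (\<lambda>Z. gcut ?I (?h k) Z * F ?z Z) (\<lambda>Z. gcut ?I (?h k) Z * G ?z Z) =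
      (\<integral>Y. (\<integral>y. gcut ?I (?h k) (Y(d := y)) * F ?z (Y(d := y)) * ?f (Y(d := y)) \<partial>lborel) \<partial>lborel_on D)"
      unfolding pairing_def
      by (rule integral_lborel_on_insert[OF D integrable_times_bounded[OF iF mf norm_ft_le]])
    also have "\<dots> = (\<integral>Y. (\<integral>y. ?H Y y \<partial>lborel) \<partial>lborel_on D)"
      unfolding EI ftI by (simp add: mult_ac)
    also have "\<dots> = (\<integral>y. (\<integral>Y. ?H Y y \<partial>lborel_on D) \<partial>lborel)"
      by (rule P.Fubini_integral[OF iH, symmetric])
    also have "\<dots> = (\<integral>y. ?c y * R k (y / e k) \<partial>lborel)"
      using e(1)[of k] by (simp add: R_def)
    also have "\<dots> = \<bar>e k\<bar> *\<^sub>R (\<integral>v. ?c (0 + e k * v) * R k ((0 + e k * v) / e k) \<partial>lborel)"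
      using e(1)[of k] by (intro lborel_integral_real_affine) auto
    also have "\<dots> = (\<integral>v. of_real pi * (W k v * R k v) \<partial>lborel)"
    proof -
      have "complex_of_real (e k) * (?c (0 + e k * v) * R k ((0 + e k * v) / e k)) = of_real pi * (W k v * R k v)" for v
      proof -
        have "e k * (exp (- (e k * (e k * v))\<^sup>2) * (sqrt pi / e k * exp (- v\<^sup>2))) = pi * (exp (- (e k * (e k * v))\<^sup>2) * exp (- v\<^sup>2) / sqrt pi)"
          using e(1)[of k] by (simp add: field_simps)
        moreover have "e k * v / e k = v" using e(1)[of k] by simp
        ultimately have "complex_of_real (e k) * ?c (0 + e k * v) = of_real pi * W k v"
          unfolding W_def add_0_left of_real_mult[symmetric] by (simp only:)
        then show ?thesis using e(1)[of k] by (simp only: mult.assoc[symmetric]) simp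
      qed
      then show ?thesis
        by (simp only: scaleR_conv_of_real abs_of_pos[OF e(1)] integral_mult_right_zero[symmetric])
    qed
    finally show ?thesis using D
      by (simp add: mult_ac flip: integral_divide_zero integral_mult_right_zero)
  qed
  define Fk where "Fk = (\<lambda>k v \<kappa> Y. F \<kappa> (Y(d := e k * v)))"
  have Fk_smooth: "smooth (order_two D) (Fk k v)" for k v
    unfolding smooth_def
  proof (intro conjI allI impI)
    have sF: "smooth (order_two D) F" using nF by (simp add: nice_def)
    fix \<kappa> assume \<kappa>: "\<kappa> \<le> order_two D"
    show "continuous_on UNIV (Fk k v \<kappa>)" unfolding Fk_def
      by (rule continuous_on_compose2[OF smoothD(1)[OF sF \<kappa>]]) (auto simp del: fun_upd_apply intro!: continuous_on_fun_upd continuous_on_const continuous_on_id)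
    fix i Y assume i: "\<kappa> i < order_two D i"
    then have "i \<noteq> d" using D(2) by (auto simp: order_two_def split: if_splits)
    then show "((\<lambda>t. Fk k v \<kappa> (Y(i := t))) has_vector_derivative Fk k v (\<kappa>(i := Suc (\<kappa> i))) Y) (at (Y i))"
      using smoothD(2)[OF sF \<kappa> i, of "Y(d := e k * v)"] unfolding Fk_def fun_upd_twist[OF \<open>i \<noteq> d\<close>] by simp
  qed
  have Fk_bound: "jet_bound D (\<lambda>_. 1) (order_two D) (\<lambda>_. M) (Fk k v)" for k v
    unfolding jet_bound_def Fk_def using niceD[OF nF] by simp
  have R_tform: "R k v / of_real (pi ^ card D) = tform (\<lambda>_. 1) ds (cut (?h k) ds (Fk k v)) (cut (?h k) ds G)" for k v
  proof -
    have "tform (\<lambda>_. 1) ds (cut (?h k) ds (Fk k v)) (cut (?h k) ds G) = pairing D (cut (?h k) ds (Fk k v) ?z) (cut (?h k) ds G ?z) / of_real (pi ^ card D)"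
      unfolding ds(1)[symmetric]
      by (rule tform_cut[OF ds(2) _ order_two_le_3 _ _ M Fk_smooth[folded ds(1)] Fk_bound[folded ds(1)] _ _ h(1) h(2) h(1) h(2)])
        (use nG ds in \<open>auto simp: nice_def order_two_def\<close>)
    then show ?thesis unfolding cut_eq_gcut[OF ds(2)] ds(1) R_def g_def pairing_def Fk_def by simp
  qed
  have habs: "\<bar>?h k i\<bar> \<le> 1" for k i using h(1)[of k i] h(2)[of k i] by simp
  define N1 where "N1 = 4320 ^ length ds * M"
  define N2 where "N2 = 4320 ^ length ds * M'"
  have N: "0 \<le> N1" "0 \<le> N2" using M by (auto simp: N1_def N2_def)
  have cb: "jet_bound D (\<lambda>_. 1) (order_two D) (\<lambda>_. N1) (cut (?h k) ds (Fk k v))" "jet_bound D (\<lambda>_. 1) (order_two D) (\<lambda>_. N2) (cut (?h k) ds G)" for k v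
    unfolding N1_def N2_def using nG
    by (auto intro!: jet_bound_cut_uniform[OF _ order_two_le_3 _ habs ds(2)] Fk_bound M simp: nice_def)
  have cs: "smooth (order_two D) (cut (?h k) ds (Fk k v))" "smooth (order_two D) (cut (?h k) ds G)" for k v
    using nG order_two_le_3 by (auto intro!: smooth_cut Fk_smooth simp: nice_def)
  have R_lim: "(\<lambda>k. R k v / of_real (pi ^ card D)) \<longlonglongrightarrow> osc D (F ?z) (G ?z)" for v
  proof -
    define F0 where "F0 = (\<lambda>\<kappa> Y. F \<kappa> (Y(d := 0)))"
    have F0: "smooth (order_two D) F0" "jet_bound D (\<lambda>_. 1) (order_two D) (\<lambda>_. M) F0"
      using Fk_smooth[of 0 0] Fk_bound[of 0 0] by (auto simp: F0_def Fk_def)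
    have "(\<lambda>k. tform (\<lambda>_. 1) ds (cut (?h k) ds (Fk k v)) (cut (?h k) ds G)) \<longlonglongrightarrow> tform (\<lambda>_. 1) ds F0 G"
    proof (rule tform_tendsto[where \<mu>="order_two D" and M=N1 and M'=N2])
      show "(\<lambda>k. cut (?h k) ds (Fk k v) \<kappa> Y) \<longlonglongrightarrow> F0 \<kappa> Y" if "\<kappa> \<le> order_two D" for \<kappa> Y
      proof (rule cut_tendsto[OF h(3) _ that])
        fix \<kappa> :: "'i \<Rightarrow> nat" assume "\<kappa> \<le> order_two D"
        then have "isCont (F \<kappa>) (Y(d := 0))"
          using nF by (simp add: nice_def smooth_def continuous_on_eq_continuous_at)
        moreover have "(\<lambda>k. Y(d := e k * v)) \<longlonglongrightarrow> Y(d := 0)"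
        proof (rule tendsto_coordinatewise)
          fix i
          have "(\<lambda>k. e k * v) \<longlonglongrightarrow> 0 * v" by (intro tendsto_intros e)
          then show "(\<lambda>k. (Y(d := e k * v)) i) \<longlonglongrightarrow> (Y(d := 0)) i" by (cases "i = d") auto
        qed
        ultimately show "(\<lambda>k. Fk k v \<kappa> Y) \<longlonglongrightarrow> F0 \<kappa> Y" unfolding Fk_def F0_def by (rule isCont_tendsto_compose)
      qed
      show "(\<lambda>k. cut (?h k) ds G \<kappa> Y) \<longlonglongrightarrow> G \<kappa> Y" if "\<kappa> \<le> order_two D" for \<kappa> Y
        by (rule cut_tendsto[OF h(3) tendsto_const that])
    qed (use F0 nG cb cs N ds in \<open>auto simp: nice_def order_two_def\<close>)
    moreover have "tform (\<lambda>_. 1) ds F0 G = osc D (F0 ?z) (G ?z)"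
      using osc_eq_tform[OF ds(2), of "order_two D" "\<lambda>_. 1" M M' F0 G] F0 nG ds M order_two_le_3 by (simp add: nice_def order_two_def)
    \<comment> \<open>\<open>lborel_on D\<close> is concentrated on functions whose coordinate
      \<open>d\<close> is 0, so freezing this coordinate at 0 changes nothing under the
      integral.\<close>
    moreover have "osc D (F0 ?z) (G ?z) = osc D (F ?z) (G ?z)"
    proof -
      have z: "zero_ext D Y = (zero_ext D Y)(d := 0)" for Y :: "'i \<Rightarrow> real" using D(2) by (auto simp: zero_ext_def)
      have eq: "pairing D (\<lambda>Y. of_real (p Y) * F0 ?z Y) H = pairing D (\<lambda>Y. of_real (p Y) * F ?z Y) H"
        if [measurable]: "p \<in> borel_measurable borel" "H \<in> borel_measurable borel" for p H
      proof -
        have [measurable]: "ft D H \<in> borel_measurable borel" by (rule ft_measurable[OF D(1)]) measurable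
        have [measurable]: "F0 ?z \<in> borel_measurable borel" by (rule smooth_measurable[OF F0(1) le_zero_fun])
        have "F0 ?z (zero_ext D Y) = F ?z (zero_ext D Y)" for Y unfolding F0_def z[of Y, symmetric] ..
        then show ?thesis unfolding pairing_def by (simp add: integral_lborel_on)
      qed
      show ?thesis unfolding osc_def
        by (rule arg_cong[where f=lim], rule ext, rule arg_cong2[where f="(/)", OF _ refl], rule eq) measurable
    qed
    ultimately show ?thesis unfolding R_tform by simp
  qed
  define BR where "BR = N1 * N2 * (\<Prod>i\<in>D. C0)"
  have R_bound: "cmod (R k v / of_real (pi ^ card D)) \<le> BR" for k v
  proof -
    have "cmod (tform (\<lambda>_. 1) ds (cut (?h k) ds (Fk k v)) (cut (?h k) ds G)) \<le> N1 * N2 * (\<Prod>i\<in>set ds. C0 * 1)"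
      by (rule tform_bound[where \<mu>="order_two D" and s="\<lambda>_. 1"]) (use cb cs N ds in \<open>auto simp: order_two_def\<close>)
    then show ?thesis unfolding R_tform BR_def ds by simp
  qed
  have mR: "R k \<in> borel_measurable borel" for k
  proof -
    have "(\<lambda>(v, Y). (Y::'i\<Rightarrow>real)(d := e k * v)) = (\<lambda>(Y, t). Y(d := t)) \<circ> (\<lambda>(v, Y). (Y, e k * v))" by auto
    also have "\<dots> \<in> borel_measurable (borel \<Otimes>\<^sub>M borel)"
      by (rule measurable_comp[OF _ measurable_fun_upd_borel]) measurable
    finally have "(\<lambda>x. F ?z ((snd x)(d := e k * fst x))) \<in> borel_measurable (borel \<Otimes>\<^sub>M borel)"
      using measurable_compose[of "\<lambda>x. (snd x)(d := e k * fst x)" "borel \<Otimes>\<^sub>M borel" borel "F ?z"] by (simp add: case_prod_beta')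
    then have m: "(\<lambda>x. F ?z ((snd x)(d := e k * fst x))) \<in> borel_measurable ((borel :: real measure) \<Otimes>\<^sub>M lborel_on D)"
      by (simp add: measurable_cong_sets[OF sets_pair_measure_cong[OF refl sets_lborel_on] refl])
    show ?thesis unfolding R_def
    proof (rule zD.borel_measurable_lebesgue_integral)
      show "(\<lambda>(v, Y). ?E k Y * F ?z (Y(d := e k * v)) * g k Y) \<in> borel_measurable (borel \<Otimes>\<^sub>M lborel_on D)"
        unfolding case_prod_beta' by (intro borel_measurable_times m) measurable
    qed
  qed
  have "(\<lambda>k. \<integral>v. W k v * (R k v / of_real (pi ^ card D)) \<partial>lborel) \<longlonglongrightarrow> (\<integral>v. of_real (exp (- v\<^sup>2) / sqrt pi) * osc D (F ?z) (G ?z) \<partial>lborel)"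
  proof (rule integral_dominated_convergence[where w="\<lambda>v. exp (- v\<^sup>2) / sqrt pi * BR"])
    show "integrable lborel (\<lambda>v. exp (- v\<^sup>2) / sqrt pi * BR)"
      using integrable_exp_neg_square by simp
    show "AE v in lborel. (\<lambda>k. W k v * (R k v / of_real (pi ^ card D))) \<longlonglongrightarrow> of_real (exp (- v\<^sup>2) / sqrt pi) * osc D (F ?z) (G ?z)"
    proof (rule AE_I2, rule tendsto_mult[OF _ R_lim])
      fix v
      have "(\<lambda>k. exp (- (e k * (e k * v))\<^sup>2) * exp (- v\<^sup>2) / sqrt pi) \<longlonglongrightarrow> exp (- (0 * (0 * v))\<^sup>2) * exp (- v\<^sup>2) / sqrt pi"
        by (intro tendsto_intros e) simp
      then show "(\<lambda>k. W k v) \<longlonglongrightarrow> of_real (exp (- v\<^sup>2) / sqrt pi)" unfolding W_def by (intro tendsto_of_real) simp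
    qed
    show "AE v in lborel. cmod (W k v * (R k v / of_real (pi ^ card D))) \<le> exp (- v\<^sup>2) / sqrt pi * BR" for k
    proof (rule AE_I2)
      fix v
      have "exp (- (e k * (e k * v))\<^sup>2) * exp (- v\<^sup>2) / sqrt pi \<le> 1 * exp (- v\<^sup>2) / sqrt pi"
        by (intro divide_right_mono mult_right_mono) auto
      then have "cmod (W k v) \<le> exp (- v\<^sup>2) / sqrt pi" unfolding W_def norm_of_real by simp
      then show "cmod (W k v * (R k v / of_real (pi ^ card D))) \<le> exp (- v\<^sup>2) / sqrt pi * BR"
        unfolding norm_mult by (intro mult_mono R_bound) auto
    qed
    show "(\<lambda>v. W k v * (R k v / of_real (pi ^ card D))) \<in> borel_measurable lborel" for k
    proof -
      have "W k \<in> borel_measurable borel"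
        unfolding W_def by (intro borel_measurable_continuous_onI continuous_intros) auto
      then show ?thesis using mR[of k] by simp
    qed
    have "continuous_on UNIV (\<lambda>v. of_real (exp (- v\<^sup>2) / sqrt pi) * osc D (F ?z) (G ?z))"
      by (intro continuous_intros) auto
    then show "(\<lambda>v. of_real (exp (- v\<^sup>2) / sqrt pi) * osc D (F ?z) (G ?z)) \<in> borel_measurable lborel"
      by (simp add: borel_measurable_continuous_onI)
  qed
  also have "(\<integral>v. of_real (exp (- v\<^sup>2) / sqrt pi) * osc D (F ?z) (G ?z) \<partial>lborel) = osc D (F ?z) (G ?z)"
  proof -
    have "(\<integral>v. complex_of_real (exp (- v\<^sup>2) / sqrt pi) \<partial>lborel) = of_real (\<integral>v. exp (- v\<^sup>2) / sqrt pi \<partial>lborel)"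
      by (rule integral_complex_of_real)
    also have "(\<integral>v. exp (- v\<^sup>2) / sqrt pi \<partial>lborel) = 1" by (simp add: integral_exp_neg_square)
    finally show ?thesis by simp
  qed
  finally have "(\<lambda>k. pairing ?I (\<lambda>Z. gcut ?I (?h k) Z * F ?z Z) (\<lambda>Z. gcut ?I (?h k) Z * G ?z Z) / of_real (pi ^ card ?I)) \<longlonglongrightarrow> osc D (F ?z) (G ?z)"
    unfolding Pk .
  moreover have "(\<lambda>k. pairing ?I (\<lambda>Z. gcut ?I (?h k) Z * F ?z Z) (\<lambda>Z. gcut ?I (?h k) Z * G ?z Z) / of_real (pi ^ card ?I)) \<longlonglongrightarrow> osc ?I (F ?z) (G ?z)"
    using D by (intro osc_tendsto[OF _ F G h h]) auto
  ultimately show ?thesis by (rule LIMSEQ_unique[symmetric])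
qed

section \<open>Bounds uniform in the dimension and the Taylor remainder\<close>

lemma mean_value_bound_01:
  fixes f :: "real \<Rightarrow> complex"
  assumes "\<And>r. (f has_vector_derivative f' r) (at r)" "\<And>r. 0 \<le> r \<Longrightarrow> r \<le> 1 \<Longrightarrow> cmod (f' r) \<le> B"
  shows "cmod (f 1 - f 0) \<le> B"
proof -
  have "norm (f 1 - f 0) \<le> B * norm (1 - 0 :: real)"
  proof (rule differentiable_bound[of "{0..1}" f "\<lambda>r h. h *\<^sub>R f' r"])
    show "(f has_derivative (\<lambda>h. h *\<^sub>R f' r)) (at r within {0..1})" for r
      using has_vector_derivative_at_within[OF assms(1)] by (simp add: has_vector_derivative_def)
    show "onorm (\<lambda>h. h *\<^sub>R f' r) \<le> B" if "r \<in> {0..1}" for r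
      by (rule onorm_le)
        (use assms(2)[of r] that in \<open>simp only: norm_scaleR mult.commute[of B] real_norm_def mult_left_mono abs_ge_zero atLeastAtMost_iff\<close>)
  qed auto
  then show ?thesis by simp
qed

text \<open>A direction with scale \<open>\<bar>s\<^sub>d\<bar> \<le> 1\<close> costs only a factor \<open>1 + O(\<bar>s\<^sub>d\<bar>)\<close>: at \<open>s\<^sub>d = 0\<close> the direction drops out, and
  the derivative in the scale is bounded. This makes the constant independent of the dimension.\<close>

lemma osc_bound_improved:
  fixes F G :: "'i::countable jet"
  assumes "finite J" "finite D" "J \<subseteq> D" "nice D \<mu> M F" "nice D \<mu> M' G"
    and "\<And>d. d \<in> D \<Longrightarrow> 2 \<le> \<mu> d" "\<And>d. d \<in> J \<Longrightarrow> 3 \<le> \<mu> d" "\<And>d. d \<in> J \<Longrightarrow> \<bar>s d\<bar> \<le> 1"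
    and "\<And>d. d \<notin> D \<Longrightarrow> s d = 0"
  shows "cmod (osc D (F (\<lambda>_. 0)) (rescale D b s G (\<lambda>_. 0))) \<le>
    M * M' * (\<Prod>d\<in>D. if d \<in> J then 1 + C0 / 2 * \<bar>s d\<bar> else C0 * max 1 (sqrt \<bar>s d\<bar>))"
  using assms
proof (induction J arbitrary: D \<mu> F G s rule: finite_induct)
  case empty
  have t2: "order_two D \<le> \<mu>" by (rule order_two_le) (use empty in auto)
  have "cmod (osc D (F (\<lambda>_. 0)) (rescale D b s G (\<lambda>_. 0))) \<le> M * M' * (\<Prod>d\<in>D. C0 * max 1 (sqrt \<bar>s d\<bar>))"
  proof (rule osc_bound[OF empty(1) nice_mono[OF empty(3) t2]])
    have G: "nice D (order_two D) M' G" by (rule nice_mono[OF empty(4) t2])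
    then show "smooth (order_two D) (rescale D b s G)" using empty(1) by (auto simp: nice_def intro!: smooth_rescale order_two_off)
    show "jet_bound D (\<lambda>d. \<bar>s d\<bar>) (order_two D) (\<lambda>_. M') (rescale D b s G)"
      using jet_bound_rescale[of D "\<lambda>_. 1" "order_two D" M' G s b] G by (simp add: nice_def)
  qed (use empty in \<open>auto simp: nice_def\<close>)
  then show ?case by simp
next
  case (insert j J)
  note D = \<open>finite D\<close> and jD = \<open>insert j J \<subseteq> D\<close> and F = \<open>nice D \<mu> M F\<close> and G = \<open>nice D \<mu> M' G\<close>
  note mu2 = insert.prems(5) and mu3 = insert.prems(6) and s1 = insert.prems(7) and s0 = insert.prems(8)
  have j: "j \<in> D" "j \<notin> J" "\<bar>s j\<bar> \<le> 1" "3 \<le> \<mu> j" using jD insert.hyps s1 mu3 by auto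
  define D' where "D' = D - {j}"
  have D': "D = insert j D'" "j \<notin> D'" "finite D'" using j D by (auto simp: D'_def)
  define p where "p = s(j := 0)"
  define q where "q = (\<lambda>i. if i = j then s j else 0)"
  let ?z = "\<lambda>_::'i. 0::nat"
  define P where "P = (\<Prod>d\<in>D'. if d \<in> J then 1 + C0 / 2 * \<bar>s d\<bar> else C0 * max 1 (sqrt \<bar>s d\<bar>))"
  have P0: "0 \<le> P" unfolding P_def using C0_nonneg by (intro prod_nonneg) auto
  have M: "0 \<le> M" "0 \<le> M'" using F G by (auto simp: nice_def)
  let ?f = "\<lambda>r. osc D (F ?z) (rescale D b (\<lambda>i. p i + r * q i) G ?z)"
  have s_eq: "(\<lambda>i. p i + 1 * q i) = s" "(\<lambda>i. p i + 0 * q i) = p" by (auto simp: p_def q_def)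
  \<comment> \<open>Differentiating in the scale uses up one order in direction \<open>j\<close>. At
    least two remain, which is enough because \<open>j\<close> is outside the \<open>J\<close> of
    the induction hypothesis.\<close>
  define \<nu> where "\<nu> = \<mu>(j := \<mu> j - 1)"
  have nu: "\<nu>(j := Suc (\<nu> j)) \<le> \<mu>" using j by (simp add: \<nu>_def le_fun_def)
  have D_bound: "cmod (\<Sum>d\<in>D. of_real (q d) / (2 * \<i>) * osc D (shift d F ?z) (rescale D b (\<lambda>i. p i + r * q i) (shift d G) ?z))
     \<le> \<bar>s j\<bar> / 2 * (M * M' * (C0 * P))" if r: "0 \<le> r" "r \<le> 1" for r
  proof -
    have "(\<Sum>d\<in>D. of_real (q d) / (2 * \<i>) * osc D (shift d F ?z) (rescale D b (\<lambda>i. p i + r * q i) (shift d G) ?z))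
      = of_real (s j) / (2 * \<i>) * osc D (shift j F ?z) (rescale D b (\<lambda>i. p i + r * q i) (shift j G) ?z)"
      using D'(2,3) unfolding D'(1) by (subst sum.insert) (auto simp: q_def intro!: sum.neutral)
    moreover have "cmod (osc D (shift j F ?z) (rescale D b (\<lambda>i. p i + r * q i) (shift j G) ?z)) \<le> M * M' * (C0 * P)"
    proof -
      have "cmod (osc D (shift j F ?z) (rescale D b (\<lambda>i. p i + r * q i) (shift j G) ?z)) \<le>
        M * M' * (\<Prod>d\<in>D. if d \<in> J then 1 + C0 / 2 * \<bar>p d + r * q d\<bar> else C0 * max 1 (sqrt \<bar>p d + r * q d\<bar>))"
      proof (rule insert.IH[where \<mu>=\<nu>, OF D _ nice_shift[OF F nu] nice_shift[OF G nu]])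
        show "J \<subseteq> D" using jD by auto
        show "2 \<le> \<nu> d" if "d \<in> D" for d using mu2[OF that] j by (auto simp: \<nu>_def)
        show "3 \<le> \<nu> d" if "d \<in> J" for d using mu3[of d] j that by (auto simp: \<nu>_def)
        show "\<bar>p d + r * q d\<bar> \<le> 1" if "d \<in> J" for d using s1[of d] j that by (auto simp: p_def q_def)
        show "p d + r * q d = 0" if "d \<notin> D" for d using s0[OF that] j that by (auto simp: p_def q_def)
      qed
      \<comment> \<open>Direction \<open>j\<close> gets the crude factor here, and this is exactly
        \<open>C0\<close> because |r s_j| \<le> 1.\<close>
      also have "(\<Prod>d\<in>D. if d \<in> J then 1 + C0 / 2 * \<bar>p d + r * q d\<bar> else C0 * max 1 (sqrt \<bar>p d + r * q d\<bar>)) = C0 * P"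
      proof -
        have "\<bar>r * s j\<bar> \<le> 1" using r j(3) by (simp add: abs_mult mult_le_one)
        then have "max 1 (sqrt \<bar>r * s j\<bar>) = 1" by simp
        moreover have "(\<Prod>d\<in>D'. if d \<in> J then 1 + C0 / 2 * \<bar>p d + r * q d\<bar> else C0 * max 1 (sqrt \<bar>p d + r * q d\<bar>)) = P"
          unfolding P_def by (intro prod.cong) (auto simp: p_def q_def D'_def)
        ultimately show ?thesis unfolding D'(1) using D'(2,3) j(2)
          by (subst prod.insert) (auto simp: p_def q_def)
      qed
      finally show ?thesis .
    qed
    ultimately show ?thesis by (simp add: norm_mult norm_divide mult_left_mono)
  qed
  have "cmod (?f 1 - ?f 0) \<le> \<bar>s j\<bar> / 2 * (M * M' * (C0 * P))"
  proof (rule mean_value_bound_01[OF osc_deriv D_bound])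
    show "finite D" "nice D \<mu> M F" "nice D \<mu> M' G" by fact+
    show "2 \<le> \<mu> d" if "d \<in> D" for d using mu2 that .
    show "3 \<le> \<mu> d" if "q d \<noteq> 0" for d using that j by (auto simp: q_def split: if_splits)
    show "q d = 0" if "d \<notin> D" for d using that j by (auto simp: q_def)
  qed
  \<comment> \<open>At scale 0 the direction \<open>j\<close> drops out and the induction hypothesis
    is used with one variable fewer; hence \<open>D\<close> is generalised in the induction.\<close>
  moreover have "cmod (?f 0) \<le> M * M' * P"
  proof -
    have t2: "order_two (insert j D') \<le> \<mu>" unfolding D'(1)[symmetric] by (rule order_two_le[OF mu2])
    have z: "rescale D b p H ?z = rescale D' b p H ?z" for H by (simp add: rescale_def)
    have "osc D (F ?z) (rescale D b p G ?z) = osc D' (F ?z) (rescale D b p G ?z)"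
      unfolding D'(1)
    proof (rule osc_drop[OF D'(3,2)])
      show "nice (insert j D') (order_two (insert j D')) M F" using nice_mono[OF F, of "order_two (insert j D')"] t2 unfolding D'(1) by simp
      have "nice (insert j D') (order_two (insert j D')) M' G" using nice_mono[OF G, of "order_two (insert j D')"] t2 unfolding D'(1) by simp
      then show "nice (insert j D') (order_two (insert j D')) (M' * (\<Prod>i\<in>insert j D'. max 1 \<bar>p i\<bar> ^ order_two (insert j D') i)) (rescale (insert j D') b p G)"
        using D' by (intro nice_rescale order_two_off order_refl) auto
      show "rescale (insert j D') b p G ?z (Y(j := t)) = rescale (insert j D') b p G ?z Y" for Y t
        unfolding rescale_zero by (rule arg_cong[where f="G ?z"]) (auto simp: p_def)
    qed
    then have "?f 0 = osc D' (F ?z) (rescale D' b p G ?z)" unfolding s_eq z[symmetric] by simp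
    moreover have "cmod (osc D' (F ?z) (rescale D' b p G ?z)) \<le> M * M' * (\<Prod>d\<in>D'. if d \<in> J then 1 + C0 / 2 * \<bar>p d\<bar> else C0 * max 1 (sqrt \<bar>p d\<bar>))"
    proof (rule insert.IH[OF D'(3), where \<mu>=\<mu>])
      show "J \<subseteq> D'" using jD j by (auto simp: D'_def)
      show "nice D' \<mu> M F" "nice D' \<mu> M' G" using F G by (auto simp: nice_def jet_bound_def)
      show "2 \<le> \<mu> d" if "d \<in> D'" for d using mu2 that by (auto simp: D'_def)
      show "3 \<le> \<mu> d" if "d \<in> J" for d using mu3 that by auto
      show "\<bar>p d\<bar> \<le> 1" if "d \<in> J" for d using s1[of d] that by (auto simp: p_def)
      show "p d = 0" if "d \<notin> D'" for d using s0[of d] that by (auto simp: p_def D'_def)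
    qed
    moreover have "(\<Prod>d\<in>D'. if d \<in> J then 1 + C0 / 2 * \<bar>p d\<bar> else C0 * max 1 (sqrt \<bar>p d\<bar>)) = P"
      unfolding P_def by (intro prod.cong) (auto simp: p_def D'_def)
    ultimately show ?thesis by simp
  qed
  ultimately have "cmod (?f 1) \<le> M * M' * P + \<bar>s j\<bar> / 2 * (M * M' * (C0 * P))"
    using norm_triangle_ineq[of "?f 0" "?f 1 - ?f 0"] by simp
  also have "\<dots> = M * M' * ((1 + C0 / 2 * \<bar>s j\<bar>) * P)" by (simp add: algebra_simps)
  also have "(1 + C0 / 2 * \<bar>s j\<bar>) * P = (\<Prod>d\<in>D. if d \<in> insert j J then 1 + C0 / 2 * \<bar>s d\<bar> else C0 * max 1 (sqrt \<bar>s d\<bar>))"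
  proof -
    have "(\<Prod>d\<in>D'. if d \<in> insert j J then 1 + C0 / 2 * \<bar>s d\<bar> else C0 * max 1 (sqrt \<bar>s d\<bar>)) = P"
      unfolding P_def by (intro prod.cong) (auto simp: D'_def)
    then show ?thesis unfolding D'(1) using D'(2,3) by (subst prod.insert) auto
  qed
  finally show ?case unfolding s_eq .
qed

definition cfac :: "real \<Rightarrow> real" where
  "cfac x = (if x \<le> 1 then 1 + C0 / 2 * x else C0 * sqrt x)"

definition K0 :: real where "K0 = 1 + C0 + C0\<^sup>2"

lemma K0_pos: "0 < K0"
  using C0_nonneg by (simp add: K0_def add_pos_nonneg)

text \<open>The two variables of an index have equal scales, so their factors combine to a square:
  the square root valid for large x becomes linear. In \<open>K0\<close>, for x \<le> 1 the summand
  \<open>C0\<close> pays for the cross term of (1 + C0 x / 2)^2 and C0^2 for its quadratic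
  term.\<close>

lemma cfac_square_le: "0 \<le> x \<Longrightarrow> (cfac x)\<^sup>2 \<le> 1 + K0 * x"
proof (cases "x \<le> 1")
  case True
  assume x: "0 \<le> x"
  have "(cfac x)\<^sup>2 = 1 + C0 * x + C0\<^sup>2 / 4 * (x * x)" using True by (simp add: cfac_def power2_eq_square algebra_simps)
  also have "\<dots> \<le> 1 + C0 * x + C0\<^sup>2 / 4 * x" using True x by (intro add_left_mono mult_left_mono mult_left_le) auto
  also have "\<dots> \<le> 1 + C0 * x + C0\<^sup>2 * x + x" using x by (intro order_trans[OF _ add_increasing2[OF x order_refl]] add_left_mono mult_right_mono) auto
  finally show ?thesis by (simp add: K0_def algebra_simps)
next
  case False
  then have "(cfac x)\<^sup>2 = C0\<^sup>2 * x" by (simp add: cfac_def power_mult_distrib)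
  also have "\<dots> \<le> K0 * x" using False C0_nonneg by (intro mult_right_mono) (auto simp: K0_def)
  finally show ?thesis by simp
qed

lemma osc_main_bound:
  fixes F G :: "'i::countable jet"
  assumes D: "finite D" and F: "nice D \<mu> M F" and G: "nice D \<mu> M' G"
    and mu: "\<And>d. d \<in> D \<Longrightarrow> 3 \<le> \<mu> d" and s: "\<And>d. d \<notin> D \<Longrightarrow> s d = 0"
  shows "cmod (osc D (F (\<lambda>_. 0)) (rescale D b s G (\<lambda>_. 0))) \<le> M * M' * (\<Prod>d\<in>D. cfac \<bar>s d\<bar>)"
proof -
  define J where "J = {d\<in>D. \<bar>s d\<bar> \<le> 1}"
  have "cmod (osc D (F (\<lambda>_. 0)) (rescale D b s G (\<lambda>_. 0))) \<le>
    M * M' * (\<Prod>d\<in>D. if d \<in> J then 1 + C0 / 2 * \<bar>s d\<bar> else C0 * max 1 (sqrt \<bar>s d\<bar>))"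
    by (rule osc_bound_improved[OF _ D _ F G]) (use D mu s in \<open>auto simp: J_def intro: order_trans[of 2 3]\<close>)
  also have "(\<Prod>d\<in>D. if d \<in> J then 1 + C0 / 2 * \<bar>s d\<bar> else C0 * max 1 (sqrt \<bar>s d\<bar>)) = (\<Prod>d\<in>D. cfac \<bar>s d\<bar>)"
    by (intro prod.cong) (auto simp: J_def cfac_def max_def)
  finally show ?thesis .
qed

section \<open>Taylor expansion in the overall scale\<close>

lemma osc_const:
  fixes F G :: "'i::countable jet"
  assumes "finite D" "nice D (order_two D) M F" "nice D (order_two D) M' G" "\<And>Y. G (\<lambda>_. 0) Y = c"
  shows "osc D (F (\<lambda>_. 0)) (G (\<lambda>_. 0)) = F (\<lambda>_. 0) (\<lambda>_. 0) * c"
  using assms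
proof (induction D rule: finite_induct)
  case empty
  then show ?case by (subst osc_empty) (auto intro: nice_measurable le_zero_fun)
next
  case (insert d D)
  have le: "order_two D \<le> order_two (insert d D)" by (simp add: order_two_def le_fun_def)
  have n: "nice D (order_two D) M F" "nice D (order_two D) M' G"
    using nice_mono[OF insert.prems(1) le] nice_mono[OF insert.prems(2) le] by (auto simp: nice_def jet_bound_def)
  have "osc (insert d D) (F (\<lambda>_. 0)) (G (\<lambda>_. 0)) = osc D (F (\<lambda>_. 0)) (G (\<lambda>_. 0))"
    using insert.prems by (intro osc_drop[OF insert.hyps]) auto
  then show ?case using insert.IH[OF n insert.prems(3)] by simp
qed

text \<open>The \<open>k\<close>-th derivative of \<open>r \<mapsto> osc F (G(b + r s \<cdot>))\<close>.\<close>

primrec taylor_term :: "'i set \<Rightarrow> ('i \<Rightarrow> real) \<Rightarrow> ('i \<Rightarrow> real) \<Rightarrow> nat \<Rightarrow> 'i::countable jet \<Rightarrow> 'i jet \<Rightarrow> real \<Rightarrow> complex" where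
  "taylor_term D b s 0 F G r = osc D (F (\<lambda>_. 0)) (rescale D b (\<lambda>i. r * s i) G (\<lambda>_. 0))"
| "taylor_term D b s (Suc k) F G r = (\<Sum>d\<in>D. of_real (s d) / (2 * \<i>) * taylor_term D b s k (shift d F) (shift d G) r)"

text \<open>The k-th power of the constant coefficient operator that sums \<open>s d\<close> times
  the mixed derivative in \<open>Y d\<close> and \<open>Z d\<close>, applied to the product of F at
  Y and G at Z.\<close>

primrec coupling :: "'i set \<Rightarrow> ('i \<Rightarrow> real) \<Rightarrow> nat \<Rightarrow> 'i jet \<Rightarrow> 'i jet \<Rightarrow> ('i \<Rightarrow> real) \<Rightarrow> ('i \<Rightarrow> real) \<Rightarrow> complex" where
  "coupling D s 0 F G Y Z = F (\<lambda>_. 0) Y * G (\<lambda>_. 0) Z"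
| "coupling D s (Suc k) F G Y Z = (\<Sum>d\<in>D. of_real (s d) * coupling D s k (shift d F) (shift d G) Y Z)"

definition ord :: "'i set \<Rightarrow> nat \<Rightarrow> 'i \<Rightarrow> nat" where
  "ord D k = (\<lambda>i. if i \<in> D then k else 0)"

context
  fixes D :: "'i::countable set" and s :: "'i \<Rightarrow> real"
  assumes D: "finite D" and s: "\<And>d. d \<notin> D \<Longrightarrow> s d = 0"
begin

lemma ord_upd: "d \<in> D \<Longrightarrow> (ord D k)(d := Suc (ord D k d)) \<le> ord D (Suc k)"
  by (simp add: ord_def le_fun_def)

lemma nice_shift_ord: "d \<in> D \<Longrightarrow> nice D (ord D (Suc k)) M A \<Longrightarrow> nice D (ord D k) M (shift d A)"
  by (rule nice_shift[OF _ ord_upd])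

lemma taylor_term_deriv:
  assumes "nice D (ord D (k + 3)) M F" "nice D (ord D (k + 3)) M' G"
  shows "(taylor_term D b s k F G has_vector_derivative taylor_term D b s (Suc k) F G r) (at r)"
  using assms
proof (induction k arbitrary: F G)
  case 0
  have "((\<lambda>r. osc D (F (\<lambda>_. 0)) (rescale D b (\<lambda>i. 0 + r * s i) G (\<lambda>_. 0))) has_vector_derivative
    (\<Sum>d\<in>D. of_real (s d) / (2 * \<i>) * osc D (shift d F (\<lambda>_. 0)) (rescale D b (\<lambda>i. 0 + r * s i) (shift d G) (\<lambda>_. 0)))) (at r)"
    using 0 by (intro osc_deriv[OF D]) (auto simp: ord_def s)
  moreover have "taylor_term D b s 0 F G = (\<lambda>r. osc D (F (\<lambda>_. 0)) (rescale D b (\<lambda>i. 0 + r * s i) G (\<lambda>_. 0)))" by (rule ext) simp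
  ultimately show ?case by simp
next
  case (Suc k)
  have "((\<lambda>r. \<Sum>d\<in>D. of_real (s d) / (2 * \<i>) * taylor_term D b s k (shift d F) (shift d G) r) has_vector_derivative
     (\<Sum>d\<in>D. of_real (s d) / (2 * \<i>) * taylor_term D b s (Suc k) (shift d F) (shift d G) r)) (at r)"
    using Suc.prems by (intro has_vector_derivative_sum has_vector_derivative_mult_right Suc.IH) (auto intro!: nice_shift_ord)
  moreover have "taylor_term D b s (Suc k) F G = (\<lambda>r. \<Sum>d\<in>D. of_real (s d) / (2 * \<i>) * taylor_term D b s k (shift d F) (shift d G) r)"
    by (rule ext) simp
  ultimately show ?case by (simp only: taylor_term.simps)
qed

lemma taylor_term_bound:
  assumes "nice D (ord D (k + 3)) M F" "nice D (ord D (k + 3)) M' G"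
  shows "cmod (taylor_term D b s k F G r) \<le> ((\<Sum>d\<in>D. \<bar>s d\<bar>) / 2) ^ k * (M * M' * (\<Prod>d\<in>D. cfac \<bar>r * s d\<bar>))"
  using assms
proof (induction k arbitrary: F G)
  case 0
  then show ?case using osc_main_bound[OF D, of "ord D 3" M F M' G "\<lambda>i. r * s i" b] by (simp add: ord_def s)
next
  case (Suc k)
  let ?B = "((\<Sum>d\<in>D. \<bar>s d\<bar>) / 2) ^ k * (M * M' * (\<Prod>d\<in>D. cfac \<bar>r * s d\<bar>))"
  have "cmod (taylor_term D b s (Suc k) F G r) \<le> (\<Sum>d\<in>D. \<bar>s d\<bar> / 2 * ?B)"
    unfolding taylor_term.simps
  proof (rule sum_norm_le)
    fix d assume d: "d \<in> D"
    have "cmod (taylor_term D b s k (shift d F) (shift d G) r) \<le> ?B"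
      using Suc.prems d by (intro Suc.IH) (auto intro!: nice_shift_ord)
    then show "cmod (of_real (s d) / (2 * \<i>) * taylor_term D b s k (shift d F) (shift d G) r) \<le> \<bar>s d\<bar> / 2 * ?B"
      by (simp add: norm_mult norm_divide mult_left_mono)
  qed
  also have "\<dots> = (\<Sum>d\<in>D. \<bar>s d\<bar>) / 2 * ?B" by (simp flip: sum_distrib_right sum_divide_distrib)
  finally show ?case by (simp add: mult.assoc)
qed

text \<open>At r = 0 the second factor is frozen at \<open>b\<close>, and integrating against a
  constant evaluates the first factor at the origin.\<close>

lemma taylor_term_zero:
  assumes "nice D (ord D (k + 2)) M F" "nice D (ord D (k + 2)) M' G"
  shows "taylor_term D b s k F G 0 = coupling D s k F G (\<lambda>_. 0) b / (2 * \<i>) ^ k"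
  using assms
proof (induction k arbitrary: F G)
  case 0
  have o: "ord D 2 = order_two D" by (simp add: ord_def order_two_def)
  have n: "nice D (order_two D) (M' * (\<Prod>i\<in>D. max 1 0 ^ order_two D i)) (rescale D b (\<lambda>_. 0) G)"
    using 0 unfolding add_0 o by (intro nice_rescale D order_two_off) auto
  have "osc D (F (\<lambda>_. 0)) (rescale D b (\<lambda>_. 0) G (\<lambda>_. 0)) = F (\<lambda>_. 0) (\<lambda>_. 0) * G (\<lambda>_. 0) b"
    using 0 unfolding add_0 o by (intro osc_const[OF D _ n]) (auto simp: rescale_zero)
  then show ?case by simp
next
  case (Suc k)
  have "taylor_term D b s k (shift d F) (shift d G) 0 = coupling D s k (shift d F) (shift d G) (\<lambda>_. 0) b / (2 * \<i>) ^ k" if "d \<in> D" for d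
    using Suc.prems that by (intro Suc.IH) (auto intro!: nice_shift_ord)
  then show ?case by (simp add: sum_divide_distrib mult.commute)
qed

lemma taylor_remainder_bound:
  assumes F: "nice D (ord D (N + 3)) M F" and G: "nice D (ord D (N + 3)) M' G"
    and B: "\<And>r. 0 \<le> r \<Longrightarrow> r \<le> 1 \<Longrightarrow> (\<Prod>d\<in>D. cfac \<bar>r * s d\<bar>) \<le> B"
  shows "cmod (osc D (F (\<lambda>_. 0)) (rescale D b s G (\<lambda>_. 0)) - (\<Sum>k<N. coupling D s k F G (\<lambda>_. 0) b / ((2 * \<i>) ^ k * fact k)))
    \<le> ((\<Sum>d\<in>D. \<bar>s d\<bar>) / 2) ^ N / fact N * (M * M' * B)"
proof -
  have M: "0 \<le> M" "0 \<le> M'" using F G by (auto simp: nice_def)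
  define S where "S = ((\<Sum>d\<in>D. \<bar>s d\<bar>) / 2)"
  have S: "0 \<le> S" unfolding S_def by (intro divide_nonneg_pos sum_nonneg) auto
  have tb: "cmod (taylor_term D b s N F G r) \<le> S ^ N * (M * M' * B)" if "0 \<le> r" "r \<le> 1" for r
  proof -
    have "cmod (taylor_term D b s N F G r) \<le> S ^ N * (M * M' * (\<Prod>d\<in>D. cfac \<bar>r * s d\<bar>))"
      unfolding S_def by (rule taylor_term_bound[OF F G])
    also have "\<dots> \<le> S ^ N * (M * M' * B)"
      using M S by (intro mult_left_mono B that mult_nonneg_nonneg zero_le_power)
    finally show ?thesis .
  qed
  have one: "osc D (F (\<lambda>_. 0)) (rescale D b s G (\<lambda>_. 0)) = taylor_term D b s 0 F G 1" by simp
  have le: "nice D (ord D (k + 3)) M F" "nice D (ord D (k + 3)) M' G" "nice D (ord D (k + 2)) M F" "nice D (ord D (k + 2)) M' G" if "k \<le> N" for k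
    using that by (auto intro!: nice_mono[OF F] nice_mono[OF G] simp: ord_def le_fun_def)
  show ?thesis
  \<comment> \<open>The integral form of the remainder contains (1 - x)^(N - 1) and starts at N = 1.
    The case N = 0 is the plain bound of the integral and will give the composition
    constant.\<close>
  proof (cases "N = 0")
    case True
    then show ?thesis using tb[of 1] by simp
  next
    case False
    let ?i = "\<lambda>x. ((1 - x) ^ (N - 1) / fact (N - 1)) *\<^sub>R taylor_term D b s N F G x"
    have I: "(?i has_integral taylor_term D b s 0 F G 1 - (\<Sum>i<N. ((1 - 0) ^ i / fact i) *\<^sub>R taylor_term D b s i F G 0)) {0..1}"
    proof (rule Taylor_has_integral)
      fix m t assume "m < N"
      then show "(taylor_term D b s m F G has_vector_derivative taylor_term D b s (Suc m) F G t) (at t within {0..1})"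
        using le[of m] by (intro has_vector_derivative_at_within[OF taylor_term_deriv]) auto
    qed (use False in auto)
    \<comment> \<open>The weight of the integral remainder has total mass
      \<open>1 / fact N\<close>.\<close>
    have J: "((\<lambda>x. ((1 - x) ^ (N - 1) / fact (N - 1)) *\<^sub>R (S ^ N * (M * M' * B))) has_integral (1 / fact N) *\<^sub>R (S ^ N * (M * M' * B))) {0..1}"
    proof (rule has_integral_scaleR_left)
      have "((\<lambda>x. (1 - x) ^ (N - 1) / fact (N - 1)) has_integral (- ((1 - 1) ^ N / fact N) - - ((1 - 0) ^ N / fact N))) {0..1::real}"
      proof (rule fundamental_theorem_of_calculus)
        fix x :: real assume "x \<in> {0..1}"
        have "fact N = real N * fact (N - 1)" using False by (simp add: fact_reduce)
        then show "((\<lambda>x. - ((1 - x) ^ N / fact N)) has_vector_derivative (1 - x) ^ (N - 1) / fact (N - 1)) (at x within {0..1})"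
          using False unfolding has_real_derivative_iff_has_vector_derivative[symmetric]
          by (auto intro!: derivative_eq_intros simp: field_simps)
      qed simp
      then show "((\<lambda>x. (1 - x) ^ (N - 1) / fact (N - 1)) has_integral 1 / fact N) {0..1::real}" using False by (simp add: power_0_left)
    qed
    have "cmod (taylor_term D b s 0 F G 1 - (\<Sum>i<N. ((1 - 0) ^ i / fact i) *\<^sub>R taylor_term D b s i F G 0)) \<le> (1 / fact N) *\<^sub>R (S ^ N * (M * M' * B))"
      unfolding integral_unique[OF I, symmetric] integral_unique[OF J, symmetric]
    proof (rule integral_norm_bound_integral)
      show "?i integrable_on {0..1}" using I by (rule has_integral_integrable)
      show "(\<lambda>x. ((1 - x) ^ (N - 1) / fact (N - 1)) *\<^sub>R (S ^ N * (M * M' * B))) integrable_on {0..1}" using J by (rule has_integral_integrable)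
      fix x :: real assume x: "x \<in> {0..1}"
      then show "cmod (?i x) \<le> ((1 - x) ^ (N - 1) / fact (N - 1)) *\<^sub>R (S ^ N * (M * M' * B))"
        using tb[of x] unfolding norm_scaleR real_scaleR_def by (intro mult_mono) auto
    qed
    moreover have "(\<Sum>i<N. ((1 - 0) ^ i / fact i) *\<^sub>R taylor_term D b s i F G 0) = (\<Sum>k<N. coupling D s k F G (\<lambda>_. 0) b / ((2 * \<i>) ^ k * fact k))"
    proof (rule sum.cong[OF refl])
      fix k assume "k \<in> {..<N}"
      then have "taylor_term D b s k F G 0 = coupling D s k F G (\<lambda>_. 0) b / (2 * \<i>) ^ k" using le[of k] by (intro taylor_term_zero) auto
      then show "((1 - 0) ^ k / fact k) *\<^sub>R taylor_term D b s k F G 0 = coupling D s k F G (\<lambda>_. 0) b / ((2 * \<i>) ^ k * fact k)"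
        by (simp add: scaleR_conv_of_real)
    qed
    ultimately show ?thesis unfolding one S_def by simp
  qed
qed

end

section \<open>Symbols as jets\<close>

text \<open>For a countable index type, Borel measurability into the product space can be checked
  coordinate by coordinate.\<close>

instance direction :: countable
  by countable_datatype

definition dirs :: "nat \<Rightarrow> direction set" where
  "dirs n = Pos ` {..<n} \<union> Mom ` {..<n}"

text \<open>The order is that of \<open>multi_index\<close>, so that
  \<open>word (dir_list n)\<close> reproduces its lists literally.\<close>

definition dir_list :: "nat \<Rightarrow> direction list" where
  "dir_list n = map Pos [0..<n] @ map Mom [0..<n]"

definition phase_point :: "nat \<Rightarrow> (direction \<Rightarrow> real) \<Rightarrow> point" where
  "phase_point n Y = ((\<lambda>j\<in>{..<n}. Y (Pos j)), (\<lambda>j\<in>{..<n}. Y (Mom j)))"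

definition word :: "direction list \<Rightarrow> (direction \<Rightarrow> nat) \<Rightarrow> direction list" where
  "word ds \<kappa> = concat (map (\<lambda>d. replicate (\<kappa> d) d) ds)"

definition jet_of :: "nat \<Rightarrow> symbol \<Rightarrow> direction jet" where
  "jet_of n A = (\<lambda>\<kappa> Y. partials (word (dir_list n) \<kappa>) A (phase_point n Y))"

definition dir_weight :: "(nat \<Rightarrow> real) \<Rightarrow> (nat \<Rightarrow> real) \<Rightarrow> direction \<Rightarrow> real" where
  "dir_weight \<rho> \<delta> d = (case d of Pos j \<Rightarrow> \<rho> j | Mom j \<Rightarrow> \<delta> j)"

lemma finite_dirs [simp]: "finite (dirs n)"
  by (simp add: dirs_def)

lemma set_dir_list: "set (dir_list n) = dirs n"
  by (auto simp: dir_list_def dirs_def)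

lemma distinct_dir_list: "distinct (dir_list n)"
  by (auto simp: dir_list_def distinct_map inj_on_def)

lemma dirs_iff [simp]: "Pos j \<in> dirs n \<longleftrightarrow> j < n" "Mom j \<in> dirs n \<longleftrightarrow> j < n"
  by (auto simp: dirs_def)

lemma prod_dirs: "(\<Prod>d\<in>dirs n. f d) = (\<Prod>j<n. f (Pos j) * f (Mom j))"
  unfolding dirs_def prod.distrib
  by (subst prod.union_disjoint) (auto simp: prod.reindex inj_on_def)

lemma sum_dirs: "(\<Sum>d\<in>dirs n. f d) = (\<Sum>j<n. f (Pos j) + f (Mom j))"
  unfolding dirs_def sum.distrib
  by (subst sum.union_disjoint) (auto simp: sum.reindex inj_on_def)

lemma multi_index_eq_word: "multi_index n \<alpha> \<beta> = word (dir_list n) (case_direction \<alpha> \<beta>)"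
  by (simp add: multi_index_def word_def dir_list_def comp_def)

lemma word_eq_multi_index: "word (dir_list n) \<kappa> = multi_index n (\<lambda>j. \<kappa> (Pos j)) (\<lambda>j. \<kappa> (Mom j))"
  by (simp add: multi_index_def word_def dir_list_def comp_def)

lemma phase_point_in_phase_space [simp]: "phase_point n Y \<in> phase_space n"
  by (auto simp: phase_point_def phase_space_def)

lemma phase_point_upd: "d \<in> dirs n \<Longrightarrow> phase_point n (Y(d := t)) = set_coord d t (phase_point n Y)"
  by (cases d) (auto simp: phase_point_def fun_eq_iff restrict_def)

lemma coord_phase_point: "d \<in> dirs n \<Longrightarrow> coord d (phase_point n Y) = Y d"
  by (cases d) (auto simp: phase_point_def)

lemma phase_point_coord: "X \<in> phase_space n \<Longrightarrow> phase_point n (\<lambda>d. coord d X) = X"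
  by (cases X) (auto simp: phase_point_def phase_space_def fun_eq_iff restrict_def PiE_def extensional_def)

lemma continuous_on_phase_point: "continuous_on UNIV (phase_point n)"
  unfolding phase_point_def
proof (intro continuous_on_Pair continuous_on_coordinatewise_then_product)
  show "continuous_on UNIV (\<lambda>Y. (\<lambda>j\<in>{..<n}. Y (Pos j)) i :: real)" "continuous_on UNIV (\<lambda>Y. (\<lambda>j\<in>{..<n}. Y (Mom j)) i :: real)" for i
    by (cases "i < n"; simp)+
qed

lemma partial_phase_point:
  assumes d: "d \<in> dirs n"
  shows "partial_exists n d F \<longleftrightarrow> (\<forall>Y. ((\<lambda>t. F (phase_point n (Y(d := t)))) has_vector_derivative partial d F (phase_point n Y)) (at (Y d)))"
proof -
  have "(\<lambda>t. F (set_coord d t (phase_point n Y))) differentiable (at (coord d (phase_point n Y))) \<longleftrightarrow>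
     ((\<lambda>t. F (phase_point n (Y(d := t)))) has_vector_derivative partial d F (phase_point n Y)) (at (Y d))" for Y
    unfolding vector_derivative_works partial_def coord_phase_point[OF d] phase_point_upd[OF d] ..
  then show ?thesis unfolding partial_exists_def using phase_point_coord by (metis phase_point_in_phase_space)
qed

text \<open>The second mixed derivative is not assumed to exist: the class provides derivatives in
  one order only, and its existence is what is wanted. Integrate \<open>fe\<close> along direction
  e, differentiate in d under the integral, compare with \<open>fd\<close>, and differentiate the
  resulting integral of the continuous \<open>h\<close>.\<close>

lemma schwarz:
  fixes f :: "('i \<Rightarrow> real) \<Rightarrow> complex"
  assumes de: "d \<noteq> e"
    and fe: "\<And>Y. ((\<lambda>t. f (Y(e := t))) has_vector_derivative fe Y) (at (Y e))"
    and fd: "\<And>Y. ((\<lambda>t. f (Y(d := t))) has_vector_derivative fd Y) (at (Y d))"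
    and h: "\<And>Y. ((\<lambda>t. fe (Y(d := t))) has_vector_derivative h Y) (at (Y d))"
    and cont: "continuous_on UNIV h"
  shows "((\<lambda>t. fd (Y(e := t))) has_vector_derivative h Y) (at (Y e))"
proof -
  define p where "p s t = Y(d := s, e := t)" for s t
  define a where "a = Y e - 1"
  have pd: "p s t d = s" "p s t e = t" "(p s t)(d := s') = p s' t" "(p s t)(e := t') = p s t'" for s t s' t'
    using de by (auto simp: p_def)
  have pY: "p (Y d) (Y e) = Y" by (simp add: p_def)
  have cp: "continuous_on UNIV (\<lambda>(s, t). h (p s t))"
    unfolding case_prod_beta p_def
    by (rule continuous_on_compose2[OF cont])
      (intro continuous_on_fun_upd continuous_on_const continuous_on_fst continuous_on_snd continuous_on_id subset_UNIV)+
  have fe_int: "((\<lambda>\<tau>. fe (p s \<tau>)) has_integral (f (p s t) - f (p s a))) {a..t}" if "a \<le> t" for s t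
  proof (rule fundamental_theorem_of_calculus[OF that])
    fix \<tau>
    show "((\<lambda>t. f (p s t)) has_vector_derivative fe (p s \<tau>)) (at \<tau> within {a..t})"
      using has_vector_derivative_at_within[OF fe[of "p s \<tau>"]] unfolding pd .
  qed
  have fd_eq: "fd (p s t) - fd (p s a) = integral {a..t} (\<lambda>\<tau>. h (p s \<tau>))" if t: "a \<le> t" for s t
  proof (rule vector_derivative_unique_at)
    have "((\<lambda>x. integral (cbox a t) (\<lambda>\<tau>. fe (p x \<tau>))) has_vector_derivative integral (cbox a t) (\<lambda>\<tau>. h (p s \<tau>))) (at s within UNIV)"
    proof (rule leibniz_rule_vector_derivative)
      show "((\<lambda>x. fe (p x \<tau>)) has_vector_derivative h (p x \<tau>)) (at x within UNIV)" for x \<tau>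
        using h[of "p x \<tau>"] unfolding pd by simp
      show "(\<lambda>\<tau>. fe (p x \<tau>)) integrable_on cbox a t" for x
        using fe_int[OF t] by (auto intro: has_integral_integrable)
      show "continuous_on (UNIV \<times> cbox a t) (\<lambda>(s, t). h (p s t))" by (rule continuous_on_subset[OF cp]) auto
    qed auto
    moreover have "integral (cbox a t) (\<lambda>\<tau>. fe (p x \<tau>)) = f (p x t) - f (p x a)" for x
      using fe_int[OF t] by (auto intro: integral_unique)
    ultimately show "((\<lambda>x. f (p x t) - f (p x a)) has_vector_derivative integral {a..t} (\<lambda>\<tau>. h (p s \<tau>))) (at s)" by simp
    have "((\<lambda>x. f (p x \<tau>)) has_vector_derivative fd (p s \<tau>)) (at s)" for \<tau>
      using fd[of "p s \<tau>"] unfolding pd .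
    then show "((\<lambda>x. f (p x t) - f (p x a)) has_vector_derivative fd (p s t) - fd (p s a)) (at s)"
      by (intro has_vector_derivative_diff)
  qed
  have "continuous_on {a..Y e + 1} (\<lambda>\<tau>. h (p (Y d) \<tau>))"
  proof -
    have "continuous_on {a..Y e + 1} (\<lambda>\<tau>. (Y d, \<tau>))" by (intro continuous_on_Pair continuous_on_const continuous_on_id)
    from continuous_on_compose2[OF cp this] show ?thesis by simp
  qed
  then have "((\<lambda>t. integral {a..t} (\<lambda>\<tau>. h (p (Y d) \<tau>))) has_vector_derivative h (p (Y d) (Y e))) (at (Y e) within {a..Y e + 1})"
    by (rule integral_has_vector_derivative) (auto simp: a_def)
  then have "((\<lambda>t. integral {a..t} (\<lambda>\<tau>. h (p (Y d) \<tau>))) has_vector_derivative h Y) (at (Y e))"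
    using at_within_Icc_at[of a "Y e" "Y e + 1"] unfolding pY by (simp add: a_def)
  from has_vector_derivative_add[OF has_vector_derivative_const this]
  have "((\<lambda>t. fd (p (Y d) a) + integral {a..t} (\<lambda>\<tau>. h (p (Y d) \<tau>))) has_vector_derivative h Y) (at (Y e))"
    by simp
  then have "((\<lambda>t. fd (p (Y d) t)) has_vector_derivative h Y) (at (Y e))"
  proof (rule has_vector_derivative_transform_within_open[of _ _ _ "{a<..<Y e + 1}"])
    fix t assume "t \<in> {a<..<Y e + 1}"
    then show "fd (p (Y d) a) + integral {a..t} (\<lambda>\<tau>. h (p (Y d) \<tau>)) = fd (p (Y d) t)"
      using fd_eq[of t "Y d"] by (simp add: algebra_simps)
  qed (auto simp: a_def)
  moreover have "p (Y d) t = Y(e := t)" for t by (auto simp: p_def)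
  ultimately show ?thesis by simp
qed

lemma word_append: "word (xs @ ys) \<kappa> = word xs \<kappa> @ word ys \<kappa>"
  by (simp add: word_def)

lemma word_Cons: "word (d # ds) \<kappa> = replicate (\<kappa> d) d @ word ds \<kappa>"
  by (simp add: word_def)

lemma word_cong: "(\<And>d. d \<in> set ds \<Longrightarrow> \<kappa> d = \<kappa>' d) \<Longrightarrow> word ds \<kappa> = word ds \<kappa>'"
  by (simp add: word_def cong: map_cong)

lemma word_zero: "(\<And>d. d \<in> set ds \<Longrightarrow> \<kappa> d = 0) \<Longrightarrow> word ds \<kappa> = []"
  by (simp add: word_def)

text \<open>If no earlier direction occurs, the new derivative is the outermost one and
  \<open>partials_exist\<close> supplies it directly; this is the base case of
  \<open>jet_of_deriv\<close>.\<close>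

lemma word_Suc_first:
  assumes "distinct (xs @ d # ys)" "\<And>e. e \<in> set xs \<Longrightarrow> \<kappa> e = 0"
  shows "word (xs @ d # ys) (\<kappa>(d := Suc (\<kappa> d))) = d # word (xs @ d # ys) \<kappa>"
proof -
  have "word xs (\<kappa>(d := Suc (\<kappa> d))) = []" "word xs \<kappa> = []" using assms by (auto intro!: word_zero)
  moreover have "word ys (\<kappa>(d := Suc (\<kappa> d))) = word ys \<kappa>" using assms by (intro word_cong) auto
  ultimately show ?thesis unfolding word_append word_Cons by simp
qed

definition order_of :: "nat \<Rightarrow> nat \<Rightarrow> direction \<Rightarrow> nat" where
  "order_of n m = (\<lambda>d. if d \<in> dirs n then m else 0)"

lemma symbol_classD:
  assumes A: "A \<in> symbol_class n m M \<rho> \<delta>" and k: "\<kappa> \<le> order_of n m"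
  shows "partials_exist n (word (dir_list n) \<kappa>) A"
    and "continuous_on UNIV (jet_of n A \<kappa>)"
    and "cmod (jet_of n A \<kappa> Y) \<le> M * (\<Prod>d\<in>dirs n. dir_weight \<rho> \<delta> d ^ \<kappa> d)"
proof -
  have kd: "\<kappa> d \<le> m" if "d \<in> dirs n" for d using k that by (metis le_fun_def order_of_def)
  let ?w = "multi_index n (\<lambda>j. \<kappa> (Pos j)) (\<lambda>j. \<kappa> (Mom j))"
  have *: "\<forall>j<n. \<kappa> (Pos j) \<le> m \<and> \<kappa> (Mom j) \<le> m" using kd by auto
  have all: "partials_exist n ?w A \<and> continuous_on (phase_space n) (partials ?w A) \<and>
      (\<forall>X\<in>phase_space n. cmod (partials ?w A X) \<le> M * (\<Prod>j<n. \<rho> j ^ \<kappa> (Pos j) * \<delta> j ^ \<kappa> (Mom j)))"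
    using A * unfolding symbol_class_def mem_Collect_eq
    by (elim allE[of _ "\<lambda>j. \<kappa> (Pos j)"] allE[of _ "\<lambda>j. \<kappa> (Mom j)"]) blast
  show "partials_exist n (word (dir_list n) \<kappa>) A" using all by (simp add: word_eq_multi_index)
  show "continuous_on UNIV (jet_of n A \<kappa>)" unfolding jet_of_def word_eq_multi_index
    by (rule continuous_on_compose2[of "phase_space n"]) (use all continuous_on_phase_point in auto)
  show "cmod (jet_of n A \<kappa> Y) \<le> M * (\<Prod>d\<in>dirs n. dir_weight \<rho> \<delta> d ^ \<kappa> d)"
    using all unfolding jet_of_def word_eq_multi_index prod_dirs by (simp add: dir_weight_def)
qed

text \<open>\<^const>\<open>multi_index\<close> prescribes an order of differentiation; Schwarz's theorem moves the new derivative past the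
  directions that precede it.\<close>

lemma jet_of_deriv:
  assumes A: "A \<in> symbol_class n m M \<rho> \<delta>" and k: "\<kappa> \<le> order_of n m" and d: "d \<in> dirs n" "\<kappa> d < m"
  shows "((\<lambda>t. jet_of n A \<kappa> (Y(d := t))) has_vector_derivative jet_of n A (\<kappa>(d := Suc (\<kappa> d))) Y) (at (Y d))"
proof -
  obtain xs ys where L: "dir_list n = xs @ d # ys" using d by (metis set_dir_list split_list)
  have dist: "distinct (xs @ d # ys)" using distinct_dir_list[of n] L by simp
  have upd_le: "\<kappa>(e := i) \<le> order_of n m" if "\<kappa> \<le> order_of n m" "i \<le> m" "e \<in> dirs n" for \<kappa> e i
    using that by (intro multi_index_upd_le) (auto simp: order_of_def)
  have outer: "((\<lambda>t. jet_of n A \<kappa> (Y(e := t))) has_vector_derivative jet_of n A (\<kappa>(e := Suc (\<kappa> e))) Y) (at (Y e))"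
    if k: "\<kappa> \<le> order_of n m" and e: "e \<in> dirs n" "\<kappa> e < m" and w: "word (dir_list n) (\<kappa>(e := Suc (\<kappa> e))) = e # word (dir_list n) \<kappa>" for \<kappa> e Y
  proof -
    have "partials_exist n (e # word (dir_list n) \<kappa>) A"
      unfolding w[symmetric] using e by (intro symbol_classD[OF A] upd_le k) auto
    then have "partial_exists n e (partials (word (dir_list n) \<kappa>) A)" by simp
    then show ?thesis unfolding partial_phase_point[OF e(1)] jet_of_def w by simp
  qed
  show ?thesis using k d(2)
  \<comment> \<open>The induction counts the derivatives already taken in directions that precede
    \<open>d\<close>.\<close>
  proof (induction "\<Sum>e\<in>set xs. \<kappa> e" arbitrary: \<kappa> Y rule: less_induct)
    case less
    show ?case
    proof (cases "\<forall>e\<in>set xs. \<kappa> e = 0")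
      case True
      then show ?thesis using less d L dist by (intro outer) (auto simp: word_Suc_first)
    next
      case False
      then obtain xa e xb where xs: "xs = xa @ e # xb" "\<kappa> e \<noteq> 0" "\<forall>c\<in>set xa. \<kappa> c = 0"
        using split_list_first_prop[of xs "\<lambda>e. \<kappa> e \<noteq> 0"] by auto
      have de: "d \<noteq> e" using dist xs by auto
      have eD: "e \<in> dirs n" using L xs by (simp flip: set_dir_list)
      \<comment> \<open>Strip one derivative in the outermost direction \<open>e\<close>. Below
        \<kappa>', differentiation in \<open>d\<close> is known by induction and differentiation in
        \<open>e\<close> is outermost, so Schwarz's theorem exchanges the two.\<close>
      define \<kappa>' where "\<kappa>' = \<kappa>(e := \<kappa> e - 1)"
      have ke: "\<kappa>'(e := Suc (\<kappa>' e)) = \<kappa>" using xs by (auto simp: \<kappa>'_def)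
      have kem: "\<kappa> e \<le> m" using less.prems(1) eD by (metis le_fun_def order_of_def)
      have k': "\<kappa>' \<le> order_of n m" unfolding \<kappa>'_def using kem eD less.prems by (intro upd_le) auto
      have kd': "\<kappa>' d = \<kappa> d" using de by (simp add: \<kappa>'_def)
      have k'd: "\<kappa>'(d := Suc (\<kappa>' d)) \<le> order_of n m" using d less.prems by (intro upd_le k') (auto simp: kd')
      have lt: "(\<Sum>c\<in>set xs. \<kappa>' c) < (\<Sum>c\<in>set xs. \<kappa> c)"
        using xs by (intro sum_strict_mono_ex1) (auto simp: \<kappa>'_def)
      have L': "dir_list n = xa @ e # (xb @ d # ys)" using L xs by simp
      have dist': "distinct (xa @ e # (xb @ d # ys))" using dist xs by simp
      have za: "\<kappa>' c = 0" "(\<kappa>'(d := Suc (\<kappa>' d))) c = 0" if "c \<in> set xa" for c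
        using that xs dist by (auto simp: \<kappa>'_def)
      have ee: "((\<lambda>t. jet_of n A \<kappa>' (Y(e := t))) has_vector_derivative jet_of n A \<kappa> Y) (at (Y e))" for Y
      proof -
        have "\<kappa>' e < m" using kem xs by (simp add: \<kappa>'_def)
        from outer[OF k' eD this] show ?thesis
          using word_Suc_first[OF dist', of \<kappa>'] za(1) unfolding L' ke by simp
      qed
      let ?kd = "\<kappa>'(d := Suc (\<kappa>' d))"
      have kde: "?kd(e := Suc (?kd e)) = \<kappa>(d := Suc (\<kappa> d))" using de xs by (auto simp: \<kappa>'_def)
      have ede: "((\<lambda>t. jet_of n A ?kd (Y(e := t))) has_vector_derivative jet_of n A (\<kappa>(d := Suc (\<kappa> d))) Y) (at (Y e))" for Y
      proof -
        have "?kd e < m" using kem xs de by (simp add: \<kappa>'_def)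
        moreover have "word (dir_list n) (\<kappa>(d := Suc (\<kappa> d))) = e # word (dir_list n) ?kd"
          unfolding L' kde[symmetric] by (rule word_Suc_first[OF dist' za(2)])
        ultimately show ?thesis by (rule outer[OF k'd eD, unfolded kde])
      qed
      show ?thesis
      proof (rule schwarz[OF _ _ ee ede])
        show "e \<noteq> d" using de by simp
        show "((\<lambda>t. jet_of n A \<kappa>' (Y(d := t))) has_vector_derivative jet_of n A ?kd Y) (at (Y d))" for Y
          using less.prems by (intro less.hyps[OF lt k']) (simp add: kd')
        show "continuous_on UNIV (jet_of n A (\<kappa>(d := Suc (\<kappa> d))))"
          using d less.prems by (intro symbol_classD[OF A] upd_le) auto
      qed
    qed
  qed
qed

lemma smooth_jet_of: "A \<in> symbol_class n m M \<rho> \<delta> \<Longrightarrow> smooth (order_of n m) (jet_of n A)"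
  unfolding smooth_def
  by (auto intro: symbol_classD jet_of_deriv simp: order_of_def split: if_splits)

lemma jet_bound_jet_of:
  "A \<in> symbol_class n m M \<rho> \<delta> \<Longrightarrow> jet_bound (dirs n) (dir_weight \<rho> \<delta>) (order_of n m) (\<lambda>_. M) (jet_of n A)"
  unfolding jet_bound_def by (auto intro: symbol_classD)

section \<open>Weyl composition as an oscillatory integral\<close>

text \<open>Exchanging positions and momenta in the second argument turns \<open>\<sigma>(Y, Z)\<close> into a diagonal pairing
  \<open>\<Sum>\<^sub>d dsign d \<cdot> Y\<^sub>d Z\<^sub>d\<close>.\<close>

fun dual :: "direction \<Rightarrow> direction" where
  "dual (Pos j) = Mom j"
| "dual (Mom j) = Pos j"

fun dsign :: "direction \<Rightarrow> real" where
  "dsign (Pos j) = - 1"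
| "dsign (Mom j) = 1"

lemma dual_dual [simp]: "dual (dual d) = d"
  by (cases d) auto

lemma dual_in_dirs [simp]: "dual d \<in> dirs n \<longleftrightarrow> d \<in> dirs n"
  by (cases d) auto

lemma dsign_facts [simp]: "dsign d \<noteq> 0" "\<bar>dsign d\<bar> = 1" "dsign d * dsign d = 1"
  by (cases d; simp)+

lemma prod_dual: "(\<Prod>d\<in>dirs n. f (dual d)) = (\<Prod>d\<in>dirs n. f d)"
  by (rule prod.reindex_bij_witness[of _ dual dual]) auto

section \<open>Change of variables on phase space\<close>

definition phase_map :: "nat \<Rightarrow> (direction \<Rightarrow> direction) \<Rightarrow> (direction \<Rightarrow> real) \<Rightarrow> point \<Rightarrow> direction \<Rightarrow> real" where
  "phase_map n \<tau> c Y = (\<lambda>d. if d \<in> dirs n then c d * coord (\<tau> d) Y else 0)"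

lemma coord_eq: "coord d Y = (case d of Pos j \<Rightarrow> fst Y j | Mom j \<Rightarrow> snd Y j)"
  by (cases d; cases Y) auto

lemma coord_measurable [measurable]:
  "d \<in> dirs n \<Longrightarrow> coord d \<in> borel_measurable (phase_lebesgue n)"
  unfolding phase_lebesgue_def coord_eq[abs_def]
proof (cases d)
  case (Pos j)
  assume "d \<in> dirs n"
  then have "(\<lambda>x. x j) \<in> borel_measurable (\<Pi>\<^sub>M j\<in>{..<n}. (lborel::real measure))"
    using measurable_component_singleton[of j "{..<n}" "\<lambda>_. lborel::real measure"] Pos by simp
  then have "(\<lambda>Y::point. fst Y j) \<in> borel_measurable ((\<Pi>\<^sub>M j\<in>{..<n}. (lborel::real measure)) \<Otimes>\<^sub>M (\<Pi>\<^sub>M j\<in>{..<n}. (lborel::real measure)))"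
    by (rule measurable_compose[OF measurable_fst])
  then show "(\<lambda>Y::point. case d of Pos j \<Rightarrow> fst Y j | Mom j \<Rightarrow> snd Y j)
    \<in> borel_measurable ((\<Pi>\<^sub>M j\<in>{..<n}. lborel) \<Otimes>\<^sub>M (\<Pi>\<^sub>M j\<in>{..<n}. lborel))" using Pos by simp
next
  case (Mom j)
  assume "d \<in> dirs n"
  then have "(\<lambda>x. x j) \<in> borel_measurable (\<Pi>\<^sub>M j\<in>{..<n}. (lborel::real measure))"
    using measurable_component_singleton[of j "{..<n}" "\<lambda>_. lborel::real measure"] Mom by simp
  then have "(\<lambda>Y::point. snd Y j) \<in> borel_measurable ((\<Pi>\<^sub>M j\<in>{..<n}. (lborel::real measure)) \<Otimes>\<^sub>M (\<Pi>\<^sub>M j\<in>{..<n}. (lborel::real measure)))"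
    by (rule measurable_compose[OF measurable_snd])
  then show "(\<lambda>Y::point. case d of Pos j \<Rightarrow> fst Y j | Mom j \<Rightarrow> snd Y j)
    \<in> borel_measurable ((\<Pi>\<^sub>M j\<in>{..<n}. lborel) \<Otimes>\<^sub>M (\<Pi>\<^sub>M j\<in>{..<n}. lborel))" using Mom by simp
qed

lemma sigma_finite_PiM_lborel: "finite I \<Longrightarrow> sigma_finite_measure (\<Pi>\<^sub>M i\<in>I. (lborel::real measure))"
  by (rule lborel_product.sigma_finite)

lemma sigma_finite_phase: "sigma_finite_measure (phase_lebesgue n)"
proof -
  interpret a: sigma_finite_measure "\<Pi>\<^sub>M j\<in>{..<n}. (lborel::real measure)" by (rule sigma_finite_PiM_lborel) simp
  interpret pair_sigma_finite "\<Pi>\<^sub>M j\<in>{..<n}. (lborel::real measure)" "\<Pi>\<^sub>M j\<in>{..<n}. (lborel::real measure)" ..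
  show ?thesis unfolding phase_lebesgue_def by (rule sigma_finite_measure_axioms)
qed

lemma emeasure_lborel_scale:
  assumes "c \<noteq> 0" "A \<in> sets borel"
  shows "ennreal \<bar>c\<bar> * emeasure lborel {y. c * y \<in> A} = emeasure lborel A"
proof -
  have "emeasure lborel A = emeasure (density (distr lborel borel ((*) c)) (\<lambda>_. ennreal \<bar>c\<bar>)) A"
    using lborel_distr_mult'[OF assms(1)] by simp
  also have "\<dots> = ennreal \<bar>c\<bar> * emeasure (distr lborel borel ((*) c)) A"
    using assms by (simp add: emeasure_density_const)
  also have "emeasure (distr lborel borel ((*) c)) A = emeasure lborel {y. c * y \<in> A}"
    using assms by (subst emeasure_distr) (auto simp: vimage_def)
  finally show ?thesis ..
qed

text \<open>A product measure is determined on boxes. The preimage of a box is a product of boxes in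
  positions and momenta with sides permuted by \<tau>; since \<tau> is an involution of
  \<open>dirs n\<close>, the product of the side lengths can be reindexed.\<close>

lemma phase_PiM:
  assumes tau: "\<tau> = id \<or> \<tau> = dual" and c: "\<And>d. c d \<noteq> 0"
  shows "density (distr (phase_lebesgue n) (\<Pi>\<^sub>M d\<in>dirs n. lborel) (\<lambda>Y. \<lambda>d\<in>dirs n. c d * coord (\<tau> d) Y))
    (\<lambda>_. ennreal (\<Prod>d\<in>dirs n. \<bar>c d\<bar>)) = (\<Pi>\<^sub>M d\<in>dirs n. lborel)" (is "density (distr _ _ ?\<Theta>) _ = _")
proof (rule lborel_product.PiM_eqI)
  have tt: "\<tau> (\<tau> d) = d" "\<tau> d \<in> dirs n \<longleftrightarrow> d \<in> dirs n" for d using tau by auto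
  let ?L = "\<Pi>\<^sub>M j\<in>{..<n}. (lborel::real measure)"
  interpret a: sigma_finite_measure ?L by (rule sigma_finite_PiM_lborel) simp
  fix A assume A: "\<And>d. d \<in> dirs n \<Longrightarrow> A d \<in> sets (lborel::real measure)"
  have m: "?\<Theta> \<in> measurable (phase_lebesgue n) (\<Pi>\<^sub>M d\<in>dirs n. lborel)"
    by (intro measurable_restrict) (simp add: tt)
  have bs: "Pi\<^sub>E (dirs n) A \<in> sets (\<Pi>\<^sub>M d\<in>dirs n. lborel)" using A by (intro sets_PiM_I_finite) auto
  define U where "U = (\<lambda>d. {y. c (\<tau> d) * y \<in> A (\<tau> d)})"
  have mU: "U d \<in> sets lborel" if "d \<in> dirs n" for d
  proof -
    have [measurable]: "A (\<tau> d) \<in> sets borel" using A[of "\<tau> d"] tt that by simp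
    have "{y \<in> space borel. c (\<tau> d) * y \<in> A (\<tau> d)} \<in> sets borel" by measurable
    then show ?thesis by (simp add: U_def)
  qed
  have pre: "?\<Theta> -` Pi\<^sub>E (dirs n) A \<inter> space (phase_lebesgue n) = (\<Pi>\<^sub>E j\<in>{..<n}. U (Pos j)) \<times> (\<Pi>\<^sub>E j\<in>{..<n}. U (Mom j))"
  proof (intro set_eqI iffI)
    fix Y assume Y: "Y \<in> ?\<Theta> -` Pi\<^sub>E (dirs n) A \<inter> space (phase_lebesgue n)"
    then have sp: "fst Y \<in> extensional {..<n}" "snd Y \<in> extensional {..<n}"
      by (auto simp: phase_lebesgue_def space_pair_measure space_PiM PiE_def)
    have "c d * coord (\<tau> d) Y \<in> A d" if "d \<in> dirs n" for d using Y that by (auto simp: PiE_def Pi_def)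
    then have U: "coord d Y \<in> U d" if "d \<in> dirs n" for d using that tt[of d] unfolding U_def by (metis mem_Collect_eq)
    show "Y \<in> (\<Pi>\<^sub>E j\<in>{..<n}. U (Pos j)) \<times> (\<Pi>\<^sub>E j\<in>{..<n}. U (Mom j))"
      using sp U[of "Pos _"] U[of "Mom _"] by (cases Y) (auto simp: PiE_def)
  next
    fix Y assume Y: "Y \<in> (\<Pi>\<^sub>E j\<in>{..<n}. U (Pos j)) \<times> (\<Pi>\<^sub>E j\<in>{..<n}. U (Mom j))"
    have U: "coord d Y \<in> U d" if "d \<in> dirs n" for d using Y that by (cases d; cases Y) auto
    have "c d * coord (\<tau> d) Y \<in> A d" if "d \<in> dirs n" for d
      using U[of "\<tau> d"] that tt[of d] unfolding U_def by simp
    moreover have "Y \<in> space (phase_lebesgue n)"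
      using Y by (cases Y) (auto simp: phase_lebesgue_def space_pair_measure space_PiM PiE_def)
    ultimately show "Y \<in> ?\<Theta> -` Pi\<^sub>E (dirs n) A \<inter> space (phase_lebesgue n)" by auto
  qed
  have "emeasure (distr (phase_lebesgue n) (\<Pi>\<^sub>M d\<in>dirs n. lborel) ?\<Theta>) (Pi\<^sub>E (dirs n) A)
    = emeasure (?L \<Otimes>\<^sub>M ?L) ((\<Pi>\<^sub>E j\<in>{..<n}. U (Pos j)) \<times> (\<Pi>\<^sub>E j\<in>{..<n}. U (Mom j)))"
    unfolding emeasure_distr[OF m bs] pre by (simp only: phase_lebesgue_def)
  also have "\<dots> = emeasure ?L (\<Pi>\<^sub>E j\<in>{..<n}. U (Pos j)) * emeasure ?L (\<Pi>\<^sub>E j\<in>{..<n}. U (Mom j))"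
    using mU by (intro a.emeasure_pair_measure_Times sets_PiM_I_finite) auto
  also have "\<dots> = (\<Prod>d\<in>dirs n. emeasure lborel (U d))"
    using mU by (subst (1 2) lborel_product.emeasure_PiM) (auto simp: prod_dirs prod.distrib)
  also have "\<dots> = (\<Prod>d\<in>dirs n. emeasure lborel (U (\<tau> d)))"
    using tau prod_dual[of "\<lambda>d. emeasure lborel (U d)" n] by auto
  finally have "emeasure (density (distr (phase_lebesgue n) (\<Pi>\<^sub>M d\<in>dirs n. lborel) ?\<Theta>) (\<lambda>_. ennreal (\<Prod>d\<in>dirs n. \<bar>c d\<bar>))) (Pi\<^sub>E (dirs n) A)
    = (\<Prod>d\<in>dirs n. ennreal \<bar>c d\<bar>) * (\<Prod>d\<in>dirs n. emeasure lborel (U (\<tau> d)))"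
    using bs by (simp add: emeasure_density_const prod_ennreal)
  also have "\<dots> = (\<Prod>d\<in>dirs n. ennreal \<bar>c d\<bar> * emeasure lborel (U (\<tau> d)))" by (rule prod.distrib[symmetric])
  also have "\<dots> = (\<Prod>d\<in>dirs n. emeasure lborel (A d))"
    using A c by (intro prod.cong refl) (auto simp: U_def tt intro!: emeasure_lborel_scale)
  finally show "emeasure (density (distr (phase_lebesgue n) (\<Pi>\<^sub>M d\<in>dirs n. lborel) ?\<Theta>) (\<lambda>_. ennreal (\<Prod>d\<in>dirs n. \<bar>c d\<bar>))) (Pi\<^sub>E (dirs n) A)
    = (\<Prod>d\<in>dirs n. emeasure lborel (A d))" .
qed simp_all

lemma integrable_scaleR_cancel:
  fixes f :: "'a \<Rightarrow> complex"
  assumes "k \<noteq> 0" "integrable M (\<lambda>x. k *\<^sub>R f x)"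
  shows "integrable M f"
  using integrable_scaleR_right[OF assms(2), of "1 / k"] assms(1) by simp

lemma phase_map_measurable:
  assumes "\<tau> = id \<or> \<tau> = dual"
  shows "phase_map n \<tau> c \<in> borel_measurable (phase_lebesgue n)"
proof (rule measurable_coordinatewise_then_product)
  fix d
  have "\<tau> d \<in> dirs n" if "d \<in> dirs n" using assms that by auto
  then show "(\<lambda>Y. phase_map n \<tau> c Y d) \<in> borel_measurable (phase_lebesgue n)"
    unfolding phase_map_def by (cases "d \<in> dirs n") simp_all
qed

lemma
  fixes F :: "(direction \<Rightarrow> real) \<Rightarrow> complex"
  assumes tau: "\<tau> = id \<or> \<tau> = dual" and c: "\<And>d. c d \<noteq> 0" and F: "F \<in> borel_measurable borel"
  shows integral_phase_map: "(\<integral>Y. F Y \<partial>lborel_on (dirs n)) = of_real (\<Prod>d\<in>dirs n. \<bar>c d\<bar>) * (\<integral>Y. F (phase_map n \<tau> c Y) \<partial>phase_lebesgue n)"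
    and integrable_phase_map: "integrable (lborel_on (dirs n)) F \<Longrightarrow> integrable (phase_lebesgue n) (\<lambda>Y. F (phase_map n \<tau> c Y))"
proof -
  let ?\<Theta> = "\<lambda>Y. \<lambda>d\<in>dirs n. c d * coord (\<tau> d) Y"
  let ?k = "\<Prod>d\<in>dirs n. \<bar>c d\<bar>"
  have k: "?k > 0" using c by (intro prod_pos) auto
  have z: "zero_ext (dirs n) (?\<Theta> Y) = phase_map n \<tau> c Y" for Y by (auto simp: zero_ext_def phase_map_def)
  have tt: "\<tau> d \<in> dirs n" if "d \<in> dirs n" for d using tau that by auto
  have m: "?\<Theta> \<in> measurable (phase_lebesgue n) (\<Pi>\<^sub>M d\<in>dirs n. lborel)"
    by (intro measurable_restrict) (simp add: tt)
  have Fz: "(\<lambda>Y. F (zero_ext (dirs n) Y)) \<in> borel_measurable (\<Pi>\<^sub>M d\<in>dirs n. lborel)"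
    using F by measurable
  have "(\<integral>Y. F Y \<partial>lborel_on (dirs n)) = (\<integral>Y. F (zero_ext (dirs n) Y) \<partial>(\<Pi>\<^sub>M d\<in>dirs n. lborel))"
    by (rule integral_lborel_on[OF F])
  also have "\<dots> = (\<integral>Y. F (zero_ext (dirs n) Y) \<partial>density (distr (phase_lebesgue n) (\<Pi>\<^sub>M d\<in>dirs n. lborel) ?\<Theta>) (\<lambda>_. ennreal ?k))"
    using phase_PiM[OF tau c, of n] by simp
  also have "\<dots> = (\<integral>Y. ?k *\<^sub>R F (zero_ext (dirs n) Y) \<partial>distr (phase_lebesgue n) (\<Pi>\<^sub>M d\<in>dirs n. lborel) ?\<Theta>)"
    using k Fz by (intro integral_density) auto
  also have "\<dots> = (\<integral>Y. ?k *\<^sub>R F (zero_ext (dirs n) (?\<Theta> Y)) \<partial>phase_lebesgue n)"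
    using Fz by (intro integral_distr[OF m]) auto
  finally show "(\<integral>Y. F Y \<partial>lborel_on (dirs n)) = of_real ?k * (\<integral>Y. F (phase_map n \<tau> c Y) \<partial>phase_lebesgue n)"
    by (simp only: z scaleR_conv_of_real integral_mult_right_zero)
  assume "integrable (lborel_on (dirs n)) F"
  then have "integrable (\<Pi>\<^sub>M d\<in>dirs n. lborel) (\<lambda>Y. F (zero_ext (dirs n) Y))" using integrable_lborel_on_iff[OF F] by simp
  then have "integrable (density (distr (phase_lebesgue n) (\<Pi>\<^sub>M d\<in>dirs n. lborel) ?\<Theta>) (\<lambda>_. ennreal ?k)) (\<lambda>Y. F (zero_ext (dirs n) Y))"
    using phase_PiM[OF tau c, of n] by simp
  then have "integrable (distr (phase_lebesgue n) (\<Pi>\<^sub>M d\<in>dirs n. lborel) ?\<Theta>) (\<lambda>Y. ?k *\<^sub>R F (zero_ext (dirs n) Y))"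
    using k Fz by (subst (asm) integrable_density) auto
  then have "integrable (distr (phase_lebesgue n) (\<Pi>\<^sub>M d\<in>dirs n. lborel) ?\<Theta>) (\<lambda>Y. F (zero_ext (dirs n) Y))"
    by (rule integrable_scaleR_cancel[OF less_imp_neq[OF k, symmetric]])
  then show "integrable (phase_lebesgue n) (\<lambda>Y. F (phase_map n \<tau> c Y))"
    using Fz by (subst (asm) integrable_distr_eq[OF m]) (auto simp: z)
qed

definition dual_jet :: "nat \<Rightarrow> symbol \<Rightarrow> direction jet" where
  "dual_jet n B = (\<lambda>\<kappa> Z. jet_of n B (\<kappa> \<circ> dual) (Z \<circ> dual))"

text \<open>The numbers |a d| and |g d| are the Jacobians of the two diagonal substitutions: the
  inner integral becomes \<open>ft\<close>, the outer one \<open>pairing\<close>.\<close>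

lemma phase_integral_eq_pairing:
  fixes FA FB :: "(direction \<Rightarrow> real) \<Rightarrow> complex"
  assumes a: "\<And>d. a d \<noteq> 0" and g: "\<And>d. g d \<noteq> 0"
    and FA: "integrable (lborel_on (dirs n)) FA" and FB: "integrable (lborel_on (dirs n)) FB"
  shows "(\<integral>(Y, Z). FA (phase_map n id (\<lambda>d. 1 / a d) Y) * FB (phase_map n dual (\<lambda>d. 1 / g d) Z) *
      wave (dirs n) (phase_map n id (\<lambda>d. 1 / a d) Y) (phase_map n dual (\<lambda>d. 1 / g d) Z) \<partial>(phase_lebesgue n \<Otimes>\<^sub>M phase_lebesgue n))
    = of_real (\<Prod>d\<in>dirs n. \<bar>a d * g d\<bar>) * pairing (dirs n) FA FB"
proof -
  interpret L: sigma_finite_measure "phase_lebesgue n" by (rule sigma_finite_phase)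
  interpret P: pair_sigma_finite "phase_lebesgue n" "phase_lebesgue n" ..
  let ?S = "phase_map n id (\<lambda>d. 1 / a d)" and ?T = "phase_map n dual (\<lambda>d. 1 / g d)"
  let ?D = "dirs n"
  have [measurable]: "FA \<in> borel_measurable borel" "FB \<in> borel_measurable borel"
    using FA FB by (auto dest!: borel_measurable_integrable)
  have a1: "1 / a d \<noteq> 0" and g1: "1 / g d \<noteq> 0" for d using a g by auto
  have [measurable]: "?S \<in> borel_measurable (phase_lebesgue n)" "?T \<in> borel_measurable (phase_lebesgue n)"
    by (auto intro!: phase_map_measurable)
  have iA: "integrable (phase_lebesgue n) (\<lambda>Y. FA (?S Y))" by (rule integrable_phase_map[OF _ a1 _ FA]) auto
  have iB: "integrable (phase_lebesgue n) (\<lambda>Y. FB (?T Y))" by (rule integrable_phase_map[OF _ g1 _ FB]) auto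
  have iBw: "integrable (phase_lebesgue n) (\<lambda>Z. FB (?T Z) * wave ?D V (?T Z))" for V
    by (rule integrable_times_bounded[OF iB, where C=1]) auto
  let ?f = "\<lambda>Y Z. FA (?S Y) * FB (?T Z) * wave ?D (?S Y) (?T Z)"
  have i: "integrable (phase_lebesgue n \<Otimes>\<^sub>M phase_lebesgue n) (\<lambda>(Y, Z). ?f Y Z)"
  proof (rule P.Fubini_integrable)
    show "integrable (phase_lebesgue n) (\<lambda>Y. \<integral>Z. norm (case (Y, Z) of (Y, Z) \<Rightarrow> ?f Y Z) \<partial>phase_lebesgue n)"
      using iA by (simp add: norm_mult)
    show "AE Y in phase_lebesgue n. integrable (phase_lebesgue n) (\<lambda>Z. case (Y, Z) of (Y, Z) \<Rightarrow> ?f Y Z)"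
      using integrable_mult_right[OF iBw] by (simp add: mult.assoc)
  qed measurable
  have inner: "(\<integral>Z. FB (?T Z) * wave ?D V (?T Z) \<partial>phase_lebesgue n) = of_real (\<Prod>d\<in>?D. \<bar>g d\<bar>) * ft ?D FB V" for V
  proof -
    have "ft ?D FB V = of_real (\<Prod>d\<in>?D. \<bar>1 / g d\<bar>) * (\<integral>Z. FB (?T Z) * wave ?D V (?T Z) \<partial>phase_lebesgue n)"
      unfolding ft_def by (rule integral_phase_map[OF _ g1]) auto
    moreover have "(\<Prod>d\<in>?D. \<bar>g d\<bar>) * (\<Prod>d\<in>?D. \<bar>1 / g d\<bar>) = 1"
      unfolding prod.distrib[symmetric] using g by (intro prod.neutral) auto
    ultimately show ?thesis by (simp add: mult.assoc[symmetric] del: of_real_prod flip: of_real_mult)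
  qed
  have "(\<integral>(Y, Z). ?f Y Z \<partial>(phase_lebesgue n \<Otimes>\<^sub>M phase_lebesgue n)) = (\<integral>Y. (\<integral>Z. ?f Y Z \<partial>phase_lebesgue n) \<partial>phase_lebesgue n)"
    using P.integral_fst[OF i] by simp
  also have "\<dots> = (\<integral>Y. of_real (\<Prod>d\<in>?D. \<bar>g d\<bar>) * (FA (?S Y) * ft ?D FB (?S Y)) \<partial>phase_lebesgue n)"
    by (intro Bochner_Integration.integral_cong refl) (simp only: mult.assoc integral_mult_right_zero inner mult.left_commute)
  also have "\<dots> = of_real (\<Prod>d\<in>?D. \<bar>g d\<bar>) * (\<integral>Y. FA (?S Y) * ft ?D FB (?S Y) \<partial>phase_lebesgue n)"
    by (rule integral_mult_right_zero)
  also have "(\<integral>Y. FA (?S Y) * ft ?D FB (?S Y) \<partial>phase_lebesgue n) = of_real (\<Prod>d\<in>?D. \<bar>a d\<bar>) * pairing ?D FA FB"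
  proof -
    have [measurable]: "ft ?D FB \<in> borel_measurable borel" by (rule ft_measurable) auto
    have "pairing ?D FA FB = of_real (\<Prod>d\<in>?D. \<bar>1 / a d\<bar>) * (\<integral>Y. FA (?S Y) * ft ?D FB (?S Y) \<partial>phase_lebesgue n)"
      unfolding pairing_def by (rule integral_phase_map[OF _ a1]) auto
    moreover have "(\<Prod>d\<in>?D. \<bar>a d\<bar>) * (\<Prod>d\<in>?D. \<bar>1 / a d\<bar>) = 1"
      unfolding prod.distrib[symmetric] using a by (intro prod.neutral) auto
    ultimately show ?thesis by (simp add: mult.assoc[symmetric] del: of_real_prod flip: of_real_mult)
  qed
  also have "of_real (\<Prod>d\<in>?D. \<bar>g d\<bar>) * (of_real (\<Prod>d\<in>?D. \<bar>a d\<bar>) * pairing ?D FA FB) = of_real (\<Prod>d\<in>?D. \<bar>a d * g d\<bar>) * pairing ?D FA FB"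
    unfolding abs_mult prod.distrib of_real_mult by (simp only: mult_ac)
  finally show ?thesis .
qed

lemma phase_add_phase_point: "phase_add n (phase_point n x) Y = phase_point n (\<lambda>d. x d + coord d Y)"
  by (cases Y) (auto simp: phase_add_def phase_point_def fun_eq_iff restrict_def)

lemma phase_point_cong: "(\<And>d. d \<in> dirs n \<Longrightarrow> x d = y d) \<Longrightarrow> phase_point n x = phase_point n y"
  by (auto simp: phase_point_def fun_eq_iff restrict_def)

lemma jet_of_zero: "jet_of n A (\<lambda>_. 0) Y = A (phase_point n Y)"
  by (simp add: jet_of_def word_zero)

text \<open>The relation \<open>a d * g d = dsign d * h\<close> turns the phase into the unit kernel
  \<open>wave\<close> and makes the Jacobian h^(2 n), which cancels the powers of h in the
  prefactor. The remaining freedom in \<open>a\<close> is used to normalise the derivatives of the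
  first symbol.\<close>

lemma weyl_composition_reg_eq:
  assumes h: "0 < h" and a: "\<And>d. 0 < a d" and g: "\<And>d. g d = dsign d * h / a d" and e: "0 < \<epsilon>"
    and iA: "integrable (lborel_on (dirs n)) (\<lambda>Y. gcut (dirs n) (\<lambda>d. sqrt \<epsilon> * a d) Y * rescale (dirs n) x a (jet_of n A) (\<lambda>_. 0) Y)"
    and iB: "integrable (lborel_on (dirs n)) (\<lambda>Z. gcut (dirs n) (\<lambda>d. sqrt \<epsilon> * \<bar>g d\<bar>) Z * rescale (dirs n) (x \<circ> dual) g (dual_jet n B) (\<lambda>_. 0) Z)"
  shows "weyl_composition_reg n h A B (phase_point n x) \<epsilon> =
    pairing (dirs n) (\<lambda>Y. gcut (dirs n) (\<lambda>d. sqrt \<epsilon> * a d) Y * rescale (dirs n) x a (jet_of n A) (\<lambda>_. 0) Y)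
      (\<lambda>Z. gcut (dirs n) (\<lambda>d. sqrt \<epsilon> * \<bar>g d\<bar>) Z * rescale (dirs n) (x \<circ> dual) g (dual_jet n B) (\<lambda>_. 0) Z) / of_real (pi ^ card (dirs n))"
    (is "_ = pairing ?D ?FA ?FB / _")
proof -
  let ?S = "phase_map n id (\<lambda>d. 1 / a d)" and ?T = "phase_map n dual (\<lambda>d. 1 / g d)"
  have a0: "a d \<noteq> 0" and g0: "g d \<noteq> 0" for d using a[of d] h by (auto simp: g)
  have card: "card ?D = 2 * n"
    unfolding dirs_def by (subst card_Un_disjoint) (auto simp: card_image inj_on_def)
  have ag: "(\<Prod>d\<in>?D. \<bar>a d * g d\<bar>) = h ^ (2 * n)"
  proof -
    have "\<bar>a d * g d\<bar> = h" for d using a0[of d] h by (simp add: g abs_mult)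
    then show ?thesis by (simp add: card)
  qed
  have FA: "?FA (?S Y) = of_real (exp (- \<epsilon> * phase_normsq n Y)) * A (phase_add n (phase_point n x) Y)" for Y
  proof -
    have "(\<Prod>d\<in>?D. exp (- (sqrt \<epsilon> * a d * ?S Y d)\<^sup>2)) = exp (\<Sum>d\<in>?D. - \<epsilon> * (coord d Y)\<^sup>2)"
      unfolding exp_sum[OF finite_dirs]
      by (intro prod.cong refl) (use a0 e in \<open>simp add: phase_map_def power_mult_distrib\<close>)
    also have "(\<Sum>d\<in>?D. - \<epsilon> * (coord d Y)\<^sup>2) = - \<epsilon> * phase_normsq n Y"
      unfolding sum_distrib_left[symmetric] sum_dirs phase_normsq_def coord_eq by simp
    finally have "gcut ?D (\<lambda>d. sqrt \<epsilon> * a d) (?S Y) = of_real (exp (- \<epsilon> * phase_normsq n Y))" by (simp only: gcut_def)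
    moreover have "rescale ?D x a (jet_of n A) (\<lambda>_. 0) (?S Y) = A (phase_add n (phase_point n x) Y)"
      unfolding rescale_zero jet_of_zero phase_add_phase_point
      by (rule arg_cong[where f=A], rule phase_point_cong) (use a0 in \<open>simp add: phase_map_def\<close>)
    ultimately show ?thesis by simp
  qed
  have FB: "?FB (?T Z) = of_real (exp (- \<epsilon> * phase_normsq n Z)) * B (phase_add n (phase_point n x) Z)" for Z
  proof -
    have "(\<Prod>d\<in>?D. exp (- (sqrt \<epsilon> * \<bar>g d\<bar> * ?T Z d)\<^sup>2)) = exp (\<Sum>d\<in>?D. - \<epsilon> * (coord (dual d) Z)\<^sup>2)"
      unfolding exp_sum[OF finite_dirs]
      by (intro prod.cong refl) (use g0 e in \<open>simp add: phase_map_def power_mult_distrib power_divide\<close>)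
    also have "(\<Sum>d\<in>?D. - \<epsilon> * (coord (dual d) Z)\<^sup>2) = - \<epsilon> * phase_normsq n Z"
      unfolding sum_distrib_left[symmetric] sum_dirs phase_normsq_def coord_eq by (simp add: add.commute)
    finally have "gcut ?D (\<lambda>d. sqrt \<epsilon> * \<bar>g d\<bar>) (?T Z) = of_real (exp (- \<epsilon> * phase_normsq n Z))" by (simp only: gcut_def)
    moreover have "rescale ?D (x \<circ> dual) g (dual_jet n B) (\<lambda>_. 0) (?T Z) = B (phase_add n (phase_point n x) Z)"
    proof -
      have "(\<lambda>_. 0) \<circ> dual = (\<lambda>_. 0::nat)" by auto
      then show ?thesis unfolding rescale_zero dual_jet_def phase_add_phase_point
        by (simp only: jet_of_zero, intro arg_cong[where f=B] phase_point_cong) (use g0 in \<open>simp add: phase_map_def\<close>)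
    qed
    ultimately show ?thesis by simp
  qed
  have w: "wave ?D (?S Y) (?T Z) = exp (- (2 * \<i> / complex_of_real h) * complex_of_real (symplectic n Y Z))" for Y Z
  proof -
    have "?S Y d * ?T Z d = dsign d * (coord d Y * coord (dual d) Z) / h" if "d \<in> ?D" for d
      using that a0[of d] h by (simp add: phase_map_def g field_simps)
    then have "(\<Sum>d\<in>?D. ?S Y d * ?T Z d) = (\<Sum>d\<in>?D. dsign d * (coord d Y * coord (dual d) Z)) / h"
      by (simp add: sum_divide_distrib)
    also have "(\<Sum>d\<in>?D. dsign d * (coord d Y * coord (dual d) Z)) = symplectic n Y Z"
      unfolding sum_dirs symplectic_def coord_eq by (simp add: sum_subtractf mult.commute)
    finally have S: "(\<Sum>d\<in>?D. ?S Y d * ?T Z d) = symplectic n Y Z / h" .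
    show ?thesis unfolding wave_def cis_conv_exp S by (rule arg_cong[where f=exp]) simp
  qed
  have E: "complex_of_real (exp (- \<epsilon> * (p + q))) = of_real (exp (- \<epsilon> * p)) * of_real (exp (- \<epsilon> * q))" for p q
    by (simp add: distrib_left exp_add exp_diff exp_minus field_simps)
  have "weyl_composition_reg n h A B (phase_point n x) \<epsilon> = of_real (1 / (pi * h) ^ (2 * n)) *
    (\<integral>(Y, Z). ?FA (?S Y) * ?FB (?T Z) * wave ?D (?S Y) (?T Z) \<partial>(phase_lebesgue n \<Otimes>\<^sub>M phase_lebesgue n))"
    unfolding weyl_composition_reg_def FA FB w
    by (intro arg_cong2[where f="(*)"] refl Bochner_Integration.integral_cong)
      (simp only: split_beta' E mult_ac)
  also have "\<dots> = of_real (1 / (pi * h) ^ (2 * n)) * (of_real (h ^ (2 * n)) * pairing ?D ?FA ?FB)"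
    unfolding phase_integral_eq_pairing[OF a0 g0 iA iB] ag ..
  also have "\<dots> = pairing ?D ?FA ?FB / of_real (pi ^ card ?D)"
    using h by (simp add: card power_mult_distrib field_simps)
  finally show ?thesis .
qed

section \<open>Weighted jets and removal of the regularisation\<close>

definition wjet :: "'i set \<Rightarrow> ('i \<Rightarrow> real) \<Rightarrow> ('i \<Rightarrow> nat) \<Rightarrow> real \<Rightarrow> 'i jet \<Rightarrow> bool" where
  "wjet D w \<mu> M A \<longleftrightarrow> 0 \<le> M \<and> smooth \<mu> A \<and> jet_bound D w \<mu> (\<lambda>_. M) A"

lemma wjet_mono: "wjet D w \<mu> M A \<Longrightarrow> \<nu> \<le> \<mu> \<Longrightarrow> wjet D w \<nu> M A"
  unfolding wjet_def using smooth_mono jet_bound_mono by blast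

lemma wjet_shift:
  assumes "wjet D w \<mu> M A" "\<nu>(d := Suc (\<nu> d)) \<le> \<mu>" "finite D" "d \<in> D" "0 \<le> w d"
  shows "wjet D w \<nu> (M * w d) (shift d A)"
  using assms unfolding wjet_def by (auto intro: smooth_shift[OF _ assms(2)] jet_bound_shift[OF _ assms(2,3,4)])

text \<open>Absorbing the weights into the constant is good enough for convergence, continuity and
  differentiability; quantitative bounds use \<open>nice_rescale_wjet\<close> instead.\<close>

lemma nice_wjet:
  assumes A: "wjet D w \<mu> M A" and w: "\<And>d. d \<in> D \<Longrightarrow> 0 \<le> w d"
  shows "nice D \<mu> (M * (\<Prod>d\<in>D. max 1 (w d) ^ \<mu> d)) A"
proof (rule niceI)
  show "0 \<le> M * (\<Prod>d\<in>D. max 1 (w d) ^ \<mu> d)" "smooth \<mu> A"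
    using A by (auto simp: wjet_def intro!: mult_nonneg_nonneg prod_nonneg)
  fix \<kappa> Y assume k: "\<kappa> \<le> \<mu>"
  have "w d ^ \<kappa> d \<le> max 1 (w d) ^ \<mu> d" if "d \<in> D" for d
  proof -
    have "w d ^ \<kappa> d \<le> max 1 (w d) ^ \<kappa> d" using w[OF that] by (intro power_mono) auto
    also have "\<dots> \<le> max 1 (w d) ^ \<mu> d" using k by (intro power_increasing) (auto simp: le_fun_def)
    finally show ?thesis .
  qed
  then have "(\<Prod>d\<in>D. w d ^ \<kappa> d) \<le> (\<Prod>d\<in>D. max 1 (w d) ^ \<mu> d)" using w by (intro prod_mono) auto
  moreover have "cmod (A \<kappa> Y) \<le> M * (\<Prod>d\<in>D. w d ^ \<kappa> d)" "0 \<le> M" using A jet_boundD[OF _ k] by (auto simp: wjet_def)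
  ultimately show "cmod (A \<kappa> Y) \<le> M * (\<Prod>d\<in>D. max 1 (w d) ^ \<mu> d)"
    by (meson mult_left_mono order_trans)
qed

text \<open>Dividing every coordinate by its weight makes all derivative bounds equal to M, so the
  weights survive only in the scales.\<close>

lemma nice_rescale_wjet:
  assumes A: "wjet D w \<mu> M A" and D: "finite D" "\<And>i. i \<notin> D \<Longrightarrow> \<mu> i = 0"
    and s: "\<And>d. d \<in> D \<Longrightarrow> \<bar>s d\<bar> * w d = 1"
  shows "nice D \<mu> M (rescale D b s A)"
proof (rule niceI)
  show "0 \<le> M" "smooth \<mu> (rescale D b s A)" using A D by (auto simp: wjet_def intro: smooth_rescale)
  fix \<kappa> Y assume k: "\<kappa> \<le> \<mu>"
  have "jet_bound D w \<mu> (\<lambda>_. M) A" using A by (simp add: wjet_def)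
  from jet_boundD[OF jet_bound_rescale[OF this] k]
  have "cmod (rescale D b s A \<kappa> Y) \<le> M * (\<Prod>d\<in>D. (\<bar>s d\<bar> * w d) ^ \<kappa> d)" .
  also have "(\<Prod>d\<in>D. (\<bar>s d\<bar> * w d) ^ \<kappa> d) = 1" by (rule prod.neutral) (simp add: s)
  finally show "cmod (rescale D b s A \<kappa> Y) \<le> M" by simp
qed

lemma comp_dual_upd: "(Z(d := t)) \<circ> dual = (Z \<circ> dual)(dual d := t)"
  by (rule ext) (auto simp: fun_upd_def)

lemma wjet_jet_of: "0 \<le> M \<Longrightarrow> A \<in> symbol_class n m M \<rho> \<delta> \<Longrightarrow> wjet (dirs n) (dir_weight \<rho> \<delta>) (order_of n m) M (jet_of n A)"
  unfolding wjet_def by (auto intro: smooth_jet_of jet_bound_jet_of)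

lemma order_of_comp_dual: "order_of n m \<circ> dual = order_of n m"
  by (auto simp: order_of_def)

lemma comp_dual_le: "\<kappa> \<le> order_of n m \<Longrightarrow> \<kappa> \<circ> dual \<le> order_of n m"
  by (subst order_of_comp_dual[symmetric]) (simp add: le_fun_def)

lemma wjet_dual_jet:
  assumes "wjet (dirs n) w (order_of n m) M (jet_of n B)"
  shows "wjet (dirs n) (w \<circ> dual) (order_of n m) M (dual_jet n B)"
proof -
  have s: "smooth (order_of n m) (jet_of n B)" and b: "jet_bound (dirs n) w (order_of n m) (\<lambda>_. M) (jet_of n B)" and M: "0 \<le> M"
    using assms by (auto simp: wjet_def)
  have "smooth (order_of n m) (dual_jet n B)"
    unfolding smooth_def
  proof (intro conjI allI impI)
    fix \<kappa> assume k: "\<kappa> \<le> order_of n m"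
    have "continuous_on UNIV (\<lambda>Z::direction \<Rightarrow> real. Z \<circ> dual)"
      by (intro continuous_on_coordinatewise_then_product) (simp add: continuous_on_product_coordinates)
    then show "continuous_on UNIV (dual_jet n B \<kappa>)" unfolding dual_jet_def
      by (intro continuous_on_compose2[OF smoothD(1)[OF s comp_dual_le[OF k]]]) auto
    fix d and Y :: "direction \<Rightarrow> real" assume d: "\<kappa> d < order_of n m d"
    then have lt: "(\<kappa> \<circ> dual) (dual d) < order_of n m (dual d)" by (simp add: order_of_def)
    have e: "(\<kappa> \<circ> dual) (dual d) = \<kappa> d" "(Y \<circ> dual) (dual d) = Y d" by simp_all
    from smoothD(2)[OF s comp_dual_le[OF k] lt, of "Y \<circ> dual"]
    show "((\<lambda>t. dual_jet n B \<kappa> (Y(d := t))) has_vector_derivative dual_jet n B (\<kappa>(d := Suc (\<kappa> d))) Y) (at (Y d))"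
      unfolding dual_jet_def comp_dual_upd e .
  qed
  moreover have "jet_bound (dirs n) (w \<circ> dual) (order_of n m) (\<lambda>_. M) (dual_jet n B)"
    unfolding jet_bound_def
  proof (intro allI impI)
    fix \<kappa> Y assume k: "\<kappa> \<le> order_of n m"
    have "cmod (dual_jet n B \<kappa> Y) \<le> M * (\<Prod>d\<in>dirs n. w d ^ (\<kappa> \<circ> dual) d)"
      unfolding dual_jet_def by (rule jet_boundD[OF b comp_dual_le[OF k]])
    also have "(\<Prod>d\<in>dirs n. w d ^ (\<kappa> \<circ> dual) d) = (\<Prod>d\<in>dirs n. (w \<circ> dual) d ^ \<kappa> d)"
      using prod_dual[of "\<lambda>d. (w \<circ> dual) d ^ \<kappa> d" n] by simp
    finally show "cmod (dual_jet n B \<kappa> Y) \<le> M * (\<Prod>d\<in>dirs n. (w \<circ> dual) d ^ \<kappa> d)" .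
  qed
  ultimately show ?thesis using M by (simp add: wjet_def)
qed

text \<open>Allows scales to be altered off \<open>D\<close>: the substitution in phase space wants
  them positive everywhere, while the Taylor expansion wants them to be 0 off
  \<open>D\<close>.\<close>

definition local_jet :: "'i set \<Rightarrow> 'i jet \<Rightarrow> bool" where
  "local_jet D A \<longleftrightarrow> (\<forall>\<kappa> Y Z. (\<forall>d\<in>D. Y d = Z d) \<longrightarrow> A \<kappa> Y = A \<kappa> Z)"

lemma local_jetD: "local_jet D A \<Longrightarrow> (\<And>d. d \<in> D \<Longrightarrow> Y d = Z d) \<Longrightarrow> A \<kappa> Y = A \<kappa> Z"
  unfolding local_jet_def by blast

lemma local_shift: "local_jet D A \<Longrightarrow> local_jet D (shift d A)"
  unfolding local_jet_def shift_def by blast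

lemma local_jet_of: "local_jet (dirs n) (jet_of n A)"
  unfolding local_jet_def jet_of_def using phase_point_cong by metis

lemma local_dual_jet: "local_jet (dirs n) (dual_jet n B)"
proof -
  have "jet_of n B \<kappa> (Y \<circ> dual) = jet_of n B \<kappa> (Z \<circ> dual)" if "\<forall>d\<in>dirs n. Y d = Z d" for \<kappa> Y Z
    by (rule local_jetD[OF local_jet_of]) (use that in simp)
  then show ?thesis unfolding local_jet_def dual_jet_def by blast
qed

lemma rescale_cong_local:
  assumes "local_jet D A" "\<And>d. d \<in> D \<Longrightarrow> b d = b' d" "\<And>d. d \<in> D \<Longrightarrow> s d = s' d"
  shows "rescale D b s A = rescale D b' s' A"
proof (intro ext)
  fix \<kappa> Y
  have "A \<kappa> (\<lambda>i. b i + s i * Y i) = A \<kappa> (\<lambda>i. b' i + s' i * Y i)"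
    by (rule local_jetD[OF assms(1)]) (simp add: assms)
  then show "rescale D b s A \<kappa> Y = rescale D b' s' A \<kappa> Y" using assms(3) by (simp add: rescale_def)
qed

lemma weyl_composition_reg_tendsto:
  assumes h: "0 < h" and a: "\<And>d. 0 < a d" and g: "\<And>d. g d = dsign d * h / a d"
    and C: "\<And>d. a d \<le> C" "\<And>d. h / a d \<le> C"
    and A: "nice (dirs n) (order_two (dirs n)) M (jet_of n A)" and B: "nice (dirs n) (order_two (dirs n)) M' (dual_jet n B)"
  shows "(weyl_composition_reg n h A B (phase_point n x) \<longlongrightarrow>
    osc (dirs n) (rescale (dirs n) x a (jet_of n A) (\<lambda>_. 0)) (rescale (dirs n) (x \<circ> dual) g (dual_jet n B) (\<lambda>_. 0))) (at_right 0)"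
  unfolding tendsto_at_iff_sequentially
proof (intro allI impI)
  fix \<epsilon> :: "nat \<Rightarrow> real" assume e: "\<forall>k. \<epsilon> k \<in> {0<..} - {0}" "\<epsilon> \<longlonglongrightarrow> 0"
  let ?D = "dirs n"
  let ?F = "rescale ?D x a (jet_of n A)" and ?G = "rescale ?D (x \<circ> dual) g (dual_jet n B)"
  have gabs: "\<bar>g d\<bar> = h / a d" for d using h a[of d] by (simp add: g abs_mult)
  have gpos: "0 < \<bar>g d\<bar>" for d unfolding gabs using h a by simp
  have aC: "\<bar>a d\<bar> \<le> C" "\<bar>g d\<bar> \<le> C" for d using C[of d] a[of d] by (auto simp: gabs)
  have ep: "0 < \<epsilon> k" for k using e by auto
  have C0: "0 < C" using C(1) a by (meson order.strict_trans2)
  define MA where "MA = M * (\<Prod>i\<in>?D. max 1 C ^ order_two ?D i)"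
  define MB where "MB = M' * (\<Prod>i\<in>?D. max 1 C ^ order_two ?D i)"
  have F: "nice ?D (order_two ?D) MA ?F" unfolding MA_def by (rule nice_rescale[OF A finite_dirs order_two_off aC(1)])
  have G: "nice ?D (order_two ?D) MB ?G" unfolding MB_def by (rule nice_rescale[OF B finite_dirs order_two_off aC(2)])
  have sq: "(\<lambda>k. sqrt (\<epsilon> k)) \<longlonglongrightarrow> 0" using tendsto_real_sqrt[OF e(2)] by simp
  have "(\<lambda>k. sqrt (\<epsilon> k) * C) \<longlonglongrightarrow> 0 * C" by (intro tendsto_intros sq)
  then have "\<forall>\<^sub>F k in sequentially. sqrt (\<epsilon> k) * C < 1" by (intro order_tendstoD(2)[where a=1]) auto
  \<comment> \<open>\<open>osc_tendsto\<close> asks for cutoff widths at most 1, which holds from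
    index \<open>K\<close> on; shifting the sequence keeps its limit.\<close>
  then obtain K where K: "\<And>k. K \<le> k \<Longrightarrow> sqrt (\<epsilon> k) * C < 1" unfolding eventually_sequentially by blast
  have small: "sqrt (\<epsilon> (k + K)) * y \<le> 1" if "y \<le> C" for k y
  proof -
    have "sqrt (\<epsilon> (k + K)) * y \<le> sqrt (\<epsilon> (k + K)) * C" using that ep[of "k + K"] by (intro mult_left_mono) auto
    then show ?thesis using K[of "k + K"] by simp
  qed
  have "(\<lambda>k. pairing ?D (\<lambda>Y. gcut ?D (\<lambda>d. sqrt (\<epsilon> (k + K)) * a d) Y * ?F (\<lambda>_. 0) Y)
      (\<lambda>Z. gcut ?D (\<lambda>d. sqrt (\<epsilon> (k + K)) * \<bar>g d\<bar>) Z * ?G (\<lambda>_. 0) Z) / of_real (pi ^ card ?D))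
    \<longlonglongrightarrow> osc ?D (?F (\<lambda>_. 0)) (?G (\<lambda>_. 0))"
  proof (rule osc_tendsto[OF finite_dirs F G, where \<eta>="\<lambda>k d. sqrt (\<epsilon> (k + K)) * a d" and \<eta>'="\<lambda>k d. sqrt (\<epsilon> (k + K)) * \<bar>g d\<bar>"])
    fix d
    show "0 < sqrt (\<epsilon> (k + K)) * a d" "0 < sqrt (\<epsilon> (k + K)) * \<bar>g d\<bar>" for k using ep[of "k + K"] a[of d] gpos[of d] by auto
    show "sqrt (\<epsilon> (k + K)) * a d \<le> 1" "sqrt (\<epsilon> (k + K)) * \<bar>g d\<bar> \<le> 1" for k using aC[of d] by (auto intro!: small)
    show "(\<lambda>k. sqrt (\<epsilon> (k + K)) * a d) \<longlonglongrightarrow> 0" "(\<lambda>k. sqrt (\<epsilon> (k + K)) * \<bar>g d\<bar>) \<longlonglongrightarrow> 0"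
      using tendsto_mult_left_zero[OF LIMSEQ_ignore_initial_segment[OF sq, of K]] by auto
  qed
  moreover have "weyl_composition_reg n h A B (phase_point n x) (\<epsilon> k) =
     pairing ?D (\<lambda>Y. gcut ?D (\<lambda>d. sqrt (\<epsilon> k) * a d) Y * ?F (\<lambda>_. 0) Y)
      (\<lambda>Z. gcut ?D (\<lambda>d. sqrt (\<epsilon> k) * \<bar>g d\<bar>) Z * ?G (\<lambda>_. 0) Z) / of_real (pi ^ card ?D)" for k
  proof (rule weyl_composition_reg_eq[OF h a g ep])
    show "integrable (lborel_on ?D) (\<lambda>Y. gcut ?D (\<lambda>d. sqrt (\<epsilon> k) * a d) Y * ?F (\<lambda>_. 0) Y)"
      using ep[of k] a by (intro integrable_gcut_times[OF finite_dirs _ F le_zero_fun]) auto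
    show "integrable (lborel_on ?D) (\<lambda>Z. gcut ?D (\<lambda>d. sqrt (\<epsilon> k) * \<bar>g d\<bar>) Z * ?G (\<lambda>_. 0) Z)"
    proof (rule integrable_gcut_times[OF finite_dirs _ G le_zero_fun])
      show "0 < sqrt (\<epsilon> k) * \<bar>g d\<bar>" for d using ep[of k] gpos[of d] by (intro mult_pos_pos) auto
    qed
  qed
  ultimately have "(\<lambda>k. weyl_composition_reg n h A B (phase_point n x) (\<epsilon> (k + K))) \<longlonglongrightarrow> osc ?D (?F (\<lambda>_. 0)) (?G (\<lambda>_. 0))"
    by simp
  from LIMSEQ_offset[OF this] show "(weyl_composition_reg n h A B (phase_point n x) \<circ> \<epsilon>) \<longlonglongrightarrow> osc ?D (?F (\<lambda>_. 0)) (?G (\<lambda>_. 0))"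
    by (simp add: o_def)
qed

lemma weyl_composition_eq_osc:
  assumes h: "0 < h" and w: "\<And>d. d \<in> dirs n \<Longrightarrow> 0 < w d"
    and A: "nice (dirs n) (order_two (dirs n)) M (jet_of n A)" and B: "nice (dirs n) (order_two (dirs n)) M' (dual_jet n B)"
  shows "weyl_composition n h A B (phase_point n x) =
    osc (dirs n) (rescale (dirs n) x (\<lambda>d. 1 / w d) (jet_of n A) (\<lambda>_. 0))
      (rescale (dirs n) (x \<circ> dual) (\<lambda>d. dsign d * h * w d) (dual_jet n B) (\<lambda>_. 0))"
proof -
  let ?D = "dirs n"
  \<comment> \<open>The value 1 off \<open>dirs n\<close> makes the scale positive everywhere, and
    together with finiteness of \<open>dirs n\<close> it yields the common bound
    \<open>C\<close>.\<close>
  define a where "a = (\<lambda>d. if d \<in> ?D then 1 / w d else 1)"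
  define g where "g = (\<lambda>d. dsign d * h / a d)"
  define C where "C = 1 + h + (\<Sum>d\<in>?D. a d + h / a d)"
  have a: "0 < a d" for d using w by (auto simp: a_def)
  have le: "a d + h / a d \<le> C" for d
  proof (cases "d \<in> ?D")
    case True
    then have "a d + h / a d \<le> (\<Sum>d\<in>?D. a d + h / a d)" using a h by (intro member_le_sum) (auto intro!: add_nonneg_nonneg simp: less_imp_le)
    then show ?thesis using h by (simp add: C_def)
  next
    case False
    have "0 \<le> (\<Sum>d\<in>?D. a d + h / a d)" using a h by (intro sum_nonneg) (auto intro!: add_nonneg_nonneg simp: less_imp_le)
    then show ?thesis using False by (simp add: C_def a_def)
  qed
  have "a d \<le> C" "h / a d \<le> C" for d using le[of d] a[of d] h divide_pos_pos[OF h a[of d]] by linarith+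
  then have "weyl_composition n h A B (phase_point n x) = osc ?D (rescale ?D x a (jet_of n A) (\<lambda>_. 0)) (rescale ?D (x \<circ> dual) g (dual_jet n B) (\<lambda>_. 0))"
    unfolding weyl_composition_def
    by (intro tendsto_Lim weyl_composition_reg_tendsto[OF h a _ _ _ A B]) (auto simp: g_def)
  also have "rescale ?D x a (jet_of n A) = rescale ?D x (\<lambda>d. 1 / w d) (jet_of n A)"
    by (rule rescale_cong_local[OF local_jet_of]) (auto simp: a_def)
  also have "rescale ?D (x \<circ> dual) g (dual_jet n B) = rescale ?D (x \<circ> dual) (\<lambda>d. dsign d * h * w d) (dual_jet n B)"
    by (rule rescale_cong_local[OF local_dual_jet]) (auto simp: a_def g_def)
  finally show ?thesis .
qed

section \<open>Powers of the symplectic operator\<close>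

lemma shift_commute: "shift d (shift e A) = shift e (shift d A)"
  by (intro ext) (cases "d = e"; simp add: shift_def fun_upd_twist)

lemma coupling_commute: "coupling D s k F G Y Z = coupling D s k G F Z Y"
  by (induction k arbitrary: F G) (simp_all add: mult.commute)

lemma coupling_cong: "(\<And>d. d \<in> D \<Longrightarrow> s d = s' d) \<Longrightarrow> coupling D s k F G Y Z = coupling D s' k F G Y Z"
  by (induction k arbitrary: F G) auto

lemma coupling_local:
  assumes "local_jet D F" "local_jet D G" "\<And>d. d \<in> D \<Longrightarrow> Y d = Y' d" "\<And>d. d \<in> D \<Longrightarrow> Z d = Z' d"
  shows "coupling D s k F G Y Z = coupling D s k F G Y' Z'"
  using assms(1,2)
proof (induction k arbitrary: F G)
  case 0
  then show ?case using local_jetD[OF 0(1), of Y Y'] local_jetD[OF 0(2), of Z Z'] assms(3,4) by simp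
next
  case (Suc k)
  then have "coupling D s k (shift d F) (shift d G) Y Z = coupling D s k (shift d F) (shift d G) Y' Z'" for d
    by (intro Suc.IH local_shift)
  then show ?case by simp
qed

lemma coupling_scale:
  "coupling D s k (\<lambda>\<kappa> Y. a * F \<kappa> Y) (\<lambda>\<kappa> Y. b * G \<kappa> Y) Y Z = a * b * coupling D s k F G Y Z"
proof (induction k arbitrary: F G)
  case (Suc k)
  have "shift d (\<lambda>\<kappa> Y. c * A \<kappa> Y) = (\<lambda>\<kappa> Y. c * shift d A \<kappa> Y)" for d c and A :: "'a jet"
    by (simp add: shift_def)
  then show ?case using Suc.IH by (simp add: sum_distrib_left mult_ac)
qed simp

text \<open>Each application differentiates both factors once in the same direction, so
  \<open>s d\<close> meets exactly one chain-rule factor \<open>a d\<close> and one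
  \<open>c d\<close>.\<close>

lemma coupling_rescale:
  assumes D: "finite D"
  shows "coupling D s k (rescale D x a F) (rescale D y c G) (\<lambda>_. 0) (\<lambda>_. 0) = coupling D (\<lambda>d. s d * a d * c d) k F G x y"
proof (induction k arbitrary: F G)
  case 0
  then show ?case by (simp add: rescale_def)
next
  case (Suc k)
  have "of_real (s d) * coupling D s k (shift d (rescale D x a F)) (shift d (rescale D y c G)) (\<lambda>_. 0) (\<lambda>_. 0)
      = of_real (s d * a d * c d) * coupling D (\<lambda>d. s d * a d * c d) k (shift d F) (shift d G) x y" if "d \<in> D" for d
    unfolding shift_rescale[OF D that] coupling_scale Suc.IH by simp
  then show ?case by (simp only: coupling.simps cong: sum.cong)
qed

lemma coupling_const: "coupling D (\<lambda>d. h * s d) k F G Y Z = of_real h ^ k * coupling D s k F G Y Z"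
  by (induction k arbitrary: F G) (simp_all add: sum_distrib_left mult_ac)

lemma jet_deriv:
  assumes "smooth \<mu> F" "0 < \<mu> d"
  shows "((\<lambda>t. F (\<lambda>_. 0) (Y(d := t))) has_vector_derivative shift d F (\<lambda>_. 0) (Y(d := u))) (at u)"
  using smoothD(2)[OF assms(1) le_zero_fun, of d "Y(d := u)"] assms(2) by (simp add: shift_def)

lemma smooth_shift_ord:
  assumes "d \<in> D" "smooth (ord D (Suc k)) F"
  shows "smooth (ord D k) (shift d F)"
  by (rule smooth_shift[OF assms(2)]) (use assms(1) in \<open>auto simp: ord_def le_fun_def\<close>)

lemma coupling_deriv_snd:
  assumes d: "d \<in> D" and G: "smooth (ord D (Suc k)) G"
  shows "((\<lambda>t. coupling D s k F G Y (Z(d := t))) has_vector_derivative coupling D s k F (shift d G) Y (Z(d := u))) (at u)"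
  using G
proof (induction k arbitrary: F G)
  case 0
  then show ?case
    unfolding coupling.simps by (intro has_vector_derivative_mult_right jet_deriv) (use d in \<open>auto simp: ord_def\<close>)
next
  case (Suc k)
  show ?case unfolding coupling.simps
    by (intro has_vector_derivative_sum has_vector_derivative_mult_right, subst shift_commute, rule Suc.IH)
      (rule smooth_shift_ord[OF _ Suc.prems])
qed

lemma coupling_deriv_fst:
  assumes d: "d \<in> D" and F: "smooth (ord D (Suc k)) F"
  shows "((\<lambda>t. coupling D s k F G (Y(d := t)) Z) has_vector_derivative coupling D s k (shift d F) G (Y(d := u)) Z) (at u)"
  using coupling_deriv_snd[OF assms] by (simp only: coupling_commute[of D s k _ G])

lemma coupling_deriv:
  assumes d: "d \<in> D" "d' \<in> D" and F: "smooth (ord D (Suc k)) F" and G: "smooth (ord D (Suc k)) G"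
  shows "((\<lambda>t. coupling D s k F G (Y(d := t)) (Z(d' := t))) has_vector_derivative
    coupling D s k (shift d F) G (Y(d := u)) (Z(d' := u)) + coupling D s k F (shift d' G) (Y(d := u)) (Z(d' := u))) (at u)"
  using F G
proof (induction k arbitrary: F G)
  case 0
  have "((\<lambda>t. F (\<lambda>_. 0) (Y(d := t)) * G (\<lambda>_. 0) (Z(d' := t))) has_vector_derivative
      F (\<lambda>_. 0) (Y(d := u)) * shift d' G (\<lambda>_. 0) (Z(d' := u)) + shift d F (\<lambda>_. 0) (Y(d := u)) * G (\<lambda>_. 0) (Z(d' := u))) (at u)"
    by (intro has_vector_derivative_mult jet_deriv) (use d 0 in \<open>auto simp: ord_def\<close>)
  then show ?case by (simp only: coupling.simps add.commute)
next
  case (Suc k)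
  have "((\<lambda>t. coupling D s k (shift e F) (shift e G) (Y(d := t)) (Z(d' := t))) has_vector_derivative
    coupling D s k (shift e (shift d F)) (shift e G) (Y(d := u)) (Z(d' := u)) + coupling D s k (shift e F) (shift e (shift d' G)) (Y(d := u)) (Z(d' := u))) (at u)"
    if "e \<in> D" for e
    unfolding shift_commute[of e] using Suc.prems that by (intro Suc.IH smooth_shift_ord)
  then have "((\<lambda>t. \<Sum>e\<in>D. of_real (s e) * coupling D s k (shift e F) (shift e G) (Y(d := t)) (Z(d' := t))) has_vector_derivative
    (\<Sum>e\<in>D. of_real (s e) * (coupling D s k (shift e (shift d F)) (shift e G) (Y(d := u)) (Z(d' := u)) + coupling D s k (shift e F) (shift e (shift d' G)) (Y(d := u)) (Z(d' := u))))) (at u)"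
    by (intro has_vector_derivative_sum has_vector_derivative_mult_right)
  then show ?case unfolding coupling.simps by (simp only: distrib_left sum.distrib)
qed

lemma coupling_continuous:
  assumes F: "smooth (ord D k) F" and G: "smooth (ord D k) G"
    and Y: "continuous_on S Y" and Z: "continuous_on S Z"
  shows "continuous_on S (\<lambda>x. coupling D s k F G (Y x) (Z x))"
  using F G
proof (induction k arbitrary: F G)
  case 0
  then show ?case unfolding coupling.simps
    by (intro continuous_intros continuous_on_compose2[OF smoothD(1)[OF 0(1) le_zero_fun] Y]
        continuous_on_compose2[OF smoothD(1)[OF 0(2) le_zero_fun] Z]) auto
next
  case (Suc k)
  then show ?case unfolding coupling.simps by (intro continuous_intros Suc.IH smooth_shift_ord)
qed

definition coords :: "point \<Rightarrow> direction \<Rightarrow> real" where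
  "coords Y = (\<lambda>d. coord d Y)"

lemma coords_set_coord: "coords (set_coord d t Y) = (coords Y)(d := t)"
  by (cases d; cases Y) (auto simp: coords_def coord_eq fun_eq_iff split: direction.splits)

lemma coords_zero: "d \<in> dirs n \<Longrightarrow> coords (phase_zero n) d = 0"
  by (cases d) (auto simp: coords_def phase_zero_def)

text \<open>\<open>partial\<close> differentiates in the coordinate of Y, whereas the jets are
  evaluated at x + Y; the two parameters differ by the constant \<open>x d\<close>.\<close>

lemma partial_eqI:
  assumes "\<And>u. ((\<lambda>t. f (y(d := t))) has_vector_derivative f' (y(d := u))) (at u)" and "y = (\<lambda>e. x e + coords Y e)"
  shows "partial d (\<lambda>Y. f (\<lambda>e. x e + coords Y e)) Y = f' (\<lambda>e. x e + coords Y e)"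
proof -
  let ?c = "x d"
  have "((\<lambda>t. f (y(d := t))) \<circ> (\<lambda>t. ?c + t) has_vector_derivative 1 *\<^sub>R f' (y(d := ?c + coord d Y))) (at (coord d Y))"
    by (intro vector_diff_chain_at assms)
      (auto simp flip: has_real_derivative_iff_has_vector_derivative intro!: derivative_eq_intros)
  moreover have "y(d := ?c + coord d Y) = y" by (auto simp: assms(2) coords_def)
  moreover have "y(d := ?c + t) = (\<lambda>e. x e + coords (set_coord d t Y) e)" for t
    by (auto simp: assms(2) coords_set_coord)
  ultimately have "((\<lambda>t. f (\<lambda>e. x e + coords (set_coord d t Y) e)) has_vector_derivative f' y) (at (coord d Y))"
    by (simp add: o_def)
  from vector_derivative_at[OF this] show ?thesis unfolding partial_def assms(2) .
qed

lemma ord_eq_order_of: "ord (dirs n) m = order_of n m"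
  by (simp add: ord_def order_of_def)

text \<open>The operator is the sum over d of \<open>dsign d\<close> times the derivatives in
  \<open>Y d\<close> and in coordinate \<open>dual d\<close> of Z; precomposition with
  \<open>dual\<close> makes it diagonal, so one application raises the exponent. The identity is
  between functions of (Y, Z), because iteration precedes the evaluation at 0.\<close>

lemma symplectic_op_coupling:
  fixes \<A> \<B> :: "direction jet"
  assumes F: "smooth (order_of n (Suc k)) \<A>" and G: "smooth (order_of n (Suc k)) \<B>"
  shows "symplectic_op n (\<lambda>(Y, Z). coupling (dirs n) dsign k \<A> \<B> (\<lambda>d. x d + coords Y d) ((\<lambda>d. x d + coords Z d) \<circ> dual))
    = (\<lambda>(Y, Z). coupling (dirs n) dsign (Suc k) \<A> \<B> (\<lambda>d. x d + coords Y d) ((\<lambda>d. x d + coords Z d) \<circ> dual))"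
proof (rule ext)
  fix W :: "point \<times> point"
  obtain y z where W: "W = (y, z)" by (cases W)
  let ?\<Phi> = "\<lambda>\<A> \<B> (Y, Z). coupling (dirs n) dsign k \<A> \<B> (\<lambda>d. x d + coords Y d) ((\<lambda>d. x d + coords Z d) \<circ> dual)"
  have snd: "partial_snd (dual d) (?\<Phi> \<A> \<B>) = ?\<Phi> \<A> (shift d \<B>)" if d: "d \<in> dirs n" for d
  proof (rule ext)
    fix W :: "point \<times> point"
    obtain a a' where W: "W = (a, a')" by (cases W)
    let ?y = "\<lambda>e. x e + coords a' e" and ?Y = "\<lambda>d. x d + coords a d"
    have "partial (dual d) (\<lambda>Z. coupling (dirs n) dsign k \<A> \<B> ?Y ((\<lambda>d. x d + coords Z d) \<circ> dual)) a'
      = coupling (dirs n) dsign k \<A> (shift d \<B>) ?Y (?y \<circ> dual)"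
    proof (rule partial_eqI[where f="\<lambda>y. coupling (dirs n) dsign k \<A> \<B> ?Y (y \<circ> dual)" and y="?y"
          and f'="\<lambda>y. coupling (dirs n) dsign k \<A> (shift d \<B>) ?Y (y \<circ> dual)"])
      show "((\<lambda>t. coupling (dirs n) dsign k \<A> \<B> ?Y (?y(dual d := t) \<circ> dual)) has_vector_derivative
        coupling (dirs n) dsign k \<A> (shift d \<B>) ?Y (?y(dual d := u) \<circ> dual)) (at u)" for u
        unfolding comp_dual_upd dual_dual using G d by (intro coupling_deriv_snd) (auto simp: ord_eq_order_of)
    qed (rule refl)
    then show "partial_snd (dual d) (?\<Phi> \<A> \<B>) W = ?\<Phi> \<A> (shift d \<B>) W"
      by (simp only: W partial_snd_def prod.case)
  qed
  have both: "partial_fst d (partial_snd (dual d) (?\<Phi> \<A> \<B>)) W = ?\<Phi> (shift d \<A>) (shift d \<B>) W" if d: "d \<in> dirs n" for d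
  proof -
    let ?y = "\<lambda>e. x e + coords y e" and ?Z = "(\<lambda>e. x e + coords z e) \<circ> dual"
    have "partial d (\<lambda>Y. coupling (dirs n) dsign k \<A> (shift d \<B>) (\<lambda>d. x d + coords Y d) ?Z) y
      = coupling (dirs n) dsign k (shift d \<A>) (shift d \<B>) ?y ?Z"
    proof (rule partial_eqI[where f="\<lambda>y. coupling (dirs n) dsign k \<A> (shift d \<B>) y ?Z" and y="?y"
          and f'="\<lambda>y. coupling (dirs n) dsign k (shift d \<A>) (shift d \<B>) y ?Z"])
      show "((\<lambda>t. coupling (dirs n) dsign k \<A> (shift d \<B>) (?y(d := t)) ?Z) has_vector_derivative
        coupling (dirs n) dsign k (shift d \<A>) (shift d \<B>) (?y(d := u)) ?Z) (at u)" for u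
        using F d by (intro coupling_deriv_fst) (auto simp: ord_eq_order_of)
    qed (rule refl)
    then show ?thesis unfolding snd[OF d] by (simp only: W partial_fst_def prod.case)
  qed
  have "symplectic_op n (?\<Phi> \<A> \<B>) W = (\<Sum>d\<in>dirs n. of_real (dsign d) * partial_fst d (partial_snd (dual d) (?\<Phi> \<A> \<B>)) W)"
    unfolding symplectic_op_def sum_dirs by (intro sum.cong refl) simp
  also have "\<dots> = (\<Sum>d\<in>dirs n. of_real (dsign d) * ?\<Phi> (shift d \<A>) (shift d \<B>) W)"
    by (intro sum.cong refl) (simp only: both)
  finally show "symplectic_op n (?\<Phi> \<A> \<B>) W = (\<lambda>(Y, Z). coupling (dirs n) dsign (Suc k) \<A> \<B> (\<lambda>d. x d + coords Y d) ((\<lambda>d. x d + coords Z d) \<circ> dual)) W"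
    by (simp only: W coupling.simps prod.case)
qed

lemma symplectic_op_power:
  assumes F: "smooth (order_of n m) (jet_of n A)" and G: "smooth (order_of n m) (dual_jet n B)" and k: "k \<le> m"
  shows "(symplectic_op n ^^ k) (\<lambda>(Y, Z). A (phase_add n (phase_point n x) Y) * B (phase_add n (phase_point n x) Z))
    = (\<lambda>(Y, Z). coupling (dirs n) dsign k (jet_of n A) (dual_jet n B) (\<lambda>d. x d + coords Y d) ((\<lambda>d. x d + coords Z d) \<circ> dual))"
  using k
proof (induction k)
  case 0
  have z: "(\<lambda>_. 0) \<circ> dual = (\<lambda>_. 0::nat)" by auto
  have zz: "((\<lambda>d. x d + coords Z d) \<circ> dual) \<circ> dual = (\<lambda>d. x d + coord d Z)" for Z by (auto simp: coords_def)
  then show ?case by (simp only: funpow.simps id_apply coupling.simps jet_of_zero dual_jet_def z zz phase_add_phase_point) (simp only: coords_def)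
next
  case (Suc k)
  have le: "order_of n (Suc k) \<le> order_of n m" using Suc.prems by (simp add: order_of_def le_fun_def)
  have "k \<le> m" using Suc.prems by simp
  have step: "(symplectic_op n ^^ Suc k) \<Phi> = symplectic_op n ((symplectic_op n ^^ k) \<Phi>)" for \<Phi> by simp
  show ?case unfolding step Suc.IH[OF \<open>k \<le> m\<close>]
    by (rule symplectic_op_coupling[OF smooth_mono[OF F le] smooth_mono[OF G le]])
qed

lemma symplectic_op_power_zero:
  assumes "smooth (order_of n m) (jet_of n A)" "smooth (order_of n m) (dual_jet n B)" "k \<le> m"
  shows "(symplectic_op n ^^ k) (\<lambda>(Y, Z). A (phase_add n (phase_point n x) Y) * B (phase_add n (phase_point n x) Z)) (phase_zero n, phase_zero n)
    = coupling (dirs n) dsign k (jet_of n A) (dual_jet n B) x (x \<circ> dual)"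
  unfolding symplectic_op_power[OF assms] prod.case
  by (rule coupling_local[OF local_jet_of local_dual_jet]) (simp_all add: coords_zero)

section \<open>The remainder and its derivatives\<close>

text \<open>The remainder for arbitrary pairs of jets, so that it makes sense for the shifted jets
  that differentiation produces.\<close>

definition rem_jet :: "nat \<Rightarrow> nat \<Rightarrow> real \<Rightarrow> (direction \<Rightarrow> real) \<Rightarrow> direction jet \<Rightarrow> direction jet \<Rightarrow> (direction \<Rightarrow> real) \<Rightarrow> complex" where
  "rem_jet n N h w F G x =
     osc (dirs n) (rescale (dirs n) x (\<lambda>d. 1 / w d) F (\<lambda>_. 0)) (rescale (dirs n) (x \<circ> dual) (\<lambda>d. dsign d * h * w d) G (\<lambda>_. 0)) -
     (\<Sum>k<N. of_real h ^ k / ((2 * \<i>) ^ k * fact k) * coupling (dirs n) dsign k F G x (x \<circ> dual))"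

text \<open>Leibniz' rule: one remainder for every distribution of the derivatives over the two
  factors. The head of the list acts on the jets first although it is the outermost derivative; this
  is harmless because shifts commute.\<close>

primrec rem_partials :: "nat \<Rightarrow> nat \<Rightarrow> real \<Rightarrow> (direction \<Rightarrow> real) \<Rightarrow> direction list \<Rightarrow> direction jet \<Rightarrow> direction jet \<Rightarrow> (direction \<Rightarrow> real) \<Rightarrow> complex" where
  "rem_partials n N h w [] F G = rem_jet n N h w F G"
| "rem_partials n N h w (d # ds) F G = (\<lambda>x. rem_partials n N h w ds (shift d F) G x + rem_partials n N h w ds F (shift (dual d) G) x)"

text \<open>\<open>N + 3\<close> derivatives serve the remainder estimate itself; each differentiation of the remainder may fall on either
  factor and consumes one more.\<close>

definition need :: "nat \<Rightarrow> nat \<Rightarrow> direction list \<Rightarrow> direction \<Rightarrow> nat" where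
  "need n N ds = (\<lambda>d. if d \<in> dirs n then N + 3 + count_list ds d else 0)"

lemma need_Cons: "d \<in> dirs n \<Longrightarrow> (need n N ds)(d := Suc (need n N ds d)) \<le> need n N (d # ds)"
  by (auto simp: need_def le_fun_def)

lemma need_Cons_dual: "d \<in> dirs n \<Longrightarrow> (need n N ds \<circ> dual)(dual d := Suc ((need n N ds \<circ> dual) (dual d))) \<le> need n N (d # ds) \<circ> dual"
  by (auto simp: need_def le_fun_def)

lemma need_mono: "need n N ds \<le> need n N (d # ds)"
  by (auto simp: need_def le_fun_def)

lemma need_mono_dual: "need n N ds \<circ> dual \<le> need n N (d # ds) \<circ> dual"
  using need_mono by (simp add: le_fun_def)

lemma need_Nil_le: "ord (dirs n) (N + 3) \<le> need n N ds" "ord (dirs n) (N + 3) \<le> need n N ds \<circ> dual"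
  by (auto simp: need_def ord_def le_fun_def)

lemma prod_list_word: "(\<Prod>d\<leftarrow>word ds \<kappa>. f d) = (\<Prod>d\<leftarrow>ds. (f d :: real) ^ \<kappa> d)"
  by (induction ds) (simp_all add: word_def prod_list_replicate)

lemma set_word: "set (word ds \<kappa>) \<subseteq> set ds"
  by (auto simp: word_def)

lemma count_list_replicate: "count_list (replicate k x) y = (if x = y then k else 0)"
  by (induction k) auto

lemma count_list_word: "distinct ds \<Longrightarrow> count_list (word ds \<kappa>) d = (if d \<in> set ds then \<kappa> d else 0)"
  by (induction ds) (auto simp: word_def count_list_replicate)

context
  fixes n N :: nat and h :: real and w :: "direction \<Rightarrow> real"
  assumes h: "0 < h" and w: "\<And>d. 0 < w d"
begin

lemma rem_jet_bound:
  assumes F: "wjet (dirs n) w (ord (dirs n) (N + 3)) M F" and G: "wjet (dirs n) (w \<circ> dual) (ord (dirs n) (N + 3)) M' G"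
    and G_local: "local_jet (dirs n) G"
  shows "cmod (rem_jet n N h w F G x) \<le> (\<Sum>j<n. h * w (Pos j) * w (Mom j)) ^ N / fact N * (M * M' * (\<Prod>j<n. 1 + K0 * (h * w (Pos j) * w (Mom j))))"
proof -
  let ?D = "dirs n"
  let ?z = "\<lambda>_::direction. 0::nat"
  \<comment> \<open>Normalising F by \<open>1 / w d\<close> and G by \<open>1 / w (dual d)\<close>
    leaves the scale \<open>dsign d * h * w d\<close>, multiplied by \<open>w (dual d)\<close>, to
    the dilation; its absolute value is h times the product of the two weights of the index.\<close>
  define s where "s = (\<lambda>d. if d \<in> ?D then dsign d * h * w d * w (dual d) else 0)"
  let ?c = "\<lambda>d. 1 / w (dual d)"
  let ?F = "rescale ?D x (\<lambda>d. 1 / w d) F" and ?G = "rescale ?D (x \<circ> dual) ?c G"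
  have off: "ord ?D (N + 3) i = 0" if "i \<notin> ?D" for i using that by (simp add: ord_def)
  have w0: "w d \<noteq> 0" "\<bar>1 / w d\<bar> * w d = 1" for d using w[of d] by auto
  have nF: "nice ?D (ord ?D (N + 3)) M ?F" by (rule nice_rescale_wjet[OF F finite_dirs off]) (use w0 in auto)
  have nG: "nice ?D (ord ?D (N + 3)) M' ?G" by (rule nice_rescale_wjet[OF G finite_dirs off]) (assumption | simp only: o_apply w0)+
  have rescale_eq: "rescale ?D (\<lambda>_. 0) s ?G ?z = rescale ?D (x \<circ> dual) (\<lambda>d. dsign d * h * w d) G ?z"
  proof
    fix Y
    have "G ?z (\<lambda>i. (x \<circ> dual) i + ?c i * (0 + s i * Y i)) = G ?z (\<lambda>i. (x \<circ> dual) i + dsign i * h * w i * Y i)"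
      by (rule local_jetD[OF G_local]) (use w0 in \<open>simp add: s_def\<close>)
    then show "rescale ?D (\<lambda>_. 0) s ?G ?z Y = rescale ?D (x \<circ> dual) (\<lambda>d. dsign d * h * w d) G ?z Y"
      by (simp only: rescale_zero)
  qed
  have coup: "coupling ?D s k ?F ?G (\<lambda>_. 0) (\<lambda>_. 0) = of_real h ^ k * coupling ?D dsign k F G x (x \<circ> dual)" for k
    unfolding coupling_rescale[OF finite_dirs] coupling_const[symmetric]
    by (rule coupling_cong) (use w0 in \<open>simp add: s_def\<close>)
  have abs_s: "\<bar>s d\<bar> = h * w d * w (dual d)" if "d \<in> ?D" for d
    using that h w[of d] w[of "dual d"] by (simp add: s_def abs_mult)
  \<comment> \<open>Every index j is counted twice, by \<open>Pos j\<close> and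
    \<open>Mom j\<close>, and this cancels the 1 / 2 that comes from 1 / (2 \<i>).\<close>
  have sum_s: "(\<Sum>d\<in>?D. \<bar>s d\<bar>) / 2 = (\<Sum>j<n. h * w (Pos j) * w (Mom j))"
  proof -
    have "(\<Sum>d\<in>?D. \<bar>s d\<bar>) = (\<Sum>j<n. h * w (Pos j) * w (Mom j) + h * w (Mom j) * w (Pos j))"
      unfolding sum_dirs by (intro sum.cong refl) (simp add: abs_s)
    also have "\<dots> = 2 * (\<Sum>j<n. h * w (Pos j) * w (Mom j))" by (simp add: sum_distrib_left mult_ac)
    finally show ?thesis by simp
  qed
  \<comment> \<open>The factors of \<open>Pos j\<close> and \<open>Mom j\<close> coincide, so
    \<open>cfac_square_le\<close> applies index by index; a contraction by r \<le> 1 only decreases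
    its right-hand side.\<close>
  have B: "(\<Prod>d\<in>?D. cfac \<bar>r * s d\<bar>) \<le> (\<Prod>j<n. 1 + K0 * (h * w (Pos j) * w (Mom j)))" if r: "0 \<le> r" "r \<le> 1" for r
  proof -
    have "(\<Prod>d\<in>?D. cfac \<bar>r * s d\<bar>) = (\<Prod>j<n. (cfac (r * (h * w (Pos j) * w (Mom j))))\<^sup>2)"
      unfolding prod_dirs by (intro prod.cong refl) (use r in \<open>simp add: abs_mult abs_s power2_eq_square mult_ac\<close>)
    also have "\<dots> \<le> (\<Prod>j<n. 1 + K0 * (h * w (Pos j) * w (Mom j)))"
    proof (rule prod_mono, intro conjI)
      fix j
      let ?y = "h * w (Pos j) * w (Mom j)"
      have y: "0 \<le> ?y" using h w[of "Pos j"] w[of "Mom j"] by simp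
      have "(cfac (r * ?y))\<^sup>2 \<le> 1 + K0 * (r * ?y)" using r y by (intro cfac_square_le) simp
      also have "\<dots> \<le> 1 + K0 * ?y" using r y K0_pos by (intro add_left_mono mult_left_mono mult_left_le_one_le) auto
      finally show "(cfac (r * ?y))\<^sup>2 \<le> 1 + K0 * ?y" .
    qed simp
    finally show ?thesis .
  qed
  have "cmod (osc ?D (?F ?z) (rescale ?D (\<lambda>_. 0) s ?G ?z) - (\<Sum>k<N. coupling ?D s k ?F ?G (\<lambda>_. 0) (\<lambda>_. 0) / ((2 * \<i>) ^ k * fact k)))
    \<le> ((\<Sum>d\<in>?D. \<bar>s d\<bar>) / 2) ^ N / fact N * (M * M' * (\<Prod>j<n. 1 + K0 * (h * w (Pos j) * w (Mom j))))"
    by (rule taylor_remainder_bound[OF finite_dirs _ nF nG B]) (simp_all add: s_def)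
  then show ?thesis unfolding rem_jet_def rescale_eq coup sum_s by simp
qed

lemma rem_jet_deriv:
  assumes F: "wjet (dirs n) w (ord (dirs n) (N + 3)) M F" and G: "wjet (dirs n) (w \<circ> dual) (ord (dirs n) (N + 3)) M' G"
    and d: "d \<in> dirs n"
  shows "((\<lambda>t. rem_jet n N h w F G (x(d := t))) has_vector_derivative
    rem_jet n N h w (shift d F) G (x(d := u)) + rem_jet n N h w F (shift (dual d) G) (x(d := u))) (at u)"
proof -
  let ?D = "dirs n"
  have w0: "0 \<le> w d" "0 \<le> (w \<circ> dual) d" for d using w[of d] w[of "dual d"] by auto
  note nF = nice_wjet[OF F w0(1)] and nG = nice_wjet[OF G w0(2)]
  have "((\<lambda>t. osc ?D (rescale ?D (x(d := t)) (\<lambda>d. 1 / w d) F (\<lambda>_. 0)) (rescale ?D ((x \<circ> dual)(dual d := t)) (\<lambda>d. dsign d * h * w d) G (\<lambda>_. 0))) has_vector_derivative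
     osc ?D (rescale ?D (x(d := u)) (\<lambda>d. 1 / w d) (shift d F) (\<lambda>_. 0)) (rescale ?D ((x \<circ> dual)(dual d := u)) (\<lambda>d. dsign d * h * w d) G (\<lambda>_. 0))
     + osc ?D (rescale ?D (x(d := u)) (\<lambda>d. 1 / w d) F (\<lambda>_. 0)) (rescale ?D ((x \<circ> dual)(dual d := u)) (\<lambda>d. dsign d * h * w d) (shift (dual d) G) (\<lambda>_. 0))) (at u)"
    using d by (intro osc_base_deriv[OF finite_dirs _ _ nF nG]) (auto simp: ord_def)
  moreover have "((\<lambda>t. \<Sum>k<N. of_real h ^ k / ((2 * \<i>) ^ k * fact k) * coupling ?D dsign k F G (x(d := t)) ((x \<circ> dual)(dual d := t))) has_vector_derivative
     (\<Sum>k<N. of_real h ^ k / ((2 * \<i>) ^ k * fact k) * (coupling ?D dsign k (shift d F) G (x(d := u)) ((x \<circ> dual)(dual d := u))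
       + coupling ?D dsign k F (shift (dual d) G) (x(d := u)) ((x \<circ> dual)(dual d := u))))) (at u)"
  proof (intro has_vector_derivative_sum has_vector_derivative_mult_right coupling_deriv)
    fix k assume "k \<in> {..<N}"
    then have le: "ord ?D (Suc k) \<le> ord ?D (N + 3)" by (auto simp: ord_def le_fun_def)
    show "smooth (ord ?D (Suc k)) F" "smooth (ord ?D (Suc k)) G"
      using F G smooth_mono[OF _ le] by (auto simp: wjet_def)
  qed (use d in auto)
  ultimately show ?thesis
    unfolding rem_jet_def comp_dual_upd distrib_left sum.distrib
    by (rule has_vector_derivative_diff[THEN has_vector_derivative_eq_rhs]) (simp add: algebra_simps)
qed

lemma rem_jet_continuous:
  assumes F: "wjet (dirs n) w (ord (dirs n) (N + 3)) M F" and G: "wjet (dirs n) (w \<circ> dual) (ord (dirs n) (N + 3)) M' G"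
  shows "continuous_on UNIV (rem_jet n N h w F G)"
proof -
  let ?D = "dirs n"
  have le: "order_two ?D \<le> ord ?D (N + 3)" by (auto simp: order_two_def ord_def le_fun_def)
  have w0: "0 \<le> w d" "0 \<le> (w \<circ> dual) d" for d using w[of d] w[of "dual d"] by auto
  note nF = nice_mono[OF nice_wjet[OF F w0(1)] le] and nG = nice_mono[OF nice_wjet[OF G w0(2)] le]
  have sm: "smooth (order_two ?D) F" "smooth (order_two ?D) G" using nF nG by (auto simp: nice_def)
  have "continuous_on UNIV (\<lambda>x. osc ?D (rescale ?D x (\<lambda>d. 1 / w d) F (\<lambda>_. 0)) (rescale ?D (x \<circ> dual) (\<lambda>d. dsign d * h * w d) G (\<lambda>_. 0)))"
  proof (rule continuous_on_sequentiallyI)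
    fix X :: "nat \<Rightarrow> direction \<Rightarrow> real" and x assume X: "X \<longlonglongrightarrow> x"
    have Xd: "(\<lambda>k. X k d) \<longlonglongrightarrow> x d" for d
      using continuous_on_tendsto_compose[OF continuous_on_product_coordinates[of d] X] by simp
    show "(\<lambda>k. osc ?D (rescale ?D (X k) (\<lambda>d. 1 / w d) F (\<lambda>_. 0)) (rescale ?D (X k \<circ> dual) (\<lambda>d. dsign d * h * w d) G (\<lambda>_. 0)))
      \<longlonglongrightarrow> osc ?D (rescale ?D x (\<lambda>d. 1 / w d) F (\<lambda>_. 0)) (rescale ?D (x \<circ> dual) (\<lambda>d. dsign d * h * w d) G (\<lambda>_. 0))"
      by (intro osc_continuous[OF finite_dirs nice_rescale[OF nF finite_dirs order_two_off order_refl] nice_rescale[OF nF finite_dirs order_two_off order_refl] _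
            nice_rescale[OF nG finite_dirs order_two_off order_refl] nice_rescale[OF nG finite_dirs order_two_off order_refl]]
          rescale_tendsto[OF sm(1)] rescale_tendsto[OF sm(2)] tendsto_const) (simp_all add: Xd)
  qed
  moreover have "continuous_on UNIV (\<lambda>x. coupling ?D dsign k F G x (x \<circ> dual))" if "k < N" for k
  proof (rule coupling_continuous)
    have le: "ord ?D k \<le> ord ?D (N + 3)" using that by (auto simp: ord_def le_fun_def)
    show "smooth (ord ?D k) F" "smooth (ord ?D k) G"
      using F G smooth_mono[OF _ le] by (auto simp: wjet_def)
    show "continuous_on UNIV (\<lambda>x::direction \<Rightarrow> real. x \<circ> dual)"
      by (intro continuous_on_coordinatewise_then_product) (simp add: continuous_on_product_coordinates)
  qed (rule continuous_on_id)
  ultimately show ?thesis unfolding rem_jet_def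
    by (intro continuous_intros) auto
qed

lemma wjet_shift_need:
  assumes "d \<in> dirs n"
  shows "wjet (dirs n) w (need n N (d # ds)) M F \<Longrightarrow> wjet (dirs n) w (need n N ds) (M * w d) (shift d F)"
    and "wjet (dirs n) (w \<circ> dual) (need n N (d # ds) \<circ> dual) M G \<Longrightarrow> wjet (dirs n) (w \<circ> dual) (need n N ds \<circ> dual) (M * w d) (shift (dual d) G)"
proof -
  show "wjet (dirs n) w (need n N (d # ds)) M F \<Longrightarrow> wjet (dirs n) w (need n N ds) (M * w d) (shift d F)"
    by (rule wjet_shift[OF _ need_Cons]) (use assms w[of d] in auto)
  assume G: "wjet (dirs n) (w \<circ> dual) (need n N (d # ds) \<circ> dual) M G"
  have "wjet (dirs n) (w \<circ> dual) (need n N ds \<circ> dual) (M * (w \<circ> dual) (dual d)) (shift (dual d) G)"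
    by (rule wjet_shift[OF G need_Cons_dual]) (use assms w[of d] in auto)
  then show "wjet (dirs n) (w \<circ> dual) (need n N ds \<circ> dual) (M * w d) (shift (dual d) G)" by simp
qed

text \<open>A derivative costs \<open>w d\<close> whichever factor it falls on, because
  \<open>w \<circ> dual\<close> takes that value at \<open>dual d\<close>; the two terms of Leibniz'
  rule therefore add up to exactly \<open>2 * w d\<close>.\<close>

lemma rem_partials_bound:
  assumes "set ds \<subseteq> dirs n" "wjet (dirs n) w (need n N ds) M F" "wjet (dirs n) (w \<circ> dual) (need n N ds \<circ> dual) M' G" "local_jet (dirs n) G"
  shows "cmod (rem_partials n N h w ds F G x) \<le> (\<Prod>d\<leftarrow>ds. 2 * w d) *
    ((\<Sum>j<n. h * w (Pos j) * w (Mom j)) ^ N / fact N * (M * M' * (\<Prod>j<n. 1 + K0 * (h * w (Pos j) * w (Mom j)))))"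
  using assms
proof (induction ds arbitrary: M M' F G)
  case Nil
  show ?case
    using rem_jet_bound[OF wjet_mono[OF Nil(2) need_Nil_le(1)] wjet_mono[OF Nil(3) need_Nil_le(2)] Nil(4)] by simp
next
  case (Cons d ds)
  then have d: "d \<in> dirs n" and ds: "set ds \<subseteq> dirs n" by auto
  note F = Cons.prems(2) and G = Cons.prems(3)
  have "cmod (rem_partials n N h w (d # ds) F G x) \<le> cmod (rem_partials n N h w ds (shift d F) G x) + cmod (rem_partials n N h w ds F (shift (dual d) G) x)"
    unfolding rem_partials.simps by (rule norm_triangle_ineq)
  also have "\<dots> \<le> (\<Prod>d\<leftarrow>ds. 2 * w d) * ((\<Sum>j<n. h * w (Pos j) * w (Mom j)) ^ N / fact N * (M * w d * M' * (\<Prod>j<n. 1 + K0 * (h * w (Pos j) * w (Mom j)))))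
    + (\<Prod>d\<leftarrow>ds. 2 * w d) * ((\<Sum>j<n. h * w (Pos j) * w (Mom j)) ^ N / fact N * (M * (M' * w d) * (\<Prod>j<n. 1 + K0 * (h * w (Pos j) * w (Mom j)))))"
    using Cons.prems(4) by (intro add_mono Cons.IH ds wjet_shift_need d F G wjet_mono[OF F need_mono] wjet_mono[OF G need_mono_dual] local_shift)
  also have "\<dots> = (\<Prod>d\<leftarrow>d # ds. 2 * w d) * ((\<Sum>j<n. h * w (Pos j) * w (Mom j)) ^ N / fact N * (M * M' * (\<Prod>j<n. 1 + K0 * (h * w (Pos j) * w (Mom j)))))"
    by (simp only: prod_list.Cons list.map) (simp add: algebra_simps)
  finally show ?case .
qed

lemma rem_partials_deriv:
  assumes "set ds \<subseteq> dirs n" "wjet (dirs n) w (need n N ds) M F" "wjet (dirs n) (w \<circ> dual) (need n N ds \<circ> dual) M' G" and d: "d \<in> dirs n"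
  shows "((\<lambda>t. rem_partials n N h w ds F G (x(d := t))) has_vector_derivative rem_partials n N h w (d # ds) F G (x(d := u))) (at u)"
  using assms(1-3)
proof (induction ds arbitrary: M M' F G)
  case Nil
  then show ?case unfolding rem_partials.simps
    by (intro rem_jet_deriv[OF wjet_mono[OF _ need_Nil_le(1)] wjet_mono[OF _ need_Nil_le(2)] d])
next
  case (Cons e ds)
  then have e: "e \<in> dirs n" and ds: "set ds \<subseteq> dirs n" by auto
  note F = wjet_shift_need(1)[OF e Cons.prems(2)] wjet_mono[OF Cons.prems(2) need_mono]
  note G = wjet_shift_need(2)[OF e Cons.prems(3)] wjet_mono[OF Cons.prems(3) need_mono_dual]
  have "((\<lambda>t. rem_partials n N h w ds (shift e F) G (x(d := t)) + rem_partials n N h w ds F (shift (dual e) G) (x(d := t)))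
    has_vector_derivative rem_partials n N h w (d # ds) (shift e F) G (x(d := u)) + rem_partials n N h w (d # ds) F (shift (dual e) G) (x(d := u))) (at u)"
    by (intro has_vector_derivative_add Cons.IH[OF ds F(1) G(2)] Cons.IH[OF ds F(2) G(1)])
  then show ?case
    by (simp only: rem_partials.simps shift_commute[of e] shift_commute[of "dual e"] add_ac)
qed

lemma rem_partials_continuous:
  assumes "set ds \<subseteq> dirs n" "wjet (dirs n) w (need n N ds) M F" "wjet (dirs n) (w \<circ> dual) (need n N ds \<circ> dual) M' G"
  shows "continuous_on UNIV (rem_partials n N h w ds F G)"
  using assms
proof (induction ds arbitrary: M M' F G)
  case Nil
  then show ?case unfolding rem_partials.simps
    by (intro rem_jet_continuous[OF wjet_mono[OF _ need_Nil_le(1)] wjet_mono[OF _ need_Nil_le(2)]])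
next
  case (Cons e ds)
  then have e: "e \<in> dirs n" and ds: "set ds \<subseteq> dirs n" by auto
  note F = wjet_shift_need(1)[OF e Cons.prems(2)] wjet_mono[OF Cons.prems(2) need_mono]
  note G = wjet_shift_need(2)[OF e Cons.prems(3)] wjet_mono[OF Cons.prems(3) need_mono_dual]
  show ?case unfolding rem_partials.simps
    by (intro continuous_on_add Cons.IH[OF ds F(1) G(2)] Cons.IH[OF ds F(2) G(1)])
qed

end

section \<open>From jets back to symbols\<close>

lemma weyl_remainder_eq_rem_jet:
  assumes h: "0 < h" and w: "\<And>d. 0 < w d" and m: "N + 3 \<le> m"
    and F: "wjet (dirs n) w (order_of n m) M (jet_of n A)" and G: "wjet (dirs n) (w \<circ> dual) (order_of n m) M' (dual_jet n B)"
  shows "weyl_remainder n N h A B (phase_point n x) = rem_jet n N h w (jet_of n A) (dual_jet n B) x"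
proof -
  let ?D = "dirs n"
  have le: "order_two ?D \<le> order_of n m" using m by (auto simp: order_two_def order_of_def le_fun_def)
  have w0: "0 \<le> w d" "0 \<le> (w \<circ> dual) d" for d using w[of d] w[of "dual d"] by auto
  note nF = nice_mono[OF nice_wjet[OF F w0(1)] le] and nG = nice_mono[OF nice_wjet[OF G w0(2)] le]
  have sm: "smooth (order_of n m) (jet_of n A)" "smooth (order_of n m) (dual_jet n B)" using F G by (auto simp: wjet_def)
  show ?thesis unfolding weyl_remainder_def rem_jet_def weyl_composition_eq_osc[where w=w, OF h w nF nG]
    by (intro arg_cong2[where f="(-)"] refl sum.cong arg_cong2[where f="(*)"] symplectic_op_power_zero[OF sm]) (use m in auto)
qed

lemma symbol_class_mono:
  assumes A: "A \<in> symbol_class n m M \<rho> \<delta>" and M: "0 \<le> M"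
    and \<rho>: "\<And>j. 0 \<le> \<rho> j" "\<And>j. \<rho> j \<le> \<rho>' j" and \<delta>: "\<And>j. 0 \<le> \<delta> j" "\<And>j. \<delta> j \<le> \<delta>' j"
  shows "A \<in> symbol_class n m M \<rho>' \<delta>'"
proof -
  have "M * (\<Prod>j<n. \<rho> j ^ \<alpha> j * \<delta> j ^ \<beta> j) \<le> M * (\<Prod>j<n. \<rho>' j ^ \<alpha> j * \<delta>' j ^ \<beta> j)" for \<alpha> \<beta>
  proof (rule mult_left_mono[OF prod_mono M], intro conjI)
    fix j
    show "0 \<le> \<rho> j ^ \<alpha> j * \<delta> j ^ \<beta> j" using \<rho>(1) \<delta>(1) by simp
    have "0 \<le> \<rho>' j" "0 \<le> \<delta>' j" using \<rho>[of j] \<delta>[of j] by linarith+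
    then show "\<rho> j ^ \<alpha> j * \<delta> j ^ \<beta> j \<le> \<rho>' j ^ \<alpha> j * \<delta>' j ^ \<beta> j"
      using \<rho> \<delta> by (intro mult_mono power_mono) auto
  qed
  then show ?thesis using A unfolding symbol_class_def mem_Collect_eq by (meson order_trans)
qed

lemma continuous_on_coords: "continuous_on S coords"
  unfolding coords_def coord_eq
proof (rule continuous_on_coordinatewise_then_product)
  fix d
  have "continuous_on S (\<lambda>Y::point. fst Y j)" "continuous_on S (\<lambda>Y::point. snd Y j)" for j
    by (rule continuous_on_compose2[OF continuous_on_product_coordinates[of j] continuous_on_fst[OF continuous_on_id]] subset_UNIV
        continuous_on_compose2[OF continuous_on_product_coordinates[of j] continuous_on_snd[OF continuous_on_id]])+
  then show "continuous_on S (\<lambda>Y::point. case d of Pos j \<Rightarrow> fst Y j | Mom j \<Rightarrow> snd Y j)"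
    by (cases d) simp_all
qed

lemma need_le_order_of:
  assumes "\<And>d. count_list ds d \<le> q" "N + 3 + q \<le> m"
  shows "need n N ds \<le> order_of n m" "need n N ds \<circ> dual \<le> order_of n m"
proof -
  have "N + 3 + count_list ds d \<le> m" for d using assms(1)[of d] assms(2) by linarith
  then show "need n N ds \<le> order_of n m" "need n N ds \<circ> dual \<le> order_of n m"
    by (simp_all add: need_def order_of_def le_fun_def)
qed

text \<open>Existence of the next partial derivative needs a formula for the previous one at every
  point, so existence and value are carried through one induction.\<close>

lemma partials_weyl_remainder:
  assumes h: "0 < h" and w: "\<And>d. 0 < w d" and m: "N + 3 + q \<le> m"
    and F: "wjet (dirs n) w (order_of n m) M (jet_of n A)" and G: "wjet (dirs n) (w \<circ> dual) (order_of n m) M' (dual_jet n B)"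
    and ds: "set ds \<subseteq> dirs n" "\<And>d. count_list ds d \<le> q"
  shows "partials_exist n ds (weyl_remainder n N h A B)"
    and "partials ds (weyl_remainder n N h A B) (phase_point n x) = rem_partials n N h w ds (jet_of n A) (dual_jet n B) x"
proof -
  have "partials_exist n ds (weyl_remainder n N h A B) \<and>
    (\<forall>x. partials ds (weyl_remainder n N h A B) (phase_point n x) = rem_partials n N h w ds (jet_of n A) (dual_jet n B) x)"
    using ds
  proof (induction ds)
    case Nil
    have "N + 3 \<le> m" using m by simp
    then show ?case using weyl_remainder_eq_rem_jet[OF h w _ F G] by simp
  next
    case (Cons d ds)
    let ?P = "partials ds (weyl_remainder n N h A B)"
    let ?R = "\<lambda>ds. rem_partials n N h w ds (jet_of n A) (dual_jet n B)"
    have d: "d \<in> dirs n" and ds: "set ds \<subseteq> dirs n" using Cons.prems by auto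
    have c: "count_list ds e \<le> q" for e using Cons.prems(2)[of e] by (simp split: if_splits)
    have nF: "wjet (dirs n) w (need n N ds) M (jet_of n A)" and nG: "wjet (dirs n) (w \<circ> dual) (need n N ds \<circ> dual) M' (dual_jet n B)"
      using wjet_mono[OF F] wjet_mono[OF G] need_le_order_of[OF c m] by auto
    have IH: "partials_exist n ds (weyl_remainder n N h A B)" "?P (phase_point n x) = ?R ds x" for x
      using Cons.IH[OF ds c] by auto
    have D: "((\<lambda>t. ?P (phase_point n (x(d := t)))) has_vector_derivative ?R (d # ds) x) (at (x d))" for x
      using rem_partials_deriv[OF h w ds nF nG d, of x "x d"] unfolding IH fun_upd_triv .
    have P: "partial d ?P (phase_point n x) = ?R (d # ds) x" for x
      unfolding partial_def coord_phase_point[OF d] phase_point_upd[OF d, symmetric] by (rule vector_derivative_at[OF D])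
    have "partial_exists n d ?P" unfolding partial_phase_point[OF d] P using D by blast
    then show ?case using IH(1) P by simp
  qed
  then show "partials_exist n ds (weyl_remainder n N h A B)"
    and "partials ds (weyl_remainder n N h A B) (phase_point n x) = rem_partials n N h w ds (jet_of n A) (dual_jet n B) x" by auto
qed

lemma weyl_remainder_in_symbol_class_pos:
  assumes h: "0 < h" and \<rho>: "\<And>j. 0 < \<rho> j" and \<delta>: "\<And>j. 0 < \<delta> j" and m: "N + 6 \<le> m" and M: "0 \<le> M" "0 \<le> M'"
    and A: "A \<in> symbol_class n m M \<rho> \<delta>" and B: "B \<in> symbol_class n m M' \<rho> \<delta>"
  shows "weyl_remainder n N h A B \<in> symbol_class n (m - N - 6)
    (M * M' * (\<Prod>j<n. 1 + K0 * h * \<rho> j * \<delta> j) * (h ^ N / fact N) * (\<Sum>j<n. \<rho> j * \<delta> j) ^ N) (\<lambda>j. 2 * \<rho> j) (\<lambda>j. 2 * \<delta> j)"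
  unfolding symbol_class_def mem_Collect_eq
proof (intro allI impI)
  fix \<alpha> \<beta> assume ab: "\<forall>j<n. \<alpha> j \<le> m - N - 6 \<and> \<beta> j \<le> m - N - 6"
  define w where "w = dir_weight \<rho> \<delta>"
  have w: "0 < w d" for d using \<rho> \<delta> by (cases d) (auto simp: w_def dir_weight_def)
  let ?R = "weyl_remainder n N h A B"
  define ds where "ds = multi_index n \<alpha> \<beta>"
  define \<kappa> where "\<kappa> = case_direction \<alpha> \<beta>"
  have ds: "ds = word (dir_list n) \<kappa>" unfolding ds_def \<kappa>_def by (rule multi_index_eq_word)
  have dsD: "set ds \<subseteq> dirs n" unfolding ds set_dir_list[symmetric] by (rule set_word)
  have c: "count_list ds d \<le> m - N - 6" for d
    using ab by (cases d) (auto simp: ds count_list_word distinct_dir_list set_dir_list \<kappa>_def)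
  have F: "wjet (dirs n) w (order_of n m) M (jet_of n A)" unfolding w_def by (rule wjet_jet_of[OF M(1) A])
  have G: "wjet (dirs n) (w \<circ> dual) (order_of n m) M' (dual_jet n B)" unfolding w_def by (rule wjet_dual_jet[OF wjet_jet_of[OF M(2) B]])
  have m': "N + 3 + (m - N - 6) \<le> m" using m by simp
  have nF: "wjet (dirs n) w (need n N ds) M (jet_of n A)" and nG: "wjet (dirs n) (w \<circ> dual) (need n N ds \<circ> dual) M' (dual_jet n B)"
    using wjet_mono[OF F] wjet_mono[OF G] need_le_order_of[OF c m'] by auto
  have P: "partials ds ?R X = rem_partials n N h w ds (jet_of n A) (dual_jet n B) (coords X)" if "X \<in> phase_space n" for X
    using partials_weyl_remainder(2)[OF h w m' F G dsD c, of "coords X"] phase_point_coord[OF that] by (simp add: coords_def)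
  have "partials_exist n ds ?R" by (rule partials_weyl_remainder(1)[OF h w m' F G dsD c])
  moreover have "continuous_on (phase_space n) (partials ds ?R)"
  proof -
    have "continuous_on (phase_space n) (\<lambda>X. rem_partials n N h w ds (jet_of n A) (dual_jet n B) (coords X))"
      by (rule continuous_on_compose2[OF rem_partials_continuous[OF h w dsD nF nG] continuous_on_coords]) auto
    then show ?thesis by (subst continuous_on_cong[OF refl P])
  qed
  moreover have "cmod (partials ds ?R X) \<le> M * M' * (\<Prod>j<n. 1 + K0 * h * \<rho> j * \<delta> j) * (h ^ N / fact N) * (\<Sum>j<n. \<rho> j * \<delta> j) ^ N *
      (\<Prod>j<n. (2 * \<rho> j) ^ \<alpha> j * (2 * \<delta> j) ^ \<beta> j)" if X: "X \<in> phase_space n" for X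
  proof -
    have "(\<Prod>d\<leftarrow>ds. 2 * w d) = (\<Prod>d\<in>dirs n. (2 * w d) ^ \<kappa> d)"
      unfolding ds prod_list_word set_dir_list[symmetric] by (rule prod.distinct_set_conv_list[OF distinct_dir_list, symmetric])
    then have W: "(\<Prod>d\<leftarrow>ds. 2 * w d) = (\<Prod>j<n. (2 * \<rho> j) ^ \<alpha> j * (2 * \<delta> j) ^ \<beta> j)"
      by (simp add: prod_dirs w_def dir_weight_def \<kappa>_def)
    have S: "(\<Sum>j<n. h * w (Pos j) * w (Mom j)) = h * (\<Sum>j<n. \<rho> j * \<delta> j)"
      by (simp add: sum_distrib_left w_def dir_weight_def mult.assoc)
    have K: "(\<Prod>j<n. 1 + K0 * (h * w (Pos j) * w (Mom j))) = (\<Prod>j<n. 1 + K0 * h * \<rho> j * \<delta> j)"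
      by (simp add: w_def dir_weight_def mult.assoc)
    show ?thesis
      using rem_partials_bound[OF h w dsD nF nG local_dual_jet, of "coords X"]
      unfolding P[OF X] W S K power_mult_distrib by (simp add: mult_ac)
  qed
  ultimately show "partials_exist n (multi_index n \<alpha> \<beta>) ?R \<and> continuous_on (phase_space n) (partials (multi_index n \<alpha> \<beta>) ?R) \<and>
    (\<forall>X\<in>phase_space n. cmod (partials (multi_index n \<alpha> \<beta>) ?R X) \<le> M * M' * (\<Prod>j<n. 1 + K0 * h * \<rho> j * \<delta> j) * (h ^ N / fact N) * (\<Sum>j<n. \<rho> j * \<delta> j) ^ N *
      (\<Prod>j<n. (2 * \<rho> j) ^ \<alpha> j * (2 * \<delta> j) ^ \<beta> j))"
    unfolding ds_def by blast
qed

text \<open>Removes the positivity of the weights, which were inverted in the rescaling.\<close>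

lemma symbol_class_tendsto:
  assumes F: "\<And>k::nat. F \<in> symbol_class n m (Mk k) (\<rho>k k) (\<delta>k k)"
    and lim: "Mk \<longlonglongrightarrow> M" "\<And>j. (\<lambda>k. \<rho>k k j) \<longlonglongrightarrow> \<rho> j" "\<And>j. (\<lambda>k. \<delta>k k j) \<longlonglongrightarrow> \<delta> j"
  shows "F \<in> symbol_class n m M \<rho> \<delta>"
  unfolding symbol_class_def mem_Collect_eq
proof (intro allI impI conjI ballI)
  fix \<alpha> \<beta> assume ab: "\<forall>j<n. \<alpha> j \<le> m \<and> \<beta> j \<le> m"
  let ?d = "multi_index n \<alpha> \<beta>"
  have *: "partials_exist n ?d F \<and> continuous_on (phase_space n) (partials ?d F) \<and>
    (\<forall>X\<in>phase_space n. cmod (partials ?d F X) \<le> Mk k * (\<Prod>j<n. \<rho>k k j ^ \<alpha> j * \<delta>k k j ^ \<beta> j))" for k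
    using F[of k] ab unfolding symbol_class_def by blast
  then show "partials_exist n ?d F" "continuous_on (phase_space n) (partials ?d F)" by auto
  fix X assume "X \<in> phase_space n"
  then have "cmod (partials ?d F X) \<le> Mk k * (\<Prod>j<n. \<rho>k k j ^ \<alpha> j * \<delta>k k j ^ \<beta> j)" for k using * by blast
  moreover have "(\<lambda>k. Mk k * (\<Prod>j<n. \<rho>k k j ^ \<alpha> j * \<delta>k k j ^ \<beta> j)) \<longlonglongrightarrow> M * (\<Prod>j<n. \<rho> j ^ \<alpha> j * \<delta> j ^ \<beta> j)"
    by (intro tendsto_intros lim)
  ultimately show "cmod (partials ?d F X) \<le> M * (\<Prod>j<n. \<rho> j ^ \<alpha> j * \<delta> j ^ \<beta> j)"
    by (intro LIMSEQ_le_const) auto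
qed

lemma weyl_remainder_in_symbol_class:
  assumes h: "0 < h" and \<rho>: "\<And>j. 0 \<le> \<rho> j" and \<delta>: "\<And>j. 0 \<le> \<delta> j" and m: "N + 6 \<le> m" and M: "0 \<le> M" "0 \<le> M'"
    and A: "A \<in> symbol_class n m M \<rho> \<delta>" and B: "B \<in> symbol_class n m M' \<rho> \<delta>"
  shows "weyl_remainder n N h A B \<in> symbol_class n (m - N - 6)
    (M * M' * (\<Prod>j<n. 1 + K0 * h * \<rho> j * \<delta> j) * (h ^ N / fact N) * (\<Sum>j<n. \<rho> j * \<delta> j) ^ N) (\<lambda>j. 2 * \<rho> j) (\<lambda>j. 2 * \<delta> j)"
proof -
  \<comment> \<open>Raising all weights by 1 / (k + 1) makes them positive and only enlarges the
    classes of A and B. The resulting bounds on the fixed remainder converge as k grows.\<close>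
  define r where "r = (\<lambda>k j. \<rho> j + inverse (real (Suc k)))"
  define s where "s = (\<lambda>k j. \<delta> j + inverse (real (Suc k)))"
  have pos: "0 < inverse (real (Suc k))" for k by simp
  have lim: "(\<lambda>k. r k j) \<longlonglongrightarrow> \<rho> j" "(\<lambda>k. s k j) \<longlonglongrightarrow> \<delta> j" for j
    unfolding r_def s_def using LIMSEQ_inverse_real_of_nat_add by auto
  show ?thesis
  proof (rule symbol_class_tendsto[where \<rho>k="\<lambda>k j. 2 * r k j" and \<delta>k="\<lambda>k j. 2 * s k j" and
        Mk="\<lambda>k. M * M' * (\<Prod>j<n. 1 + K0 * h * r k j * s k j) * (h ^ N / fact N) * (\<Sum>j<n. r k j * s k j) ^ N"])
    fix k
    have "A \<in> symbol_class n m M (r k) (s k)" "B \<in> symbol_class n m M' (r k) (s k)"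
      using \<rho> \<delta> M by (auto simp: r_def s_def intro!: symbol_class_mono[OF A] symbol_class_mono[OF B])
    moreover have "0 < r k j" "0 < s k j" for j
      using \<rho>[of j] \<delta>[of j] pos[of k] unfolding r_def s_def by linarith+
    ultimately show "weyl_remainder n N h A B \<in> symbol_class n (m - N - 6)
      (M * M' * (\<Prod>j<n. 1 + K0 * h * r k j * s k j) * (h ^ N / fact N) * (\<Sum>j<n. r k j * s k j) ^ N) (\<lambda>j. 2 * r k j) (\<lambda>j. 2 * s k j)"
      by (intro weyl_remainder_in_symbol_class_pos h m M)
  qed (intro tendsto_intros lim)+
qed

text \<open>For N = 0 the expansion is empty and the remainder is the composition itself; with m = 6
  the resulting class has order 0 and asserts just the supremum bound. One constant thus serves both
  parts of the theorem.\<close>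

lemma composition_constant_K0: "composition_constant K0"
  unfolding composition_constant_def
proof (intro conjI allI impI ballI K0_pos)
  fix n :: nat and M M' :: real and \<rho> \<delta> :: "nat \<Rightarrow> real" and h :: real and A B :: symbol and X
  assume "0 \<le> M" "0 \<le> M'" "\<forall>j. 0 \<le> \<rho> j" "\<forall>j. 0 \<le> \<delta> j" "0 < h" "A \<in> symbol_class n 6 M \<rho> \<delta>" "B \<in> symbol_class n 6 M' \<rho> \<delta>"
    and X: "X \<in> phase_space n"
  then have "weyl_remainder n 0 h A B \<in> symbol_class n (6 - 0 - 6)
    (M * M' * (\<Prod>j<n. 1 + K0 * h * \<rho> j * \<delta> j) * (h ^ 0 / fact 0) * (\<Sum>j<n. \<rho> j * \<delta> j) ^ 0) (\<lambda>j. 2 * \<rho> j) (\<lambda>j. 2 * \<delta> j)"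
    by (intro weyl_remainder_in_symbol_class) auto
  from symbol_classD(3)[OF this le_zero_fun, of "\<lambda>d. coord d X"]
  show "cmod (weyl_composition n h A B X) \<le> M * M' * (\<Prod>j<n. 1 + K0 * h * \<rho> j * \<delta> j)"
    by (simp add: jet_of_zero phase_point_coord[OF X] weyl_remainder_def)
qed

theorem theorem1p3:
  "\<exists>K. composition_constant K \<and>
     (\<forall>(n::nat) (N::nat) (m::nat) (M::real) (M'::real) (\<rho>::nat \<Rightarrow> real) (\<delta>::nat \<Rightarrow> real)
        (h::real) (A::symbol) (B::symbol).
        n \<ge> 1 \<longrightarrow> N \<ge> 1 \<longrightarrow> m \<ge> N + 6 \<longrightarrow>
        M \<ge> 0 \<longrightarrow> M' \<ge> 0 \<longrightarrow> (\<forall>j. \<rho> j \<ge> 0) \<longrightarrow> (\<forall>j. \<delta> j \<ge> 0) \<longrightarrow> h > 0 \<longrightarrow>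
        A \<in> symbol_class n m M \<rho> \<delta> \<longrightarrow> B \<in> symbol_class n m M' \<rho> \<delta> \<longrightarrow>
        weyl_remainder n N h A B \<in>
          symbol_class n (m - N - 6)
            (M * M' * (\<Prod>j<n. 1 + K * h * \<rho> j * \<delta> j) * (h ^ N / fact N) * (\<Sum>j<n. \<rho> j * \<delta> j) ^ N)
            (\<lambda>j. 2 * \<rho> j) (\<lambda>j. 2 * \<delta> j))"
proof (intro exI[of _ K0] conjI allI impI composition_constant_K0)
qed (intro weyl_remainder_in_symbol_class; blast)

end
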